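(* Let $n\geq 2$, let $\beta\in\mathbb{Z}^n$ be a vector with all entries $\beta_k\geq 1$, and let $\Sigma\subset\mathbb{C}^n$ be a weighted homogeneous subvariety with respect to $\beta$. Consider a $(0,1)$-form $\lambda=\sum_{k=1}^n f_k\,d\overline{z_k}$, where the coefficients $f_k$ are all Borel-measurable functions on $\Sigma$ and $z_1,\dots,z_n$ are the Cartesian coordinates of $\mathbb{C}^n$. If $\lambda$ is bounded and has compact support in $\Sigma$, then the function $$g(z):=\sum_{k=1}^n\frac{\beta_k}{2\pi i}\int_{w\in\mathbb{C}} f_k(w^{\beta}*z)\,\frac{\overline{(w^{\beta_k}z_k)}\;dw\wedge d\overline{w}}{\overline{w}\,(w-1)}$$ is well defined for all $z\in\Sigma$. If, in addition, $\lambda$ is $\overline{\partial}$-closed on the regular part of $\Sigma$, then $g$ is a solution of the equation $\lambda=\overline{\partial}g$ on the regular part of $\Sigma$.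
   Context: For $s\in\mathbb{C}$ and $z\in\mathbb{C}^n$ put $s^{\beta}*z:=(s^{\beta_1}z_1,s^{\beta_2}z_2,\dots,s^{\beta_n}z_n)$. A holomorphic polynomial $Q$ on $\mathbb{C}^n$ is weighted homogeneous of degree $d\geq 1$ with respect to $\beta$ if $Q(s^{\beta}*z)=s^dQ(z)$ for all $s\in\mathbb{C}$, $z\in\mathbb{C}^n$. An algebraic subvariety $\Sigma\subset\mathbb{C}^n$ is weighted homogeneous with respect to $\beta$ if it is the zero locus of finitely many polynomials $Q_k$, each weighted homogeneous with respect to the same vector $\beta$, of possibly different degrees $d_k\geq 1$. (Hence $s^\beta*z\in\Sigma$ for $z\in\Sigma$, $s\in\mathbb{C}$.) The regular part $\Sigma^*=\Sigma_{reg}$ is the complex manifold of all regular points of $\Sigma$, and it is viewed as a Hermitian submanifold of $\mathbb{C}^n$ with the induced metric. The form $\lambda=\sum_k f_k\,d\overline{z_k}$ is understood as a form on $\Sigma^*$ by restriction. All $\overline{\partial}$-differentials are taken in the sense of distributions. That $\lambda$ is bounded with compact support in $\Sigma$ means that the coefficients $f_k$ are bounded on $\Sigma$ and vanish outside a compact subset of $\Sigma$. *)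

theory Defs
  imports "HOL-Analysis.Analysis"
begin

section \<open>Weighted homogeneous varieties\<close>

definition weighted_action :: "('n::finite \<Rightarrow> nat) \<Rightarrow> complex \<Rightarrow> complex ^ 'n \<Rightarrow> complex ^ 'n" where
  "weighted_action \<beta> s z = (\<chi> k. s ^ \<beta> k * z $ k)"

definition holomorphic_polynomial :: "(complex ^ 'n::finite \<Rightarrow> complex) \<Rightarrow> bool" where
  "holomorphic_polynomial Q \<longleftrightarrow>
     (\<exists>(A :: ('n \<Rightarrow> nat) set) c. finite A \<and> (\<forall>z. Q z = (\<Sum>a\<in>A. c a * (\<Prod>k\<in>UNIV. z $ k ^ a k))))"

definition weighted_homogeneous :: "('n::finite \<Rightarrow> nat) \<Rightarrow> nat \<Rightarrow> (complex ^ 'n \<Rightarrow> complex) \<Rightarrow> bool" where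
  "weighted_homogeneous \<beta> d Q \<longleftrightarrow>
     holomorphic_polynomial Q \<and> d \<ge> 1 \<and> (\<forall>s z. Q (weighted_action \<beta> s z) = s ^ d * Q z)"

definition weighted_homogeneous_variety :: "('n::finite \<Rightarrow> nat) \<Rightarrow> (complex ^ 'n) set \<Rightarrow> bool" where
  "weighted_homogeneous_variety \<beta> S \<longleftrightarrow>
     (\<exists>\<Q>. finite \<Q> \<and> (\<forall>Q\<in>\<Q>. \<exists>d. weighted_homogeneous \<beta> d Q) \<and> S = {z. \<forall>Q\<in>\<Q>. Q z = 0})"

section \<open>The regular part and its charts\<close>

definition holomorphic_map_on :: "(complex ^ 'n::finite) set \<Rightarrow> (complex ^ 'n \<Rightarrow> complex ^ 'n) \<Rightarrow> bool" where
  "holomorphic_map_on V F \<longleftrightarrow>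
     (\<forall>x\<in>V. \<exists>F'. (F has_derivative F') (at x) \<and> (\<forall>c v. F' (c *s v) = c *s F' v))"

definition biholomorphic_on :: "(complex ^ 'n::finite) set \<Rightarrow> (complex ^ 'n \<Rightarrow> complex ^ 'n) \<Rightarrow> bool" where
  "biholomorphic_on V \<Phi> \<longleftrightarrow>
     open V \<and> open (\<Phi> ` V) \<and> inj_on \<Phi> V \<and>
     holomorphic_map_on V \<Phi> \<and> holomorphic_map_on (\<Phi> ` V) (the_inv_into V \<Phi>)"

text \<open>
  A coordinate subspace of dimension \<open>card I\<close> plays the role of the model space
  \<open>\<complex>\<^sup>d\<close>, \<open>d = card I\<close>, so that manifolds of every dimension \<open>d \<le> n\<close> (including \<open>d = 0\<close>) can be
  treated within the type \<open>complex ^ 'n\<close>.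
\<close>

definition coord_subspace :: "'n::finite set \<Rightarrow> (complex ^ 'n) set" where
  "coord_subspace I = {x. \<forall>k. k \<notin> I \<longrightarrow> x $ k = 0}"

definition coord_embedding :: "'n::finite set \<Rightarrow> ('n \<Rightarrow> complex) \<Rightarrow> complex ^ 'n" where
  "coord_embedding I x = (\<chi> k. if k \<in> I then x k else 0)"

text \<open>Lebesgue measure of the coordinate subspace, carried by \<^term>\<open>coord_subspace I\<close>.\<close>

definition coord_lebesgue :: "'n::finite set \<Rightarrow> (complex ^ 'n) measure" where
  "coord_lebesgue I = distr (Pi\<^sub>M I (\<lambda>_. lborel)) borel (coord_embedding I)"

text \<open>
  A chart of \<open>M\<close> as a complex submanifold of \<open>\<complex>\<^sup>n\<close>: an ambient biholomorphic map which
  straightens \<open>M\<close>. The restriction of \<open>\<Phi>\<close> to \<open>V \<inter> coord_subspace I\<close> is a holomorphic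
  parametrization of an open piece of \<open>M\<close>.
\<close>

definition submanifold_chart ::
  "(complex ^ 'n::finite) set \<Rightarrow> 'n set \<Rightarrow> (complex ^ 'n) set \<Rightarrow> (complex ^ 'n \<Rightarrow> complex ^ 'n) \<Rightarrow> bool" where
  "submanifold_chart M I V \<Phi> \<longleftrightarrow>
     biholomorphic_on V \<Phi> \<and> \<Phi> ` (V \<inter> coord_subspace I) = M \<inter> \<Phi> ` V"

definition regular_part :: "(complex ^ 'n::finite) set \<Rightarrow> (complex ^ 'n) set" where
  "regular_part S = {p \<in> S. \<exists>I V \<Phi>. submanifold_chart S I V \<Phi> \<and> p \<in> \<Phi> ` V}"

section \<open>Distributional \<open>\<partial>\<close>-bar on a complex manifold in local coordinates\<close>

primrec times_cont_diff :: "nat \<Rightarrow> ('a::euclidean_space \<Rightarrow> 'b::real_normed_vector) \<Rightarrow> bool" where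
  "times_cont_diff 0 \<phi> \<longleftrightarrow> continuous_on UNIV \<phi>"
| "times_cont_diff (Suc m) \<phi> \<longleftrightarrow>
     (\<forall>x. \<phi> differentiable at x) \<and> (\<forall>v. times_cont_diff m (\<lambda>x. frechet_derivative \<phi> (at x) v))"

text \<open>
  The restrictions of these functions to \<open>coord_subspace I\<close> are exactly the smooth functions with
  compact support in \<open>V \<inter> coord_subspace I\<close>. Only these restrictions and their derivatives in
  the directions of \<open>coord_subspace I\<close> are used below.
\<close>

definition test_function ::
  "'n::finite set \<Rightarrow> (complex ^ 'n) set \<Rightarrow> (complex ^ 'n \<Rightarrow> complex) \<Rightarrow> bool" where
  "test_function I V \<phi> \<longleftrightarrow>
     (\<forall>m. times_cont_diff m \<phi>) \<and>
     (\<exists>K. compact K \<and> K \<subseteq> V \<inter> coord_subspace I \<and> (\<forall>x\<in>coord_subspace I - K. \<phi> x = 0))"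

text \<open>The Wirtinger derivative with respect to the conjugate of the \<open>j\<close>-th coordinate.\<close>

definition wirtinger_bar :: "'n::finite \<Rightarrow> (complex ^ 'n \<Rightarrow> complex) \<Rightarrow> complex ^ 'n \<Rightarrow> complex" where
  "wirtinger_bar j \<phi> x =
     (frechet_derivative \<phi> (at x) (axis j 1) + \<i> * frechet_derivative \<phi> (at x) (axis j \<i>)) / 2"

text \<open>
  With \<open>z' = cnj z\<close> and \<open>t' = cnj t\<close>: the coefficient of \<open>dt'\<^sub>j\<close>, \<open>j \<in> I\<close>, in the pull-back of the
  form \<open>\<Sum>\<^sub>k f\<^sub>k dz'\<^sub>k\<close> under the chart. As \<open>\<Phi>\<close> is holomorphic, \<open>dz'\<^sub>k\<close> is pulled back to
  \<open>\<Sum>\<^sub>j cnj (\<partial>\<Phi>\<^sub>k/\<partial>t\<^sub>j) dt'\<^sub>j\<close>.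
\<close>

definition pullback_coeff ::
  "(complex ^ 'n::finite \<Rightarrow> complex ^ 'n) \<Rightarrow> ('n \<Rightarrow> complex ^ 'n \<Rightarrow> complex) \<Rightarrow> 'n \<Rightarrow> complex ^ 'n \<Rightarrow> complex" where
  "pullback_coeff \<Phi> f j t =
     (\<Sum>k\<in>UNIV. f k (\<Phi> t) * cnj (frechet_derivative \<Phi> (at t) (axis j 1) $ k))"

definition chart_locally_integrable ::
  "'n::finite set \<Rightarrow> (complex ^ 'n) set \<Rightarrow> (complex ^ 'n \<Rightarrow> complex) \<Rightarrow> bool" where
  "chart_locally_integrable I V u \<longleftrightarrow>
     (\<forall>K. compact K \<longrightarrow> K \<subseteq> V \<inter> coord_subspace I \<longrightarrow> set_integrable (coord_lebesgue I) K u)"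

definition chart_integral ::
  "'n::finite set \<Rightarrow> (complex ^ 'n) set \<Rightarrow> (complex ^ 'n \<Rightarrow> complex) \<Rightarrow> complex" where
  "chart_integral I V u = set_lebesgue_integral (coord_lebesgue I) (V \<inter> coord_subspace I) u"

text \<open>
  The equations \<open>\<partial>F\<^sub>j/\<partial>t'\<^sub>i = \<partial>F\<^sub>i/\<partial>t'\<^sub>j\<close> for the coefficients \<open>F\<^sub>j\<close> of the form restricted to \<open>M\<close>,
  in the sense of distributions in every chart.
\<close>

definition dbar_closed_on ::
  "(complex ^ 'n::finite) set \<Rightarrow> ('n \<Rightarrow> complex ^ 'n \<Rightarrow> complex) \<Rightarrow> bool" where
  "dbar_closed_on M f \<longleftrightarrow>
     (\<forall>I V \<Phi>. submanifold_chart M I V \<Phi> \<longrightarrow>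
        (\<forall>j\<in>I. chart_locally_integrable I V (pullback_coeff \<Phi> f j)) \<and>
        (\<forall>i\<in>I. \<forall>j\<in>I. \<forall>\<phi>. test_function I V \<phi> \<longrightarrow>
           chart_integral I V (\<lambda>t. pullback_coeff \<Phi> f j t * wirtinger_bar i \<phi> t) =
           chart_integral I V (\<lambda>t. pullback_coeff \<Phi> f i t * wirtinger_bar j \<phi> t)))"

text \<open>The equations \<open>\<partial>g/\<partial>t'\<^sub>j = F\<^sub>j\<close>, in the sense of distributions in every chart.\<close>

definition dbar_solution_on ::
  "(complex ^ 'n::finite) set \<Rightarrow> (complex ^ 'n \<Rightarrow> complex) \<Rightarrow> ('n \<Rightarrow> complex ^ 'n \<Rightarrow> complex) \<Rightarrow> bool" where
  "dbar_solution_on M g f \<longleftrightarrow>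
     (\<forall>I V \<Phi>. submanifold_chart M I V \<Phi> \<longrightarrow>
        chart_locally_integrable I V (g \<circ> \<Phi>) \<and>
        (\<forall>j\<in>I. chart_locally_integrable I V (pullback_coeff \<Phi> f j)) \<and>
        (\<forall>j\<in>I. \<forall>\<phi>. test_function I V \<phi> \<longrightarrow>
           chart_integral I V (\<lambda>t. g (\<Phi> t) * wirtinger_bar j \<phi> t) =
           - chart_integral I V (\<lambda>t. pullback_coeff \<Phi> f j t * \<phi> t)))"

section \<open>The integral operator\<close>

text \<open>With \<open>w = x + \<i> y\<close> one has \<open>dw \<and> d(cnj w) = - 2 \<i> dx \<and> dy\<close>.\<close>

definition integral_dw_dwbar :: "(complex \<Rightarrow> complex) \<Rightarrow> complex" where
  "integral_dw_dwbar h = - 2 * \<i> * (\<integral>w. h w \<partial>lborel)"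

definition dbar_integrand ::
  "('n::finite \<Rightarrow> nat) \<Rightarrow> ('n \<Rightarrow> complex ^ 'n \<Rightarrow> complex) \<Rightarrow> complex ^ 'n \<Rightarrow> 'n \<Rightarrow> complex \<Rightarrow> complex" where
  "dbar_integrand \<beta> f z k w =
     f k (weighted_action \<beta> w z) * cnj (w ^ \<beta> k * z $ k) / (cnj w * (w - 1))"

definition dbar_operator ::
  "('n::finite \<Rightarrow> nat) \<Rightarrow> ('n \<Rightarrow> complex ^ 'n \<Rightarrow> complex) \<Rightarrow> complex ^ 'n \<Rightarrow> complex" where
  "dbar_operator \<beta> f z =
     (\<Sum>k\<in>UNIV. of_nat (\<beta> k) / (2 * of_real pi * \<i>) * integral_dw_dwbar (dbar_integrand \<beta> f z k))"

end

theory Submission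
  imports Defs "HOL-Complex_Analysis.Cauchy_Integral_Formula" "HOL-Real_Asymp.Real_Asymp"
begin

text \<open>
  Write \<open>w z\<close> for the weighted action. In a chart \<open>\<Phi>\<close>, the pull-back of \<open>\<lambda>\<close> under
  \<open>(t, w) \<mapsto> w \<Phi>(t)\<close> is \<open>a dw' + \<Sum>\<^sub>j b\<^sub>j dt'\<^sub>j\<close> (primes denote conjugates), and
  \<open>g(\<Phi>(t)) = - 1/\<pi> \<integral> a(t, w) / (w - 1)\<close> is a Cauchy transform in \<open>w\<close>. The equation
  \<open>\<partial>a/\<partial>t'\<^sub>i = \<partial>b\<^sub>i/\<partial>w'\<close> for \<open>w \<noteq> 0\<close> gives \<open>\<partial>g/\<partial>t'\<^sub>i = b\<^sub>i(t, 1)\<close>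
  by the Cauchy-Pompeiu formula; the origin is removable since everything is bounded.

  In dimension at least two this mixed equation follows, without any change of variables, from
  closedness in the charts \<open>t \<mapsto> (w\<^sub>0 + c t\<^sub>l) \<Phi>(t)\<close>, \<open>l \<noteq> i\<close>: integrate over \<open>w\<^sub>0\<close> and
  compare small \<open>c\<close> with \<open>c = 0\<close>. In dimension one it holds for polynomial coefficients because
  orbits are tangent to the curve, and polynomials are dense in \<open>L\<^sup>1\<close>. Evaluating \<open>b\<^sub>i\<close> at
  \<open>w = 1\<close> needs its weak continuity there, which follows from the bounded distortion of
  Lebesgue measure under the action.
\<close>

section \<open>Smooth functions\<close>

text \<open>The coefficients are merely bounded and Borel, and closedness is known only against test
  functions in charts of the regular part. The orbit map in \<open>(t, w)\<close> has one dimension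
  too many to be such a chart. The twist \<open>w0 + c * t $ l\<close> stores the missing variable
  in a coordinate that is already present: it adds \<open>cnj c\<close> times the orbit coefficient
  a to b_l, and \<open>cnj c\<close> times the \<open>dbar\<close> of the factor in w to the
  derivative of the test function. Both sides of the closedness identity become affine in
  \<open>cnj c\<close>, and their linear parts form the mixed equation. A curve has no second
  coordinate to carry the twist.

  A second obstacle: 0 may itself be a regular point. Near it orbits shrink and the support in w is
  not uniformly bounded, as the one-variable formula requires. The operator stays bounded all the
  same, because the growth of that support as z_k tends to 0 is compensated by the factor z_k in the
  integrand. The point can therefore be cut out of the test function and restored by dominated
  convergence.

  Data are cut to a compact K and extended by zero, so that Fubini applies on whole spaces.\<close>

lemma times_cont_diff_SucI:
  assumes "\<And>x. (\<phi> has_derivative D x) (at x)" "\<And>v. times_cont_diff m (\<lambda>x. D x v)"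
  shows "times_cont_diff (Suc m) \<phi>"
proof -
  have "frechet_derivative \<phi> (at x) = D x" for x
    using frechet_derivative_at[OF assms(1)[of x]] by simp
  then show ?thesis
    using assms by (auto simp: differentiable_def)
qed

lemma times_cont_diff_has_derivative:
  assumes "times_cont_diff (Suc m) \<phi>"
  shows "(\<phi> has_derivative frechet_derivative \<phi> (at x)) (at x)"
  using assms frechet_derivative_works by auto

lemma times_cont_diff_continuous:
  assumes "times_cont_diff m \<phi>" shows "continuous_on UNIV \<phi>"
proof (cases m)
  case (Suc k)
  then show ?thesis using assms
    by (auto intro!: differentiable_imp_continuous_within continuous_at_imp_continuous_on)
qed (use assms in simp)

lemma times_cont_diff_Suc_lower: "times_cont_diff (Suc m) \<phi> \<Longrightarrow> times_cont_diff m \<phi>"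
proof (induction m arbitrary: \<phi>)
  case 0
  then show ?case using times_cont_diff_continuous[OF "0.prems"] by simp
next
  case (Suc m)
  then show ?case by (metis times_cont_diff.simps(2))
qed

lemma times_cont_diff_const: "times_cont_diff m (\<lambda>x. c)"
proof (induction m arbitrary: c)
  case (Suc m)
  show ?case by (rule times_cont_diff_SucI[where D = "\<lambda>_ _. 0"]) (auto simp: Suc)
qed simp

lemma times_cont_diff_bounded_linear:
  assumes "bounded_linear L" shows "times_cont_diff m L"
proof (cases m)
  case 0
  then show ?thesis using assms by (simp add: linear_continuous_on)
next
  case (Suc k)
  have "times_cont_diff (Suc k) L"
    by (rule times_cont_diff_SucI[where D = "\<lambda>_. L"])
      (auto simp: times_cont_diff_const assms bounded_linear_imp_has_derivative)
  then show ?thesis using Suc by simp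
qed

lemma times_cont_diff_add:
  "times_cont_diff m f \<Longrightarrow> times_cont_diff m g \<Longrightarrow> times_cont_diff m (\<lambda>x. f x + g x)"
proof (induction m arbitrary: f g)
  case 0
  then show ?case by (auto intro: continuous_intros)
next
  case (Suc m)
  show ?case
    by (rule times_cont_diff_SucI[OF has_derivative_add[OF Suc.prems[THEN times_cont_diff_has_derivative]]])
      (use Suc in auto)
qed

lemma times_cont_diff_bilinear:
  assumes "bounded_bilinear p"
  shows "times_cont_diff m f \<Longrightarrow> times_cont_diff m g \<Longrightarrow> times_cont_diff m (\<lambda>x. p (f x) (g x))"
proof (induction m arbitrary: f g)
  case 0
  then show ?case by (auto intro: bounded_bilinear.continuous_on[OF assms])
next
  case (Suc m)
  note lower = Suc.prems[THEN times_cont_diff_Suc_lower]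
  show ?case
    by (rule times_cont_diff_SucI[OF bounded_bilinear.FDERIV[OF assms
            Suc.prems[THEN times_cont_diff_has_derivative]]])
      (use Suc lower in \<open>auto intro!: times_cont_diff_add\<close>)
qed

lemma times_cont_diff_affine:
  assumes "bounded_linear L"
  shows "times_cont_diff m \<phi> \<Longrightarrow> times_cont_diff m (\<lambda>x. \<phi> (c + L x))"
proof (induction m arbitrary: \<phi>)
  case 0
  then show ?case
    using assms continuous_on_compose2[of UNIV \<phi> UNIV "\<lambda>x. c + L x"] linear_continuous_on[OF assms]
    by (simp add: continuous_on_add)
next
  case (Suc m)
  have D: "((\<lambda>x. \<phi> (c + L x)) has_derivative
      (\<lambda>v. frechet_derivative \<phi> (at (c + L x)) (L v))) (at x)" for x
  proof (rule has_derivative_compose[of "\<lambda>x. c + L x" L])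
    show "((\<lambda>x. c + L x) has_derivative L) (at x)"
      using bounded_linear_imp_has_derivative[OF assms] by (auto intro!: derivative_eq_intros)
  qed (rule times_cont_diff_has_derivative[OF Suc.prems])
  show ?case
    by (rule times_cont_diff_SucI[OF D]) (use Suc in auto)
qed

text \<open>One differentiation trades \<open>h k\<close> for \<open>h (Suc k)\<close>, so the
  induction runs over a whole tower of successive derivatives and no formula for higher derivatives
  of a composition is required. The tower is asked for only at values of \<open>q\<close>, which
  admits functions such as 1/y along a positive \<open>q\<close>.\<close>

lemma times_cont_diff_scalar_compose:
  fixes h :: "nat \<Rightarrow> real \<Rightarrow> real"
  assumes h: "\<And>k x. (h k has_real_derivative h (Suc k) (q x)) (at (q x))"
    and q: "\<And>m. times_cont_diff m q"
  shows "times_cont_diff m (\<lambda>x. h k (q x))"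
proof (induction m arbitrary: k)
  case 0
  have "isCont (\<lambda>x. h k (q x)) x" for x
    using isCont_o2[of x q "h k"] DERIV_isCont[OF h[of k x]] times_cont_diff_continuous[OF q[of 0]]
    by (simp add: continuous_on_eq_continuous_at)
  then show ?case by (auto intro: continuous_at_imp_continuous_on)
next
  case (Suc m)
  have qd: "(q has_derivative frechet_derivative q (at x)) (at x)" for x
    by (rule times_cont_diff_has_derivative[OF q])
  have D: "((\<lambda>x. h k (q x)) has_derivative
      (\<lambda>v. h (Suc k) (q x) * frechet_derivative q (at x) v)) (at x)" for x
    by (rule has_derivative_compose[OF qd, of "h k" "(*) (h (Suc k) (q x))"])
      (use h in \<open>simp add: has_field_derivative_def\<close>)
  have "times_cont_diff m (\<lambda>x. frechet_derivative q (at x) v)" for v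
    using q[of "Suc m"] by simp
  then show ?case
    by (intro times_cont_diff_SucI[OF D] times_cont_diff_bilinear[OF bounded_bilinear_mult] Suc)
qed

definition smooth :: "('a::euclidean_space \<Rightarrow> 'b::real_normed_vector) \<Rightarrow> bool" where
  "smooth \<phi> \<longleftrightarrow> (\<forall>m. times_cont_diff m \<phi>)"

lemma smooth_const: "smooth (\<lambda>x. c)"
  and smooth_bounded_linear: "bounded_linear L \<Longrightarrow> smooth L"
  and smooth_add: "smooth f \<Longrightarrow> smooth g \<Longrightarrow> smooth (\<lambda>x. f x + g x)"
  and smooth_bilinear: "bounded_bilinear p \<Longrightarrow> smooth f \<Longrightarrow> smooth g \<Longrightarrow> smooth (\<lambda>x. p (f x) (g x))"
  and smooth_affine: "bounded_linear L \<Longrightarrow> smooth f \<Longrightarrow> smooth (\<lambda>x. f (c + L x))"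
  by (auto simp: smooth_def times_cont_diff_const times_cont_diff_bounded_linear
      times_cont_diff_add times_cont_diff_bilinear times_cont_diff_affine)

lemmas smooth_mult = smooth_bilinear[OF bounded_bilinear_mult]

lemma smooth_scalar_compose:
  fixes h :: "nat \<Rightarrow> real \<Rightarrow> real"
  assumes "\<And>k x. (h k has_real_derivative h (Suc k) (q x)) (at (q x))" "smooth q"
  shows "smooth (\<lambda>x. h k (q x))"
  using assms times_cont_diff_scalar_compose[of h q] by (simp add: smooth_def)

lemma smooth_linear_compose:
  assumes "bounded_linear L" "smooth f" shows "smooth (\<lambda>x. L (f x))"
proof -
  have "times_cont_diff m (\<lambda>x. L (f x))" if "times_cont_diff m f" for m f
    using that
  proof (induction m arbitrary: f)
    case 0
    then show ?case using assms(1) bounded_linear.continuous_on by auto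
  next
    case (Suc m)
    show ?case
      by (rule times_cont_diff_SucI[OF bounded_linear.has_derivative[OF assms(1)
              times_cont_diff_has_derivative[OF Suc.prems]]]) (use Suc in auto)
  qed
  then show ?thesis using assms(2) by (auto simp: smooth_def)
qed

lemma smooth_has_derivative:
  "smooth f \<Longrightarrow> (f has_derivative frechet_derivative f (at x)) (at x)"
  using times_cont_diff_has_derivative smooth_def by blast

lemma smooth_frechet_derivative: "smooth f \<Longrightarrow> smooth (\<lambda>x. frechet_derivative f (at x) v)"
  unfolding smooth_def by (metis times_cont_diff.simps(2))

lemma smooth_continuous_on: "smooth f \<Longrightarrow> continuous_on X f"
  using times_cont_diff_continuous smooth_def continuous_on_subset by blast

text \<open>Provides the dense class of coefficients used on curves. Real polynomial functions are
  smooth by induction over their generators; the complex case is put together from real and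
  imaginary parts.\<close>

lemma smooth_polynomial_function:
  fixes p :: "'a::euclidean_space \<Rightarrow> complex"
  assumes "polynomial_function p" shows "smooth p"
proof -
  have real: "smooth q" if "real_polynomial_function q" for q :: "'a \<Rightarrow> real"
    using that by induction (auto intro: smooth_const smooth_bounded_linear smooth_add smooth_mult)
  have "real_polynomial_function (\<lambda>x. Re (p x))" "real_polynomial_function (\<lambda>x. Im (p x))"
    using assms bounded_linear_Re bounded_linear_Im
    unfolding polynomial_function_def o_def by blast+
  then have "smooth (\<lambda>x. complex_of_real (Re (p x)) + complex_of_real (Im (p x)) * \<i>)"
    by (intro smooth_add smooth_mult smooth_const smooth_linear_compose[OF bounded_linear_of_real] real)
  then show ?thesis by (simp add: complex_eq[symmetric] mult.commute)
qed

section \<open>The flat function \<open>exp (- 1 / x)\<close>\<close>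

text \<open>With y = 1/x, the x-derivative of P(y) exp(-y) is y^2 (P(y) - P'(y)) exp(-y); this is
  the recursion.\<close>

primrec flat_poly :: "nat \<Rightarrow> real poly" where
  "flat_poly 0 = 1"
| "flat_poly (Suc k) = [:0, 0, 1:] * (flat_poly k - pderiv (flat_poly k))"

definition flat :: "nat \<Rightarrow> real \<Rightarrow> real" where
  "flat k x = (if x > 0 then poly (flat_poly k) (1 / x) * exp (- (1 / x)) else 0)"

lemma tendsto_poly_exp_minus: "((\<lambda>y::real. poly p y * exp (- y)) \<longlongrightarrow> 0) at_top"
proof -
  have "((\<lambda>y. \<Sum>i\<le>degree p. coeff p i * (y ^ i / exp y)) \<longlongrightarrow> (\<Sum>i\<le>degree p. coeff p i * 0)) at_top"
    by (intro tendsto_intros tendsto_power_div_exp_0)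
  moreover have "(\<Sum>i\<le>degree p. coeff p i * (y ^ i / exp y)) = poly p y * exp (- y)" for y
    by (simp add: poly_altdef exp_minus sum_distrib_right divide_simps)
  ultimately show ?thesis by simp
qed

lemma flat_has_derivative: "(flat k has_real_derivative flat (Suc k) x) (at x)"
proof -
  consider "x < 0" | "x = 0" | "x > 0" by linarith
  then show ?thesis
  proof cases
    case 1
    have "((\<lambda>_. 0) has_real_derivative 0) (at x)" by simp
    then have "(flat k has_real_derivative 0) (at x)"
      by (rule has_field_derivative_transform_within_open[where S = "{..<0}"])
        (use 1 in \<open>auto simp: flat_def\<close>)
    then show ?thesis using 1 by (simp add: flat_def)
  next
    case 3
    have "((\<lambda>x. poly (flat_poly k) (1 / x) * exp (- (1 / x))) has_real_derivative flat (Suc k) x) (at x)"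
      using 3 by (auto intro!: derivative_eq_intros simp: flat_def field_simps power2_eq_square)
    then show ?thesis
      by (rule has_field_derivative_transform_within_open[where S = "{0<..}"])
        (use 3 in \<open>auto simp: flat_def\<close>)
  next
    case 2
    \<comment> \<open>The extra factor y comes from the difference quotient at 0:
      \<open>flat k h / h\<close> equals y P(y) exp(-y) with y = 1/h and P =
      \<open>flat_poly k\<close>.\<close>
    have "((\<lambda>y. poly ([:0, 1:] * flat_poly k) y * exp (- y)) \<longlongrightarrow> 0) at_top"
      by (rule tendsto_poly_exp_minus)
    then have "((\<lambda>h. poly ([:0, 1:] * flat_poly k) (inverse h) * exp (- (inverse h))) \<longlongrightarrow> 0) (at_right 0)"
      using filterlim_compose[OF _ filterlim_inverse_at_top_right] by blast
    then have R: "((\<lambda>h. (flat k h - flat k 0) / (h - 0)) \<longlongrightarrow> 0) (at_right 0)"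
      by (rule Lim_transform_eventually)
        (auto simp: eventually_at_filter flat_def field_simps)
    have L: "((\<lambda>h. (flat k h - flat k 0) / (h - 0)) \<longlongrightarrow> 0) (at_left 0)"
      by (rule Lim_transform_eventually[OF tendsto_const])
        (auto simp: eventually_at_filter flat_def)
    have "(flat k has_real_derivative 0) (at 0)"
      unfolding has_field_derivative_iff using L R by (simp add: filterlim_at_split)
    then show ?thesis using 2 by (simp add: flat_def)
  qed
qed

lemma smooth_flat: "smooth q \<Longrightarrow> smooth (\<lambda>x. flat k (q x))"
  by (rule smooth_scalar_compose) (rule flat_has_derivative)

lemma flat_0_bounds: "0 \<le> flat 0 x" "flat 0 x \<le> 1"
  by (auto simp: flat_def)

text \<open>With y = 1/x, \<open>flat 1 x\<close> is y^2 exp(-y), and the quadratic Taylor bound for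
  exp controls both y exp(-y) and y^2 exp(-y). The weight \<open>x + 1\<close> anticipates the
  argument \<open>r\<^sup>2 * (w \<bullet> w) - 1\<close> of \<open>cut_zero\<close>, for which it
  becomes r^2 |w|^2.\<close>

lemma flat_1_bounds:
  shows "0 \<le> flat 1 x" "flat 1 x \<le> 2" "(x + 1) * flat 1 x \<le> 3"
proof -
  have *: "y * exp (- y) \<le> 1" "y\<^sup>2 * exp (- y) \<le> 2" if "y > 0" for y :: real
  proof -
    have "1 + y + y\<^sup>2 / 2 \<le> exp y"
      using exp_lower_Taylor_quadratic[of y] that by simp
    moreover have "y\<^sup>2 > 0" using that by simp
    ultimately have "y \<le> exp y" "y\<^sup>2 \<le> 2 * exp y" using that by linarith+
    then show "y * exp (- y) \<le> 1" "y\<^sup>2 * exp (- y) \<le> 2"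
      by (auto simp: exp_minus field_simps)
  qed
  have f1: "flat 1 x = (1 / x)\<^sup>2 * exp (- (1 / x))" if "x > 0"
    using that by (simp add: flat_def power2_eq_square)
  show "0 \<le> flat 1 x" using f1 by (cases "x > 0") (auto simp: flat_def)
  show "flat 1 x \<le> 2" using f1 *(2)[of "1 / x"] by (cases "x > 0") (auto simp: flat_def)
  show "(x + 1) * flat 1 x \<le> 3"
  proof (cases "x > 0")
    case True
    have "(x + 1) * flat 1 x = (1 / x) * exp (- (1 / x)) + (1 / x)\<^sup>2 * exp (- (1 / x))"
      using True unfolding f1[OF True] by (simp add: field_simps power2_eq_square)
    moreover have "1 / x > 0" using True by simp
    ultimately show ?thesis using *[of "1 / x"] by linarith
  qed (simp add: flat_def)
qed

lemma tendsto_flat_0: "(flat 0 \<longlongrightarrow> 1) at_top"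
proof -
  have "((\<lambda>x::real. exp (- (1 / x))) \<longlongrightarrow> exp (- 0)) at_top"
    by (intro tendsto_intros tendsto_divide_0[OF tendsto_const] filterlim_at_top_imp_at_infinity filterlim_ident)
  then have "((\<lambda>x::real. exp (- (1 / x))) \<longlongrightarrow> 1) at_top" by simp
  then show ?thesis
    by (rule Lim_transform_eventually) (use eventually_gt_at_top[of 0] in \<open>auto elim!: eventually_mono simp: flat_def\<close>)
qed

lemma tendsto_flat_1: "((\<lambda>x. (x + 1) * flat 1 x) \<longlongrightarrow> 0) at_top"
proof -
  have "((\<lambda>x::real. (1 / x + (1 / x)\<^sup>2) * exp (- (1 / x))) \<longlongrightarrow> (0 + 0\<^sup>2) * exp (- 0)) at_top"
    by (intro tendsto_intros tendsto_divide_0[OF tendsto_const] filterlim_at_top_imp_at_infinity filterlim_ident)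
  then have "((\<lambda>x::real. (1 / x + (1 / x)\<^sup>2) * exp (- (1 / x))) \<longlongrightarrow> 0) at_top" by simp
  then show ?thesis
    by (rule Lim_transform_eventually)
      (rule eventually_mono[OF eventually_gt_at_top[of 0]], simp add: flat_def field_simps power2_eq_square)
qed

section \<open>Wirtinger derivatives in one variable\<close>

definition dbar :: "(complex \<Rightarrow> complex) \<Rightarrow> complex \<Rightarrow> complex" where
  "dbar \<theta> w = (frechet_derivative \<theta> (at w) 1 + \<i> * frechet_derivative \<theta> (at w) \<i>) / 2"

lemma dbar_eqI:
  assumes "(\<theta> has_derivative D) (at w)" shows "dbar \<theta> w = (D 1 + \<i> * D \<i>) / 2"
  using frechet_derivative_at[OF assms] by (simp add: dbar_def)

lemma dbar_mult:
  assumes "smooth f" "smooth g"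
  shows "dbar (\<lambda>w. f w * g w) w = dbar f w * g w + f w * dbar g w"
proof -
  have "((\<lambda>w. f w * g w) has_derivative
     (\<lambda>h. f w * frechet_derivative g (at w) h + frechet_derivative f (at w) h * g w)) (at w)"
    using assms[THEN smooth_has_derivative] by (auto intro!: derivative_eq_intros)
  from dbar_eqI[OF this] show ?thesis unfolding dbar_def[of f] dbar_def[of g] by (simp add: algebra_simps add_divide_distrib)
qed

lemma dbar_real_compose:
  assumes "(h has_real_derivative h') (at (q w))" "(q has_derivative D) (at w)"
  shows "dbar (\<lambda>w. complex_of_real (h (q w))) w = of_real h' * (of_real (D 1) + \<i> * of_real (D \<i>)) / 2"
proof -
  have "((\<lambda>w. h (q w)) has_derivative (\<lambda>v. h' * D v)) (at w)"
    using has_derivative_compose[OF assms(2), of h "(*) h'"] assms(1)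
    by (simp add: has_field_derivative_def)
  then have "((\<lambda>w. complex_of_real (h (q w))) has_derivative (\<lambda>v. of_real (h' * D v))) (at w)"
    by (rule has_derivative_of_real)
  from dbar_eqI[OF this] show ?thesis by (simp add: field_simps)
qed

lemma smooth_dbar: "smooth f \<Longrightarrow> smooth (dbar f)"
proof -
  assume "smooth f"
  then have "smooth (\<lambda>w. (frechet_derivative f (at w) 1 + \<i> * frechet_derivative f (at w) \<i>) * (1/2))"
    by (intro smooth_mult smooth_add smooth_const smooth_frechet_derivative)
  moreover have "dbar f = (\<lambda>w. (frechet_derivative f (at w) 1 + \<i> * frechet_derivative f (at w) \<i>) * (1/2))"
    by (auto simp: dbar_def)
  ultimately show ?thesis by simp
qed

section \<open>Cut-offs and the regularised Cauchy kernel\<close>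

lemma smooth_norm_power2: "smooth (\<lambda>w::complex. (w - a) \<bullet> (w - a))"
proof -
  have "smooth (\<lambda>w::complex. w + (- a))"
    by (intro smooth_add smooth_const smooth_bounded_linear bounded_linear_ident)
  then show ?thesis by (intro smooth_bilinear[OF bounded_bilinear_inner]) simp_all
qed

text \<open>Vanishes for |w| \<le> 1/r and tends to 1 off the origin as r grows. As a function of r
  |w| alone it has a \<open>dbar\<close> of size 1/|w|, uniformly in r.\<close>

definition cut_zero :: "real \<Rightarrow> complex \<Rightarrow> complex" where
  "cut_zero r w = of_real (flat 0 (r\<^sup>2 * (w \<bullet> w) - 1))"

text \<open>For r > 0 it vanishes where |w| \<ge> r. Since \<open>flat 0\<close> reaches 1 only in
  the limit at infinity, the argument is scaled so that it tends to infinity at every fixed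
  w.\<close>

definition cut_infinity :: "real \<Rightarrow> complex \<Rightarrow> complex" where
  "cut_infinity r w = of_real (flat 0 (r - (w \<bullet> w) / r))"

text \<open>Smooth substitute for 1/(w - 1): the conjugate of w - 1 over |w - 1|^2 + e^2.\<close>

definition cauchy_kernel :: "real \<Rightarrow> complex \<Rightarrow> complex" where
  "cauchy_kernel e w = cnj (w - 1) * of_real (inverse ((w - 1) \<bullet> (w - 1) + e\<^sup>2))"

lemma smooth_cut_zero: "smooth (cut_zero r)"
proof -
  have "smooth (\<lambda>w::complex. r\<^sup>2 * ((w - 0) \<bullet> (w - 0)) + (- 1))"
    by (intro smooth_add smooth_const smooth_mult smooth_norm_power2)
  then show ?thesis unfolding cut_zero_def
    by (intro smooth_linear_compose[OF bounded_linear_of_real] smooth_flat) simp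
qed

lemma smooth_cut_infinity: "smooth (cut_infinity r)"
proof -
  have "smooth (\<lambda>w::complex. r + ((w - 0) \<bullet> (w - 0)) * (- (1 / r)))"
    by (intro smooth_add smooth_const smooth_mult smooth_norm_power2)
  then show ?thesis unfolding cut_infinity_def
    by (intro smooth_linear_compose[OF bounded_linear_of_real] smooth_flat) simp
qed

lemma dbar_cut_zero:
  "dbar (cut_zero r) w = of_real (flat 1 (r\<^sup>2 * (w \<bullet> w) - 1) * r\<^sup>2) * w"
proof -
  have "((\<lambda>w::complex. r\<^sup>2 * (w \<bullet> w) - 1) has_derivative (\<lambda>v. r\<^sup>2 * (2 * (w \<bullet> v)))) (at w)"
    by (auto intro!: derivative_eq_intros simp: inner_commute)
  from dbar_real_compose[OF flat_has_derivative this, of 0] show ?thesis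
    unfolding cut_zero_def by (simp add: complex_eq_iff inner_complex_def)
qed

lemma dbar_cut_infinity:
  "dbar (cut_infinity r) w = - of_real (flat 1 (r - (w \<bullet> w) / r) / r) * w"
proof -
  have "((\<lambda>w::complex. r - (w \<bullet> w) / r) has_derivative (\<lambda>v. - (2 * (w \<bullet> v) / r))) (at w)"
    by (cases "r = 0") (auto intro!: derivative_eq_intros simp: inner_commute)
  from dbar_real_compose[OF flat_has_derivative this, of 0] show ?thesis
    unfolding cut_infinity_def by (simp add: complex_eq_iff inner_complex_def)
qed

text \<open>The tower of derivatives of 1/y, in the shape that \<open>smooth_scalar_compose\<close>
  expects.\<close>

lemma inverse_derivatives:
  fixes y :: real
  assumes "y > 0"
  shows "((\<lambda>y. (-1) ^ k * fact k / y ^ Suc k) has_real_derivative (-1) ^ Suc k * fact (Suc k) / y ^ Suc (Suc k)) (at y)"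
proof -
  have "((\<lambda>y. (-1) ^ k * fact k * inverse (y ^ Suc k)) has_real_derivative
      (-1) ^ k * fact k * (- (inverse (y ^ Suc k) * (real (Suc k) * y ^ k) * inverse (y ^ Suc k)))) (at y)"
    using assms by (auto intro!: derivative_eq_intros simp del: power_Suc)
  moreover have e: "inverse (y ^ Suc k) * (real (Suc k) * y ^ k) * inverse (y ^ Suc k) = real (Suc k) / y ^ Suc (Suc k)"
    using assms by (simp add: divide_simps del: of_nat_Suc)
  moreover have "(-1) ^ k * fact k * (- (real (Suc k) / y ^ Suc (Suc k))) = (-1) ^ Suc k * fact (Suc k) / y ^ Suc (Suc k)"
    by simp
  ultimately show ?thesis unfolding e divide_inverse[of _ "_ ^ Suc k"] by (simp only:)
qed

lemma smooth_cauchy_kernel: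
  assumes "e > 0" shows "smooth (cauchy_kernel e)"
proof -
  have pos: "(w - 1) \<bullet> (w - 1) + e\<^sup>2 > 0" for w :: complex
    using assms by (intro add_nonneg_pos) auto
  have q: "smooth (\<lambda>w::complex. (w - 1) \<bullet> (w - 1) + e\<^sup>2)"
    by (intro smooth_add smooth_const smooth_norm_power2)
  have "smooth (\<lambda>w::complex. (-1) ^ 0 * fact 0 / ((w - 1) \<bullet> (w - 1) + e\<^sup>2) ^ Suc 0)"
    using smooth_scalar_compose[where h = "\<lambda>k y. (-1) ^ k * fact k / y ^ Suc k" and k = 0, OF inverse_derivatives[OF pos] q]
    by simp
  then have i: "smooth (\<lambda>w::complex. inverse ((w - 1) \<bullet> (w - 1) + e\<^sup>2))"
    by (simp add: inverse_eq_divide)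
  have "smooth (\<lambda>w. cnj w + (- 1))"
    by (intro smooth_add smooth_const smooth_bounded_linear bounded_linear_cnj)
  then show ?thesis unfolding cauchy_kernel_def
    by (intro smooth_mult smooth_linear_compose[OF bounded_linear_of_real] i) simp
qed

text \<open>With r = |w - 1|^2 + e^2 the product rule gives 1/r - |w - 1|^2 / r^2 = e^2 / r^2, a
  bump that concentrates at 1 as e tends to 0. Its mass does not depend on e.\<close>

lemma dbar_cauchy_kernel:
  assumes "e > 0"
  shows "dbar (cauchy_kernel e) w = of_real (e\<^sup>2 / ((w - 1) \<bullet> (w - 1) + e\<^sup>2)\<^sup>2)"
proof -
  define r where "r = (w - 1) \<bullet> (w - 1) + e\<^sup>2"
  have r: "r > 0" unfolding r_def using assms by (intro add_nonneg_pos) auto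
  have inv: "((\<lambda>w. inverse ((w - 1) \<bullet> (w - 1) + e\<^sup>2)) has_derivative
     (\<lambda>v. - (inverse r * (2 * ((w - 1) \<bullet> v)) * inverse r))) (at w)"
    unfolding r_def using r[unfolded r_def]
    by (auto intro!: derivative_eq_intros simp: inner_commute)
  have "(cauchy_kernel e has_derivative
     (\<lambda>v. cnj (w - 1) * of_real (- (inverse r * (2 * ((w - 1) \<bullet> v)) * inverse r)) + cnj v * of_real (inverse r))) (at w)"
    unfolding cauchy_kernel_def
    by (rule has_derivative_eq_rhs[OF has_derivative_mult[OF _ has_derivative_of_real[OF inv]]])
      (auto intro!: derivative_eq_intros simp: r_def)
  note dbar_eqI[OF this]
  also have "(cnj (w - 1) * of_real (- (inverse r * (2 * ((w - 1) \<bullet> 1)) * inverse r)) + cnj 1 * of_real (inverse r) +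
      \<i> * (cnj (w - 1) * of_real (- (inverse r * (2 * ((w - 1) \<bullet> \<i>)) * inverse r)) + cnj \<i> * of_real (inverse r))) / 2
     = of_real (inverse r) - cnj (w - 1) * (w - 1) * of_real (inverse r * inverse r)"
  proof -
    have "(cnj (w - 1) * of_real (- (s * (2 * ((w - 1) \<bullet> 1)) * s)) + cnj 1 * of_real s +
      \<i> * (cnj (w - 1) * of_real (- (s * (2 * ((w - 1) \<bullet> \<i>)) * s)) + cnj \<i> * of_real s)) / 2
     = of_real s - cnj (w - 1) * (w - 1) * of_real (s * s)" for s
      by (simp add: complex_eq_iff inner_complex_def algebra_simps diff_divide_distrib add_divide_distrib)
    then show ?thesis .
  qed
  also have "cnj (w - 1) * (w - 1) = of_real (r - e\<^sup>2)"
    by (simp add: r_def complex_eq_iff inner_complex_def algebra_simps)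
  also have "of_real (inverse r) - of_real (r - e\<^sup>2) * of_real (inverse r * inverse r) = (of_real (e\<^sup>2 / r\<^sup>2) :: complex)"
    using r by (simp add: field_simps power2_eq_square)
  finally show ?thesis by (simp add: r_def)
qed

section \<open>Integrals over the complex plane\<close>

lemma lborel_complex: "(lborel :: complex measure) = distr (lborel \<Otimes>\<^sub>M lborel) borel (\<lambda>(x, y). Complex x y)"
proof (rule lborel_eqI)
  have meas: "(\<lambda>(x, y). Complex x y) \<in> borel_measurable (lborel \<Otimes>\<^sub>M lborel)"
    by (subst borel_measurable_complex_iff) (auto simp: split_beta)
  fix l u :: complex
  assume le: "\<And>b. b \<in> Basis \<Longrightarrow> l \<bullet> b \<le> u \<bullet> b"
  have "(\<lambda>(x, y). Complex x y) -` box l u = {Re l <..< Re u} \<times> {Im l <..< Im u}"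
    by (auto simp: box_def Basis_complex_def inner_complex_def)
  then show "emeasure (distr (lborel \<Otimes>\<^sub>M lborel) borel (\<lambda>(x, y). Complex x y)) (box l u) =
      ennreal (\<Prod>b\<in>Basis. (u - l) \<bullet> b)"
    using le[of 1] le[of \<i>] meas
    by (simp add: emeasure_distr space_pair_measure lborel.emeasure_pair_measure_Times
        Basis_complex_def inner_complex_def ennreal_mult)
qed simp

section \<open>The mass of the bump and the local integrability of 1/|w - a|\<close>

lemma nn_integral_complex:
  assumes [measurable]: "h \<in> borel_measurable borel"
  shows "(\<integral>\<^sup>+w. h w \<partial>(lborel :: complex measure)) = (\<integral>\<^sup>+x. \<integral>\<^sup>+y. h (Complex x y) \<partial>lborel \<partial>lborel)"
proof -
  have meas: "(\<lambda>(x, y). Complex x y) \<in> lborel \<Otimes>\<^sub>M lborel \<rightarrow>\<^sub>M borel"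
    by (subst borel_measurable_complex_iff) (auto simp: split_beta)
  have meas2: "(\<lambda>z. h (case z of (x, y) \<Rightarrow> Complex x y)) \<in> borel_measurable (lborel \<Otimes>\<^sub>M lborel)"
    using measurable_compose[OF meas assms] .
  show ?thesis
    by (subst lborel_complex, subst nn_integral_distr[OF meas])
      (simp_all add: lborel.nn_integral_fst[OF meas2, symmetric])
qed

text \<open>The inner integral of the bump, over the imaginary part, with A = 1 + x^2. An explicit
  antiderivative gives the half line and evenness doubles it.\<close>

lemma has_bochner_integral_rational_square:
  fixes A :: real
  assumes "A > 0"
  shows "has_bochner_integral lborel (\<lambda>x. 1 / (A + x\<^sup>2)\<^sup>2) (pi / (2 * A * sqrt A))"
proof -
  let ?F = "\<lambda>x. x / (2 * A * (A + x\<^sup>2)) + arctan (x / sqrt A) / (2 * A * sqrt A)"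
  have pos: "A + x\<^sup>2 > 0" for x :: real using assms by (simp add: add_pos_nonneg)
  have A: "A = (sqrt A)\<^sup>2" "sqrt A > 0" using assms by auto
  have D: "(?F has_real_derivative 1 / (A + x\<^sup>2)\<^sup>2) (at x)" for x
  proof -
    define s where "s = sqrt A"
    have s: "s > 0" "A = s\<^sup>2" using A by (auto simp: s_def)
    have sp: "s\<^sup>2 + x\<^sup>2 > 0" using pos[of x] s by simp
    have e1: "1 + (x / s)\<^sup>2 = (s\<^sup>2 + x\<^sup>2) / s\<^sup>2" using s by (simp add: field_simps)
    have "((\<lambda>x. x / (2 * s\<^sup>2 * (s\<^sup>2 + x\<^sup>2)) + arctan (x / s) / (2 * s\<^sup>2 * s)) has_real_derivative
       ((2 * s\<^sup>2 * (s\<^sup>2 + x\<^sup>2)) - x * (2 * s\<^sup>2 * (2 * x))) / (2 * s\<^sup>2 * (s\<^sup>2 + x\<^sup>2))\<^sup>2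
        + inverse (1 + (x / s)\<^sup>2) * (1 / s) / (2 * s\<^sup>2 * s)) (at x)"
      using s sp by (auto intro!: derivative_eq_intros simp: power2_eq_square mult_ac)
    moreover have "((2 * s\<^sup>2 * (s\<^sup>2 + x\<^sup>2)) - x * (2 * s\<^sup>2 * (2 * x))) / (2 * s\<^sup>2 * (s\<^sup>2 + x\<^sup>2))\<^sup>2
        = (s\<^sup>2 - x\<^sup>2) / (2 * s\<^sup>2 * (s\<^sup>2 + x\<^sup>2)\<^sup>2)"
      using s sp by (simp add: divide_simps) (simp add: power2_eq_square power4_eq_xxxx algebra_simps)
    moreover have "inverse (1 + (x / s)\<^sup>2) * (1 / s) / (2 * s\<^sup>2 * s) = 1 / (2 * s\<^sup>2 * (s\<^sup>2 + x\<^sup>2))"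
      unfolding e1 using s sp by (simp add: divide_simps) (simp add: power2_eq_square power4_eq_xxxx algebra_simps)
    moreover have "(s\<^sup>2 - x\<^sup>2) / (2 * s\<^sup>2 * (s\<^sup>2 + x\<^sup>2)\<^sup>2) + 1 / (2 * s\<^sup>2 * (s\<^sup>2 + x\<^sup>2)) = 1 / (s\<^sup>2 + x\<^sup>2)\<^sup>2"
    proof -
      have "1 / (2 * s\<^sup>2 * (s\<^sup>2 + x\<^sup>2)) = (s\<^sup>2 + x\<^sup>2) / (2 * s\<^sup>2 * (s\<^sup>2 + x\<^sup>2)\<^sup>2)"
        using s sp by (simp add: power2_eq_square)
      then have "(s\<^sup>2 - x\<^sup>2) / (2 * s\<^sup>2 * (s\<^sup>2 + x\<^sup>2)\<^sup>2) + 1 / (2 * s\<^sup>2 * (s\<^sup>2 + x\<^sup>2))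
          = (2 * s\<^sup>2) / (2 * s\<^sup>2 * (s\<^sup>2 + x\<^sup>2)\<^sup>2)"
        by (simp add: add_divide_distrib[symmetric])
      then show ?thesis using s by simp
    qed
    ultimately show ?thesis using s by (simp add: s_def[symmetric])
  qed
  have 1: "((\<lambda>x. x / (2 * A * (A + x\<^sup>2))) \<longlongrightarrow> 0) at_top"
    using assms by real_asymp
  have "((\<lambda>x. arctan (x / sqrt A)) \<longlongrightarrow> pi / 2) at_top"
    by (rule filterlim_compose[OF tendsto_arctan_at_top])
      (use A(2) in real_asymp)
  then have "((\<lambda>x. arctan (x / sqrt A) / (2 * A * sqrt A)) \<longlongrightarrow> pi / 2 / (2 * A * sqrt A)) at_top"
    using assms by (intro tendsto_intros) auto
  from tendsto_add[OF 1 this]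
  have lim: "(?F \<longlongrightarrow> pi / 2 / (2 * A * sqrt A)) at_top" by simp
  have scale: "ennreal (indicator {0..} x *\<^sub>R c) = ennreal c * indicator {0..} x" for x c :: real
    by (simp add: indicator_def)
  have "has_bochner_integral lborel (\<lambda>x. indicator {0..} x *\<^sub>R (1 / (A + x\<^sup>2)\<^sup>2)) (pi / 2 / (2 * A * sqrt A))"
  proof (rule has_bochner_integral_nn_integral)
    have "(\<integral>\<^sup>+x. ennreal (1 / (A + x\<^sup>2)\<^sup>2) * indicator {0 ..} x \<partial>lborel) = pi / 2 / (2 * A * sqrt A) - ?F 0"
      by (rule nn_integral_FTC_atLeast[OF _ D _ lim]) auto
    then show "(\<integral>\<^sup>+x. ennreal (indicator {0..} x *\<^sub>R (1 / (A + x\<^sup>2)\<^sup>2)) \<partial>lborel) = ennreal (pi / 2 / (2 * A * sqrt A))"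
      by (simp only: scale) simp
  qed (use assms in auto)
  from has_bochner_integral_even_function[OF this] show ?thesis
    by (simp add: field_simps)
qed

text \<open>The remaining outer integral: the antiderivative (pi/2) y / sqrt (1 + y^2) rises from 0
  to pi/2 on the half line.\<close>

lemma has_bochner_integral_inverse_three_halves:
  "has_bochner_integral lborel (\<lambda>y::real. pi / (2 * (1 + y\<^sup>2) * sqrt (1 + y\<^sup>2))) pi"
proof -
  let ?F = "\<lambda>y::real. (pi / 2) * (y / sqrt (1 + y\<^sup>2))"
  have pos: "1 + y\<^sup>2 > 0" for y :: real by (simp add: add_pos_nonneg)
  have D: "(?F has_real_derivative pi / (2 * (1 + y\<^sup>2) * sqrt (1 + y\<^sup>2))) (at y)" for y
  proof -
    define s where "s = sqrt (1 + y\<^sup>2)"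
    have s: "s > 0" "1 + y\<^sup>2 = s\<^sup>2" using pos[of y] by (auto simp: s_def)
    have "((\<lambda>y. sqrt (1 + y\<^sup>2)) has_real_derivative inverse s / 2 * (2 * y)) (at y)"
      unfolding s_def using pos[of y] by (auto intro!: derivative_eq_intros)
    from DERIV_cmult[OF DERIV_divide[OF DERIV_ident this], of "pi / 2"]
    have "(?F has_real_derivative (pi / 2) * ((s - y * (inverse s / 2 * (2 * y))) / (s * s))) (at y)"
      using s by (simp add: s_def[symmetric] mult.commute)
    moreover have "(s - y * (inverse s / 2 * (2 * y))) / (s * s) = 1 / (s\<^sup>2 * s)"
    proof -
      have "s - y * (inverse s / 2 * (2 * y)) = (s\<^sup>2 - y\<^sup>2) / s"
        using s(1) by (simp add: field_simps power2_eq_square)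
      also have "s\<^sup>2 - y\<^sup>2 = 1" using s(2) by simp
      finally show ?thesis using s(1) by (simp add: field_simps power2_eq_square)
    qed
    moreover have "pi / (2 * (1 + y\<^sup>2) * sqrt (1 + y\<^sup>2)) = pi / 2 * (1 / (s\<^sup>2 * s))"
      unfolding s_def[symmetric] s(2) using s(1) by simp
    ultimately show ?thesis by (simp only:)
  qed
  have lim: "(?F \<longlongrightarrow> pi / 2) at_top" by real_asymp
  have scale: "ennreal (indicator {0..} x *\<^sub>R c) = ennreal c * indicator {0..} x" for x c :: real
    by (simp add: indicator_def)
  have "has_bochner_integral lborel (\<lambda>y. indicator {0..} y *\<^sub>R (pi / (2 * (1 + y\<^sup>2) * sqrt (1 + y\<^sup>2)))) (pi / 2)"
  proof (rule has_bochner_integral_nn_integral)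
    have "(\<integral>\<^sup>+y. ennreal (pi / (2 * (1 + y\<^sup>2) * sqrt (1 + y\<^sup>2))) * indicator {0 ..} y \<partial>lborel) = pi / 2 - ?F 0"
      by (rule nn_integral_FTC_atLeast[OF _ D _ lim]) auto
    then show "(\<integral>\<^sup>+y. ennreal (indicator {0..} y *\<^sub>R (pi / (2 * (1 + y\<^sup>2) * sqrt (1 + y\<^sup>2)))) \<partial>lborel) = ennreal (pi / 2)"
      by (simp only: scale) simp
  qed auto
  from has_bochner_integral_even_function[OF this] show ?thesis by simp
qed

text \<open>This value is the origin of the factor pi in the Cauchy-Pompeiu formula below.\<close>

lemma has_bochner_integral_poisson_mass:
  "has_bochner_integral lborel (\<lambda>u::complex. 1 / (1 + u \<bullet> u)\<^sup>2) pi"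
proof (rule has_bochner_integral_nn_integral)
  have "(\<integral>\<^sup>+u. ennreal (1 / (1 + u \<bullet> u)\<^sup>2) \<partial>(lborel :: complex measure)) =
      (\<integral>\<^sup>+x. \<integral>\<^sup>+y. ennreal (1 / ((1 + x\<^sup>2) + y\<^sup>2)\<^sup>2) \<partial>lborel \<partial>lborel)"
    by (subst nn_integral_complex) (auto simp: inner_complex_def power2_eq_square add.assoc)
  also have "\<dots> = (\<integral>\<^sup>+x. ennreal (pi / (2 * (1 + x\<^sup>2) * sqrt (1 + x\<^sup>2))) \<partial>lborel)"
  proof (rule nn_integral_cong)
    fix x :: real
    have "1 + x\<^sup>2 > 0" by (simp add: add_pos_nonneg)
    from has_bochner_integral_rational_square[OF this]
    show "(\<integral>\<^sup>+y. ennreal (1 / ((1 + x\<^sup>2) + y\<^sup>2)\<^sup>2) \<partial>lborel) = ennreal (pi / (2 * (1 + x\<^sup>2) * sqrt (1 + x\<^sup>2)))"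
      by (subst nn_integral_eq_integral) (auto simp: has_bochner_integral_iff)
  qed
  also have "\<dots> = ennreal pi"
    using has_bochner_integral_inverse_three_halves
    by (subst nn_integral_eq_integral) (auto simp: has_bochner_integral_iff add_nonneg_nonneg)
  finally show "(\<integral>\<^sup>+u. ennreal (1 / (1 + u \<bullet> u)\<^sup>2) \<partial>(lborel :: complex measure)) = ennreal pi" .
qed auto

text \<open>Polar coordinates are avoided: 1/|w - a| is dominated by the sum of the indicators of
  the balls of radius r/2^n with weights 2^(n+1)/r, and the areas turn this into a geometric series
  with sum 4 pi r, twice the exact value. Only the linear growth in r matters later.\<close>

lemma nn_integral_inverse_norm:
  fixes a :: complex
  assumes "r > 0"
  shows "(\<integral>\<^sup>+w. ennreal (indicator (ball a r) w / cmod (w - a)) \<partial>lborel) \<le> ennreal (4 * pi * r)"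
proof -
  let ?h = "\<lambda>n w. ennreal (2 ^ Suc n / r) * indicator (ball a (r / 2 ^ n)) w"
  have single: "f k \<le> (\<Sum>n. f n)" for f :: "nat \<Rightarrow> ennreal" and k
    using sum_le_suminf[of f "{k}"] by simp
  have le: "ennreal (indicator (ball a r) w / cmod (w - a)) \<le> (\<Sum>n. ?h n w)" for w
  proof (cases "w \<in> ball a r \<and> w \<noteq> a")
    case True
    define d where "d = cmod (w - a)"
    have d: "0 < d" "d < r" using True by (auto simp: d_def dist_norm norm_minus_commute)
    have "(\<lambda>n. r * (1/2) ^ n) \<longlonglongrightarrow> r * 0"
      by (intro tendsto_intros LIMSEQ_power_zero) auto
    then have "eventually (\<lambda>n. r * (1/2) ^ n < d) sequentially"
      using d order_tendstoD(2) by fastforce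
    then obtain n0 where n0: "r * (1/2) ^ n0 < d" by (auto simp: eventually_sequentially)
    \<comment> \<open>The first dyadic radius below d; with n = k + 1 this places d between
      r/2^(k+1) and r/2^k.\<close>
    define n where "n = (LEAST n. r * (1/2) ^ n < d)"
    have n: "r * (1/2) ^ n < d" using LeastI[of "\<lambda>n. r * (1/2) ^ n < d", OF n0] by (simp add: n_def)
    then have "n \<noteq> 0" using d by (intro notI) simp
    then obtain k where k: "n = Suc k" by (cases n) auto
    have "\<not> r * (1/2) ^ k < d"
      using not_less_Least[of k "\<lambda>n. r * (1/2) ^ n < d"] k by (simp add: n_def)
    moreover have "r * (1/2) ^ k \<noteq> d \<or> r * (1/2) ^ k = d" by simp
    ultimately have dk: "d \<le> r / 2 ^ k" by (simp add: power_divide)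
    have d2: "r / 2 ^ Suc k < d" using n k by (simp add: power_divide)
    show ?thesis
    proof (cases "d < r / 2 ^ k")
      case True
      then have "w \<in> ball a (r / 2 ^ k)" by (simp add: d_def dist_norm norm_minus_commute)
      then have "ennreal (indicator (ball a r) w / cmod (w - a)) \<le> ?h k w"
        using d d2 assms by (auto simp: d_def[symmetric] indicator_def field_simps intro!: ennreal_leI)
      also have "\<dots> \<le> (\<Sum>n. ?h n w)" by (rule single)
      finally show ?thesis .
    next
      \<comment> \<open>If d is exactly a dyadic radius, the open ball of that radius misses w. The
        next larger ball contains it and its weight is still 1/d.\<close>
      case False
      then have dk': "d = r / 2 ^ k" using dk by simp
      then have "k \<noteq> 0" using d by (intro notI) simp
      then obtain j where j: "k = Suc j" by (cases k) auto
      have "r / (2 * 2 ^ j) < r / 2 ^ j" using assms by (simp add: field_simps)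
      then have "w \<in> ball a (r / 2 ^ j)" using dk' j by (simp add: d_def dist_norm norm_minus_commute)
      then have "ennreal (indicator (ball a r) w / cmod (w - a)) \<le> ?h j w"
        using d dk' j assms by (auto simp: d_def[symmetric] indicator_def field_simps intro!: ennreal_leI)
      also have "\<dots> \<le> (\<Sum>n. ?h n w)" by (rule single)
      finally show ?thesis .
    qed
  qed (auto simp: indicator_def)
  have "(\<integral>\<^sup>+w. ennreal (indicator (ball a r) w / cmod (w - a)) \<partial>lborel) \<le> (\<integral>\<^sup>+w. (\<Sum>n. ?h n w) \<partial>lborel)"
    by (intro nn_integral_mono le)
  also have "\<dots> = (\<Sum>n. \<integral>\<^sup>+w. ?h n w \<partial>lborel)"
    by (rule nn_integral_suminf) (intro borel_measurable_times_ennreal borel_measurable_indicator borel_measurable_const; simp add: borel_open)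
  also have "\<dots> = (\<Sum>n. ennreal (2 * pi * r * (1 / 2) ^ n))"
  proof (intro suminf_cong)
    fix n
    have "(\<integral>\<^sup>+w. ?h n w \<partial>lborel) = ennreal (2 ^ Suc n / r) * emeasure lborel (ball a (r / 2 ^ n))"
      by (rule nn_integral_cmult_indicator) (simp add: borel_open)
    also have "emeasure lborel (ball a (r / 2 ^ n)) = ennreal (pi * (r / 2 ^ n)\<^sup>2)"
      using assms by (subst emeasure_ball) (simp_all add: unit_ball_vol_2)
    also have "ennreal (2 ^ Suc n / r) * \<dots> = ennreal (2 ^ Suc n / r * (pi * (r / 2 ^ n)\<^sup>2))"
      by (rule ennreal_mult[symmetric]) (use assms in auto)
    also have "2 ^ Suc n / r * (pi * (r / 2 ^ n)\<^sup>2) = 2 * pi * r * (1 / 2) ^ n"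
      using assms by (simp add: field_simps power2_eq_square power_divide)
    finally show "(\<integral>\<^sup>+w. ?h n w \<partial>lborel) = ennreal (2 * pi * r * (1 / 2) ^ n)" .
  qed
  also have "\<dots> = ennreal (\<Sum>n. 2 * pi * r * (1 / 2) ^ n)"
    using assms by (intro suminf_ennreal2 summable_mult summable_geometric) auto
  also have "(\<Sum>n. 2 * pi * r * (1 / 2 :: real) ^ n) = 4 * pi * r"
    by (subst suminf_mult) (auto simp: suminf_geometric)
  finally show ?thesis .
qed

lemma integrable_inverse_norm:
  fixes a :: complex
  assumes "bounded X" "X \<in> sets borel"
  shows "integrable lborel (\<lambda>w. indicator X w / cmod (w - a))"
proof -
  obtain r where r: "r > 0" "X \<subseteq> ball a r"
    using bounded_subset_ballD[OF assms(1), of a] by auto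
  have *: "indicator X w / cmod (w - a) \<le> indicator (ball a r) w / cmod (w - a)" for w
    using r by (intro divide_right_mono) (auto simp: indicator_def)
  have [measurable]: "X \<in> sets borel" by fact
  have "(\<integral>\<^sup>+w. ennreal (norm (indicator X w / cmod (w - a))) \<partial>lborel) \<le>
     (\<integral>\<^sup>+w. ennreal (indicator (ball a r) w / cmod (w - a)) \<partial>lborel)"
    using * by (intro nn_integral_mono ennreal_leI) simp
  also have "\<dots> < \<infinity>" using nn_integral_inverse_norm[OF r(1), of a] by (simp add: le_less_trans)
  finally show ?thesis by (intro integrableI_bounded) measurable
qed

lemma lborel_integral_affine:
  fixes h :: "'a::euclidean_space \<Rightarrow> complex"
  assumes [measurable]: "h \<in> borel_measurable borel" and "c \<noteq> 0"
  shows "(\<integral>w. h w \<partial>lborel) = \<bar>c\<bar> ^ DIM('a) *\<^sub>R (\<integral>w. h (t + c *\<^sub>R w) \<partial>lborel)"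
  by (subst lborel_affine[OF assms(2), of t])
    (simp add: integral_density integral_distr)

text \<open>Domination uniform in e. It includes w = 1, where the kernel vanishes and the quotient
  by zero is 0.\<close>

lemma cauchy_kernel_norm_le: "cmod (cauchy_kernel e w) \<le> 1 / cmod (w - 1)"
proof (cases "w = 1")
  case False
  have "cmod (cauchy_kernel e w) = cmod (w - 1) * inverse ((w - 1) \<bullet> (w - 1) + e\<^sup>2)"
    unfolding cauchy_kernel_def norm_mult norm_of_real complex_mod_cnj by (subst abs_of_nonneg) auto
  also have "\<dots> \<le> cmod (w - 1) * inverse ((w - 1) \<bullet> (w - 1))"
    using False by (intro mult_left_mono le_imp_inverse_le) auto
  finally show ?thesis using False by (simp add: dot_square_norm power2_eq_square field_simps)
qed (simp add: cauchy_kernel_def)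

lemma cauchy_kernel_tendsto: "((\<lambda>n. cauchy_kernel (1 / real (Suc n)) w) \<longlongrightarrow> 1 / (w - 1)) sequentially"
proof (cases "w = 1")
  case False
  have "((\<lambda>n. cauchy_kernel (1 / real (Suc n)) w) \<longlongrightarrow> cnj (w - 1) * of_real (inverse ((w - 1) \<bullet> (w - 1) + 0\<^sup>2))) sequentially"
    unfolding cauchy_kernel_def
    by (intro tendsto_intros LIMSEQ_Suc[OF lim_1_over_n]) (use False in auto)
  also have "cnj (w - 1) * of_real (inverse ((w - 1) \<bullet> (w - 1) + 0\<^sup>2)) = 1 / (w - 1)"
    using False complex_norm_square[of "w - 1"]
    by (simp add: dot_square_norm of_real_inverse[symmetric] divide_simps del: of_real_power)
  finally show ?thesis .
qed (simp add: cauchy_kernel_def)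

section \<open>Uniform bounds and limits of the cut-offs\<close>

lemma norm_cut_zero_le: "cmod (cut_zero r w) \<le> 1"
  and norm_cut_infinity_le: "cmod (cut_infinity r w) \<le> 1"
  using flat_0_bounds by (simp_all add: cut_zero_def cut_infinity_def)

text \<open>|w| times the left side is (x + 1) \<open>flat 1 x\<close> at x = r^2 |w|^2 - 1, hence
  at most 3. The bound is free of r and integrable in the plane, which is what makes an isolated
  point removable.\<close>

lemma norm_dbar_cut_zero_le: "cmod (dbar (cut_zero r) w) \<le> 3 / cmod w"
proof (cases "w = 0")
  case False
  have "cmod (dbar (cut_zero r) w) * cmod w = (r\<^sup>2 * (w \<bullet> w) - 1 + 1) * flat 1 (r\<^sup>2 * (w \<bullet> w) - 1)"
    using flat_1_bounds(1)[of "r\<^sup>2 * (w \<bullet> w) - 1"]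
    by (simp add: dbar_cut_zero norm_mult dot_square_norm power2_eq_square)
  also have "\<dots> \<le> 3" by (rule flat_1_bounds)
  finally show ?thesis using False by (simp add: field_simps)
qed (simp add: dbar_cut_zero)

lemma filterlim_cut_arg:
  assumes "w \<noteq> 0"
  shows "filterlim (\<lambda>n. (real (Suc n))\<^sup>2 * ((w::complex) \<bullet> w) - 1) at_top sequentially"
proof -
  define c where "c = w \<bullet> w"
  have "c > 0" using assms by (simp add: c_def)
  then show ?thesis unfolding c_def[symmetric] by real_asymp
qed

lemma cut_zero_tendsto:
  assumes "w \<noteq> 0" shows "(\<lambda>n. cut_zero (real (Suc n)) w) \<longlonglongrightarrow> 1"
proof -
  have "(\<lambda>n. complex_of_real (flat 0 ((real (Suc n))\<^sup>2 * (w \<bullet> w) - 1))) \<longlonglongrightarrow> of_real 1"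
    by (intro tendsto_of_real filterlim_compose[OF tendsto_flat_0] filterlim_cut_arg assms)
  then show ?thesis by (simp add: cut_zero_def)
qed

lemma dbar_cut_zero_tendsto: "(\<lambda>n. dbar (cut_zero (real (Suc n))) w) \<longlonglongrightarrow> 0"
proof (cases "w = 0")
  case False
  let ?q = "\<lambda>n. (real (Suc n))\<^sup>2 * (w \<bullet> w) - 1"
  have "(\<lambda>n. complex_of_real ((?q n + 1) * flat 1 (?q n)) * (w / of_real (w \<bullet> w))) \<longlonglongrightarrow> of_real 0 * (w / of_real (w \<bullet> w))"
    by (intro tendsto_mult tendsto_const tendsto_of_real filterlim_compose[OF tendsto_flat_1] filterlim_cut_arg False)
  moreover have "complex_of_real ((?q n + 1) * flat 1 (?q n)) * (w / of_real (w \<bullet> w)) = dbar (cut_zero (real (Suc n))) w" for n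
    using False unfolding dbar_cut_zero by (simp add: field_simps)
  ultimately show ?thesis by simp
qed (simp add: dbar_cut_zero)

lemma cut_infinity_tendsto: "(\<lambda>n. cut_infinity (real (Suc n)) w) \<longlonglongrightarrow> 1"
proof -
  define c where "c = w \<bullet> w"
  have "filterlim (\<lambda>n. real (Suc n) - c / real (Suc n)) at_top sequentially"
    by real_asymp
  from filterlim_compose[OF tendsto_flat_0 this] tendsto_of_real
  have "(\<lambda>n. complex_of_real (flat 0 (real (Suc n) - c / real (Suc n)))) \<longlonglongrightarrow> of_real 1"
    by blast
  then show ?thesis by (simp add: cut_infinity_def c_def)
qed

lemma norm_dbar_cut_infinity_le:
  assumes "r > 0" shows "cmod (dbar (cut_infinity r) w) \<le> 2 * cmod w / r"
proof -
  have "cmod (dbar (cut_infinity r) w) = flat 1 (r - (w \<bullet> w) / r) * (cmod w / r)"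
    using flat_1_bounds(1)[of "r - (w \<bullet> w) / r"] assms
    by (simp add: dbar_cut_infinity norm_mult norm_divide)
  also have "\<dots> \<le> 2 * (cmod w / r)"
    by (rule mult_right_mono[OF flat_1_bounds(2)]) (use assms in simp)
  finally show ?thesis by simp
qed

section \<open>The weak Cauchy-Pompeiu formula\<close>

lemma integrable_bounded_support:
  fixes h :: "complex \<Rightarrow> complex"
  assumes [measurable]: "h \<in> borel_measurable borel"
    and "\<And>w. cmod (h w) \<le> C" "\<And>w. cmod w > R \<Longrightarrow> h w = 0"
  shows "integrable lborel h"
proof (rule Bochner_Integration.integrable_bound)
  show "integrable lborel (\<lambda>w. C * indicator (cball (0::complex) R) w)"
    using emeasure_lborel_cball_finite[of "0::complex" R]
    by (intro integrable_mult_right integrable_real_indicator) simp_all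
  show "AE w in lborel. norm (h w) \<le> norm (C * indicator (cball (0::complex) R) w)"
    using assms(2,3) order_trans[OF norm_ge_zero assms(2)]
    by (intro AE_I2) (auto simp: indicator_def not_le)
qed simp

text \<open>The substitution w = 1 + e u turns the bump into the fixed density 1/(1 + |u|^2)^2,
  since the Jacobian e^2 cancels the scaling, and dominated convergence applies. The function
  \<open>h n\<close> may depend on n because the cut-offs do.\<close>

lemma cauchy_kernel_approximate_identity:
  fixes h :: "nat \<Rightarrow> complex \<Rightarrow> complex"
  assumes meas [measurable]: "\<And>n. h n \<in> borel_measurable borel"
    and bound: "\<And>n w. cmod (h n w) \<le> C"
    and lim: "\<And>u. (\<lambda>n. h n (1 + (1 / real (Suc n)) *\<^sub>R u)) \<longlonglongrightarrow> b"
  shows "(\<lambda>n. \<integral>w. h n w * dbar (cauchy_kernel (1 / real (Suc n))) w \<partial>lborel) \<longlonglongrightarrow> of_real pi * b"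
proof -
  have resc: "(\<integral>w. h n w * dbar (cauchy_kernel (1 / real (Suc n))) w \<partial>lborel) =
      (\<integral>u. h n (1 + (1 / real (Suc n)) *\<^sub>R u) * of_real (1 / (1 + u \<bullet> u)\<^sup>2) \<partial>lborel)" for n
  proof -
    define e where "e = 1 / real (Suc n)"
    have e: "e > 0" by (simp add: e_def)
    have meas': "(\<lambda>w. h n w * of_real (e\<^sup>2 / ((w - 1) \<bullet> (w - 1) + e\<^sup>2)\<^sup>2)) \<in> borel_measurable borel"
      by measurable
    have "(\<integral>w. h n w * dbar (cauchy_kernel e) w \<partial>lborel) =
       e\<^sup>2 *\<^sub>R (\<integral>u. h n (1 + e *\<^sub>R u) * of_real (e\<^sup>2 / ((1 + e *\<^sub>R u - 1) \<bullet> (1 + e *\<^sub>R u - 1) + e\<^sup>2)\<^sup>2) \<partial>lborel)"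
      using e by (simp only: dbar_cauchy_kernel[OF e])
        (subst lborel_integral_affine[OF meas', of e 1]; simp)
    also have "\<dots> = (\<integral>u. e\<^sup>2 *\<^sub>R (h n (1 + e *\<^sub>R u) * of_real (e\<^sup>2 / ((1 + e *\<^sub>R u - 1) \<bullet> (1 + e *\<^sub>R u - 1) + e\<^sup>2)\<^sup>2)) \<partial>lborel)"
      by simp
    also have "\<dots> = (\<integral>u. h n (1 + e *\<^sub>R u) * of_real (1 / (1 + u \<bullet> u)\<^sup>2) \<partial>lborel)"
    proof (rule Bochner_Integration.integral_cong)
      fix u :: complex
      have a1: "(1 + e *\<^sub>R u - 1) \<bullet> (1 + e *\<^sub>R u - 1) + e\<^sup>2 = e\<^sup>2 * (1 + u \<bullet> u)"
        by (simp add: power2_eq_square algebra_simps)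
      have "1 + u \<bullet> u > 0" by (simp add: add_pos_nonneg)
      then have "e\<^sup>2 * (e\<^sup>2 / (e\<^sup>2 * a)\<^sup>2) = 1 / a\<^sup>2" if "a > 0" for a
        using e that by (simp add: divide_simps power2_eq_square)
      from this[OF \<open>1 + u \<bullet> u > 0\<close>] have "e\<^sup>2 * (e\<^sup>2 / ((1 + e *\<^sub>R u - 1) \<bullet> (1 + e *\<^sub>R u - 1) + e\<^sup>2)\<^sup>2) = 1 / (1 + u \<bullet> u)\<^sup>2"
        unfolding a1 .
      then have "complex_of_real (e\<^sup>2) * of_real (e\<^sup>2 / ((1 + e *\<^sub>R u - 1) \<bullet> (1 + e *\<^sub>R u - 1) + e\<^sup>2)\<^sup>2) = of_real (1 / (1 + u \<bullet> u)\<^sup>2)"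
        by (metis of_real_mult)
      then show "e\<^sup>2 *\<^sub>R (h n (1 + e *\<^sub>R u) * of_real (e\<^sup>2 / ((1 + e *\<^sub>R u - 1) \<bullet> (1 + e *\<^sub>R u - 1) + e\<^sup>2)\<^sup>2)) =
          h n (1 + e *\<^sub>R u) * of_real (1 / (1 + u \<bullet> u)\<^sup>2)"
        unfolding scaleR_conv_of_real by (metis mult.left_commute)
    qed simp
    finally show ?thesis by (simp add: e_def)
  qed
  have C: "C \<ge> 0" using order_trans[OF norm_ge_zero bound] .
  have mass: "integrable lborel (\<lambda>u::complex. 1 / (1 + u \<bullet> u)\<^sup>2)" "(\<integral>u. 1 / (1 + u \<bullet> u)\<^sup>2 \<partial>(lborel :: complex measure)) = pi"
    using has_bochner_integral_poisson_mass by (auto simp: has_bochner_integral_iff)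
  have "(\<lambda>n. \<integral>u. h n (1 + (1 / real (Suc n)) *\<^sub>R u) * of_real (1 / (1 + u \<bullet> u)\<^sup>2) \<partial>lborel) \<longlonglongrightarrow>
     (\<integral>u. b * complex_of_real (1 / (1 + u \<bullet> u)\<^sup>2) \<partial>(lborel :: complex measure))"
  proof (rule integral_dominated_convergence[where w = "\<lambda>u::complex. C * (1 / (1 + u \<bullet> u)\<^sup>2)"])
    show "integrable lborel (\<lambda>u::complex. C * (1 / (1 + u \<bullet> u)\<^sup>2))"
      by (rule integrable_mult_right) (rule mass(1))
    show "AE u in lborel. (\<lambda>n. h n (1 + (1 / real (Suc n)) *\<^sub>R u) * of_real (1 / (1 + u \<bullet> u)\<^sup>2)) \<longlonglongrightarrow>
        b * complex_of_real (1 / (1 + u \<bullet> u)\<^sup>2)"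
      by (intro AE_I2 tendsto_intros lim)
    show "AE u in lborel. norm (h n (1 + (1 / real (Suc n)) *\<^sub>R u) * complex_of_real (1 / (1 + u \<bullet> u)\<^sup>2)) \<le> C * (1 / (1 + u \<bullet> u)\<^sup>2)" for n
      unfolding norm_mult norm_of_real using bound C by (intro AE_I2 mult_mono) auto
  qed simp_all
  also have "(\<integral>u. b * complex_of_real (1 / (1 + u \<bullet> u)\<^sup>2) \<partial>(lborel :: complex measure)) = b * of_real pi"
    unfolding integral_mult_right_zero integral_complex_of_real mass(2) ..
  finally show ?thesis unfolding resc by (simp add: mult.commute)
qed

text \<open>
  The weak form of \<open>dbar B = - \<alpha>\<close> is only required off the origin: the isolated point is removable
  because \<open>\<alpha>\<close> and \<open>B\<close> are bounded.
\<close>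

lemma weak_cauchy_pompeiu:
  fixes \<alpha> B :: "complex \<Rightarrow> complex"
  assumes meas [measurable]: "\<alpha> \<in> borel_measurable borel" "B \<in> borel_measurable borel"
    and bound: "\<And>w. cmod (\<alpha> w) \<le> C" "\<And>w. cmod (B w) \<le> C"
    and supp: "\<And>w. cmod w > R \<Longrightarrow> \<alpha> w = 0" "\<And>w. cmod w > R \<Longrightarrow> B w = 0"
    and cont: "isCont B 1"
    and weak: "\<And>\<theta> W. smooth \<theta> \<Longrightarrow> compact W \<Longrightarrow> 0 \<notin> W \<Longrightarrow> (\<And>w. w \<notin> W \<Longrightarrow> \<theta> w = 0) \<Longrightarrow>
      (\<integral>w. \<alpha> w * \<theta> w \<partial>lborel) = (\<integral>w. B w * dbar \<theta> w \<partial>lborel)"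
  shows "(\<integral>w. \<alpha> w / (w - 1) \<partial>lborel) = of_real pi * B 1"
proof -
  define z i k where "z n = cut_zero (real (Suc n))" and "i n = cut_infinity (real (Suc n))"
    and "k n = cauchy_kernel (1 / real (Suc n))" for n
  have C: "C \<ge> 0" using order_trans[OF norm_ge_zero bound(1)] .
  have smooth: "smooth (z n)" "smooth (i n)" "smooth (k n)" for n
    by (simp_all add: z_def i_def k_def smooth_cut_zero smooth_cut_infinity smooth_cauchy_kernel)
  note [measurable] = smooth[THEN smooth_continuous_on, THEN borel_measurable_continuous_onI]
    smooth[THEN smooth_dbar, THEN smooth_continuous_on, THEN borel_measurable_continuous_onI]
  have zi_smooth: "smooth (\<lambda>w. i n w * k n w)" for n
    by (intro smooth_mult smooth)
  \<comment> \<open>An admissible test function replacing 1/(w - 1): the pole is smoothed, and the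
    two cut-offs confine the support to a closed annulus around 0.\<close>
  have th_smooth: "smooth (\<lambda>w. z n w * (i n w * k n w))" for n
    by (intro smooth_mult smooth)
  have supp_th: "z n w * (i n w * k n w) = 0" if "w \<notin> cball 0 (real (Suc n)) - ball 0 (1 / real (Suc n))" for n w
  proof -
    define x where "x = real (Suc n)"
    have x: "x > 0" by (simp add: x_def)
    from that consider "x < cmod w" | "cmod w < 1 / x" by (auto simp: x_def)
    then show ?thesis
    proof cases
      case 1
      then have "x\<^sup>2 \<le> (cmod w)\<^sup>2" using x by (intro power_mono) auto
      then have "x - (w \<bullet> w) / x \<le> 0" using x by (simp add: dot_square_norm field_simps power2_eq_square)
      then have "i n w = 0" by (simp add: i_def cut_infinity_def flat_def x_def)
      then show ?thesis by simp
    next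
      case 2
      then have "x * cmod w \<le> 1" using x by (simp add: field_simps)
      then have "(x * cmod w)\<^sup>2 \<le> 1\<^sup>2" using x by (intro power_mono) auto
      then have "x\<^sup>2 * (w \<bullet> w) - 1 \<le> 0" by (simp add: dot_square_norm power_mult_distrib)
      then have "z n w = 0" unfolding z_def cut_zero_def flat_def x_def[symmetric] by simp
      then show ?thesis by simp
    qed
  qed
  have eq: "(\<integral>w. \<alpha> w * (z n w * (i n w * k n w)) \<partial>lborel) =
      (\<integral>w. B w * dbar (\<lambda>w. z n w * (i n w * k n w)) w \<partial>lborel)" for n
    by (rule weak[OF th_smooth _ _ supp_th, of "cball 0 (real (Suc n)) - ball 0 (1 / real (Suc n))" n])
      (auto intro: compact_diff)
  have nz: "cmod (z n w) \<le> 1" "cmod (i n w) \<le> 1" "cmod (k n w) \<le> 1 / cmod (w - 1)" for n w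
    by (simp_all add: z_def i_def k_def norm_cut_zero_le norm_cut_infinity_le cauchy_kernel_norm_le)
  have dz: "cmod (dbar (z n) w) \<le> 3 / cmod w" for n w
    by (simp add: z_def norm_dbar_cut_zero_le)
  have di: "cmod (dbar (i n) w) \<le> 2 * R" if "cmod w \<le> R" for n w
  proof -
    have "cmod (dbar (i n) w) \<le> 2 * cmod w / real (Suc n)"
      by (simp add: i_def norm_dbar_cut_infinity_le)
    also have "\<dots> \<le> 2 * cmod w / 1" by (intro divide_left_mono) auto
    finally show ?thesis using that by simp
  qed
  define J :: "complex \<Rightarrow> real" where "J w = indicator (cball 0 R) w" for w
  have J: "J w = (if cmod w \<le> R then 1 else 0 :: real)" for w by (simp add: J_def indicator_def)
  have int1: "integrable lborel (\<lambda>w. J w / cmod (w - 1))" and int0: "integrable lborel (\<lambda>w. J w / cmod (w - 0))"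
    unfolding J_def by (rule integrable_inverse_norm; simp)+
  \<comment> \<open>From 1 \<le> |w| + |w - 1|: the product of the two singularities is dominated by
    their sum, and each of them is integrable.\<close>
  have two: "1 / cmod w * (1 / cmod (w - 1)) \<le> 1 / cmod w + 1 / cmod (w - 1)" for w
  proof (cases "w = 0 \<or> w = 1")
    case False
    have "1 \<le> cmod w + cmod (w - 1)"
      using norm_triangle_ineq4[of w "w - 1"] by simp
    moreover have "0 < cmod w * cmod (w - 1)" using False by simp
    ultimately have "1 / (cmod w * cmod (w - 1)) \<le> (cmod w + cmod (w - 1)) / (cmod w * cmod (w - 1))"
      by (intro divide_right_mono) auto
    then show ?thesis using False by (simp add: add_divide_distrib add.commute)
  qed auto
  have lhs: "(\<lambda>n. \<integral>w. \<alpha> w * (z n w * (i n w * k n w)) \<partial>lborel) \<longlonglongrightarrow> (\<integral>w. \<alpha> w / (w - 1) \<partial>lborel)"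
  proof (rule integral_dominated_convergence[where w = "\<lambda>w. C * (J w / cmod (w - 1))"])
    show "integrable lborel (\<lambda>w. C * (J w / cmod (w - 1)))" by (rule integrable_mult_right[OF int1])
    have "(\<lambda>n. \<alpha> w * (z n w * (i n w * k n w))) \<longlonglongrightarrow> \<alpha> w * (1 * (1 * (1 / (w - 1))))" if "w \<noteq> 0" for w
      unfolding z_def i_def k_def
      by (intro tendsto_intros cut_zero_tendsto cut_infinity_tendsto cauchy_kernel_tendsto that)
    then have *: "(\<lambda>n. \<alpha> w * (z n w * (i n w * k n w))) \<longlonglongrightarrow> \<alpha> w / (w - 1)" if "w \<noteq> 0" for w
      using that by simp
    show "AE w in lborel. (\<lambda>n. \<alpha> w * (z n w * (i n w * k n w))) \<longlonglongrightarrow> \<alpha> w / (w - 1)"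
      using AE_lborel_singleton[of "0::complex"] by eventually_elim (rule *)
    show "AE w in lborel. norm (\<alpha> w * (z n w * (i n w * k n w))) \<le> C * (J w / cmod (w - 1))" for n
    proof (rule AE_I2)
      fix w
      have "norm (\<alpha> w * (z n w * (i n w * k n w))) \<le> (C * J w) * (1 * (1 * (1 / cmod (w - 1))))"
        unfolding norm_mult using bound(1)[of w] supp(1)[of w] C nz
        by (intro mult_mono) (auto simp: J)
      then show "norm (\<alpha> w * (z n w * (i n w * k n w))) \<le> C * (J w / cmod (w - 1))" by simp
    qed
  qed measurable
  have b1: "norm (B w * (dbar (z n) w * (i n w * k n w))) \<le> 3 * C * (J w / cmod (w - 0) + J w / cmod (w - 1))" for n w
  proof -
    have "norm (B w * (dbar (z n) w * (i n w * k n w))) \<le> (C * J w) * (3 / cmod w * (1 * (1 / cmod (w - 1))))"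
      unfolding norm_mult using bound(2)[of w] supp(2)[of w] C nz dz
      by (intro mult_mono) (auto simp: J)
    also have "\<dots> = 3 * C * J w * (1 / cmod w * (1 / cmod (w - 1)))" by simp
    also have "\<dots> \<le> 3 * C * J w * (1 / cmod w + 1 / cmod (w - 1))"
      using two[of w] C by (intro mult_left_mono) (auto simp: J)
    finally show ?thesis by (simp add: algebra_simps)
  qed
  have b2: "norm (B w * (z n w * (dbar (i n) w * k n w))) \<le> C * (2 * R) * (J w / cmod (w - 1))" for n w
  proof (cases "cmod w \<le> R")
    case True
    have "norm (B w * (z n w * (dbar (i n) w * k n w))) \<le> C * (1 * (2 * R * (1 / cmod (w - 1))))"
      unfolding norm_mult using bound(2)[of w] C nz di[OF True]
      by (intro mult_mono) (auto intro!: mult_nonneg_nonneg order_trans[OF norm_ge_zero True])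
    then show ?thesis using True by (simp add: J)
  qed (use supp J in simp)
  have i1: "integrable lborel (\<lambda>w. 3 * C * (J w / cmod (w - 0) + J w / cmod (w - 1)))"
    and i2: "integrable lborel (\<lambda>w. C * (2 * R) * (J w / cmod (w - 1)))"
    by (intro integrable_mult_right Bochner_Integration.integrable_add int0 int1)+
  \<comment> \<open>Here the origin disappears: the derivative of the cut-off at 0 tends to 0
    pointwise and is dominated by 3/|w|.\<close>
  have t1: "(\<lambda>n. \<integral>w. B w * (dbar (z n) w * (i n w * k n w)) \<partial>lborel) \<longlonglongrightarrow> (\<integral>w. 0 \<partial>(lborel::complex measure))"
  proof (rule integral_dominated_convergence[OF _ _ i1])
    show "AE w in lborel. (\<lambda>n. B w * (dbar (z n) w * (i n w * k n w))) \<longlonglongrightarrow> 0"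
    proof (rule AE_I2)
      fix w
      have "(\<lambda>n. B w * (dbar (z n) w * (i n w * k n w))) \<longlonglongrightarrow> B w * (0 * (1 * (1 / (w - 1))))"
        unfolding z_def i_def k_def
        by (intro tendsto_intros dbar_cut_zero_tendsto cut_infinity_tendsto cauchy_kernel_tendsto)
      then show "(\<lambda>n. B w * (dbar (z n) w * (i n w * k n w))) \<longlonglongrightarrow> 0" by simp
    qed
  qed (use b1 in \<open>auto intro!: AE_I2\<close>)
  have t2: "(\<lambda>n. \<integral>w. B w * (z n w * (dbar (i n) w * k n w)) \<partial>lborel) \<longlonglongrightarrow> (\<integral>w. 0 \<partial>(lborel::complex measure))"
  proof (rule integral_dominated_convergence[OF _ _ i2])
    have *: "(\<lambda>n. B w * (z n w * (dbar (i n) w * k n w))) \<longlonglongrightarrow> 0" if "w \<noteq> 0" for w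
    proof -
      have "(\<lambda>n. dbar (i n) w) \<longlonglongrightarrow> 0"
      proof (rule Lim_null_comparison)
        show "\<forall>\<^sub>F n in sequentially. norm (dbar (i n) w) \<le> 2 * cmod w / real (Suc n)"
          by (simp add: i_def norm_dbar_cut_infinity_le)
        show "(\<lambda>n. 2 * cmod w / real (Suc n)) \<longlonglongrightarrow> 0" by real_asymp
      qed
      then have "(\<lambda>n. B w * (z n w * (dbar (i n) w * k n w))) \<longlonglongrightarrow> B w * (1 * (0 * (1 / (w - 1))))"
        unfolding z_def k_def
        by (intro tendsto_intros cut_zero_tendsto cauchy_kernel_tendsto that)
      then show ?thesis by simp
    qed
    show "AE w in lborel. (\<lambda>n. B w * (z n w * (dbar (i n) w * k n w))) \<longlonglongrightarrow> 0"
      using AE_lborel_singleton[of "0::complex"] by eventually_elim (rule *)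
  qed (use b2 in \<open>auto intro!: AE_I2\<close>)
  \<comment> \<open>The only term of the product rule that survives: the derivative falls on the
    kernel and concentrates at w = 1, where \<open>B\<close> is continuous and both cut-offs tend to
    1 along the rescaled points.\<close>
  have t3: "(\<lambda>n. \<integral>w. (B w * (z n w * i n w)) * dbar (k n) w \<partial>lborel) \<longlonglongrightarrow> of_real pi * B 1"
    unfolding k_def
  proof (rule cauchy_kernel_approximate_identity)
    show "cmod (B w * (z n w * i n w)) \<le> C" for n w
      using mult_mono[OF bound(2)[of w] mult_mono[OF nz(1) nz(2), of n w n w]] C by (simp add: norm_mult)
    fix u :: complex
    let ?p = "\<lambda>n. 1 + (1 / real (Suc n)) *\<^sub>R u"
    have p: "?p \<longlonglongrightarrow> 1 + 0 *\<^sub>R u" by (intro tendsto_intros LIMSEQ_Suc[OF lim_1_over_n])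
    then have p1: "?p \<longlonglongrightarrow> 1" by simp
    have "(\<lambda>n. B (?p n)) \<longlonglongrightarrow> B 1" using isCont_tendsto_compose[OF cont p1] .
    moreover have pp: "(\<lambda>n. ?p n \<bullet> ?p n) \<longlonglongrightarrow> (1::complex) \<bullet> 1" by (rule tendsto_inner[OF p1 p1])
    have "filterlim (\<lambda>n. (?p n \<bullet> ?p n) * (real (Suc n))\<^sup>2) at_top sequentially"
      by (rule filterlim_tendsto_pos_mult_at_top[OF pp]) (simp, real_asymp)
    then have "filterlim (\<lambda>n. -1 + (real (Suc n))\<^sup>2 * (?p n \<bullet> ?p n)) at_top sequentially"
      by (intro filterlim_tendsto_add_at_top[OF tendsto_const]) (simp add: mult.commute)
    then have "filterlim (\<lambda>n. (real (Suc n))\<^sup>2 * (?p n \<bullet> ?p n) - 1) at_top sequentially"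
      by (simp add: algebra_simps)
    from tendsto_of_real[OF filterlim_compose[OF tendsto_flat_0 this]]
    have "(\<lambda>n. z n (?p n)) \<longlonglongrightarrow> of_real 1"
      unfolding z_def cut_zero_def .
    moreover have "(\<lambda>n. i n (?p n)) \<longlonglongrightarrow> of_real 1"
    proof -
      have "(\<lambda>n. - ((?p n \<bullet> ?p n) * (1 / real (Suc n)))) \<longlonglongrightarrow> - (((1::complex) \<bullet> 1) * 0)"
        by (intro tendsto_intros pp LIMSEQ_Suc[OF lim_1_over_n])
      then have "filterlim (\<lambda>n. - ((?p n \<bullet> ?p n) * (1 / real (Suc n))) + real (Suc n)) at_top sequentially"
        by (rule filterlim_tendsto_add_at_top) real_asymp
      then have "filterlim (\<lambda>n. real (Suc n) - (?p n \<bullet> ?p n) / real (Suc n)) at_top sequentially"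
        by simp
      from tendsto_of_real[OF filterlim_compose[OF tendsto_flat_0 this]]
      show ?thesis unfolding i_def cut_infinity_def .
    qed
    ultimately have "(\<lambda>n. B (?p n) * (z n (?p n) * i n (?p n))) \<longlonglongrightarrow> B 1 * (of_real 1 * of_real 1)"
      by (intro tendsto_mult)
    then show "(\<lambda>n. B (?p n) * (z n (?p n) * i n (?p n))) \<longlonglongrightarrow> B 1" by simp
  qed measurable
  have split: "(\<integral>w. B w * dbar (\<lambda>w. z n w * (i n w * k n w)) w \<partial>lborel) =
     (\<integral>w. B w * (dbar (z n) w * (i n w * k n w)) \<partial>lborel) +
     ((\<integral>w. B w * (z n w * (dbar (i n) w * k n w)) \<partial>lborel) +
      (\<integral>w. (B w * (z n w * i n w)) * dbar (k n) w \<partial>lborel))" for n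
  proof -
    have I1: "integrable lborel (\<lambda>w. B w * (dbar (z n) w * (i n w * k n w)))"
      by (rule Bochner_Integration.integrable_bound[OF i1], measurable)
        (rule AE_I2, rule order_trans[OF b1], simp only: real_norm_def abs_ge_self)
    have I2: "integrable lborel (\<lambda>w. B w * (z n w * (dbar (i n) w * k n w)))"
      by (rule Bochner_Integration.integrable_bound[OF i2], measurable)
        (rule AE_I2, rule order_trans[OF b2], simp only: real_norm_def abs_ge_self)
    have I3: "integrable lborel (\<lambda>w. (B w * (z n w * i n w)) * dbar (k n) w)"
    proof -
      have "bounded (dbar (k n) ` cball 0 R)"
        by (intro compact_imp_bounded compact_continuous_image smooth_continuous_on smooth_dbar smooth) simp
      then obtain D where D: "\<forall>w\<in>cball 0 R. cmod (dbar (k n) w) \<le> D" "D > 0"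
        unfolding bounded_pos by auto
      have "cmod ((B w * (z n w * i n w)) * dbar (k n) w) \<le> (C * (1 * 1)) * D" for w
      proof (cases "cmod w \<le> R")
        case True
        show ?thesis unfolding norm_mult using bound(2)[of w] C nz bspec[OF D(1), of w] True D(2)
          by (intro mult_mono) auto
      qed (use supp D C in auto)
      then show ?thesis
        by (rule integrable_bounded_support[rotated]) (use supp in auto)
    qed
    have "(\<integral>w. B w * dbar (\<lambda>w. z n w * (i n w * k n w)) w \<partial>lborel) =
      (\<integral>w. B w * (dbar (z n) w * (i n w * k n w)) + (B w * (z n w * (dbar (i n) w * k n w)) +
        (B w * (z n w * i n w)) * dbar (k n) w) \<partial>lborel)"
      by (intro Bochner_Integration.integral_cong refl, subst dbar_mult[OF smooth(1) zi_smooth],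
          subst dbar_mult[OF smooth(2) smooth(3)], simp add: algebra_simps)
    then show ?thesis
      by (simp only: Bochner_Integration.integral_add[OF I1 Bochner_Integration.integrable_add[OF I2 I3]]
          Bochner_Integration.integral_add[OF I2 I3])
  qed
  have "(\<lambda>n. \<integral>w. B w * dbar (\<lambda>w. z n w * (i n w * k n w)) w \<partial>lborel) \<longlonglongrightarrow> 0 + (0 + of_real pi * B 1)"
    unfolding split using tendsto_add[OF t1 tendsto_add[OF t2 t3]] by simp
  then show ?thesis using LIMSEQ_unique[OF lhs[unfolded eq]] by simp
qed

section \<open>Lebesgue measure on coordinate subspaces\<close>

interpretation lborel_product: product_sigma_finite "\<lambda>_. lborel :: 'a::euclidean_space measure"
  by standard

lemma sets_coord_lebesgue [simp, measurable_cong]: "sets (coord_lebesgue I) = sets borel"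
  and space_coord_lebesgue [simp]: "space (coord_lebesgue I) = UNIV"
  by (simp_all add: coord_lebesgue_def)

lemma measurable_coord_embedding [measurable]:
  fixes I :: "'n::finite set"
  shows "coord_embedding I \<in> Pi\<^sub>M I (\<lambda>_. lborel) \<rightarrow>\<^sub>M borel"
proof (subst borel_measurable_euclidean_space, intro ballI)
  fix b :: "complex ^ 'n"
  assume "b \<in> Basis"
  then obtain k u where b: "b = axis k u" by (auto simp: Basis_vec_def)
  have "(\<lambda>x. coord_embedding I x \<bullet> b) = (\<lambda>x. (if k \<in> I then x k else 0) \<bullet> u)"
    by (auto simp: b inner_axis coord_embedding_def)
  moreover have "(\<lambda>x. (if k \<in> I then x k else 0) \<bullet> u) \<in> borel_measurable (Pi\<^sub>M I (\<lambda>_. lborel))"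
    by (cases "k \<in> I") (simp_all add: measurable_component_singleton)
  ultimately show "(\<lambda>x. coord_embedding I x \<bullet> b) \<in> borel_measurable (Pi\<^sub>M I (\<lambda>_. lborel))"
    by simp
qed

lemma borel_measurable_vec_nth_complex [measurable]: "(\<lambda>t :: complex ^ 'n. t $ k) \<in> borel_measurable borel"
  by (intro borel_measurable_continuous_onI continuous_intros)

lemma sets_coord_box [measurable]:
  fixes A :: "'n::finite \<Rightarrow> complex set"
  assumes "\<And>k. k \<in> I \<Longrightarrow> A k \<in> sets borel"
  shows "{t. \<forall>k\<in>I. t $ k \<in> A k} \<in> sets borel"
proof -
  have "{t :: complex ^ 'n. t $ k \<in> A k} \<in> sets borel" if "k \<in> I" for k
    using measurable_sets[OF borel_measurable_vec_nth_complex assms[OF that]] by (simp add: vimage_def)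
  then have "(\<Inter>k\<in>I. {t :: complex ^ 'n. t $ k \<in> A k}) \<in> sets borel"
    by (cases "I = {}") (auto intro: sets.finite_INT)
  then show ?thesis by (simp add: INTER_eq)
qed

lemma emeasure_coord_box:
  assumes "\<And>k. k \<in> I \<Longrightarrow> A k \<in> sets borel"
  shows "emeasure (coord_lebesgue I) {t. \<forall>k\<in>I. t $ k \<in> A k} = (\<Prod>k\<in>I. emeasure lborel (A k))"
proof -
  have "coord_embedding I -` {t. \<forall>k\<in>I. t $ k \<in> A k} \<inter> space (Pi\<^sub>M I (\<lambda>_. lborel)) = Pi\<^sub>E I A"
    by (auto simp: coord_embedding_def space_PiM PiE_def Pi_def)
  then show ?thesis
    using assms by (simp add: coord_lebesgue_def emeasure_distr sets_coord_box lborel_product.emeasure_PiM)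
qed

lemma closed_coord_subspace: "closed (coord_subspace I :: (complex ^ 'n::finite) set)"
proof -
  have "coord_subspace I = (\<Inter>k\<in>-I. {x :: complex ^ 'n. x $ k = 0})"
    by (auto simp: coord_subspace_def)
  moreover have "closed {x :: complex ^ 'n. x $ k = 0}" for k
    by (intro closed_Collect_eq continuous_intros)
  ultimately show ?thesis by auto
qed

lemma sets_coord_subspace [measurable]: "coord_subspace I \<in> sets borel"
  by (simp add: borel_closed closed_coord_subspace)

lemma AE_coord_subspace: "AE t in coord_lebesgue I. t \<in> coord_subspace I"
  unfolding coord_lebesgue_def
  by (subst AE_distr_iff) (auto simp: coord_embedding_def coord_subspace_def)

lemma emeasure_coord_cball_finite: "emeasure (coord_lebesgue I) (cball 0 r) < \<infinity>"
proof -
  have "emeasure (coord_lebesgue I) (cball 0 r) \<le> emeasure (coord_lebesgue I) {t. \<forall>k\<in>I. t $ k \<in> cball 0 r}"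
    by (intro emeasure_mono) (auto intro: order_trans[OF Finite_Cartesian_Product.norm_nth_le] sets_coord_box)
  also have "\<dots> < \<infinity>"
    using emeasure_lborel_cball_finite[of "0::complex" r]
    by (subst emeasure_coord_box) (auto simp: power_eq_top_ennreal less_top[symmetric])
  finally show ?thesis .
qed

lemma emeasure_coord_bounded_finite:
  assumes "bounded X" shows "emeasure (coord_lebesgue I) X < \<infinity>"
proof (cases "X \<in> sets borel")
  case True
  obtain r where "X \<subseteq> cball 0 r" using bounded_subset_ballD[OF assms, of 0] ball_subset_cball by blast
  then have "emeasure (coord_lebesgue I) X \<le> emeasure (coord_lebesgue I) (cball 0 r)"
    by (intro emeasure_mono) auto
  then show ?thesis using emeasure_coord_cball_finite le_less_trans by blast
qed (simp add: emeasure_notin_sets)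

lemma sigma_finite_coord_lebesgue: "sigma_finite_measure (coord_lebesgue I)"
proof
  show "\<exists>A. countable A \<and> A \<subseteq> sets (coord_lebesgue I) \<and> \<Union>A = space (coord_lebesgue I) \<and>
      (\<forall>a\<in>A. emeasure (coord_lebesgue I) a \<noteq> \<infinity>)"
  proof (intro exI[of _ "range (\<lambda>n::nat. cball 0 (real n))"] conjI ballI)
    show "\<Union> (range (\<lambda>n::nat. cball 0 (real n))) = space (coord_lebesgue I)"
      using real_arch_simple by auto
    show "emeasure (coord_lebesgue I) a \<noteq> \<infinity>" if "a \<in> range (\<lambda>n::nat. cball 0 (real n))" for a
      using that emeasure_coord_cball_finite[of I] by (auto simp: less_top)
  qed auto
qed

text \<open>Enlarging X to a polydisc gives a product function whose only unbounded factor is the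
  planar 1/|x - c|. It will dominate the derivatives of a cut-off in one chart coordinate.\<close>

lemma integrable_coord_inverse_norm:
  fixes X :: "(complex ^ 'n::finite) set"
  assumes "i \<in> I" "bounded X" and [measurable]: "X \<in> sets borel"
  shows "integrable (coord_lebesgue I) (\<lambda>t. indicator X t / cmod (t $ i - c))"
proof -
  obtain r where r: "X \<subseteq> cball 0 r" using bounded_subset_ballD[OF assms(2), of 0] ball_subset_cball by blast
  define h where "h k x = (if k = i then indicator (cball 0 r) x / cmod (x - c) else indicator (cball 0 r) x :: real)"
    for k :: 'n and x
  have "integrable lborel (h k)" for k
    unfolding h_def using emeasure_lborel_cball_finite[of "0::complex" r]
    by (cases "k = i") (auto intro: integrable_inverse_norm integrable_real_indicator)
  then have "integrable (Pi\<^sub>M I (\<lambda>_. lborel)) (\<lambda>x. \<Prod>k\<in>I. h k (x k))"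
    by (intro lborel_product.product_integrable_prod) auto
  also have "(\<lambda>x. \<Prod>k\<in>I. h k (x k)) = (\<lambda>x. \<Prod>k\<in>I. h k (coord_embedding I x $ k))"
    by (auto simp: coord_embedding_def)
  finally have prod: "integrable (coord_lebesgue I) (\<lambda>t. \<Prod>k\<in>I. h k (t $ k))"
  proof -
    assume *: "integrable (Pi\<^sub>M I (\<lambda>_. lborel)) (\<lambda>x. \<Prod>k\<in>I. h k (coord_embedding I x $ k))"
    have "(\<lambda>x. h k x) \<in> borel_measurable borel" for k
    proof -
      have [measurable]: "cball (0::complex) r \<in> sets borel" by simp
      show ?thesis unfolding h_def by (cases "k = i") simp_all
    qed
    then have "(\<lambda>t :: complex ^ 'n. \<Prod>k\<in>I. h k (t $ k)) \<in> borel_measurable borel"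
      by (intro borel_measurable_prod measurable_compose[OF borel_measurable_vec_nth_complex])
    then show ?thesis
      unfolding coord_lebesgue_def using * by (subst integrable_distr_eq) auto
  qed
  have "indicator X t / cmod (t $ i - c) \<le> (\<Prod>k\<in>I. h k (t $ k))" for t
  proof (cases "t \<in> X")
    case True
    then have "cmod (t $ k) \<le> r" for k
      using r by (meson mem_cball_0 Finite_Cartesian_Product.norm_nth_le order_trans subsetD)
    then have "(\<Prod>k\<in>I. h k (t $ k)) = (\<Prod>k\<in>I. if k = i then 1 / cmod (t $ i - c) else 1)"
      by (intro prod.cong) (auto simp: h_def)
    also have "\<dots> = 1 / cmod (t $ i - c)" using assms(1) by (simp add: prod.delta)
    finally show ?thesis using True by simp
  qed (auto intro!: prod_nonneg simp: h_def)
  then show ?thesis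
    by (intro Bochner_Integration.integrable_bound[OF prod])
      (auto intro!: AE_I2 order_trans[OF _ abs_ge_self])
qed

lemma integral_coord_singleton:
  fixes h :: "complex ^ 'n::finite \<Rightarrow> 'b::{banach, second_countable_topology}"
  assumes [measurable]: "h \<in> borel_measurable borel"
  shows "(\<integral>t. h t \<partial>coord_lebesgue {j}) = (\<integral>x. h (axis j x) \<partial>lborel)"
proof -
  have e: "coord_embedding {j} x = axis j (x j)" for x :: "'n \<Rightarrow> complex"
    by (auto simp: coord_embedding_def vec_eq_iff axis_def)
  have "(\<integral>t. h t \<partial>coord_lebesgue {j}) = (\<integral>x. h (axis j (x j)) \<partial>Pi\<^sub>M {j} (\<lambda>_. lborel))"
    unfolding coord_lebesgue_def by (subst integral_distr) (simp_all add: e)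
  also have "\<dots> = (\<integral>x. h (axis j x) \<partial>lborel)"
  proof (rule lborel_product.product_integral_singleton)
    have "continuous_on UNIV (axis j :: complex \<Rightarrow> complex ^ 'n)"
      by (auto intro!: linear_continuous_on linear_conv_bounded_linear[THEN iffD1] linearI
          simp: axis_def vec_eq_iff)
    then have "(axis j :: complex \<Rightarrow> complex ^ 'n) \<in> borel_measurable borel"
      by (rule borel_measurable_continuous_onI)
    then show "(\<lambda>x. h (axis j x)) \<in> borel_measurable lborel" by simp
  qed
  finally show ?thesis .
qed

section \<open>Distortion of measure by maps with Lipschitz inverse\<close>

text \<open>Only the coordinates in I are constrained. The floors make the cubes half open, so that
  those of one mesh are disjoint and cover.\<close>

definition grid_cube :: "'n::finite set \<Rightarrow> real \<Rightarrow> ('n \<Rightarrow> int \<times> int) \<Rightarrow> (complex ^ 'n) set" where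
  "grid_cube I s \<sigma> = {t. \<forall>k\<in>I. t $ k \<in> {z. \<lfloor>Re z / s\<rfloor> = fst (\<sigma> k) \<and> \<lfloor>Im z / s\<rfloor> = snd (\<sigma> k)}}"

lemma emeasure_grid_square:
  assumes "s > 0"
  shows "emeasure lborel {z. \<lfloor>Re z / s\<rfloor> = a \<and> \<lfloor>Im z / s\<rfloor> = b} = ennreal (s\<^sup>2)"
proof -
  have "{z. \<lfloor>Re z / s\<rfloor> = a \<and> \<lfloor>Im z / s\<rfloor> = b} \<in> sets borel"
    by measurable
  have eq: "{x. \<lfloor>x / s\<rfloor> = c} = {s * of_int c ..< s * of_int (c + 1)}" for c
    using assms by (auto simp: floor_eq_iff field_simps)
  have "emeasure lborel {z. \<lfloor>Re z / s\<rfloor> = a \<and> \<lfloor>Im z / s\<rfloor> = b} =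
    (\<integral>\<^sup>+z. indicator {z. \<lfloor>Re z / s\<rfloor> = a \<and> \<lfloor>Im z / s\<rfloor> = b} z \<partial>lborel)"
    by (subst nn_integral_indicator) auto
  also have "\<dots> = (\<integral>\<^sup>+x. \<integral>\<^sup>+y. indicator {z. \<lfloor>Re z / s\<rfloor> = a \<and> \<lfloor>Im z / s\<rfloor> = b} (Complex x y) \<partial>lborel \<partial>lborel)"
    by (rule nn_integral_complex) measurable
  also have "\<dots> = (\<integral>\<^sup>+x. \<integral>\<^sup>+y. indicator {x. \<lfloor>x / s\<rfloor> = a} x * indicator {x. \<lfloor>x / s\<rfloor> = b} y \<partial>lborel \<partial>lborel)"
    by (intro nn_integral_cong) (auto simp: indicator_def)
  also have "\<dots> = emeasure lborel {x. \<lfloor>x / s\<rfloor> = a} * emeasure lborel {x. \<lfloor>x / s\<rfloor> = b}"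
    unfolding eq by (simp add: nn_integral_cmult nn_integral_multc)
  also have "\<dots> = ennreal (s\<^sup>2)"
    unfolding eq using assms by (simp add: algebra_simps ennreal_mult[symmetric] power2_eq_square)
  finally show ?thesis .
qed

lemma sets_grid_cube [measurable]: "grid_cube I s \<sigma> \<in> sets borel"
  unfolding grid_cube_def by (rule sets_coord_box) measurable

lemma emeasure_grid_cube:
  assumes "s > 0" shows "emeasure (coord_lebesgue I) (grid_cube I s \<sigma>) = ennreal (s ^ (2 * card I))"
proof -
  have "emeasure (coord_lebesgue I) (grid_cube I s \<sigma>) = (\<Prod>k\<in>I. ennreal (s\<^sup>2))"
    unfolding grid_cube_def
    by (subst emeasure_coord_box) (auto simp: emeasure_grid_square[OF assms])
  also have "\<dots> = ennreal ((s\<^sup>2) ^ card I)" by (simp add: ennreal_power)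
  finally show ?thesis by (simp add: power_mult)
qed

text \<open>Each complex coordinate contributes at most 2 s, s for each of its real and imaginary
  parts, and the norm is at most the sum over all coordinates.\<close>

lemma grid_cube_dist:
  fixes x y :: "complex ^ 'n::finite"
  assumes "s > 0" "x \<in> grid_cube I s \<sigma> \<inter> coord_subspace I" "y \<in> grid_cube I s \<sigma> \<inter> coord_subspace I"
  shows "dist x y \<le> 2 * real CARD('n) * s"
proof -
  have fl: "\<bar>a - b\<bar> \<le> s" if "\<lfloor>a / s\<rfloor> = \<lfloor>b / s\<rfloor>" for a b
  proof -
    have "\<bar>a / s - b / s\<bar> \<le> 1" using that by linarith
    then show ?thesis using assms(1) by (simp add: diff_divide_distrib[symmetric] abs_divide)
  qed
  have comp: "cmod ((x - y) $ k) \<le> 2 * s" for k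
  proof (cases "k \<in> I")
    case True
    have "\<bar>Re (x $ k) - Re (y $ k)\<bar> \<le> s" "\<bar>Im (x $ k) - Im (y $ k)\<bar> \<le> s"
      by (rule fl; use assms True in \<open>auto simp: grid_cube_def\<close>)+
    then show ?thesis using cmod_le[of "(x - y) $ k"] by simp
  qed (use assms in \<open>auto simp: coord_subspace_def\<close>)
  have "dist x y \<le> (\<Sum>k\<in>UNIV. cmod ((x - y) $ k))"
    unfolding dist_norm norm_vec_def by (rule L2_set_le_sum) simp
  also have "\<dots> \<le> (\<Sum>k\<in>(UNIV::'n set). 2 * s)" by (intro sum_mono comp)
  finally show ?thesis by (simp add: mult_ac)
qed

text \<open>A differentiation-free comparison of measures: the hypothesis on sets of small diameter
  compares both measures on grid cubes, cubes exhaust open sets, and outer regularity passes to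
  Borel sets. No Jacobian is ever computed.\<close>

lemma measure_le_coord_lebesgue:
  fixes \<rho> :: "(complex ^ 'n::finite) measure"
  assumes sets [measurable_cong, simp]: "sets \<rho> = sets borel"
    and conc: "AE t in \<rho>. t \<in> coord_subspace I"
    and bdd: "AE t in \<rho>. t \<in> ball 0 R"
    and small: "\<And>Q \<delta>. Q \<in> sets borel \<Longrightarrow> \<delta> > 0 \<Longrightarrow>
        (\<And>x y. x \<in> Q \<inter> coord_subspace I \<Longrightarrow> y \<in> Q \<inter> coord_subspace I \<Longrightarrow> dist x y \<le> \<delta>) \<Longrightarrow>
        emeasure \<rho> Q \<le> ennreal (C * \<delta> ^ (2 * card I))"
    and C: "C \<ge> 0"
    and A: "A \<in> sets borel"
  shows "emeasure \<rho> A \<le> ennreal (C * (2 * real CARD('n)) ^ (2 * card I)) * emeasure (coord_lebesgue I) A"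
proof -
  define C' where "C' = C * (2 * real CARD('n)) ^ (2 * card I)"
  have C': "C' \<ge> 0" using C by (simp add: C'_def)
  have cube: "emeasure \<rho> (grid_cube I s \<sigma>) \<le> ennreal C' * emeasure (coord_lebesgue I) (grid_cube I s \<sigma>)"
    if "s > 0" for s \<sigma>
  proof -
    have "emeasure \<rho> (grid_cube I s \<sigma>) \<le> ennreal (C * (2 * real CARD('n) * s) ^ (2 * card I))"
      using that grid_cube_dist[OF that] by (intro small) auto
    also have "\<dots> = ennreal (C' * s ^ (2 * card I))" by (simp add: C'_def power_mult_distrib mult_ac)
    also have "\<dots> = ennreal C' * emeasure (coord_lebesgue I) (grid_cube I s \<sigma>)"
      using C' that by (simp add: emeasure_grid_cube[OF that] ennreal_mult)
    finally show ?thesis .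
  qed
  have opn: "emeasure \<rho> U \<le> ennreal C' * emeasure (coord_lebesgue I) U" if U: "open U" for U
  proof -
    define s where "s m = (1 / 2 :: real) ^ m" for m :: nat
    have s: "s m > 0" for m by (simp add: s_def)
    define \<Sigma> where "\<Sigma> m = {\<sigma> \<in> Pi\<^sub>E I (\<lambda>_. UNIV). grid_cube I (s m) \<sigma> \<inter> coord_subspace I \<subseteq> U}" for m
    define W where "W m = (\<Union>\<sigma>\<in>\<Sigma> m. grid_cube I (s m) \<sigma>)" for m
    have count: "countable (\<Sigma> m)" for m
      unfolding \<Sigma>_def by (rule countable_subset[of _ "Pi\<^sub>E I (\<lambda>_. UNIV)"]) (auto intro: countable_PiE)
    have [measurable]: "W m \<in> sets borel" for m
      unfolding W_def by (intro sets.countable_UN'' count) simp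
    have disj: "disjoint_family_on (grid_cube I (s m)) (\<Sigma> m)" for m
    proof (unfold disjoint_family_on_def, intro ballI impI)
      fix \<sigma> \<tau> assume st: "\<sigma> \<in> \<Sigma> m" "\<tau> \<in> \<Sigma> m" "\<sigma> \<noteq> \<tau>"
      show "grid_cube I (s m) \<sigma> \<inter> grid_cube I (s m) \<tau> = {}"
      proof (rule ccontr)
        assume "grid_cube I (s m) \<sigma> \<inter> grid_cube I (s m) \<tau> \<noteq> {}"
        then obtain x where x: "x \<in> grid_cube I (s m) \<sigma>" "x \<in> grid_cube I (s m) \<tau>" by auto
        have "\<sigma> k = \<tau> k" if "k \<in> I" for k
          using x that by (auto simp: grid_cube_def prod_eq_iff)
        moreover have "\<sigma> k = \<tau> k" if "k \<notin> I" for k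
          using st that by (auto simp: \<Sigma>_def PiE_def extensional_def)
        ultimately show False using st(3) by (metis ext)
      qed
    qed
    have Wm: "emeasure \<rho> (W m) \<le> ennreal C' * emeasure (coord_lebesgue I) U" for m
    proof -
      have "emeasure \<rho> (W m) = (\<integral>\<^sup>+\<sigma>. emeasure \<rho> (grid_cube I (s m) \<sigma>) \<partial>count_space (\<Sigma> m))"
        unfolding W_def by (intro emeasure_UN_countable count disj) simp
      also have "\<dots> \<le> (\<integral>\<^sup>+\<sigma>. ennreal C' * emeasure (coord_lebesgue I) (grid_cube I (s m) \<sigma>) \<partial>count_space (\<Sigma> m))"
        by (intro nn_integral_mono cube s)
      also have "\<dots> = ennreal C' * (\<integral>\<^sup>+\<sigma>. emeasure (coord_lebesgue I) (grid_cube I (s m) \<sigma>) \<partial>count_space (\<Sigma> m))"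
        by (rule nn_integral_cmult) simp
      also have "(\<integral>\<^sup>+\<sigma>. emeasure (coord_lebesgue I) (grid_cube I (s m) \<sigma>) \<partial>count_space (\<Sigma> m)) = emeasure (coord_lebesgue I) (W m)"
        unfolding W_def by (intro emeasure_UN_countable[symmetric] count disj) simp
      also have "\<dots> \<le> emeasure (coord_lebesgue I) U"
      proof (rule emeasure_mono_AE)
        show "AE x in coord_lebesgue I. x \<in> W m \<longrightarrow> x \<in> U"
          using AE_coord_subspace by eventually_elim (auto simp: W_def \<Sigma>_def)
      qed (use U in simp)
      finally show ?thesis by (simp add: mult_left_mono)
    qed
    \<comment> \<open>Intersecting over all finer meshes gives an increasing sequence without any
      comparison of grids of different mesh.\<close>
    define D where "D m = (\<Inter>l\<in>{m..}. W l)" for m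
    have [measurable]: "D m \<in> sets borel" for m
      unfolding D_def by (intro sets.countable_INT'') auto
    have cover: "\<exists>m. x \<in> D m" if x: "x \<in> U" "x \<in> coord_subspace I" for x
    proof -
      obtain r where r: "r > 0" "ball x r \<subseteq> U" using U x(1) open_contains_ball by blast
      have "(\<lambda>m. 2 * real CARD('n) * s m) \<longlonglongrightarrow> 2 * real CARD('n) * 0"
        unfolding s_def by (intro tendsto_intros LIMSEQ_power_zero) auto
      then have "eventually (\<lambda>m. 2 * real CARD('n) * s m < r) sequentially"
        using r(1) order_tendstoD(2) by fastforce
      then obtain m where m: "\<And>l. l \<ge> m \<Longrightarrow> 2 * real CARD('n) * s l < r" by (auto simp: eventually_sequentially)
      have "x \<in> W l" if "l \<ge> m" for l
      proof -
        define \<sigma> where "\<sigma> = restrict (\<lambda>k. (\<lfloor>Re (x $ k) / s l\<rfloor>, \<lfloor>Im (x $ k) / s l\<rfloor>)) I"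
        have xs: "x \<in> grid_cube I (s l) \<sigma>" by (simp add: grid_cube_def \<sigma>_def)
        have "grid_cube I (s l) \<sigma> \<inter> coord_subspace I \<subseteq> U"
        proof
          fix y assume "y \<in> grid_cube I (s l) \<sigma> \<inter> coord_subspace I"
          then have "dist x y < r" using grid_cube_dist[OF s, of x I l \<sigma> y] xs x(2) m[OF that] by simp
          then show "y \<in> U" using r by auto
        qed
        then have "\<sigma> \<in> \<Sigma> l" by (simp add: \<Sigma>_def \<sigma>_def)
        then show ?thesis using xs by (auto simp: W_def)
      qed
      then show ?thesis by (auto simp: D_def)
    qed
    have "emeasure \<rho> U \<le> emeasure \<rho> (\<Union>m. D m)"
    proof (rule emeasure_mono_AE)
      show "AE x in \<rho>. x \<in> U \<longrightarrow> x \<in> (\<Union>m. D m)"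
        using conc by eventually_elim (use cover in auto)
    qed simp
    also have "\<dots> = (SUP m. emeasure \<rho> (D m))"
      by (rule SUP_emeasure_incseq[symmetric]) (auto simp: D_def incseq_def)
    also have "\<dots> \<le> ennreal C' * emeasure (coord_lebesgue I) U"
    proof (rule SUP_least)
      fix m
      have "emeasure \<rho> (D m) \<le> emeasure \<rho> (W m)" by (intro emeasure_mono) (auto simp: D_def)
      then show "emeasure \<rho> (D m) \<le> ennreal C' * emeasure (coord_lebesgue I) U" using Wm order_trans by blast
    qed
    finally show ?thesis .
  qed
  \<comment> \<open>Lebesgue measure is restricted to the ball carrying \<open>\<rho>\<close> to
    obtain a finite measure, as outer regularity requires.\<close>
  define \<nu> where "\<nu> = scale_measure (ennreal C') (density (coord_lebesgue I) (indicator (ball 0 R)))"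
  have \<nu>: "sets \<nu> = sets borel" "\<And>X. X \<in> sets borel \<Longrightarrow> emeasure \<nu> X = ennreal C' * emeasure (coord_lebesgue I) (X \<inter> ball 0 R)"
    by (simp_all add: \<nu>_def emeasure_restricted Int_commute)
  have fin: "emeasure \<nu> (space \<nu>) \<noteq> \<infinity>"
    using \<nu>(2)[of UNIV] emeasure_coord_bounded_finite[of "ball 0 R" I]
    by (simp add: \<nu>_def space_scale_measure ennreal_mult_eq_top_iff less_top)
  have "emeasure \<rho> A \<le> emeasure \<nu> A"
    unfolding outer_regular[OF \<nu>(1) fin A]
  proof (rule INF_greatest)
    fix U assume "U \<in> {U. A \<subseteq> U \<and> open U}"
    then have U: "A \<subseteq> U" "open U" by auto
    have "emeasure \<rho> A \<le> emeasure \<rho> (U \<inter> ball 0 R)"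
    proof (rule emeasure_mono_AE)
      show "AE x in \<rho>. x \<in> A \<longrightarrow> x \<in> U \<inter> ball 0 R" using bdd by eventually_elim (use U in auto)
    qed (use U in auto)
    also have "\<dots> \<le> emeasure \<nu> U" using opn[of "U \<inter> ball 0 R"] U by (simp add: \<nu>(2) open_Int)
    finally show "emeasure \<rho> A \<le> emeasure \<nu> U" .
  qed
  also have "\<dots> \<le> ennreal C' * emeasure (coord_lebesgue I) A"
    using A by (simp add: \<nu>(2)) (intro mult_left_mono emeasure_mono; auto)
  finally show ?thesis by (simp add: C'_def)
qed

text \<open>If the inverse of \<tau> is L-Lipschitz, the preimage of a set of diameter \<delta> lies
  in a polydisc of radius L \<delta>, of volume (pi L^2 \<delta>^2)^card I. So the image under
  \<tau> of Lebesgue measure on E satisfies the small-set condition of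
  \<open>measure_le_coord_lebesgue\<close>.\<close>

lemma nn_integral_lipschitz_inverse:
  fixes \<tau> :: "complex ^ 'n::finite \<Rightarrow> complex ^ 'n" and h :: "complex ^ 'n \<Rightarrow> ennreal"
  assumes E [measurable]: "E \<in> sets borel" and EI: "E \<subseteq> coord_subspace I"
    and \<tau> [measurable]: "\<tau> \<in> borel_measurable borel"
    and img: "\<And>t. t \<in> E \<Longrightarrow> \<tau> t \<in> coord_subspace I \<inter> ball 0 R"
    and lip: "\<And>s t. s \<in> E \<Longrightarrow> t \<in> E \<Longrightarrow> dist s t \<le> L * dist (\<tau> s) (\<tau> t)" and L: "L > 0"
    and h [measurable]: "h \<in> borel_measurable borel"
  shows "(\<integral>\<^sup>+t. h (\<tau> t) * indicator E t \<partial>coord_lebesgue I) \<le>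
    ennreal ((pi * L\<^sup>2) ^ card I * (2 * real CARD('n)) ^ (2 * card I)) * (\<integral>\<^sup>+t. h t \<partial>coord_lebesgue I)"
proof -
  define \<rho> where "\<rho> = distr (density (coord_lebesgue I) (indicator E)) borel \<tau>"
  have [simp, measurable_cong]: "sets \<rho> = sets borel" and sp: "space \<rho> = UNIV" by (simp_all add: \<rho>_def)
  have em: "emeasure \<rho> Q = emeasure (coord_lebesgue I) (E \<inter> \<tau> -` Q)" if [measurable]: "Q \<in> sets borel" for Q
  proof -
    have [measurable]: "\<tau> -` Q \<in> sets borel" using measurable_sets[OF \<tau> that] by simp
    have "emeasure \<rho> Q = (\<integral>\<^sup>+t. indicator E t * indicator (\<tau> -` Q) t \<partial>coord_lebesgue I)"
      unfolding \<rho>_def by (simp add: emeasure_distr emeasure_density)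
    also have "\<dots> = (\<integral>\<^sup>+t. indicator (E \<inter> \<tau> -` Q) t \<partial>coord_lebesgue I)"
      by (simp add: indicator_inter_arith)
    finally show ?thesis by simp
  qed
  have AEE: "AE t in density (coord_lebesgue I) (indicator E). t \<in> E"
    by (subst AE_density) (auto simp: indicator_def)
  have "AE t in density (coord_lebesgue I) (indicator E). \<tau> t \<in> coord_subspace I \<inter> ball 0 R"
    using AEE by eventually_elim (use img in auto)
  then have "AE t in \<rho>. t \<in> coord_subspace I \<inter> ball 0 R"
    unfolding \<rho>_def by (subst AE_distr_iff) simp_all
  then have AEc: "AE t in \<rho>. t \<in> coord_subspace I" and AEb: "AE t in \<rho>. t \<in> ball 0 R"
    by simp_all
  have small: "emeasure \<rho> Q \<le> ennreal ((pi * L\<^sup>2) ^ card I * \<delta> ^ (2 * card I))"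
    if Q: "Q \<in> sets borel" and \<delta>: "\<delta> > 0"
      and diam: "\<And>x y. x \<in> Q \<inter> coord_subspace I \<Longrightarrow> y \<in> Q \<inter> coord_subspace I \<Longrightarrow> dist x y \<le> \<delta>" for Q \<delta>
  proof (cases "E \<inter> \<tau> -` Q = {}")
    case True
    then show ?thesis by (simp add: em[OF Q])
  next
    case False
    then obtain s where s: "s \<in> E" "\<tau> s \<in> Q" by auto
    have sub: "E \<inter> \<tau> -` Q \<subseteq> {t. \<forall>k\<in>I. t $ k \<in> cball (s $ k) (L * \<delta>)}"
    proof safe
      fix t k assume t: "t \<in> E" "\<tau> t \<in> Q"
      have "dist (s $ k) (t $ k) \<le> dist s t" by (rule dist_vec_nth_le)
      also have "\<dots> \<le> L * dist (\<tau> s) (\<tau> t)" using lip s t by blast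
      also have "\<dots> \<le> L * \<delta>" using diam s t img L by (intro mult_left_mono) auto
      finally show "t $ k \<in> cball (s $ k) (L * \<delta>)" by simp
    qed
    have "emeasure \<rho> Q \<le> emeasure (coord_lebesgue I) {t. \<forall>k\<in>I. t $ k \<in> cball (s $ k) (L * \<delta>)}"
      unfolding em[OF Q] by (intro emeasure_mono sub) (simp add: sets_coord_box)
    also have "\<dots> = (\<Prod>k\<in>I. ennreal (pi * (L * \<delta>)\<^sup>2))"
      using L \<delta> by (subst emeasure_coord_box) (auto simp: emeasure_cball unit_ball_vol_2 intro!: prod.cong)
    also have "\<dots> = ennreal ((pi * (L * \<delta>)\<^sup>2) ^ card I)"
      by (simp add: ennreal_power)
    also have "(pi * (L * \<delta>)\<^sup>2) ^ card I = (pi * L\<^sup>2) ^ card I * \<delta> ^ (2 * card I)"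
      by (simp add: power_mult power_mult_distrib)
    finally show ?thesis .
  qed
  define c where "c = ennreal ((pi * L\<^sup>2) ^ card I * (2 * real CARD('n)) ^ (2 * card I))"
  have "\<rho> \<le> scale_measure c (coord_lebesgue I)"
  proof (subst le_measure)
    show "\<forall>A\<in>sets \<rho>. emeasure \<rho> A \<le> emeasure (scale_measure c (coord_lebesgue I)) A"
    proof
      fix A assume "A \<in> sets \<rho>"
      then have A: "A \<in> sets borel" by simp
      show "emeasure \<rho> A \<le> emeasure (scale_measure c (coord_lebesgue I)) A"
        unfolding emeasure_scale_measure c_def
      proof (rule measure_le_coord_lebesgue[OF _ AEc AEb _ _ A])
        show "emeasure \<rho> Q \<le> ennreal ((pi * L\<^sup>2) ^ card I * \<delta> ^ (2 * card I))"
          if "Q \<in> sets borel" "\<delta> > 0"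
            "\<And>x y. x \<in> Q \<inter> coord_subspace I \<Longrightarrow> y \<in> Q \<inter> coord_subspace I \<Longrightarrow> dist x y \<le> \<delta>" for Q \<delta>
          using small[OF that] .
      qed simp_all
    qed
  qed simp
  then have "nn_integral \<rho> h \<le> nn_integral (scale_measure c (coord_lebesgue I)) h"
    by (intro nn_integral_mono_measure) simp_all
  moreover have "nn_integral \<rho> h = (\<integral>\<^sup>+t. h (\<tau> t) * indicator E t \<partial>coord_lebesgue I)"
    unfolding \<rho>_def by (simp add: nn_integral_distr nn_integral_density mult.commute)
  moreover have "nn_integral (scale_measure c (coord_lebesgue I)) h = c * nn_integral (coord_lebesgue I) h"
    by (rule nn_integral_scale_measure) simp
  ultimately show ?thesis by (simp add: c_def)
qed

section \<open>Density of continuous functions and polynomials\<close>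

text \<open>Induction over integrable functions. For an indicator, outer regularity of the set and
  of its complement leaves only a thin overlap, across which an Urysohn function interpolates; sums
  and limits divide the error into halves.\<close>

lemma finite_measure_L1_continuous:
  fixes f :: "'a::euclidean_space \<Rightarrow> complex"
  assumes sets [measurable_cong, simp]: "sets \<nu> = sets borel" and fin: "finite_measure \<nu>"
    and f: "integrable \<nu> f" and e: "e > 0"
  shows "\<exists>p. continuous_on UNIV p \<and> integrable \<nu> p \<and> (\<integral>x. norm (f x - p x) \<partial>\<nu>) < e"
  using f e
proof (induction arbitrary: e rule: integrable_induct)
  case (base A c)
  interpret finite_measure \<nu> by fact
  \<comment> \<open>The overlap will have measure below 2 d, so the error stays below
    \<open>norm c / (norm c + 1) * e\<close>; the summand 1 covers c = 0.\<close>
  define d where "d = e / (norm c + 1) / 2"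
  have d: "d > 0" using base by (simp add: d_def add_nonneg_pos)
  have [simp]: "space \<nu> = UNIV" using sets_eq_imp_space_eq[OF sets] by simp
  have outer: "\<exists>U. B \<subseteq> U \<and> open U \<and> measure \<nu> U < measure \<nu> B + d" if "B \<in> sets borel" for B
  proof -
    have "emeasure \<nu> B < ennreal (measure \<nu> B + d)"
      using d by (simp add: emeasure_eq_measure ennreal_less_iff)
    then have "(INF U\<in>{U. B \<subseteq> U \<and> open U}. emeasure \<nu> U) < ennreal (measure \<nu> B + d)"
      using outer_regular[OF sets _ that] by (simp add: emeasure_finite)
    then obtain U where "B \<subseteq> U" "open U" "emeasure \<nu> U < ennreal (measure \<nu> B + d)"
      unfolding INF_less_iff by auto
    then show ?thesis by (auto simp: emeasure_eq_measure ennreal_less_iff)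
  qed
  have A: "A \<in> sets borel" using base by simp
  obtain U where U: "A \<subseteq> U" "open U" "measure \<nu> U < measure \<nu> A + d"
    using outer[OF A] by auto
  have "- A \<in> sets borel" using A by (simp add: borel_comp)
  then obtain V where V: "- A \<subseteq> V" "open V" "measure \<nu> V < measure \<nu> (- A) + d"
    using outer by blast
  have mA: "measure \<nu> (- A) = measure \<nu> UNIV - measure \<nu> A"
    using finite_measure_compl[of A] A by (simp add: Compl_eq_Diff_UNIV)
  have mV: "measure \<nu> (- V) = measure \<nu> UNIV - measure \<nu> V"
    using finite_measure_compl[of V] V by (simp add: Compl_eq_Diff_UNIV)
  \<comment> \<open>\<open>U \<inter> V\<close> is what is left of U after removing
    \<open>- V\<close>, and \<open>- V \<subseteq> A \<subseteq> U\<close> with both measures within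
    d of that of A.\<close>
  have UV: "measure \<nu> (U \<inter> V) < 2 * d"
  proof -
    have "- V \<subseteq> U" using U V by auto
    then have "measure \<nu> (U - (- V)) = measure \<nu> U - measure \<nu> (- V)"
      using U(2) V(2) by (intro finite_measure_Diff) auto
    then have "measure \<nu> (U \<inter> V) = measure \<nu> U - measure \<nu> (- V)" by (simp add: Diff_Compl)
    then show ?thesis using U(3) V(3) mA mV by linarith
  qed
  obtain g :: "'a \<Rightarrow> real" where g: "continuous_on UNIV g" "\<And>x. g x \<in> closed_segment 1 0"
      "\<And>x. x \<in> - V \<Longrightarrow> g x = 1" "\<And>x. x \<in> - U \<Longrightarrow> g x = 0"
    using Urysohn[of "- V" "- U" "1::real" 0] U V by (auto simp: closed_open)
  have g01: "0 \<le> g x" "g x \<le> 1" for x using g(2)[of x] by (auto simp: closed_segment_eq_real_ivl)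
  have [measurable]: "g \<in> borel_measurable borel" by (rule borel_measurable_continuous_onI) (rule g(1))
  have int_g: "integrable \<nu> (\<lambda>x. g x *\<^sub>R c)"
    by (rule integrable_const_bound[where B = "norm c"]) (use g01 in \<open>auto intro!: mult_left_le_one_le\<close>)
  have pt: "norm (indicator A x *\<^sub>R c - g x *\<^sub>R c) \<le> norm c * indicator (U \<inter> V) x" for x
  proof -
    have *: "norm (indicator A x *\<^sub>R c - g x *\<^sub>R c) = \<bar>indicator A x - g x\<bar> * norm c"
      by (simp add: scaleR_diff_left[symmetric])
    show ?thesis
    proof (cases "x \<in> U \<inter> V")
      case True
      have "\<bar>indicator A x - g x\<bar> \<le> 1" using g01[of x] by (auto simp: indicator_def)
      then show ?thesis unfolding * using True by (simp add: mult_left_le_one_le)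
    next
      case False
      then have "indicator A x - g x = 0"
      proof (cases "x \<in> U")
        case True
        then have "x \<in> - V" "x \<in> A" using False V(1) by auto
        then show ?thesis using g(3) by simp
      next
        case False
        then have "x \<notin> A" "x \<in> - U" using U(1) by auto
        then show ?thesis using g(4) by simp
      qed
      then show ?thesis unfolding * by simp
    qed
  qed
  have UVs: "U \<inter> V \<in> sets borel" using U V by auto
  have "(\<integral>x. norm (indicator A x *\<^sub>R c - g x *\<^sub>R c) \<partial>\<nu>) \<le> (\<integral>x. norm c * indicator (U \<inter> V) x \<partial>\<nu>)"
  proof (rule integral_mono)
    show "integrable \<nu> (\<lambda>x. norm (indicator A x *\<^sub>R c - g x *\<^sub>R c))"
      using base by (intro integrable_norm Bochner_Integration.integrable_diff int_g) (auto intro: integrable_real_indicator simp: emeasure_finite)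
    show "integrable \<nu> (\<lambda>x. norm c * indicator (U \<inter> V) x)"
      using UVs by (intro integrable_mult_right integrable_real_indicator) (auto simp: emeasure_eq_measure)
  qed (rule pt)
  also have "\<dots> = norm c * measure \<nu> (U \<inter> V)" by simp
  also have "\<dots> \<le> norm c * (2 * d)" using UV by (intro mult_left_mono) auto
  also have "\<dots> = norm c / (norm c + 1) * e"
  proof -
    have "2 * d = e / (norm c + 1)" unfolding d_def mult_2 by (rule field_sum_of_halves)
    then show ?thesis by simp
  qed
  also have "\<dots> < 1 * e"
  proof (rule mult_strict_right_mono)
    have "norm c < norm c + 1" "norm c + 1 > 0" using norm_ge_zero[of c] by linarith+
    then show "norm c / (norm c + 1) < 1" by (simp only: divide_less_eq_1_pos)
  qed (use base in simp)
  finally have "(\<integral>x. norm (indicator A x *\<^sub>R c - g x *\<^sub>R c) \<partial>\<nu>) < e" by simp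
  moreover have "continuous_on UNIV (\<lambda>x. g x *\<^sub>R c)" by (intro continuous_intros g(1))
  ultimately show ?case using int_g by blast
next
  case (add f g)
  obtain p where p: "continuous_on UNIV p" "integrable \<nu> p" "(\<integral>x. norm (f x - p x) \<partial>\<nu>) < e / 2"
    using add.IH(1)[of "e / 2"] add.prems by auto
  obtain q where q: "continuous_on UNIV q" "integrable \<nu> q" "(\<integral>x. norm (g x - q x) \<partial>\<nu>) < e / 2"
    using add.IH(2)[of "e / 2"] add.prems by auto
  have "(\<integral>x. norm (f x + g x - (p x + q x)) \<partial>\<nu>) \<le> (\<integral>x. norm (f x - p x) + norm (g x - q x) \<partial>\<nu>)"
    using add.hyps p q
    by (intro integral_mono integrable_norm Bochner_Integration.integrable_add Bochner_Integration.integrable_diff)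
      (auto simp: algebra_simps intro: order_trans[OF _ norm_triangle_ineq])
  also have "\<dots> = (\<integral>x. norm (f x - p x) \<partial>\<nu>) + (\<integral>x. norm (g x - q x) \<partial>\<nu>)"
    using add.hyps p q by (intro Bochner_Integration.integral_add integrable_norm Bochner_Integration.integrable_diff)
  also have "\<dots> < e" using p q by simp
  finally show ?case
    using p q by (intro exI[of _ "\<lambda>x. p x + q x"]) (auto intro: continuous_intros)
next
  case (lim f s)
  have "(\<lambda>i. \<integral>x. norm (f x - s i x) \<partial>\<nu>) \<longlonglongrightarrow> (\<integral>x. 0 \<partial>\<nu>)"
  proof (rule integral_dominated_convergence[where w = "\<lambda>x. 3 * norm (f x)"])
    show "AE x in \<nu>. (\<lambda>i. norm (f x - s i x)) \<longlonglongrightarrow> 0"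
    proof (rule AE_I2)
      fix x assume "x \<in> space \<nu>"
      then have "(\<lambda>i. norm (f x - s i x)) \<longlonglongrightarrow> norm (f x - f x)" by (intro tendsto_intros lim)
      then show "(\<lambda>i. norm (f x - s i x)) \<longlonglongrightarrow> 0" by simp
    qed
    show "AE x in \<nu>. norm (norm (f x - s i x)) \<le> 3 * norm (f x)" for i
    proof (rule AE_I2)
      fix x assume "x \<in> space \<nu>"
      then show "norm (norm (f x - s i x)) \<le> 3 * norm (f x)"
        using lim.hyps(3)[of x i] norm_triangle_ineq4[of "f x" "s i x"] by simp
    qed
  qed (use lim in \<open>auto dest: borel_measurable_integrable\<close>)
  then have "(\<lambda>i. \<integral>x. norm (f x - s i x) \<partial>\<nu>) \<longlonglongrightarrow> 0" by simp
  from order_tendstoD(2)[OF this, of "e / 2"]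
  have "eventually (\<lambda>i. (\<integral>x. norm (f x - s i x) \<partial>\<nu>) < e / 2) sequentially"
    using lim.prems by simp
  then obtain i where i: "(\<integral>x. norm (f x - s i x) \<partial>\<nu>) < e / 2" by (auto simp: eventually_sequentially)
  obtain p where p: "continuous_on UNIV p" "integrable \<nu> p" "(\<integral>x. norm (s i x - p x) \<partial>\<nu>) < e / 2"
    using lim.IH[of "e / 2" i] lim.prems by auto
  have "(\<integral>x. norm (f x - p x) \<partial>\<nu>) \<le> (\<integral>x. norm (f x - s i x) + norm (s i x - p x) \<partial>\<nu>)"
    using lim.hyps p
    by (intro integral_mono integrable_norm Bochner_Integration.integrable_add Bochner_Integration.integrable_diff)
      (auto intro: order_trans[OF _ norm_triangle_ineq])
  also have "\<dots> = (\<integral>x. norm (f x - s i x) \<partial>\<nu>) + (\<integral>x. norm (s i x - p x) \<partial>\<nu>)"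
    using lim.hyps p by (intro Bochner_Integration.integral_add integrable_norm Bochner_Integration.integrable_diff)
  also have "\<dots> < e" using p i by simp
  finally show ?case using p by blast
qed

text \<open>A continuous approximation is replaced by a polynomial that is uniformly close to it on
  the compact set carrying \<nu>; the finite mass turns uniform closeness into closeness in
  L1.\<close>

lemma finite_measure_L1_polynomial:
  fixes f :: "'a::euclidean_space \<Rightarrow> complex"
  assumes sets [measurable_cong, simp]: "sets \<nu> = sets borel" and fin: "finite_measure \<nu>"
    and C: "compact C" "AE x in \<nu>. x \<in> C"
    and f: "integrable \<nu> f" and e: "e > 0"
  obtains p where "polynomial_function p" "integrable \<nu> p" "(\<integral>x. norm (f x - p x) \<partial>\<nu>) < e"
proof -
  interpret finite_measure \<nu> by fact
  obtain q where q: "continuous_on UNIV q" "integrable \<nu> q" "(\<integral>x. norm (f x - q x) \<partial>\<nu>) < e / 2"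
    using finite_measure_L1_continuous[OF sets fin f, of "e / 2"] e by auto
  define d where "d = e / 2 / (measure \<nu> UNIV + 1)"
  have m: "measure \<nu> UNIV + 1 > 0" by (simp add: add_nonneg_pos)
  have d: "d > 0" unfolding d_def using e m by (intro divide_pos_pos) simp_all
  obtain p where p: "polynomial_function p" "\<And>x. x \<in> C \<Longrightarrow> norm (q x - p x) < d"
    using Stone_Weierstrass_polynomial_function[OF C(1) continuous_on_subset[OF q(1)] d] by auto
  have [measurable]: "p \<in> borel_measurable borel"
    by (intro borel_measurable_continuous_onI continuous_on_polymonial_function p)
  have AEd: "AE x in \<nu>. norm (q x - p x) \<le> d"
    using C(2) by eventually_elim (use p(2) in \<open>auto intro: less_imp_le\<close>)
  have qp: "integrable \<nu> (\<lambda>x. q x - p x)"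
    by (rule integrable_const_bound[OF AEd]) (use q(2) in \<open>auto dest: borel_measurable_integrable\<close>)
  have ip: "integrable \<nu> p" using Bochner_Integration.integrable_diff[OF q(2) qp] by simp
  have [simp]: "space \<nu> = UNIV" using sets_eq_imp_space_eq[OF sets] by simp
  have "(\<integral>x. norm (q x - p x) \<partial>\<nu>) \<le> (\<integral>x. d \<partial>\<nu>)"
    by (rule integral_mono_AE) (use qp AEd in auto)
  also have "\<dots> = d * measure \<nu> UNIV" by simp
  also have "\<dots> \<le> d * (measure \<nu> UNIV + 1)" using d by (intro mult_left_mono) auto
  also have "\<dots> = e / 2" 
  proof -
    have "M \<noteq> 0 \<Longrightarrow> e / 2 / M * M = e / 2" for M by simp
    from this[of "measure \<nu> UNIV + 1"] m show ?thesis unfolding d_def by (simp only: less_imp_neq[OF m, symmetric] not_False_eq_True)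
  qed
  finally have qp2: "(\<integral>x. norm (q x - p x) \<partial>\<nu>) \<le> e / 2" .
  have "(\<integral>x. norm (f x - p x) \<partial>\<nu>) \<le> (\<integral>x. norm (f x - q x) + norm (q x - p x) \<partial>\<nu>)"
    using f q ip
    by (intro integral_mono integrable_norm Bochner_Integration.integrable_add Bochner_Integration.integrable_diff)
      (auto intro: order_trans[OF _ norm_triangle_ineq])
  also have "\<dots> = (\<integral>x. norm (f x - q x) \<partial>\<nu>) + (\<integral>x. norm (q x - p x) \<partial>\<nu>)"
    using f q ip by (intro Bochner_Integration.integral_add integrable_norm Bochner_Integration.integrable_diff)
  also have "\<dots> < e" using q qp2 by simp
  finally show ?thesis using that p(1) ip by blast
qed

section \<open>Holomorphic maps in several variables\<close>

lemma bounded_linear_axis: "bounded_linear (axis k :: 'a::euclidean_space \<Rightarrow> 'a ^ 'n::finite)"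
  by (intro linear_conv_bounded_linear[THEN iffD1] linearI) (auto simp: axis_def vec_eq_iff)

lemma vec_as_axis_sum: "x = (\<Sum>k\<in>UNIV. axis k (x $ k :: 'a::comm_monoid_add))"
  by (simp add: vec_eq_iff axis_def if_distrib cong: if_cong)

lemma norm_le_component_sum:
  fixes x :: "complex ^ 'n::finite"
  shows "norm x \<le> (\<Sum>k\<in>UNIV. cmod (x $ k))"
  unfolding norm_vec_def by (rule L2_set_le_sum) simp

lemma axis_zero: "axis j (0 :: complex) = (0 :: complex ^ 'n::finite)"
  by (simp add: axis_def vec_eq_iff)

lemma norm_axis_complex: "norm (axis j c :: complex ^ 'n::finite) = cmod c"
proof (rule antisym)
  have "(\<Sum>k\<in>UNIV. cmod ((axis j c :: complex ^ 'n) $ k)) = (\<Sum>k\<in>UNIV. if k = j then cmod c else 0)"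
    by (intro sum.cong) (auto simp: axis_def)
  also have "\<dots> = cmod c" by simp
  finally have e: "(\<Sum>k\<in>UNIV. cmod ((axis j c :: complex ^ 'n) $ k)) = cmod c" .
  have "norm (axis j c :: complex ^ 'n) \<le> (\<Sum>k\<in>UNIV. cmod ((axis j c :: complex ^ 'n) $ k))"
    by (rule norm_le_component_sum)
  then show "norm (axis j c :: complex ^ 'n) \<le> cmod c" unfolding e .
  show "cmod c \<le> norm (axis j c :: complex ^ 'n)"
    using Finite_Cartesian_Product.norm_nth_le[of "axis j c :: complex ^ 'n" j] by simp
qed

lemma has_derivative_vecI:
  fixes f :: "'a::euclidean_space \<Rightarrow> 'b::euclidean_space ^ 'n::finite"
  assumes "\<And>k. ((\<lambda>x. f x $ k) has_derivative (\<lambda>h. D h $ k)) F"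
  shows "(f has_derivative D) F"
proof -
  have "((\<lambda>x. \<Sum>k\<in>UNIV. axis k (f x $ k)) has_derivative (\<lambda>h. \<Sum>k\<in>UNIV. axis k (D h $ k))) F"
    by (intro has_derivative_sum bounded_linear.has_derivative[OF bounded_linear_axis] assms)
  then show ?thesis by (simp add: vec_as_axis_sum[symmetric])
qed

lemma holomorphic_map_onD:
  assumes "holomorphic_map_on V F" "x \<in> V"
  shows "(F has_derivative frechet_derivative F (at x)) (at x)"
    and "frechet_derivative F (at x) (c *s v) = c *s frechet_derivative F (at x) v"
proof -
  obtain F' where F': "(F has_derivative F') (at x)" "\<And>c v. F' (c *s v) = c *s F' v"
    using assms unfolding holomorphic_map_on_def by blast
  have "F' = frechet_derivative F (at x)" by (rule frechet_derivative_at[OF F'(1)])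
  then show "(F has_derivative frechet_derivative F (at x)) (at x)"
    "frechet_derivative F (at x) (c *s v) = c *s frechet_derivative F (at x) v"
    using F' by auto
qed

lemma holomorphic_map_on_continuous:
  assumes "holomorphic_map_on V F" shows "continuous_on V F"
  using holomorphic_map_onD(1)[OF assms] has_derivative_continuous
  by (blast intro: continuous_at_imp_continuous_on)

lemma axis_smult: "axis j c = c *s (axis j 1 :: complex ^ 'n::finite)"
  by (simp add: vec_eq_iff axis_def)

lemma holomorphic_map_partial_expansion:
  assumes "holomorphic_map_on V F" "x \<in> V"
  shows "frechet_derivative F (at x) v = (\<Sum>j\<in>UNIV. v $ j *s frechet_derivative F (at x) (axis j 1))"
proof -
  have lin: "linear (frechet_derivative F (at x))"
    using holomorphic_map_onD(1)[OF assms] has_derivative_linear by blast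
  have "frechet_derivative F (at x) v = frechet_derivative F (at x) (\<Sum>j\<in>UNIV. axis j (v $ j))"
    by (subst vec_as_axis_sum[of v]) simp
  also have "\<dots> = (\<Sum>j\<in>UNIV. frechet_derivative F (at x) (axis j (v $ j)))"
    by (rule linear_sum[OF lin])
  also have "\<dots> = (\<Sum>j\<in>UNIV. v $ j *s frechet_derivative F (at x) (axis j 1))"
    by (subst axis_smult) (simp add: holomorphic_map_onD(2)[OF assms])
  finally show ?thesis .
qed

section \<open>Cauchy estimates and Lipschitz bounds\<close>

lemma holomorphic_map_slice_derivative:
  assumes "holomorphic_map_on V F" "t + axis j \<zeta> \<in> V"
  shows "((\<lambda>\<zeta>. F (t + axis j \<zeta>) $ k) has_field_derivative
     frechet_derivative F (at (t + axis j \<zeta>)) (axis j 1) $ k) (at \<zeta>)"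
proof -
  have "((\<lambda>\<zeta>. t + axis j \<zeta>) has_derivative axis j) (at \<zeta>)"
    using bounded_linear_imp_has_derivative[OF bounded_linear_axis] by (auto intro!: derivative_eq_intros)
  from has_derivative_compose[OF this holomorphic_map_onD(1)[OF assms]]
  have "((\<lambda>\<zeta>. F (t + axis j \<zeta>) $ k) has_derivative
      (\<lambda>h. frechet_derivative F (at (t + axis j \<zeta>)) (axis j h) $ k)) (at \<zeta>)"
    by (rule bounded_linear.has_derivative[OF bounded_linear_vec_nth])
  then show ?thesis
    unfolding has_field_derivative_def
    by (subst (asm) axis_smult) (simp add: holomorphic_map_onD(2)[OF assms] mult.commute[of _ "_ $ k"])
qed

text \<open>\<open>holomorphic_map_on\<close> asks only for a complex linear derivative at each
  point. Continuity of the partials follows from Cauchy's inequality for the difference of two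
  one-variable slices, which is uniformly small because F is uniformly continuous on compact
  sets.\<close>

lemma continuous_on_partials:
  fixes F :: "complex ^ 'n::finite \<Rightarrow> complex ^ 'n"
  assumes F: "holomorphic_map_on V F" and V: "open V"
  shows "continuous_on V (\<lambda>t. frechet_derivative F (at t) (axis j 1) $ k)"
proof (intro continuous_at_imp_continuous_on ballI)
  fix x assume x: "x \<in> V"
  let ?G = "\<lambda>t. frechet_derivative F (at t) (axis j 1) $ k"
  \<comment> \<open>Radius 2 r leaves room for slices of radius r through every point within r of
    x.\<close>
  obtain r where r: "r > 0" "cball x (2 * r) \<subseteq> V"
  proof -
    obtain q where "q > 0" "cball x q \<subseteq> V" using V x open_contains_cball by blast
    then show ?thesis using that[of "q / 2"] by simp
  qed
  have tb: "t + axis j \<zeta> \<in> cball x (2 * r)" if "t \<in> cball x r" "\<zeta> \<in> cball 0 r" for t \<zeta>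
  proof -
    have "dist x (t + axis j \<zeta>) \<le> dist x t + norm (axis j \<zeta>)"
      using dist_triangle[of x "t + axis j \<zeta>" t] by (simp add: dist_norm)
    then show ?thesis using that by (simp add: norm_axis_complex)
  qed
  have diff: "cmod (?G t - ?G s) \<le> B / r"
    if t: "t \<in> cball x r" and s: "s \<in> cball x r"
      and B: "\<And>\<zeta>. \<zeta> \<in> cball 0 r \<Longrightarrow> cmod (F (t + axis j \<zeta>) $ k - F (s + axis j \<zeta>) $ k) \<le> B" for t s B
  proof -
    let ?h = "\<lambda>\<zeta>. F (t + axis j \<zeta>) $ k - F (s + axis j \<zeta>) $ k"
    have D: "(?h has_field_derivative (frechet_derivative F (at (t + axis j \<zeta>)) (axis j 1) $ k -
        frechet_derivative F (at (s + axis j \<zeta>)) (axis j 1) $ k)) (at \<zeta>)" if "\<zeta> \<in> cball 0 r" for \<zeta>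
      using tb[OF t that] tb[OF s that] r(2)
      by (intro DERIV_diff holomorphic_map_slice_derivative[OF F]) auto
    have D0: "deriv ?h 0 = ?G t - ?G s"
    proof -
      have "(0::complex) \<in> cball 0 r" using r(1) by simp
      from DERIV_imp_deriv[OF D[OF this]] show ?thesis by (simp only: axis_zero add_0_right)
    qed
    have "norm ((deriv ^^ 1) ?h 0) \<le> fact 1 * B / r ^ 1"
    proof (rule Cauchy_inequality)
      show "?h holomorphic_on ball 0 r"
        unfolding holomorphic_on_def
      proof
        fix \<zeta> :: complex assume "\<zeta> \<in> ball 0 r"
        then have "\<zeta> \<in> cball 0 r" by simp
        from has_field_derivative_at_within[OF D[OF this]] show "?h field_differentiable at \<zeta> within ball 0 r"
          unfolding field_differentiable_def by (rule exI)
      qed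
      show "continuous_on (cball 0 r) ?h"
        by (intro continuous_at_imp_continuous_on ballI) (rule DERIV_isCont[OF D])
      show "norm (?h \<zeta>) \<le> B" if "norm (0 - \<zeta>) = r" for \<zeta>
        using that by (intro B) simp
    qed (rule r(1))
    then show ?thesis using D0 by simp
  qed
  have "uniformly_continuous_on (cball x (2 * r)) F"
    using r(2) holomorphic_map_on_continuous[OF F] continuous_on_subset
    by (intro compact_uniformly_continuous) auto
  then have uc: "\<exists>d>0. \<forall>u\<in>cball x (2 * r). \<forall>v\<in>cball x (2 * r). dist v u < d \<longrightarrow> dist (F v) (F u) < e"
    if "e > 0" for e using that unfolding uniformly_continuous_on_def by blast
  show "isCont ?G x"
    unfolding continuous_at_eps_delta
  proof (intro allI impI)
    fix e :: real assume e: "e > 0"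
    obtain d where d: "d > 0" "\<And>u v. u \<in> cball x (2 * r) \<Longrightarrow> v \<in> cball x (2 * r) \<Longrightarrow> dist v u < d \<Longrightarrow> dist (F v) (F u) < e * r / 2"
      using uc[of "e * r / 2"] e r by auto
    have "dist (?G t) (?G x) < e" if "dist t x < min d r" for t
    proof -
      have t: "t \<in> cball x r" and x': "x \<in> cball x r" using that r by (auto simp: dist_commute)
      have "cmod (?G t - ?G x) \<le> (e * r / 2) / r"
      proof (rule diff[OF t x'])
        fix \<zeta> :: complex assume z: "\<zeta> \<in> cball 0 r"
        have "dist (F (t + axis j \<zeta>)) (F (x + axis j \<zeta>)) < e * r / 2"
          using that by (intro d(2) tb t x' z) (auto simp: dist_norm)
        then show "cmod (F (t + axis j \<zeta>) $ k - F (x + axis j \<zeta>) $ k) \<le> e * r / 2"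
          using dist_vec_nth_le[of "F (t + axis j \<zeta>)" k "F (x + axis j \<zeta>)"] by (simp add: dist_norm)
      qed
      then show ?thesis using e r by (simp add: dist_norm)
    qed
    then show "\<exists>d>0. \<forall>t. dist t x < d \<longrightarrow> dist (?G t) (?G x) < e"
      using d r by (intro exI[of _ "min d r"]) auto
  qed
qed

text \<open>K need not be convex, so the mean value inequality is used on small balls only;
  compactness turns the local Lipschitz property into a global one.\<close>

lemma holomorphic_map_lipschitz_on_compact:
  fixes F :: "complex ^ 'n::finite \<Rightarrow> complex ^ 'n"
  assumes F: "holomorphic_map_on V F" and V: "open V" and K: "compact K" "K \<subseteq> V"
  obtains L where "L > 0" "\<And>s t. s \<in> K \<Longrightarrow> t \<in> K \<Longrightarrow> dist (F s) (F t) \<le> L * dist s t"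
proof -
  have "local_lipschitz {0::real} V (\<lambda>_. F)"
  proof (rule local_lipschitzI)
    fix t :: real and x assume x: "x \<in> V"
    obtain r where r: "r > 0" "cball x r \<subseteq> V" using V x open_contains_cball by blast
    have "\<exists>B. \<forall>y\<in>cball x r. cmod (frechet_derivative F (at y) (axis j 1) $ k) \<le> B" for j k
    proof -
      have "bounded ((\<lambda>t. frechet_derivative F (at t) (axis j 1) $ k) ` cball x r)"
        by (intro compact_imp_bounded compact_continuous_image continuous_on_subset[OF continuous_on_partials[OF F V] r(2)]) simp
      then show ?thesis by (auto simp: bounded_iff)
    qed
    then obtain B where B: "\<And>j k y. y \<in> cball x r \<Longrightarrow> cmod (frechet_derivative F (at y) (axis j 1) $ k) \<le> B j k"
      by metis
    define L where "L = (\<Sum>k\<in>UNIV. \<Sum>j\<in>UNIV. B j k)"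
    have bound: "norm (frechet_derivative F (at y) v) \<le> L * norm v" if y: "y \<in> cball x r" for y v
    proof -
      have yV: "y \<in> V" using y r by auto
      have "norm (frechet_derivative F (at y) v) \<le> (\<Sum>k\<in>UNIV. cmod (frechet_derivative F (at y) v $ k))"
        by (rule norm_le_component_sum)
      also have "\<dots> \<le> (\<Sum>k\<in>UNIV. (\<Sum>j\<in>UNIV. B j k) * norm v)"
      proof (rule sum_mono)
        fix k
        have "cmod (frechet_derivative F (at y) v $ k) = cmod (\<Sum>j\<in>UNIV. v $ j * frechet_derivative F (at y) (axis j 1) $ k)"
          by (subst holomorphic_map_partial_expansion[OF F yV]) simp
        also have "\<dots> \<le> (\<Sum>j\<in>UNIV. cmod (v $ j * frechet_derivative F (at y) (axis j 1) $ k))"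
          by (rule norm_sum)
        also have "\<dots> \<le> (\<Sum>j\<in>UNIV. norm v * B j k)"
          unfolding norm_mult using B[OF y] Finite_Cartesian_Product.norm_nth_le by (intro sum_mono mult_mono) auto
        finally show "cmod (frechet_derivative F (at y) v $ k) \<le> (\<Sum>j\<in>UNIV. B j k) * norm v"
          by (simp add: sum_distrib_left mult.commute)
      qed
      finally show ?thesis by (simp add: L_def sum_distrib_right)
    qed
    have L: "L \<ge> 0"
      unfolding L_def using order_trans[OF norm_ge_zero B[of x]] r by (intro sum_nonneg) auto
    have "norm (F u - F v) \<le> L * norm (u - v)" if "u \<in> cball x r" "v \<in> cball x r" for u v
    proof (rule differentiable_bound[OF convex_cball _ _ that])
      show "(F has_derivative frechet_derivative F (at y)) (at y within cball x r)" if "y \<in> cball x r" for y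
        using holomorphic_map_onD(1)[OF F] r that by (blast intro: has_derivative_at_withinI)
      show "onorm (frechet_derivative F (at y)) \<le> L" if "y \<in> cball x r" for y
        using bound[OF that] by (intro onorm_bound L) auto
    qed
    then have "L-lipschitz_on (cball x r \<inter> V) F"
      using L by (intro lipschitz_onI) (auto simp: dist_norm)
    then show "\<exists>u>0. \<exists>L. \<forall>t\<in>cball t u \<inter> {0}. L-lipschitz_on (cball x u \<inter> V) F"
      using r(1) by blast
  qed
  then have "local_lipschitz {0::real} K (\<lambda>_. F)"
    using K(2) by (rule local_lipschitz_subset[OF _ order_refl])
  then obtain L where L: "L-lipschitz_on K F"
    using local_lipschitz_compact_implies_lipschitz[OF _ K(1), of "{0::real}" "\<lambda>_. F"] by auto
  have "dist (F s) (F t) \<le> (L + 1) * dist s t" if "s \<in> K" "t \<in> K" for s t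
    using lipschitz_onD[OF L that] zero_le_dist[of s t] by (simp only: distrib_right mult_1)
  moreover have "L + 1 > 0" using lipschitz_on_nonneg[OF L] by simp
  ultimately show ?thesis using that by blast
qed

lemma biholomorphic_expansive_on_compact:
  fixes \<Phi> :: "complex ^ 'n::finite \<Rightarrow> complex ^ 'n"
  assumes \<Phi>: "biholomorphic_on V \<Phi>" and K: "compact K" "K \<subseteq> V"
  obtains L where "L > 0" "\<And>s t. s \<in> K \<Longrightarrow> t \<in> K \<Longrightarrow> dist s t \<le> L * dist (\<Phi> s) (\<Phi> t)"
proof -
  have b: "open V" "open (\<Phi> ` V)" "inj_on \<Phi> V" "holomorphic_map_on V \<Phi>" "holomorphic_map_on (\<Phi> ` V) (the_inv_into V \<Phi>)"
    using \<Phi> by (auto simp: biholomorphic_on_def)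
  have "compact (\<Phi> ` K)" "\<Phi> ` K \<subseteq> \<Phi> ` V"
    using K continuous_on_subset[OF holomorphic_map_on_continuous[OF b(4)]] by (auto intro: compact_continuous_image)
  from holomorphic_map_lipschitz_on_compact[OF b(5,2) this] obtain L where
    L: "L > 0" "\<And>s t. s \<in> \<Phi> ` K \<Longrightarrow> t \<in> \<Phi> ` K \<Longrightarrow> dist (the_inv_into V \<Phi> s) (the_inv_into V \<Phi> t) \<le> L * dist s t"
    by blast
  have "dist s t \<le> L * dist (\<Phi> s) (\<Phi> t)" if "s \<in> K" "t \<in> K" for s t
  proof -
    have "s \<in> V" "t \<in> V" using that K(2) by auto
    then show ?thesis using L(2)[of "\<Phi> s" "\<Phi> t"] that by (simp add: the_inv_into_f_f[OF b(3)])
  qed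
  then show ?thesis using that L(1) by blast
qed

text \<open>The lower distance bound yields injectivity, continuity of the inverse and, in the
  limit, injectivity of the derivative; invariance of domain opens the image. To recognise a
  perturbed map as a chart it is then enough to check one metric inequality.\<close>

lemma expansive_holomorphic_map_biholomorphic:
  fixes \<Psi> :: "complex ^ 'n::finite \<Rightarrow> complex ^ 'n"
  assumes V: "open V" and \<Psi>: "holomorphic_map_on V \<Psi>" and m: "m > 0"
    and exp: "\<And>s t. s \<in> V \<Longrightarrow> t \<in> V \<Longrightarrow> m * dist s t \<le> dist (\<Psi> s) (\<Psi> t)"
  shows "biholomorphic_on V \<Psi>"
proof -
  have inj: "inj_on \<Psi> V"
  proof (rule inj_onI)
    fix s t assume "s \<in> V" "t \<in> V" "\<Psi> s = \<Psi> t"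
    then have "m * dist s t \<le> 0" using exp[of s t] by simp
    then show "s = t" using m by (simp add: mult_le_0_iff)
  qed
  have opn: "open (\<Psi> ` V)"
    by (rule invariance_of_domain[OF holomorphic_map_on_continuous[OF \<Psi>] V inj])
  let ?g = "the_inv_into V \<Psi>"
  have g: "?g (\<Psi> t) = t" if "t \<in> V" for t using the_inv_into_f_f[OF inj that] .
  have contg: "continuous_on (\<Psi> ` V) ?g"
  proof (rule continuous_onI)
    fix y e assume y: "y \<in> \<Psi> ` V" and e: "(e::real) > 0"
    then obtain t where t: "t \<in> V" "y = \<Psi> t" by auto
    have "dist (?g z) (?g y) \<le> e" if z: "z \<in> \<Psi> ` V" "dist z y < m * e" for z
    proof -
      obtain s where s: "s \<in> V" "z = \<Psi> s" using z by auto
      have "m * dist s t < m * e" using exp[OF s(1) t(1)] z s t by simp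
      then show ?thesis using m g s t by simp
    qed
    then show "\<exists>d>0. \<forall>z\<in>\<Psi> ` V. dist z y < d \<longrightarrow> dist (?g z) (?g y) \<le> e"
      using m e by (intro exI[of _ "m * e"]) auto
  qed
  have "\<exists>g'. (?g has_derivative g') (at y) \<and> (\<forall>c v. g' (c *s v) = c *s g' v)" if y: "y \<in> \<Psi> ` V" for y
  proof -
    obtain x where x: "x \<in> V" "y = \<Psi> x" using y by auto
    let ?D = "frechet_derivative \<Psi> (at x)"
    note D = holomorphic_map_onD[OF \<Psi> x(1)]
    have linD: "linear ?D" using D(1) has_derivative_linear by blast
    have ker: "v = 0" if v: "?D v = 0" for v
    proof (rule ccontr)
      assume v0: "v \<noteq> 0"
      obtain d where d: "d > 0" "\<And>y. norm (y - x) < d \<Longrightarrow> norm (\<Psi> y - \<Psi> x - ?D (y - x)) \<le> m / 2 * norm (y - x)"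
        using D(1) m unfolding has_derivative_at_alt by (meson half_gt_zero)
      obtain r where r: "r > 0" "ball x r \<subseteq> V" using V x(1) open_contains_ball by blast
      \<comment> \<open>The scaled kernel vector has length min d r / 2: short enough to stay in V,
        and so short that the linear approximation error is at most half of what expansion
        demands.\<close>
      define q where "q = min d r / (2 * norm v)"
      have q: "q > 0" using d r v0 by (simp add: q_def)
      have nq: "norm (q *\<^sub>R v) = min d r / 2" using v0 d r by (simp add: q_def)
      have "norm (\<Psi> (x + q *\<^sub>R v) - \<Psi> x - ?D (q *\<^sub>R v)) \<le> m / 2 * norm (q *\<^sub>R v)"
        using d(2)[of "x + q *\<^sub>R v"] nq d r by simp
      moreover have "?D (q *\<^sub>R v) = 0" using v by (simp add: linear_scale[OF linD])
      moreover have "m * norm (q *\<^sub>R v) \<le> norm (\<Psi> (x + q *\<^sub>R v) - \<Psi> x)"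
      proof -
        have "x + q *\<^sub>R v \<in> ball x r" using nq d r by (simp add: dist_norm del: norm_scaleR)
        then have "x + q *\<^sub>R v \<in> V" using r by blast
        then show ?thesis using exp[of "x + q *\<^sub>R v" x] x r by (auto simp: dist_norm)
      qed
      ultimately have "m * norm (q *\<^sub>R v) \<le> m / 2 * norm (q *\<^sub>R v)" by simp
      moreover have "norm (q *\<^sub>R v) > 0" using q v0 by simp
      ultimately show False using m by simp
    qed
    have injD: "inj ?D"
      using ker by (simp add: linear_injective_0[OF linD])
    obtain g' where g': "linear g'" "g' \<circ> ?D = id" using linear_injective_left_inverse[OF linD injD] by blast
    have surj: "surj ?D" using linear_injective_imp_surjective[OF linD injD] by simp
    have g'D: "g' (?D v) = v" for v using g'(2) by (metis comp_apply id_apply)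
    have clin: "g' (c *s u) = c *s g' u" for c u
    proof -
      obtain v where "u = ?D v" using surj by (metis surj_def)
      then show ?thesis using g'D[of v] g'D[of "c *s v"] D(2) by simp
    qed
    have "(?g has_derivative g') (at y)"
    proof (rule has_derivative_inverse_basic[of \<Psi> ?D])
      show "(\<Psi> has_derivative ?D) (at (?g y))" using D(1) g x by simp
      show "bounded_linear g'" using g'(1) by (simp add: linear_conv_bounded_linear)
      show "continuous (at y) ?g" using contg opn y continuous_on_eq_continuous_at by blast
      show "\<Psi> (?g z) = z" if "z \<in> \<Psi> ` V" for z using that g by auto
    qed (use g' opn y in auto)
    then show ?thesis using clin by blast
  qed
  then have "holomorphic_map_on (\<Psi> ` V) ?g" unfolding holomorphic_map_on_def by blast
  then show ?thesis using V opn inj \<Psi> by (simp add: biholomorphic_on_def)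
qed

lemma compact_neighbourhood:
  fixes K :: "'a::euclidean_space set"
  assumes "compact K" "open V" "K \<subseteq> V"
  obtains U L where "open U" "K \<subseteq> U" "U \<subseteq> L" "compact L" "L \<subseteq> V"
proof -
  obtain e where e: "e > 0" "(\<Union>x\<in>K. ball x e) \<subseteq> V"
    using compact_subset_open_imp_ball_epsilon_subset[OF assms] by blast
  let ?L = "{x + y | x y. x \<in> K \<and> y \<in> cball 0 (e / 2)}"
  have "compact ?L" by (rule compact_sums[OF assms(1) compact_cball])
  moreover have "?L \<subseteq> V"
  proof
    fix z assume "z \<in> ?L"
    then obtain x y where "x \<in> K" "norm y \<le> e / 2" "z = x + y" by auto
    then have "z \<in> ball x e" using e(1) by (simp add: dist_norm)
    then show "z \<in> V" using e(2) \<open>x \<in> K\<close> by blast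
  qed
  moreover have "(\<Union>x\<in>K. ball x (e / 2)) \<subseteq> ?L"
  proof
    fix z assume "z \<in> (\<Union>x\<in>K. ball x (e / 2))"
    then obtain x where "x \<in> K" "dist x z < e / 2" by auto
    then have "z = x + (z - x) \<and> x \<in> K \<and> z - x \<in> cball 0 (e / 2)"
      by (simp add: dist_norm norm_minus_commute)
    then show "z \<in> ?L"
      unfolding mem_Collect_eq by (rule exI[of _ "z - x", THEN exI[of _ x]])
  qed
  moreover have "open (\<Union>x\<in>K. ball x (e / 2))" "K \<subseteq> (\<Union>x\<in>K. ball x (e / 2))" using e by auto
  ultimately show ?thesis using that by blast
qed

section \<open>The weighted action\<close>

lemma weighted_action_nth [simp]: "weighted_action \<beta> w z $ k = w ^ \<beta> k * z $ k"
  by (simp add: weighted_action_def)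

lemma weighted_action_mult: "weighted_action \<beta> u (weighted_action \<beta> v z) = weighted_action \<beta> (u * v) z"
  by (simp add: vec_eq_iff power_mult_distrib)

lemma weighted_action_one [simp]: "weighted_action \<beta> 1 z = z"
  by (simp add: vec_eq_iff)

lemma weighted_action_diff: "weighted_action \<beta> w (x - y) = weighted_action \<beta> w x - weighted_action \<beta> w y"
  by (simp add: vec_eq_iff algebra_simps)

lemma continuous_on_weighted_action [continuous_intros]:
  "continuous_on X f \<Longrightarrow> continuous_on X g \<Longrightarrow> continuous_on X (\<lambda>x. weighted_action \<beta> (f x) (g x))"
  unfolding weighted_action_def by (intro continuous_intros)

lemma borel_measurable_weighted_action [measurable]:
  assumes [measurable]: "f \<in> borel_measurable M" "g \<in> borel_measurable M"
  shows "(\<lambda>x. weighted_action \<beta> (f x) (g x)) \<in> borel_measurable M"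
proof -
  have "continuous_on UNIV (\<lambda>p. weighted_action \<beta> (fst p) (snd p))"
    by (intro continuous_intros)
  from borel_measurable_continuous_Pair[OF assms this] show ?thesis by simp
qed

text \<open>The base is at least 1, so one exponent, the sum of all weights, serves every
  coordinate.\<close>

lemma norm_weighted_action_le:
  fixes z :: "complex ^ 'n::finite"
  shows "norm (weighted_action \<beta> w z) \<le> (1 + cmod w) ^ (\<Sum>k\<in>UNIV. \<beta> k) * norm z"
proof -
  define C where "C = (1 + cmod w) ^ (\<Sum>k\<in>UNIV. \<beta> k)"
  have C: "C \<ge> 0" by (simp add: C_def)
  have "norm (weighted_action \<beta> w z) \<le> norm (C *\<^sub>R z)"
  proof (rule norm_le_componentwise_cart)
    fix k
    have "cmod w ^ \<beta> k \<le> (1 + cmod w) ^ \<beta> k" by (intro power_mono) auto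
    also have "\<dots> \<le> C" unfolding C_def by (intro power_increasing member_le_sum) auto
    finally show "norm (weighted_action \<beta> w z $ k) \<le> norm ((C *\<^sub>R z) $ k)"
      using C by (simp add: norm_mult norm_power mult_right_mono)
  qed
  then show ?thesis using C by (simp add: C_def)
qed

lemma norm_weighted_action_diff_le:
  fixes z :: "complex ^ 'n::finite"
  assumes "cmod u \<le> R" "cmod v \<le> R"
  shows "norm (weighted_action \<beta> u z - weighted_action \<beta> v z) \<le>
    (\<Sum>k\<in>UNIV. real (\<beta> k) * R ^ (\<beta> k - 1)) * cmod (u - v) * norm z"
proof -
  define C where "C = (\<Sum>k\<in>UNIV. real (\<beta> k) * R ^ (\<beta> k - 1)) * cmod (u - v)"
  have R: "R \<ge> 0" using assms(1) norm_ge_zero order_trans by blast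
  then have C: "C \<ge> 0" unfolding C_def by (intro mult_nonneg_nonneg sum_nonneg) auto
  have pw: "cmod (u ^ b - v ^ b) \<le> real b * R ^ (b - 1) * cmod (u - v)" for b
  proof (rule field_differentiable_bound[of "cball 0 R"])
    show "((\<lambda>z. z ^ b) has_field_derivative of_nat b * z ^ (b - 1)) (at z within cball 0 R)" for z :: complex
      by (auto intro!: derivative_eq_intros)
    show "norm (of_nat b * z ^ (b - 1)) \<le> real b * R ^ (b - 1)" if "z \<in> cball 0 R" for z :: complex
      using that by (auto simp: norm_mult norm_power intro!: mult_left_mono power_mono)
  qed (use assms in auto)
  have "norm (weighted_action \<beta> u z - weighted_action \<beta> v z) \<le> norm (C *\<^sub>R z)"
  proof (rule norm_le_componentwise_cart)
    fix k
    have "cmod (u ^ \<beta> k - v ^ \<beta> k) \<le> real (\<beta> k) * R ^ (\<beta> k - 1) * cmod (u - v)" by (rule pw)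
    also have "\<dots> \<le> C"
      unfolding C_def using R
      by (intro mult_right_mono member_le_sum[where f = "\<lambda>k. real (\<beta> k) * R ^ (\<beta> k - 1)"]) auto
    finally have "cmod (u ^ \<beta> k - v ^ \<beta> k) * cmod (z $ k) \<le> C * cmod (z $ k)" by (intro mult_right_mono) auto
    then show "norm ((weighted_action \<beta> u z - weighted_action \<beta> v z) $ k) \<le> norm ((C *\<^sub>R z) $ k)"
      using C by (simp add: norm_mult[symmetric] left_diff_distrib)
  qed
  then show ?thesis using C by (simp add: C_def)
qed

section \<open>Perturbed charts\<close>

lemma twisted_chart_derivative:
  fixes \<Phi> :: "complex ^ 'n::finite \<Rightarrow> complex ^ 'n" and w0 c :: complex and l :: 'n
  assumes "holomorphic_map_on V \<Phi>" "t \<in> V"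
  defines "w \<equiv> w0 + c * t $ l"
  shows "((\<lambda>t. weighted_action \<beta> (w0 + c * t $ l) (\<Phi> t)) has_derivative
     (\<lambda>h. \<chi> k. w ^ \<beta> k * frechet_derivative \<Phi> (at t) h $ k +
        of_nat (\<beta> k) * w ^ (\<beta> k - 1) * (c * h $ l) * \<Phi> t $ k)) (at t)"
proof (rule has_derivative_vecI)
  fix k
  have 1: "((\<lambda>t. \<Phi> t $ k) has_derivative (\<lambda>h. frechet_derivative \<Phi> (at t) h $ k)) (at t)"
    by (rule bounded_linear.has_derivative[OF bounded_linear_vec_nth holomorphic_map_onD(1)[OF assms(1,2)]])
  have "((\<lambda>t. t $ l) has_derivative (\<lambda>h. h $ l)) (at t)"
    by (rule bounded_linear_imp_has_derivative[OF bounded_linear_vec_nth])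
  then have D: "((\<lambda>t. w0 + c * t $ l) has_derivative (\<lambda>h. c * h $ l)) (at t)"
    by (auto intro!: derivative_eq_intros)
  have 2: "((\<lambda>t. (w0 + c * t $ l) ^ \<beta> k) has_derivative (\<lambda>h. of_nat (\<beta> k) * w ^ (\<beta> k - 1) * (c * h $ l))) (at t)"
  proof -
    have "((\<lambda>w. w ^ \<beta> k) has_field_derivative of_nat (\<beta> k) * w ^ (\<beta> k - 1)) (at w)"
      by (auto intro!: derivative_eq_intros)
    then show ?thesis
      using has_derivative_compose[OF D, of "\<lambda>w. w ^ \<beta> k" "\<lambda>h. of_nat (\<beta> k) * w ^ (\<beta> k - 1) * h"]
      by (simp add: has_field_derivative_def w_def)
  qed
  show "((\<lambda>t. weighted_action \<beta> (w0 + c * t $ l) (\<Phi> t) $ k) has_derivative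
     (\<lambda>h. (\<chi> k. w ^ \<beta> k * frechet_derivative \<Phi> (at t) h $ k +
        of_nat (\<beta> k) * w ^ (\<beta> k - 1) * (c * h $ l) * \<Phi> t $ k) $ k)) (at t)"
    using has_derivative_mult[OF 2 1] by (simp add: w_def)
qed

text \<open>The term in c is the velocity along the orbit. It enters the l-th partial derivative
  only, which is how the orbit coefficient becomes visible inside an ordinary chart.\<close>

lemma twisted_chart_partial:
  fixes \<Phi> :: "complex ^ 'n::finite \<Rightarrow> complex ^ 'n"
  assumes "holomorphic_map_on V \<Phi>" "t \<in> V"
  shows "frechet_derivative (\<lambda>t. weighted_action \<beta> (w0 + c * t $ l) (\<Phi> t)) (at t) (axis j 1) $ k =
    (w0 + c * t $ l) ^ \<beta> k * frechet_derivative \<Phi> (at t) (axis j 1) $ k +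
    (if j = l then c * (of_nat (\<beta> k) * (w0 + c * t $ l) ^ (\<beta> k - 1) * \<Phi> t $ k) else 0)"
  unfolding frechet_derivative_at[OF twisted_chart_derivative[OF assms], symmetric]
  by (simp add: axis_def)

lemma twisted_chart_holomorphic:
  assumes "holomorphic_map_on V \<Phi>" "V' \<subseteq> V"
  shows "holomorphic_map_on V' (\<lambda>t. weighted_action \<beta> (w0 + c * t $ l) (\<Phi> t))"
  unfolding holomorphic_map_on_def
proof (intro ballI exI conjI allI)
  fix t assume "t \<in> V'"
  then have t: "t \<in> V" using assms by auto
  show "((\<lambda>t. weighted_action \<beta> (w0 + c * t $ l) (\<Phi> t)) has_derivative
     (\<lambda>h. \<chi> k. (w0 + c * t $ l) ^ \<beta> k * frechet_derivative \<Phi> (at t) h $ k +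
        of_nat (\<beta> k) * (w0 + c * t $ l) ^ (\<beta> k - 1) * (c * h $ l) * \<Phi> t $ k)) (at t)"
    by (rule twisted_chart_derivative[OF assms(1) t])
qed (simp add: vec_eq_iff holomorphic_map_onD(2)[OF assms(1)] subsetD[OF assms(2)] algebra_simps)

text \<open>With frozen w the map is \<Phi> followed by an invertible linear map and expands
  distances by at least 1/(Q M). Letting w vary with t costs at most A B |c| times the distance,
  half of that for |c| \<le> c0. The bound c0 must not depend on w0, since w0 will be integrated
  over.\<close>

lemma twisted_chart_biholomorphic:
  fixes \<Phi> :: "complex ^ 'n::finite \<Rightarrow> complex ^ 'n"
  assumes \<Phi>: "biholomorphic_on V \<Phi>" and K: "compact K" "K \<subseteq> V" and W: "compact W" "0 \<notin> W"
  shows "\<exists>c0>0. \<forall>c w0. cmod c \<le> c0 \<longrightarrow> (\<exists>V'. V' \<subseteq> V \<and> {t \<in> K. w0 + c * t $ l \<in> W} \<subseteq> V' \<and>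
      (\<forall>t\<in>V'. w0 + c * t $ l \<noteq> 0) \<and> biholomorphic_on V' (\<lambda>t. weighted_action \<beta> (w0 + c * t $ l) (\<Phi> t)))"
proof -
  have hol: "holomorphic_map_on V \<Phi>" and V: "open V" using \<Phi> by (auto simp: biholomorphic_on_def)
  obtain U L where UL: "open U" "K \<subseteq> U" "U \<subseteq> L" "compact L" "L \<subseteq> V"
    using compact_neighbourhood[OF K(1) V K(2)] by blast
  obtain M where M: "M > 0" "\<And>s t. s \<in> L \<Longrightarrow> t \<in> L \<Longrightarrow> dist s t \<le> M * dist (\<Phi> s) (\<Phi> t)"
    using biholomorphic_expansive_on_compact[OF \<Phi> UL(4,5)] by blast
  have "bounded (\<Phi> ` L)"
    using UL holomorphic_map_on_continuous[OF hol] continuous_on_subset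
    by (intro compact_imp_bounded compact_continuous_image) auto
  then obtain B where B: "B > 0" "\<And>t. t \<in> L \<Longrightarrow> norm (\<Phi> t) \<le> B" by (auto simp: bounded_pos)
  have "bounded W" using W(1) by (rule compact_imp_bounded)
  then obtain R where R: "R > 0" "\<And>w. w \<in> W \<Longrightarrow> cmod w \<le> R" by (auto simp: bounded_pos)
  have "bounded (inverse ` W)"
    using W by (intro compact_imp_bounded compact_continuous_image continuous_on_inverse continuous_on_id) auto
  then obtain b where b: "b > 0" "\<And>w. w \<in> W \<Longrightarrow> cmod (inverse w) \<le> b" by (auto simp: bounded_pos)
  define N where "N = (\<Sum>k\<in>UNIV. \<beta> k)"
  define Q where "Q = (1 + (b + 1)) ^ N"
  have Q: "Q > 0" using b by (simp add: Q_def)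
  define A where "A = (\<Sum>k\<in>UNIV. real (\<beta> k) * (R + 1) ^ (\<beta> k - 1))"
  have A: "A \<ge> 0" unfolding A_def using R by (intro sum_nonneg) auto
  \<comment> \<open>Chosen so that the twist consumes half of the expansion 1/(Q M); the summand 1
    keeps the denominator positive.\<close>
  define c0 where "c0 = 1 / (2 * Q * M * (A * B + 1))"
  have AB: "A * B + 1 > 0" using A B by (simp add: add_nonneg_pos)
  have c0: "c0 > 0" using Q M AB by (simp add: c0_def)
  have "\<exists>V'. V' \<subseteq> V \<and> {t \<in> K. w0 + c * t $ l \<in> W} \<subseteq> V' \<and>
      (\<forall>t\<in>V'. w0 + c * t $ l \<noteq> 0) \<and> biholomorphic_on V' (\<lambda>t. weighted_action \<beta> (w0 + c * t $ l) (\<Phi> t))"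
    if c: "cmod c \<le> c0" for c w0
  proof -
    let ?w = "\<lambda>t :: complex ^ 'n. w0 + c * t $ l"
    let ?\<Psi> = "\<lambda>t. weighted_action \<beta> (?w t) (\<Phi> t)"
    \<comment> \<open>Only points whose twist lies in an annulus around W are kept. All constants
      then depend on K and W alone, and 0 is avoided.\<close>
    define V' where "V' = U \<inter> {t. cmod (?w t) < R + 1} \<inter> {t. 1 / (b + 1) < cmod (?w t)}"
    have opn: "open V'"
      unfolding V'_def by (intro open_Int UL open_Collect_less continuous_intros)
    have V'V: "V' \<subseteq> V" using UL by (auto simp: V'_def)
    have w: "?w t \<noteq> 0" "cmod (?w t) \<le> R + 1" "cmod (inverse (?w t)) \<le> b + 1" if "t \<in> V'" for t
    proof -
      have p: "1 / (b + 1) < cmod (?w t)" "cmod (?w t) < R + 1" using that by (auto simp: V'_def)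
      have "0 < 1 / (b + 1)" using b by simp
      then have "0 < cmod (?w t)" using p(1) by (rule less_trans)
      then show "?w t \<noteq> 0" by auto
      show "cmod (?w t) \<le> R + 1" using p by simp
      show "cmod (inverse (?w t)) \<le> b + 1"
        using le_imp_inverse_le[OF less_imp_le[OF p(1)] \<open>0 < 1 / (b + 1)\<close>] by (simp add: norm_inverse)
    qed
    have sub: "{t \<in> K. ?w t \<in> W} \<subseteq> V'"
    proof safe
      fix t assume t: "t \<in> K" "?w t \<in> W"
      have "?w t \<noteq> 0" using t W by metis
      moreover have "cmod (inverse (?w t)) < b + 1" using b(2)[OF t(2)] by simp
      ultimately have "inverse (b + 1) < inverse (inverse (cmod (?w t)))"
        using b(1) by (intro less_imp_inverse_less) (auto simp: norm_inverse)
      then have "1 / (b + 1) < cmod (?w t)" by (simp add: inverse_eq_divide)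
      then show "t \<in> V'" using t R(2)[OF t(2)] UL by (auto simp: V'_def)
    qed
    have exp: "1 / (2 * Q * M) * dist s t \<le> dist (?\<Psi> s) (?\<Psi> t)" if st: "s \<in> V'" "t \<in> V'" for s t
    proof -
      have L: "s \<in> L" "t \<in> L" using st UL by (auto simp: V'_def)
      have "norm (\<Phi> s - \<Phi> t) = norm (weighted_action \<beta> (inverse (?w s)) (weighted_action \<beta> (?w s) (\<Phi> s - \<Phi> t)))"
        using w(1)[OF st(1)] by (simp add: weighted_action_mult)
      also have "\<dots> \<le> (1 + cmod (inverse (?w s))) ^ N * norm (weighted_action \<beta> (?w s) (\<Phi> s - \<Phi> t))"
        unfolding N_def by (rule norm_weighted_action_le)
      also have "\<dots> \<le> Q * norm (weighted_action \<beta> (?w s) (\<Phi> s - \<Phi> t))"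
        unfolding Q_def using w(3)[OF st(1)] by (intro mult_right_mono power_mono) auto
      finally have 1: "norm (\<Phi> s - \<Phi> t) \<le> Q * norm (weighted_action \<beta> (?w s) (\<Phi> s - \<Phi> t))" .
      have "dist s t \<le> M * norm (\<Phi> s - \<Phi> t)" using M(2)[OF L] by (simp add: dist_norm)
      also have "\<dots> \<le> M * (Q * norm (weighted_action \<beta> (?w s) (\<Phi> s - \<Phi> t)))"
        using 1 M by (intro mult_left_mono) auto
      finally have 2: "1 / (Q * M) * dist s t \<le> norm (weighted_action \<beta> (?w s) (\<Phi> s - \<Phi> t))"
        using Q M by (simp add: field_simps)
      have "norm (weighted_action \<beta> (?w s) (\<Phi> t) - weighted_action \<beta> (?w t) (\<Phi> t)) \<le> A * cmod (?w s - ?w t) * norm (\<Phi> t)"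
        unfolding A_def by (rule norm_weighted_action_diff_le) (use w st in auto)
      also have "cmod (?w s - ?w t) = cmod c * cmod ((s - t) $ l)"
        by (simp add: norm_mult[symmetric] algebra_simps)
      also have "A * (cmod c * cmod ((s - t) $ l)) * norm (\<Phi> t) \<le> A * (c0 * dist s t) * B"
        unfolding dist_norm using A B(2)[OF L(2)] c c0 Finite_Cartesian_Product.norm_nth_le[of "s - t" l]
        by (intro mult_mono) auto
      also have "\<dots> = A * B * c0 * dist s t" by simp
      also have "\<dots> \<le> (A * B + 1) * c0 * dist s t"
        using c0 by (intro mult_right_mono) auto
      also have "(A * B + 1) * c0 = 1 / (2 * Q * M)" using AB by (simp add: c0_def)
      finally have 3: "norm (weighted_action \<beta> (?w s) (\<Phi> t) - weighted_action \<beta> (?w t) (\<Phi> t)) \<le> 1 / (2 * Q * M) * dist s t" .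
      have "?\<Psi> s - ?\<Psi> t = weighted_action \<beta> (?w s) (\<Phi> s - \<Phi> t) + (weighted_action \<beta> (?w s) (\<Phi> t) - weighted_action \<beta> (?w t) (\<Phi> t))"
        by (simp add: weighted_action_diff)
      then have "dist (?\<Psi> s) (?\<Psi> t) \<ge> norm (weighted_action \<beta> (?w s) (\<Phi> s - \<Phi> t)) - norm (weighted_action \<beta> (?w s) (\<Phi> t) - weighted_action \<beta> (?w t) (\<Phi> t))"
        unfolding dist_norm by (metis norm_diff_ineq)
      then have "dist (?\<Psi> s) (?\<Psi> t) \<ge> 1 / (Q * M) * dist s t - 1 / (2 * Q * M) * dist s t"
        using order_trans[OF diff_mono[OF 2 3]] by blast
      also have "1 / (Q * M) * dist s t - 1 / (2 * Q * M) * dist s t = 1 / (2 * Q * M) * dist s t"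
        using Q M by (simp add: field_simps)
      finally show ?thesis by simp
    qed
    have "biholomorphic_on V' ?\<Psi>"
      by (rule expansive_holomorphic_map_biholomorphic[OF opn twisted_chart_holomorphic[OF hol V'V] _ exp])
        (use Q M in simp)
    then show ?thesis using V'V sub w(1) by blast
  qed
  then show ?thesis using c0 by blast
qed

lemma submanifold_chart_mem_iff:
  assumes "submanifold_chart M I V \<Phi>" "t \<in> V" shows "\<Phi> t \<in> M \<longleftrightarrow> t \<in> coord_subspace I"
proof -
  have inj: "inj_on \<Phi> V" and eq: "\<Phi> ` (V \<inter> coord_subspace I) = M \<inter> \<Phi> ` V"
    using assms by (auto simp: submanifold_chart_def biholomorphic_on_def)
  show ?thesis
  proof
    assume "\<Phi> t \<in> M"
    then have "\<Phi> t \<in> \<Phi> ` (V \<inter> coord_subspace I)" using eq assms(2) by auto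
    then obtain s where "s \<in> V" "s \<in> coord_subspace I" "\<Phi> t = \<Phi> s" by auto
    then show "t \<in> coord_subspace I" using inj assms(2) by (metis inj_onD)
  qed (use eq assms(2) in auto)
qed

lemma twisted_submanifold_chart:
  assumes chart: "submanifold_chart M I V \<Phi>"
    and inv: "\<And>w z. w \<noteq> 0 \<Longrightarrow> weighted_action \<beta> w z \<in> M \<longleftrightarrow> z \<in> M"
    and V': "V' \<subseteq> V" "\<And>t. t \<in> V' \<Longrightarrow> w0 + c * t $ l \<noteq> 0"
    and \<Psi>: "biholomorphic_on V' (\<lambda>t. weighted_action \<beta> (w0 + c * t $ l) (\<Phi> t))"
  shows "submanifold_chart M I V' (\<lambda>t. weighted_action \<beta> (w0 + c * t $ l) (\<Phi> t))"
proof -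
  have "weighted_action \<beta> (w0 + c * t $ l) (\<Phi> t) \<in> M \<longleftrightarrow> t \<in> coord_subspace I" if "t \<in> V'" for t
    using inv[OF V'(2)[OF that]] submanifold_chart_mem_iff[OF chart, of t] that V' by auto
  then show ?thesis unfolding submanifold_chart_def using \<Psi> by auto
qed

section \<open>Invariance of the variety and of its regular part\<close>

lemma weighted_homogeneous_variety_closed:
  assumes "weighted_homogeneous_variety \<beta> S" shows "closed S"
proof -
  obtain Qs where Qs: "\<forall>Q\<in>Qs. \<exists>d. weighted_homogeneous \<beta> d Q" "S = {z. \<forall>Q\<in>Qs. Q z = 0}"
    using assms unfolding weighted_homogeneous_variety_def by (elim exE conjE) (rule that)
  have "closed {z. Q z = 0}" if Q: "Q \<in> Qs" for Q
  proof -
    obtain d where "weighted_homogeneous \<beta> d Q" using bspec[OF Qs(1) Q] by (elim exE) (rule that)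
    then have "holomorphic_polynomial Q" by (simp add: weighted_homogeneous_def)
    then obtain A c where Q: "\<forall>z. Q z = (\<Sum>a\<in>A. c a * (\<Prod>k\<in>UNIV. z $ k ^ a k))"
      unfolding holomorphic_polynomial_def by (elim exE conjE) (rule that)
    have "continuous_on UNIV (\<lambda>z :: complex ^ 'a. \<Sum>a\<in>A. c a * (\<Prod>k\<in>UNIV. z $ k ^ a k))"
      by (intro continuous_intros)
    then have "closed {z. (\<Sum>a\<in>A. c a * (\<Prod>k\<in>UNIV. z $ k ^ a k)) = 0}" 
      by (intro closed_Collect_eq continuous_on_const)
    then show ?thesis by (simp only: Q)
  qed
  then have "closed (\<Inter>Q\<in>Qs. {z. Q z = 0})" by (intro closed_INT ballI)
  moreover have "S = (\<Inter>Q\<in>Qs. {z. Q z = 0})" unfolding Qs(2) by (rule set_eqI) simp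
  ultimately show ?thesis by (simp only:)
qed

lemma weighted_homogeneous_variety_action:
  assumes "weighted_homogeneous_variety \<beta> S" "z \<in> S" shows "weighted_action \<beta> w z \<in> S"
proof -
  obtain Qs where Qs: "\<forall>Q\<in>Qs. \<exists>d. weighted_homogeneous \<beta> d Q" "S = {z. \<forall>Q\<in>Qs. Q z = 0}"
    using assms unfolding weighted_homogeneous_variety_def by (elim exE conjE) (rule that)
  have "Q (weighted_action \<beta> w z) = 0" if Q: "Q \<in> Qs" for Q
  proof -
    obtain d where "weighted_homogeneous \<beta> d Q" using bspec[OF Qs(1) Q] by (elim exE) (rule that)
    then have "Q (weighted_action \<beta> w z) = w ^ d * Q z" by (simp add: weighted_homogeneous_def)
    then show ?thesis using Q assms(2) Qs(2) by simp
  qed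
  then show ?thesis using Qs(2) by simp
qed

text \<open>The converse inclusion is the action of the inverse of w.\<close>

lemma action_mem_iffI:
  assumes "\<And>w z. w \<noteq> 0 \<Longrightarrow> z \<in> M \<Longrightarrow> weighted_action \<beta> w z \<in> M" "w \<noteq> 0"
  shows "weighted_action \<beta> w z \<in> M \<longleftrightarrow> z \<in> M"
proof
  assume "weighted_action \<beta> w z \<in> M"
  then have "weighted_action \<beta> (inverse w) (weighted_action \<beta> w z) \<in> M" using assms by simp
  then show "z \<in> M" using assms(2) by (simp add: weighted_action_mult)
qed (use assms in simp)

text \<open>A chart moved by a fixed nonzero w is again a chart: the untwisted case c = 0 of the
  perturbed charts.\<close>

lemma regular_part_action:
  assumes S: "weighted_homogeneous_variety \<beta> S" and w: "w \<noteq> 0"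
  shows "weighted_action \<beta> w z \<in> regular_part S \<longleftrightarrow> z \<in> regular_part S"
proof (rule action_mem_iffI[OF _ w])
  have invS: "weighted_action \<beta> w z \<in> S \<longleftrightarrow> z \<in> S" if "w \<noteq> 0" for w z
    using weighted_homogeneous_variety_action[OF S] that by (rule action_mem_iffI)
  fix w :: complex and z assume w: "w \<noteq> 0" and z: "z \<in> regular_part S"
  obtain I V \<Phi> where chart: "submanifold_chart S I V \<Phi>" and "z \<in> \<Phi> ` V" "z \<in> S"
    using z unfolding regular_part_def by blast
  then obtain t where t: "t \<in> V" "z = \<Phi> t" by auto
  have bih: "biholomorphic_on V \<Phi>" using chart by (simp add: submanifold_chart_def)
  \<comment> \<open>With c = 0 the twist is the constant w, so the coordinate index
    \<open>undefined\<close> has no influence; the compact sets shrink to the point t and the value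
    w.\<close>
  have "\<exists>V'. V' \<subseteq> V \<and> {t' \<in> {t}. w + 0 * t' $ undefined \<in> {w}} \<subseteq> V' \<and>
      (\<forall>t\<in>V'. w + 0 * t $ undefined \<noteq> 0) \<and> biholomorphic_on V' (\<lambda>t. weighted_action \<beta> (w + 0 * t $ undefined) (\<Phi> t))"
  proof -
    have "compact {t}" "{t} \<subseteq> V" "compact {w}" "0 \<notin> {w}" using t(1) w by simp_all
    from twisted_chart_biholomorphic[OF bih this, of undefined \<beta>] show ?thesis
      by (elim exE conjE) (erule allE[of _ 0], erule allE[of _ w], simp)
  qed
  then obtain V' where V': "V' \<subseteq> V" "{t' \<in> {t}. w + 0 * t' $ undefined \<in> {w}} \<subseteq> V'"
      "\<forall>t\<in>V'. w + 0 * t $ undefined \<noteq> 0" "biholomorphic_on V' (\<lambda>t. weighted_action \<beta> (w + 0 * t $ undefined) (\<Phi> t))"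
    by blast
  have "submanifold_chart S I V' (\<lambda>t. weighted_action \<beta> (w + 0 * t $ undefined) (\<Phi> t))"
    using V' by (intro twisted_submanifold_chart[OF chart invS]) auto
  moreover have "weighted_action \<beta> w z \<in> (\<lambda>t. weighted_action \<beta> (w + 0 * t $ undefined) (\<Phi> t)) ` V'"
    using V'(2) t by auto
  moreover have "weighted_action \<beta> w z \<in> S" using invS[OF w] \<open>z \<in> S\<close> by simp
  ultimately show "weighted_action \<beta> w z \<in> regular_part S" unfolding regular_part_def by blast
qed

section \<open>A compact piece of a chart\<close>

lemma borel_measurable_cnj_compose [measurable]:
  "h \<in> borel_measurable N \<Longrightarrow> (\<lambda>x. cnj (h x)) \<in> borel_measurable N"
  by (erule measurable_compose) (intro borel_measurable_continuous_onI continuous_on_cnj continuous_on_id)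

text \<open>K will carry the support of a test function. The family u stands for coefficients
  extended to the whole space, bounded and Borel, so that every integrand below is Borel on all of
  \<open>complex ^ 'n\<close>. Of M only the invariance under nonzero w enters besides the
  chart.\<close>

locale chart_piece =
  fixes \<beta> :: "'n::finite \<Rightarrow> nat" and M :: "(complex ^ 'n) set" and I :: "'n set"
    and V :: "(complex ^ 'n) set" and \<Phi> :: "complex ^ 'n \<Rightarrow> complex ^ 'n" and K :: "(complex ^ 'n) set"
    and u :: "'n \<Rightarrow> complex ^ 'n \<Rightarrow> complex" and F :: real
  assumes chart: "submanifold_chart M I V \<Phi>"
    and inv: "\<And>w z. w \<noteq> 0 \<Longrightarrow> weighted_action \<beta> w z \<in> M \<longleftrightarrow> z \<in> M"
    and K: "compact K" "K \<subseteq> V \<inter> coord_subspace I"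
    and u_meas [measurable]: "\<And>k. u k \<in> borel_measurable borel"
    and u_bound: "\<And>k z. cmod (u k z) \<le> F"
begin

abbreviation "\<mu> \<equiv> coord_lebesgue I"

lemma F_nonneg: "F \<ge> 0"
  using u_bound norm_ge_zero order_trans by blast

lemma bihol: "biholomorphic_on V \<Phi>" and V_open: "open V" and \<Phi>_hol: "holomorphic_map_on V \<Phi>"
  and \<Phi>_inj: "inj_on \<Phi> V"
  using chart by (auto simp: submanifold_chart_def biholomorphic_on_def)

lemma K_sub: "K \<subseteq> V" "K \<subseteq> coord_subspace I"
  using K by auto

lemma K_sets [measurable]: "K \<in> sets borel"
  using K(1) by (simp add: borel_compact)

lemma emeasure_K: "emeasure \<mu> K < \<infinity>"
  using K(1) compact_imp_bounded emeasure_coord_bounded_finite by blast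

lemma \<Phi>_in_M: "t \<in> K \<Longrightarrow> \<Phi> t \<in> M"
  using submanifold_chart_mem_iff[OF chart] K_sub by blast

lemma \<Phi>_continuous: "continuous_on V \<Phi>"
  by (rule holomorphic_map_on_continuous[OF \<Phi>_hol])

text \<open>Nothing is known about \<Phi> outside V; cutting to K makes the map globally Borel and
  bounded.\<close>

definition \<Phi>\<^sub>0 :: "complex ^ 'n \<Rightarrow> complex ^ 'n" where
  "\<Phi>\<^sub>0 t = indicator K t *\<^sub>R \<Phi> t"

definition D\<^sub>0 :: "'n \<Rightarrow> complex ^ 'n \<Rightarrow> complex ^ 'n" where
  "D\<^sub>0 j t = indicator K t *\<^sub>R frechet_derivative \<Phi> (at t) (axis j 1)"

lemma \<Phi>0_eq: "t \<in> K \<Longrightarrow> \<Phi>\<^sub>0 t = \<Phi> t" and D0_eq: "t \<in> K \<Longrightarrow> D\<^sub>0 j t = frechet_derivative \<Phi> (at t) (axis j 1)"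
  by (simp_all add: \<Phi>\<^sub>0_def D\<^sub>0_def)

lemma partial_continuous: "continuous_on V (\<lambda>t. frechet_derivative \<Phi> (at t) (axis j 1))"
proof -
  have "continuous_on V (\<lambda>t. \<chi> k. frechet_derivative \<Phi> (at t) (axis j 1) $ k)"
    by (intro continuous_on_vec_lambda continuous_on_partials[OF \<Phi>_hol V_open])
  then show ?thesis by (simp only: vec_lambda_eta)
qed

lemma \<Phi>0_meas [measurable]: "\<Phi>\<^sub>0 \<in> borel_measurable borel"
  and D0_meas [measurable]: "D\<^sub>0 j \<in> borel_measurable borel"
  unfolding \<Phi>\<^sub>0_def[abs_def] D\<^sub>0_def[abs_def]
  by (auto intro!: borel_measurable_continuous_on_indicator
      continuous_on_subset[OF \<Phi>_continuous K_sub(1)] continuous_on_subset[OF partial_continuous K_sub(1)])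

lemma \<Phi>0_bounded: "\<exists>C\<ge>0. \<forall>t. norm (\<Phi>\<^sub>0 t) \<le> C" and D0_bounded: "\<exists>C\<ge>0. \<forall>t. norm (D\<^sub>0 j t) \<le> C"
proof -
  have *: "\<exists>C\<ge>0. \<forall>t. norm (indicator K t *\<^sub>R h t) \<le> C" if h: "continuous_on V h" for h :: "complex ^ 'n \<Rightarrow> complex ^ 'n"
  proof -
    have "bounded (h ` K)"
      by (intro compact_imp_bounded compact_continuous_image continuous_on_subset[OF h K_sub(1)] K)
    then obtain C where "C > 0" "\<forall>t\<in>K. norm (h t) \<le> C" by (auto simp: bounded_pos)
    then show ?thesis by (intro exI[of _ C]) (auto simp: indicator_def)
  qed
  show "\<exists>C\<ge>0. \<forall>t. norm (\<Phi>\<^sub>0 t) \<le> C" "\<exists>C\<ge>0. \<forall>t. norm (D\<^sub>0 j t) \<le> C"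
    unfolding \<Phi>\<^sub>0_def D\<^sub>0_def by (rule * [OF \<Phi>_continuous], rule *[OF partial_continuous])
qed

text \<open>The coefficient a of the overview: conjugated derivatives in w of the orbit map, paired
  with the form. Writing \<open>w ^ (\<beta> k - 1)\<close> instead of a quotient by w keeps it
  bounded near w = 0.\<close>

definition coeff_w :: "complex ^ 'n \<Rightarrow> complex \<Rightarrow> complex" where
  "coeff_w t w = (\<Sum>k\<in>UNIV. u k (weighted_action \<beta> w (\<Phi>\<^sub>0 t)) * cnj (of_nat (\<beta> k) * w ^ (\<beta> k - 1) * \<Phi>\<^sub>0 t $ k))"

text \<open>The coefficients b_j of the overview; at w = 1 they are the pull-back under the chart
  itself.\<close>

definition coeff_t :: "'n \<Rightarrow> complex ^ 'n \<Rightarrow> complex \<Rightarrow> complex" where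
  "coeff_t j t w = (\<Sum>k\<in>UNIV. u k (weighted_action \<beta> w (\<Phi>\<^sub>0 t)) * cnj (w ^ \<beta> k * D\<^sub>0 j t $ k))"

lemma coeff_meas [measurable]:
  assumes [measurable]: "h \<in> N \<rightarrow>\<^sub>M borel" "g \<in> N \<rightarrow>\<^sub>M borel"
  shows "(\<lambda>x. coeff_w (h x) (g x)) \<in> borel_measurable N" "(\<lambda>x. coeff_t j (h x) (g x)) \<in> borel_measurable N"
  unfolding coeff_w_def coeff_t_def by (measurable, measurable)

lemma coeff_w_bounded: "\<exists>C\<ge>0. \<forall>t w. cmod w \<le> R \<longrightarrow> cmod (coeff_w t w) \<le> C"
proof -
  obtain C where C: "C \<ge> 0" "\<And>t. norm (\<Phi>\<^sub>0 t) \<le> C" using \<Phi>0_bounded by auto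
  let ?B = "\<Sum>k\<in>UNIV. F * (real (\<beta> k) * \<bar>R\<bar> ^ (\<beta> k - 1) * C)"
  have "cmod (coeff_w t w) \<le> ?B" if w: "cmod w \<le> R" for t w
    unfolding coeff_w_def
  proof (rule order_trans[OF norm_sum sum_mono])
    fix k
    have "cmod (\<Phi>\<^sub>0 t $ k) \<le> C" using C(2) Finite_Cartesian_Product.norm_nth_le order_trans by blast
    then show "cmod (u k (weighted_action \<beta> w (\<Phi>\<^sub>0 t)) * cnj (of_nat (\<beta> k) * w ^ (\<beta> k - 1) * \<Phi>\<^sub>0 t $ k)) \<le>
        F * (real (\<beta> k) * \<bar>R\<bar> ^ (\<beta> k - 1) * C)"
      unfolding norm_mult complex_mod_cnj norm_power norm_of_nat
      using w F_nonneg u_bound C(1) by (intro mult_mono power_mono mult_nonneg_nonneg) auto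
  qed
  moreover have "?B \<ge> 0" using F_nonneg C(1) by (intro sum_nonneg mult_nonneg_nonneg) auto
  ultimately show ?thesis by blast
qed

lemma coeff_t_bounded: "\<exists>C\<ge>0. \<forall>t w. cmod w \<le> R \<longrightarrow> cmod (coeff_t j t w) \<le> C"
proof -
  obtain C where C: "C \<ge> 0" "\<And>t. norm (D\<^sub>0 j t) \<le> C" using D0_bounded by auto
  let ?B = "\<Sum>k\<in>UNIV. F * (\<bar>R\<bar> ^ \<beta> k * C)"
  have "cmod (coeff_t j t w) \<le> ?B" if w: "cmod w \<le> R" for t w
    unfolding coeff_t_def
  proof (rule order_trans[OF norm_sum sum_mono])
    fix k
    have "cmod (D\<^sub>0 j t $ k) \<le> C" using C(2) Finite_Cartesian_Product.norm_nth_le order_trans by blast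
    then show "cmod (u k (weighted_action \<beta> w (\<Phi>\<^sub>0 t)) * cnj (w ^ \<beta> k * D\<^sub>0 j t $ k)) \<le> F * (\<bar>R\<bar> ^ \<beta> k * C)"
      unfolding norm_mult complex_mod_cnj norm_power
      using w F_nonneg u_bound C(1) by (intro mult_mono power_mono mult_nonneg_nonneg) auto
  qed
  moreover have "?B \<ge> 0" using F_nonneg C(1) by (intro sum_nonneg mult_nonneg_nonneg) auto
  ultimately show ?thesis by blast
qed

section \<open>Integration over the product of the piece with the w-plane\<close>

lemma integrable_on_piece:
  fixes h :: "complex ^ 'n \<Rightarrow> 'b::{banach, second_countable_topology}"
  assumes [measurable]: "h \<in> borel_measurable borel"
    and "\<And>t. t \<in> K \<Longrightarrow> norm (h t) \<le> C" "\<And>t. t \<notin> K \<Longrightarrow> h t = 0"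
  shows "integrable \<mu> h"
proof (rule Bochner_Integration.integrable_bound)
  show "integrable \<mu> (\<lambda>t. \<bar>C\<bar> * indicator K t)"
    using emeasure_K by (intro integrable_mult_right integrable_real_indicator) auto
  show "AE t in \<mu>. norm (h t) \<le> norm (\<bar>C\<bar> * indicator K t :: real)"
  proof (rule AE_I2)
    fix t show "norm (h t) \<le> norm (\<bar>C\<bar> * indicator K t :: real)"
      using assms(2,3)[of t] by (cases "t \<in> K") auto
  qed
qed simp

sublocale pair: pair_sigma_finite \<mu> "lborel :: complex measure"
  by (intro pair_sigma_finite.intro sigma_finite_coord_lebesgue sigma_finite_lborel)

lemma integrable_on_product:
  fixes h :: "(complex ^ 'n) \<times> complex \<Rightarrow> complex"
  assumes [measurable]: "h \<in> borel_measurable (\<mu> \<Otimes>\<^sub>M lborel)"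
    and "\<And>t w. t \<in> K \<Longrightarrow> cmod w \<le> R \<Longrightarrow> cmod (h (t, w)) \<le> C" "\<And>t w. t \<notin> K \<or> cmod w > R \<Longrightarrow> h (t, w) = 0"
  shows "integrable (\<mu> \<Otimes>\<^sub>M lborel) h"
proof (rule Bochner_Integration.integrable_bound)
  have "emeasure (\<mu> \<Otimes>\<^sub>M lborel) (K \<times> cball (0::complex) R) = emeasure \<mu> K * emeasure lborel (cball (0::complex) R)"
    by (intro lborel.emeasure_pair_measure_Times) auto
  also have "\<dots> < \<infinity>" using emeasure_K emeasure_lborel_cball_finite[of "0::complex" R] by (simp add: ennreal_mult_less_top)
  finally show "integrable (\<mu> \<Otimes>\<^sub>M lborel) (\<lambda>x. \<bar>C\<bar> * indicator (K \<times> cball (0::complex) R) x)"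
    by (intro integrable_mult_right integrable_real_indicator) auto
  show "AE x in \<mu> \<Otimes>\<^sub>M lborel. norm (h x) \<le> norm (\<bar>C\<bar> * indicator (K \<times> cball (0::complex) R) x :: real)"
  proof (rule AE_I2)
    fix x :: "(complex ^ 'n) \<times> complex"
    obtain t w where x: "x = (t, w)" by (cases x)
    show "norm (h x) \<le> norm (\<bar>C\<bar> * indicator (K \<times> cball (0::complex) R) x :: real)"
      using assms(2)[of t w] assms(3)[of t w] by (cases "t \<in> K \<and> cmod w \<le> R") (auto simp: x not_le)
  qed
qed simp

text \<open>For each fixed t the shift in w is a translation of the plane, and Fubini exchanges the
  order. After integration over w0 the twist therefore vanishes from the arguments.\<close>

lemma integral_shift:
  fixes H :: "complex ^ 'n \<Rightarrow> complex \<Rightarrow> complex"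
  assumes meas [measurable]: "case_prod H \<in> borel_measurable (borel \<Otimes>\<^sub>M borel)"
    and H: "integrable (\<mu> \<Otimes>\<^sub>M lborel) (case_prod H)"
    and \<gamma> [measurable]: "\<gamma> \<in> borel_measurable borel"
  shows "(\<integral>w. \<integral>t. H t (w + \<gamma> t) \<partial>\<mu> \<partial>lborel) = (\<integral>w. \<integral>t. H t w \<partial>\<mu> \<partial>lborel)"
proof -
  have shift: "(\<integral>w. h (w + a) \<partial>lborel) = (\<integral>w. h w \<partial>lborel)" if [measurable]: "h \<in> borel_measurable borel"
    for h :: "complex \<Rightarrow> complex" and a
  proof -
    have "(\<integral>w. h w \<partial>lborel) = (\<integral>w. h w \<partial>distr lborel borel ((+) a))" by (simp only: lborel_distr_plus)
    also have "\<dots> = (\<integral>w. h (a + w) \<partial>lborel)" by (rule integral_distr) auto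
    finally show ?thesis by (simp add: add.commute)
  qed
  have nshift: "(\<integral>\<^sup>+w. h (w + a) \<partial>lborel) = (\<integral>\<^sup>+w. h w \<partial>lborel)" if [measurable]: "h \<in> borel_measurable borel"
    for h :: "complex \<Rightarrow> ennreal" and a
  proof -
    have "(\<integral>\<^sup>+w. h w \<partial>lborel) = (\<integral>\<^sup>+w. h w \<partial>distr lborel borel ((+) a))" by (simp only: lborel_distr_plus)
    also have "\<dots> = (\<integral>\<^sup>+w. h (a + w) \<partial>lborel)" by (rule nn_integral_distr) auto
    finally show ?thesis by (simp add: add.commute)
  qed
  have Hm: "(\<lambda>w. H t w) \<in> borel_measurable borel" for t
    using measurable_compose[OF measurable_Pair1' meas, of t] by simp
  have meas2 [measurable]: "(\<lambda>(t, w). H t (w + \<gamma> t)) \<in> borel_measurable (\<mu> \<Otimes>\<^sub>M lborel)"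
  proof -
    have "(\<lambda>x. (fst x, snd x + \<gamma> (fst x))) \<in> \<mu> \<Otimes>\<^sub>M lborel \<rightarrow>\<^sub>M borel \<Otimes>\<^sub>M borel" by measurable
    from measurable_compose[OF this meas] show ?thesis by (simp add: split_beta')
  qed
  have meas1 [measurable]: "case_prod H \<in> borel_measurable (\<mu> \<Otimes>\<^sub>M lborel)"
    using H by (rule borel_measurable_integrable)
  have "(\<integral>\<^sup>+x. ennreal (norm ((\<lambda>(t, w). H t (w + \<gamma> t)) x)) \<partial>(\<mu> \<Otimes>\<^sub>M lborel)) =
      (\<integral>\<^sup>+t. \<integral>\<^sup>+w. ennreal (norm (H t (w + \<gamma> t))) \<partial>lborel \<partial>\<mu>)"
    by (subst lborel.nn_integral_fst[symmetric]) auto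
  also have "\<dots> = (\<integral>\<^sup>+t. \<integral>\<^sup>+w. ennreal (norm (H t w)) \<partial>lborel \<partial>\<mu>)"
    by (intro nn_integral_cong nshift) (use Hm in auto)
  also have "\<dots> = (\<integral>\<^sup>+x. ennreal (norm (case_prod H x)) \<partial>(\<mu> \<Otimes>\<^sub>M lborel))"
    by (subst lborel.nn_integral_fst[symmetric]) auto
  also have "\<dots> < \<infinity>" using H by (simp add: integrable_iff_bounded)
  finally have int2: "integrable (\<mu> \<Otimes>\<^sub>M lborel) (\<lambda>(t, w). H t (w + \<gamma> t))"
    by (intro integrableI_bounded) auto
  have "(\<integral>w. \<integral>t. H t (w + \<gamma> t) \<partial>\<mu> \<partial>lborel) = (\<integral>t. \<integral>w. H t (w + \<gamma> t) \<partial>lborel \<partial>\<mu>)"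
    by (rule pair.Fubini_integral[OF int2])
  also have "\<dots> = (\<integral>t. \<integral>w. H t w \<partial>lborel \<partial>\<mu>)"
    by (intro Bochner_Integration.integral_cong refl shift Hm)
  also have "\<dots> = (\<integral>w. \<integral>t. H t w \<partial>\<mu> \<partial>lborel)"
    by (rule pair.Fubini_integral[OF H, symmetric])
  finally show ?thesis .
qed

text \<open>For w near 1 the action moves the piece inside a slightly larger compact piece of the
  same chart. Read in the chart it is a map with Lipschitz inverse, with constants uniform in w, so
  integrals along the moved piece are controlled by one integral over L.\<close>

lemma nn_integral_action_le:
  "\<exists>\<eta>>0. \<exists>C\<ge>0. \<exists>L. compact L \<and> L \<subseteq> V \<inter> coord_subspace I \<and>
    (\<forall>w h. cmod (w - 1) < \<eta> \<longrightarrow> h \<in> borel_measurable borel \<longrightarrow>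
      (\<integral>\<^sup>+t. h (weighted_action \<beta> w (\<Phi>\<^sub>0 t)) * indicator K t \<partial>\<mu>) \<le>
      ennreal C * (\<integral>\<^sup>+t. h (indicator L t *\<^sub>R \<Phi> t) * indicator L t \<partial>\<mu>))"
proof -
  obtain U L where UL: "open U" "K \<subseteq> U" "U \<subseteq> L" "compact L" "L \<subseteq> V"
    using compact_neighbourhood[OF K(1) V_open K_sub(1)] by blast
  have UV: "U \<subseteq> V" using UL by auto
  have opnU: "open (\<Phi> ` U)"
    by (intro invariance_of_domain continuous_on_subset[OF \<Phi>_continuous] UL inj_on_subset[OF \<Phi>_inj] UV)
  have opnV: "open (\<Phi> ` V)"
    by (intro invariance_of_domain \<Phi>_continuous V_open \<Phi>_inj)
  have "compact (\<Phi> ` K)"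
    by (intro compact_continuous_image continuous_on_subset[OF \<Phi>_continuous] K K_sub)
  moreover have "\<Phi> ` K \<subseteq> \<Phi> ` U" using UL by auto
  ultimately obtain e where e: "e > 0" "(\<Union>x\<in>\<Phi> ` K. ball x e) \<subseteq> \<Phi> ` U"
    using compact_subset_open_imp_ball_epsilon_subset[OF _ opnU] by blast
  obtain B where B: "B \<ge> 0" "\<And>t. norm (\<Phi>\<^sub>0 t) \<le> B" using \<Phi>0_bounded by auto
  define A where "A = (\<Sum>k\<in>UNIV. real (\<beta> k) * 2 ^ (\<beta> k - 1))"
  have A: "A \<ge> 0" unfolding A_def by (intro sum_nonneg) auto
  have AB: "A * B + 1 > 0" using A B by (simp add: add_nonneg_pos)
  \<comment> \<open>The first entry bounds w and its inverse by 2; the second keeps every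
    displacement of a point of \<open>\<Phi>\<close> K\<open>below e, hence inside\<close>\<Phi>
    \<open>U\<close>.\<close>
  define \<eta> where "\<eta> = min (1 / 2) (e / (A * B + 1))"
  have \<eta>: "\<eta> > 0" using e AB by (simp add: \<eta>_def)
  define N where "N = (\<Sum>k\<in>UNIV. \<beta> k)"
  obtain L1 where L1: "L1 > 0" "\<And>s t. s \<in> L \<Longrightarrow> t \<in> L \<Longrightarrow> dist s t \<le> L1 * dist (\<Phi> s) (\<Phi> t)"
    using biholomorphic_expansive_on_compact[OF bihol UL(4,5)] by blast
  obtain L2 where L2: "L2 > 0" "\<And>s t. s \<in> L \<Longrightarrow> t \<in> L \<Longrightarrow> dist (\<Phi> s) (\<Phi> t) \<le> L2 * dist s t"
    using holomorphic_map_lipschitz_on_compact[OF \<Phi>_hol V_open UL(4,5)] by blast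
  \<comment> \<open>From \<tau> back to t: L2 for \<Phi> at the moved points, \<open>3 ^ N\<close>
    for the inverse action with |1/w| \<le> 2, L1 for inverting \<Phi>.\<close>
  define Lc where "Lc = L1 * (3 ^ N * L2)"
  have Lc: "Lc > 0" using L1 L2 by (simp add: Lc_def)
  have "bounded L" using UL(4) by (rule compact_imp_bounded)
  then obtain R where R: "L \<subseteq> ball 0 R" using bounded_subset_ballD[of L 0] by auto
  define L' where "L' = L \<inter> coord_subspace I"
  have L': "compact L'" "L' \<subseteq> V \<inter> coord_subspace I"
    using UL compact_Int_closed[OF UL(4) closed_coord_subspace] by (auto simp: L'_def)
  have L'm [measurable]: "L' \<in> sets borel" using L'(1) by (simp add: borel_compact)
  define C where "C = (pi * Lc\<^sup>2) ^ card I * (2 * real CARD('n)) ^ (2 * card I)"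
  have \<Phi>L [measurable]: "(\<lambda>t. indicator L' t *\<^sub>R \<Phi> t) \<in> borel_measurable borel"
    using L'(2) by (intro borel_measurable_continuous_on_indicator L'm continuous_on_subset[OF \<Phi>_continuous]) auto
  have "(\<integral>\<^sup>+t. h (weighted_action \<beta> w (\<Phi>\<^sub>0 t)) * indicator K t \<partial>\<mu>) \<le>
      ennreal C * (\<integral>\<^sup>+t. h (indicator L' t *\<^sub>R \<Phi> t) * indicator L' t \<partial>\<mu>)"
    if w: "cmod (w - 1) < \<eta>" and h [measurable]: "h \<in> borel_measurable borel" for w h
  proof -
    let ?g = "the_inv_into V \<Phi>"
    have w2: "cmod w \<le> 2" "cmod (inverse w) \<le> 2" "w \<noteq> 0"
    proof -
      have a: "cmod (w - 1) < 1 / 2" using w by (simp add: \<eta>_def)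
      have b: "1 - cmod (w - 1) \<le> cmod w" using norm_triangle_ineq2[of 1 "1 - w"] by (simp add: norm_minus_commute)
      show "w \<noteq> 0" using a by auto
      show "cmod w \<le> 2" using a norm_triangle_ineq[of "w - 1" 1] by simp
      have "1 / 2 \<le> cmod w" using a b by simp
      from le_imp_inverse_le[OF this] show "cmod (inverse w) \<le> 2" by (simp add: norm_inverse)
    qed
    have img: "weighted_action \<beta> w (\<Phi> t) \<in> \<Phi> ` U" if t: "t \<in> K" for t
    proof -
      have "norm (weighted_action \<beta> w (\<Phi> t) - weighted_action \<beta> 1 (\<Phi> t)) \<le> A * cmod (w - 1) * norm (\<Phi> t)"
        unfolding A_def by (rule norm_weighted_action_diff_le) (use w2 in auto)
      also have "\<dots> \<le> A * cmod (w - 1) * B" using A B(2)[of t] \<Phi>0_eq[OF t] by (intro mult_left_mono) auto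
      also have "\<dots> = (A * B) * cmod (w - 1)" by simp
      also have "\<dots> \<le> (A * B) * (e / (A * B + 1))"
        using w A B by (intro mult_left_mono) (auto simp: \<eta>_def)
      also have "\<dots> < (A * B + 1) * (e / (A * B + 1))" using e AB by (intro mult_strict_right_mono) auto
      also have "\<dots> = e" using AB by simp
      finally have "weighted_action \<beta> w (\<Phi> t) \<in> ball (\<Phi> t) e" by (simp add: dist_norm norm_minus_commute)
      then show ?thesis using e(2) t by blast
    qed
    \<comment> \<open>The action conjugated by the chart. It maps K into the coordinate subspace
      because M is invariant.\<close>
    define \<tau> where "\<tau> t = indicator K t *\<^sub>R ?g (weighted_action \<beta> w (\<Phi> t))" for t
    have \<tau>: "\<tau> t \<in> U" "\<Phi> (\<tau> t) = weighted_action \<beta> w (\<Phi> t)" "\<tau> t \<in> L'" if t: "t \<in> K" for t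
    proof -
      obtain s where s: "s \<in> U" "weighted_action \<beta> w (\<Phi> t) = \<Phi> s" using img[OF t] by auto
      have "\<tau> t = s" using s t UV the_inv_into_f_f[OF \<Phi>_inj, of s] by (auto simp: \<tau>_def)
      moreover have "s \<in> coord_subspace I"
        using submanifold_chart_mem_iff[OF chart, of s] s UV inv[OF w2(3), of "\<Phi> t"] \<Phi>_in_M[OF t] by auto
      ultimately show "\<tau> t \<in> U" "\<Phi> (\<tau> t) = weighted_action \<beta> w (\<Phi> t)" "\<tau> t \<in> L'"
        using s UL by (auto simp: L'_def)
    qed
    have cont_g: "continuous_on (\<Phi> ` V) ?g"
      using bihol unfolding biholomorphic_on_def by (intro holomorphic_map_on_continuous) auto
    have \<tau>m [measurable]: "\<tau> \<in> borel_measurable borel"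
      unfolding \<tau>_def
    proof (intro borel_measurable_continuous_on_indicator K_sets)
      have "continuous_on K (\<lambda>t. weighted_action \<beta> w (\<Phi> t))"
        by (intro continuous_intros continuous_on_subset[OF \<Phi>_continuous] K_sub)
      then show "continuous_on K (\<lambda>t. ?g (weighted_action \<beta> w (\<Phi> t)))"
        by (rule continuous_on_compose2[OF cont_g]) (use img UV in blast)
    qed
    have lip: "dist s t \<le> Lc * dist (\<tau> s) (\<tau> t)" if st: "s \<in> K" "t \<in> K" for s t
    proof -
      have "dist (\<Phi> s) (\<Phi> t) = norm (weighted_action \<beta> (inverse w) (weighted_action \<beta> w (\<Phi> s - \<Phi> t)))"
        using w2 by (simp add: weighted_action_mult dist_norm)
      also have "\<dots> \<le> (1 + cmod (inverse w)) ^ N * norm (weighted_action \<beta> w (\<Phi> s - \<Phi> t))"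
        unfolding N_def by (rule norm_weighted_action_le)
      also have "\<dots> \<le> 3 ^ N * norm (weighted_action \<beta> w (\<Phi> s - \<Phi> t))"
        using w2 by (intro mult_right_mono power_mono) auto
      also have "norm (weighted_action \<beta> w (\<Phi> s - \<Phi> t)) = dist (\<Phi> (\<tau> s)) (\<Phi> (\<tau> t))"
        using \<tau>(2) st by (simp add: dist_norm weighted_action_diff)
      also have "3 ^ N * \<dots> \<le> 3 ^ N * (L2 * dist (\<tau> s) (\<tau> t))"
        using \<tau>(3) st by (intro mult_left_mono L2) (auto simp: L'_def)
      finally have "L1 * dist (\<Phi> s) (\<Phi> t) \<le> L1 * (3 ^ N * (L2 * dist (\<tau> s) (\<tau> t)))"
        using L1 by (intro mult_left_mono) auto
      moreover have "dist s t \<le> L1 * dist (\<Phi> s) (\<Phi> t)" using st UL by (intro L1) auto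
      ultimately show ?thesis by (simp add: Lc_def mult.assoc)
    qed
    have "(\<integral>\<^sup>+t. h (weighted_action \<beta> w (\<Phi>\<^sub>0 t)) * indicator K t \<partial>\<mu>) =
        (\<integral>\<^sup>+t. (h (indicator L' (\<tau> t) *\<^sub>R \<Phi> (\<tau> t)) * indicator L' (\<tau> t)) * indicator K t \<partial>\<mu>)"
    proof (rule nn_integral_cong)
      fix t show "h (weighted_action \<beta> w (\<Phi>\<^sub>0 t)) * indicator K t =
          (h (indicator L' (\<tau> t) *\<^sub>R \<Phi> (\<tau> t)) * indicator L' (\<tau> t)) * indicator K t"
        using \<tau>[of t] by (cases "t \<in> K") (auto simp: \<Phi>0_eq)
    qed
    also have "\<dots> \<le> ennreal C * (\<integral>\<^sup>+t. h (indicator L' t *\<^sub>R \<Phi> t) * indicator L' t \<partial>\<mu>)"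
      unfolding C_def
    proof (rule nn_integral_lipschitz_inverse[OF K_sets K_sub(2) \<tau>m _ lip Lc])
      show "\<tau> t \<in> coord_subspace I \<inter> ball 0 R" if "t \<in> K" for t
        using \<tau>[OF that] R by (auto simp: L'_def)
    qed measurable
    finally show ?thesis .
  qed
  moreover have "C \<ge> 0" by (simp add: C_def)
  ultimately show ?thesis using \<eta> L' by blast
qed

text \<open>The analogue of the continuity of translations in L1. For continuous v this is dominated
  convergence; in general v is approximated in L1, and \<open>nn_integral_action_le\<close> keeps
  the error small simultaneously for all w near 1. Without it, the value at w = 1, a null set of the
  product, would carry no information.\<close>

lemma isCont_action_integral:
  fixes v :: "complex ^ 'n \<Rightarrow> complex"
  assumes v [measurable]: "v \<in> borel_measurable borel" and vb: "\<And>z. cmod (v z) \<le> G"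
    and \<psi> [measurable]: "\<psi> \<in> borel_measurable borel" and \<psi>b: "\<And>t. cmod (\<psi> t) \<le> P" and \<psi>0: "\<And>t. t \<notin> K \<Longrightarrow> \<psi> t = 0"
  shows "isCont (\<lambda>w. \<integral>t. v (weighted_action \<beta> w (\<Phi>\<^sub>0 t)) * \<psi> t \<partial>\<mu>) 1"
proof -
  obtain \<eta> C L where \<eta>: "\<eta> > 0" "C \<ge> 0" and L: "compact L" "L \<subseteq> V \<inter> coord_subspace I"
    and le: "\<And>w h. cmod (w - 1) < \<eta> \<Longrightarrow> h \<in> borel_measurable borel \<Longrightarrow>
      (\<integral>\<^sup>+t. h (weighted_action \<beta> w (\<Phi>\<^sub>0 t)) * indicator K t \<partial>\<mu>) \<le>
      ennreal C * (\<integral>\<^sup>+t. h (indicator L t *\<^sub>R \<Phi> t) * indicator L t \<partial>\<mu>)"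
    using nn_integral_action_le by blast
  have P: "P \<ge> 0" using order_trans[OF norm_ge_zero \<psi>b] .
  have [measurable]: "L \<in> sets borel" using L(1) by (simp add: borel_compact)
  have [measurable]: "(\<lambda>t. indicator L t *\<^sub>R \<Phi> t) \<in> borel_measurable borel"
    using L(2) by (intro borel_measurable_continuous_on_indicator continuous_on_subset[OF \<Phi>_continuous]) auto
  \<comment> \<open>The image on M of Lebesgue measure on L: one finite measure in which the
    approximation error is measured for all w at once.\<close>
  define \<nu> where "\<nu> = distr (density \<mu> (indicator L)) borel (\<lambda>t. indicator L t *\<^sub>R \<Phi> t)"
  have \<nu>s: "sets \<nu> = sets borel" by (simp add: \<nu>_def)
  have \<nu>n: "(\<integral>\<^sup>+x. h x \<partial>\<nu>) = (\<integral>\<^sup>+t. h (indicator L t *\<^sub>R \<Phi> t) * indicator L t \<partial>\<mu>)"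
    if [measurable]: "h \<in> borel_measurable borel" for h
    unfolding \<nu>_def by (simp add: nn_integral_distr nn_integral_density mult.commute)
  have fin: "finite_measure \<nu>"
  proof
    have "emeasure \<nu> (space \<nu>) = (\<integral>\<^sup>+x. 1 \<partial>\<nu>)" by simp
    also have "\<dots> = emeasure \<mu> L" by (subst \<nu>n) simp_all
    also have "\<dots> \<noteq> \<infinity>" using emeasure_coord_bounded_finite[OF compact_imp_bounded[OF L(1)]] by (simp add: less_top)
    finally show "emeasure \<nu> (space \<nu>) \<noteq> \<infinity>" .
  qed
  have iv: "integrable \<nu> v"
    by (rule finite_measure.integrable_const_bound[OF fin, of _ G]) (use vb in \<open>auto simp: \<nu>_def\<close>)
  let ?G = "\<lambda>p w. \<integral>t. p (weighted_action \<beta> w (\<Phi>\<^sub>0 t)) * \<psi> t \<partial>\<mu>"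
  obtain B where B: "B \<ge> 0" "\<And>t. norm (\<Phi>\<^sub>0 t) \<le> B" using \<Phi>0_bounded by auto
  have iva: "integrable \<mu> (\<lambda>t. v (weighted_action \<beta> w (\<Phi>\<^sub>0 t)) * \<psi> t)" for w
  proof (rule integrable_on_piece)
    show "norm (v (weighted_action \<beta> w (\<Phi>\<^sub>0 t)) * \<psi> t) \<le> G * P" for t
      unfolding norm_mult using vb \<psi>b order_trans[OF norm_ge_zero vb] by (intro mult_mono) auto
  qed (use \<psi>0 in auto)
  have approx: "\<exists>p. isCont (?G p) 1 \<and> (\<forall>w. cmod (w - 1) < min \<eta> 1 \<longrightarrow> cmod (?G v w - ?G p w) \<le> e)" if e: "e > 0" for e
  proof -
    have CP: "C * P + 1 > 0" using \<eta> P by (simp add: add_nonneg_pos)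
    obtain p where p: "continuous_on UNIV p" "integrable \<nu> p" "(\<integral>x. norm (v x - p x) \<partial>\<nu>) < e / (C * P + 1)"
      using finite_measure_L1_continuous[OF \<nu>s fin iv, of "e / (C * P + 1)"] e CP by auto
    have [measurable]: "p \<in> borel_measurable borel" by (rule borel_measurable_continuous_onI[OF p(1)])
    define R where "R = 3 ^ (\<Sum>k\<in>UNIV. \<beta> k) * B"
    have wR: "weighted_action \<beta> w (\<Phi>\<^sub>0 t) \<in> cball 0 R" if "cmod (w - 1) < 1" for w t
    proof -
      have "cmod w \<le> 2" using that norm_triangle_ineq[of "w - 1" 1] by simp
      have "norm (weighted_action \<beta> w (\<Phi>\<^sub>0 t)) \<le> (1 + cmod w) ^ (\<Sum>k\<in>UNIV. \<beta> k) * norm (\<Phi>\<^sub>0 t)"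
        by (rule norm_weighted_action_le)
      also have "\<dots> \<le> R" unfolding R_def using B \<open>cmod w \<le> 2\<close> by (intro mult_mono power_mono) auto
      finally show ?thesis by simp
    qed
    have "bounded (p ` cball 0 R)"
      by (intro compact_imp_bounded compact_continuous_image continuous_on_subset[OF p(1)]) auto
    then obtain Q where Q: "Q > 0" "\<And>z. z \<in> cball 0 R \<Longrightarrow> cmod (p z) \<le> Q" by (auto simp: bounded_pos)
    have pb: "cmod (p (weighted_action \<beta> w (\<Phi>\<^sub>0 t)) * \<psi> t) \<le> Q * P" if "cmod (w - 1) < 1" for w t
      unfolding norm_mult using Q(2)[OF wR[OF that]] Q(1) \<psi>b by (intro mult_mono) auto
    have ipa: "integrable \<mu> (\<lambda>t. p (weighted_action \<beta> w (\<Phi>\<^sub>0 t)) * \<psi> t)" if "cmod (w - 1) < 1" for w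
      by (rule integrable_on_piece) (use \<psi>0 pb[OF that] in auto)
    have "isCont (?G p) 1"
      unfolding continuous_at_sequentially comp_def
    proof (intro allI impI)
      fix x :: "nat \<Rightarrow> complex" assume x: "x \<longlonglongrightarrow> 1"
      then have "eventually (\<lambda>n. cmod (x n - 1) < 1) sequentially"
        using tendstoD[of x 1 sequentially 1] by (simp add: dist_norm)
      then obtain n0 where n0: "\<And>n. n \<ge> n0 \<Longrightarrow> cmod (x n - 1) < 1" by (auto simp: eventually_sequentially)
      have "(\<lambda>n. ?G p (x (n + n0))) \<longlonglongrightarrow> ?G p 1"
      proof (rule integral_dominated_convergence[where w = "\<lambda>t. Q * P * indicator K t"])
        show "integrable \<mu> (\<lambda>t. Q * P * indicator K t)"
          by (rule integrable_on_piece[of _ "Q * P"]) (use Q P in auto)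
        show "AE t in \<mu>. (\<lambda>n. p (weighted_action \<beta> (x (n + n0)) (\<Phi>\<^sub>0 t)) * \<psi> t) \<longlonglongrightarrow> p (weighted_action \<beta> 1 (\<Phi>\<^sub>0 t)) * \<psi> t"
        proof (intro AE_I2 tendsto_mult tendsto_const)
          fix t
          have "continuous_on UNIV (\<lambda>w. p (weighted_action \<beta> w (\<Phi>\<^sub>0 t)))"
            by (intro continuous_on_compose2[OF p(1)] continuous_intros) auto
          then have "isCont (\<lambda>w. p (weighted_action \<beta> w (\<Phi>\<^sub>0 t))) 1" by (simp add: continuous_on_eq_continuous_at)
          then show "(\<lambda>n. p (weighted_action \<beta> (x (n + n0)) (\<Phi>\<^sub>0 t))) \<longlonglongrightarrow> p (weighted_action \<beta> 1 (\<Phi>\<^sub>0 t))"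
            by (rule isCont_tendsto_compose) (rule LIMSEQ_ignore_initial_segment[OF x])
        qed
        show "AE t in \<mu>. norm (p (weighted_action \<beta> (x (n + n0)) (\<Phi>\<^sub>0 t)) * \<psi> t) \<le> Q * P * indicator K t" for n
        proof (rule AE_I2)
          fix t show "norm (p (weighted_action \<beta> (x (n + n0)) (\<Phi>\<^sub>0 t)) * \<psi> t) \<le> Q * P * indicator K t"
            using pb[OF n0, of "n + n0" t] \<psi>0[of t] by (cases "t \<in> K") auto
        qed
      qed measurable
      then show "(\<lambda>n. ?G p (x n)) \<longlonglongrightarrow> ?G p 1" by (rule LIMSEQ_offset)
    qed
    moreover have "cmod (?G v w - ?G p w) \<le> e" if w: "cmod (w - 1) < min \<eta> 1" for w
    proof -
      have w1: "cmod (w - 1) < 1" "cmod (w - 1) < \<eta>" using w by auto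
      have "?G v w - ?G p w = (\<integral>t. (v (weighted_action \<beta> w (\<Phi>\<^sub>0 t)) - p (weighted_action \<beta> w (\<Phi>\<^sub>0 t))) * \<psi> t \<partial>\<mu>)"
        by (subst Bochner_Integration.integral_diff[OF iva ipa[OF w1(1)], symmetric]) (simp add: left_diff_distrib)
      also have "ennreal (cmod \<dots>) \<le> (\<integral>\<^sup>+t. ennreal (cmod ((v (weighted_action \<beta> w (\<Phi>\<^sub>0 t)) - p (weighted_action \<beta> w (\<Phi>\<^sub>0 t))) * \<psi> t)) \<partial>\<mu>)"
        using Bochner_Integration.integrable_diff[OF iva ipa[OF w1(1)]]
        by (intro integral_norm_bound_ennreal) (simp add: left_diff_distrib)
      also have "\<dots> \<le> (\<integral>\<^sup>+t. (ennreal P * ennreal (cmod (v (weighted_action \<beta> w (\<Phi>\<^sub>0 t)) - p (weighted_action \<beta> w (\<Phi>\<^sub>0 t))))) * indicator K t \<partial>\<mu>)"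
      proof (rule nn_integral_mono)
        fix t show "ennreal (cmod ((v (weighted_action \<beta> w (\<Phi>\<^sub>0 t)) - p (weighted_action \<beta> w (\<Phi>\<^sub>0 t))) * \<psi> t)) \<le>
            (ennreal P * ennreal (cmod (v (weighted_action \<beta> w (\<Phi>\<^sub>0 t)) - p (weighted_action \<beta> w (\<Phi>\<^sub>0 t))))) * indicator K t"
          using \<psi>b[of t] \<psi>0[of t] P
          by (cases "t \<in> K") (auto simp: norm_mult ennreal_mult[symmetric] mult.commute[of P] intro!: ennreal_leI mult_left_mono)
      qed
      also have "\<dots> \<le> ennreal C * (\<integral>\<^sup>+x. ennreal P * ennreal (cmod (v x - p x)) \<partial>\<nu>)"
        using le[OF w1(2), of "\<lambda>x. ennreal P * ennreal (cmod (v x - p x))"]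
        by (subst \<nu>n) simp_all
      also have "(\<integral>\<^sup>+x. ennreal P * ennreal (cmod (v x - p x)) \<partial>\<nu>) = ennreal P * (\<integral>\<^sup>+x. ennreal (cmod (v x - p x)) \<partial>\<nu>)"
        by (rule nn_integral_cmult) (simp add: \<nu>_def)
      also have "(\<integral>\<^sup>+x. ennreal (cmod (v x - p x)) \<partial>\<nu>) = ennreal (\<integral>x. norm (v x - p x) \<partial>\<nu>)"
        using iv p(2) by (intro nn_integral_eq_integral) auto
      also have "ennreal C * (ennreal P * ennreal (\<integral>x. norm (v x - p x) \<partial>\<nu>)) = ennreal (C * P * (\<integral>x. norm (v x - p x) \<partial>\<nu>))"
        using \<eta> P by (simp add: ennreal_mult mult.assoc)
      also have "\<dots> \<le> ennreal ((C * P + 1) * (e / (C * P + 1)))"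
      proof (intro ennreal_leI mult_mono)
        show "(\<integral>x. norm (v x - p x) \<partial>\<nu>) \<le> e / (C * P + 1)" using p(3) by simp
      qed (use CP in simp_all)
      also have "(C * P + 1) * (e / (C * P + 1)) = e" using CP by simp
      finally show ?thesis using e by (simp add: ennreal_le_iff)
    qed
    ultimately show ?thesis by blast
  qed
  show ?thesis
    unfolding continuous_at_eps_delta
  proof (intro allI impI)
    fix e :: real assume e: "e > 0"
    obtain p where p: "isCont (?G p) 1" "\<And>w. cmod (w - 1) < min \<eta> 1 \<Longrightarrow> cmod (?G v w - ?G p w) \<le> e / 4"
      using approx[of "e / 4"] e by auto
    obtain d where d: "d > 0" "\<And>w. dist w 1 < d \<Longrightarrow> dist (?G p w) (?G p 1) < e / 4"
      using continuous_at_eps_delta[THEN iffD1, OF p(1), rule_format, of "e / 4"] e by auto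
    have "dist (?G v w) (?G v 1) < e" if w: "dist w 1 < min d (min \<eta> 1)" for w
    proof -
      have 1: "cmod (?G v w - ?G p w) \<le> e / 4" "cmod (?G v 1 - ?G p 1) \<le> e / 4"
        by (rule p(2); use w \<eta> in \<open>simp add: dist_norm\<close>)+
      have 2: "cmod (?G p w - ?G p 1) < e / 4" using d(2)[of w] w by (simp add: dist_norm)
      have tri: "cmod (a - d) \<le> cmod (a - b) + cmod (b - c) + cmod (d - c)" for a b c d :: complex
        using norm_triangle_ineq4[of "a - c" "d - c"] norm_triangle_ineq[of "a - b" "b - c"] by simp
      have "cmod (?G v w - ?G v 1) \<le> cmod (?G v w - ?G p w) + cmod (?G p w - ?G p 1) + cmod (?G v 1 - ?G p 1)"
        by (rule tri)
      then show ?thesis using 1 2 e by (simp add: dist_norm)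
    qed
    then show "\<exists>d>0. \<forall>w. dist w 1 < d \<longrightarrow> dist (?G v w) (?G v 1) < e"
      using d \<eta> by (intro exI[of _ "min d (min \<eta> 1)"]) auto
  qed
qed

end

section \<open>Integration by parts\<close>

text \<open>Difference quotients integrate to 0 by translation invariance. The Lipschitz bound and
  the compact support make their convergence dominated.\<close>

lemma integral_derivative_zero:
  fixes h :: "complex \<Rightarrow> complex"
  assumes D: "\<And>x. (h has_derivative D x) (at x)" and B: "\<And>x v. norm (D x v) \<le> B * norm v"
    and R: "\<And>x. norm x > R \<Longrightarrow> h x = 0"
  shows "(\<integral>x. D x v \<partial>lborel) = 0"
proof -
  have cont: "continuous_on UNIV h"
    using D has_derivative_continuous by (intro continuous_at_imp_continuous_on) blast
  have [measurable]: "h \<in> borel_measurable borel" by (rule borel_measurable_continuous_onI[OF cont])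
  have "bounded (h ` cball 0 R)"
    by (intro compact_imp_bounded compact_continuous_image continuous_on_subset[OF cont]) auto
  then obtain C where C: "C > 0" "\<forall>x\<in>cball 0 R. norm (h x) \<le> C" by (auto simp: bounded_pos)
  have "norm (h x) \<le> C" for x
    using C R[of x] by (cases "norm x \<le> R") auto
  then have int: "integrable lborel h"
    using R by (intro integrable_bounded_support) auto
  have B0: "B \<ge> 0" using order_trans[OF norm_ge_zero B[of 0 1]] by simp
  have lip: "norm (h y - h x) \<le> B * norm (y - x)" for x y
  proof (rule differentiable_bound[of UNIV])
    show "onorm (D z) \<le> B" for z
      using B by (intro onorm_bound B0) auto
  qed (use D in auto)
  let ?q = "\<lambda>n x. of_nat (Suc n) * (h (x + v / of_nat (Suc n)) - h x)"
  have tr: "(\<integral>x. h (x + a) \<partial>lborel) = (\<integral>x. h x \<partial>lborel)" "integrable lborel (\<lambda>x. h (x + a))" for a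
  proof -
    have "(\<integral>x. h x \<partial>lborel) = (\<integral>x. h x \<partial>distr lborel borel ((+) a))" by (simp only: lborel_distr_plus)
    also have "\<dots> = (\<integral>x. h (a + x) \<partial>lborel)" by (rule integral_distr) auto
    finally show "(\<integral>x. h (x + a) \<partial>lborel) = (\<integral>x. h x \<partial>lborel)" by (simp add: add.commute)
    have "integrable (distr lborel borel ((+) a)) h" using int by (simp only: lborel_distr_plus)
    then have "integrable lborel (\<lambda>x. h (a + x))" by (subst (asm) integrable_distr_eq) auto
    then show "integrable lborel (\<lambda>x. h (x + a))" by (simp add: add.commute)
  qed
  have zero: "(\<integral>x. ?q n x \<partial>lborel) = 0" for n
    using int tr by (simp del: of_nat_Suc)
  have lim: "(\<lambda>n. ?q n x) \<longlonglongrightarrow> D x v" for x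
  proof -
    have lin: "linear (D x)" using D has_derivative_linear by blast
    have "((\<lambda>s. x + s *\<^sub>R v) has_derivative (\<lambda>s. s *\<^sub>R v)) (at 0)"
      by (auto intro!: derivative_eq_intros)
    moreover have "(h has_derivative D x) (at (x + 0 *\<^sub>R v))" using D[of x] by simp
    ultimately have d: "((\<lambda>s. h (x + s *\<^sub>R v)) has_derivative (\<lambda>s. D x (s *\<^sub>R v))) (at 0)"
      by (rule has_derivative_compose)
    \<comment> \<open>The parameter s is real while h is complex valued; real and imaginary parts
      reduce the limit of quotients to real functions of a real variable.\<close>
    have part: "((\<lambda>s. (f (h (x + s *\<^sub>R v)) - f (h (x + 0 *\<^sub>R v))) / (s - 0)) \<longlongrightarrow> f (D x v)) (at 0)"
      if f: "bounded_linear f" for f :: "complex \<Rightarrow> real"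
    proof -
      interpret f: bounded_linear f by fact
      have "((\<lambda>s. f (h (x + s *\<^sub>R v))) has_derivative (\<lambda>s. f (D x (s *\<^sub>R v)))) (at 0)"
        by (rule bounded_linear.has_derivative[OF f d])
      then have "((\<lambda>s. f (h (x + s *\<^sub>R v))) has_field_derivative f (D x v)) (at 0)"
        by (simp add: has_field_derivative_def linear_scale[OF lin] f.scaleR mult.commute[of _ "f (D x v)"])
      then show ?thesis by (simp add: has_field_derivative_iff)
    qed
    have "((\<lambda>s. Complex ((Re (h (x + s *\<^sub>R v)) - Re (h (x + 0 *\<^sub>R v))) / (s - 0))
        ((Im (h (x + s *\<^sub>R v)) - Im (h (x + 0 *\<^sub>R v))) / (s - 0))) \<longlongrightarrow> Complex (Re (D x v)) (Im (D x v))) (at 0)"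
      by (intro tendsto_Complex part bounded_linear_Re bounded_linear_Im)
    moreover have "Complex ((Re (h (x + s *\<^sub>R v)) - Re (h (x + 0 *\<^sub>R v))) / (s - 0))
        ((Im (h (x + s *\<^sub>R v)) - Im (h (x + 0 *\<^sub>R v))) / (s - 0)) = (h (x + s *\<^sub>R v) - h (x + 0 *\<^sub>R v)) /\<^sub>R (s - 0)" for s
      by (simp add: complex_eq_iff divide_inverse mult.commute)
    ultimately have "((\<lambda>s. (h (x + s *\<^sub>R v) - h (x + 0 *\<^sub>R v)) /\<^sub>R (s - 0)) \<longlongrightarrow> D x v) (at 0)"
      by simp
    moreover have "filterlim (\<lambda>n. 1 / real (Suc n)) (at 0) sequentially"
      by (intro filterlim_atI LIMSEQ_Suc[OF lim_1_over_n]) auto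
    ultimately have "(\<lambda>n. (h (x + (1 / real (Suc n)) *\<^sub>R v) - h (x + 0 *\<^sub>R v)) /\<^sub>R (1 / real (Suc n) - 0)) \<longlonglongrightarrow> D x v"
      by (rule filterlim_compose)
    then show ?thesis by (simp add: scaleR_conv_of_real divide_inverse mult.commute del: of_nat_Suc)
  qed
  have "(\<lambda>n. \<integral>x. ?q n x \<partial>lborel) \<longlonglongrightarrow> (\<integral>x. D x v \<partial>lborel)"
  proof (rule integral_dominated_convergence[where w = "\<lambda>x. B * norm v * indicator (cball 0 (R + norm v)) x"])
    show "(\<lambda>x. D x v) \<in> borel_measurable lborel"
      by (rule borel_measurable_LIMSEQ_metric[OF _ lim]) measurable
    show "integrable lborel (\<lambda>x. B * norm v * indicator (cball (0::complex) (R + norm v)) x)"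
      using emeasure_lborel_cball_finite[of "0::complex" "R + norm v"]
      by (intro integrable_mult_right integrable_real_indicator) auto
    show "AE x in lborel. norm (?q n x) \<le> B * norm v * indicator (cball 0 (R + norm v)) x" for n
    proof (rule AE_I2)
      fix x
      have nv: "norm (v / of_nat (Suc n)) = norm v / real (Suc n)" by (simp add: norm_divide del: of_nat_Suc)
      show "norm (?q n x) \<le> B * norm v * indicator (cball 0 (R + norm v)) x"
      proof (cases "x \<in> cball 0 (R + norm v)")
        case True
        have "norm (?q n x) \<le> real (Suc n) * (B * norm (x + v / of_nat (Suc n) - x))"
          unfolding norm_mult norm_of_nat by (intro mult_left_mono lip) auto
        also have "\<dots> = B * norm v" by (simp add: nv del: of_nat_Suc)
        finally show ?thesis using True by simp
      next
        case False
        have "norm v / real (Suc n) \<le> norm v / 1" by (intro divide_left_mono) auto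
        then have "R < norm (x + v / of_nat (Suc n))"
          using False norm_diff_ineq[of x "v / of_nat (Suc n)"] nv by simp
        moreover have "R < norm x" using False norm_ge_zero[of v] by (simp del: norm_ge_zero)
        ultimately show ?thesis using R False by simp
      qed
    qed
    show "AE x in lborel. (\<lambda>n. ?q n x) \<longlonglongrightarrow> D x v" by (rule AE_I2) (rule lim)
  qed measurable
  then show ?thesis unfolding zero using LIMSEQ_unique tendsto_const by metis
qed

text \<open>The function a lives on U only, but a \<theta> extends by zero to the plane; both of its
  partial derivatives have integral 0, and \<open>dbar\<close> combines them.\<close>

lemma integral_by_parts_dbar:
  fixes a \<theta> :: "complex \<Rightarrow> complex"
  assumes U: "open U" and K: "compact K" "K \<subseteq> U"
    and \<theta>: "smooth \<theta>" "\<And>x. x \<notin> K \<Longrightarrow> \<theta> x = 0"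
    and a: "\<And>x. x \<in> U \<Longrightarrow> (a has_derivative Da x) (at x)"
    and cont: "\<And>v. continuous_on U (\<lambda>x. Da x v)"
  shows "(\<integral>x. indicator K x *\<^sub>R ((Da x 1 + \<i> * Da x \<i>) / 2 * \<theta> x + a x * dbar \<theta> x) \<partial>lborel) = 0"
proof -
  define D where "D x v = indicator K x *\<^sub>R (Da x v * \<theta> x + a x * frechet_derivative \<theta> (at x) v)" for x v
  define h where "h x = (if x \<in> U then a x * \<theta> x else 0)" for x
  have \<theta>': "(\<theta> has_derivative frechet_derivative \<theta> (at x)) (at x)" for x by (rule smooth_has_derivative[OF \<theta>(1)])
  have out: "open (- K)" using K by (simp add: compact_imp_closed open_Compl)
  have zero: "(h has_derivative (\<lambda>_. 0)) (at x)" if "x \<notin> K" for x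
    by (rule has_derivative_transform_within_open[OF has_derivative_const[of 0] out]) (use that \<theta>(2) in \<open>auto simp: h_def\<close>)
  have inside: "(h has_derivative (\<lambda>v. a x * frechet_derivative \<theta> (at x) v + Da x v * \<theta> x)) (at x)" if "x \<in> U" for x
    by (rule has_derivative_transform_within_open[OF has_derivative_mult[OF a[OF that] \<theta>'] U that]) (simp add: h_def)
  have hD: "(h has_derivative D x) (at x)" for x
  proof (cases "x \<in> K")
    case True
    then have "D x = (\<lambda>v. a x * frechet_derivative \<theta> (at x) v + Da x v * \<theta> x)" by (auto simp: D_def)
    then show ?thesis using inside True K(2) by auto
  next
    case False
    then have "D x = (\<lambda>v. 0)" by (auto simp: D_def)
    then show ?thesis using zero[OF False] by simp
  qed
  have acont: "continuous_on U a"
    using a has_derivative_continuous by (intro continuous_at_imp_continuous_on) blast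
  have Dcont: "continuous_on K (\<lambda>x. Da x v * \<theta> x + a x * frechet_derivative \<theta> (at x) v)" for v
    using continuous_on_subset[OF cont K(2)] continuous_on_subset[OF acont K(2)]
    by (intro continuous_on_add continuous_on_mult smooth_continuous_on[OF \<theta>(1)]
        smooth_continuous_on[OF smooth_frechet_derivative[OF \<theta>(1)]])
  have "\<exists>B\<ge>0. \<forall>x. norm (D x v) \<le> B" for v
  proof -
    have "bounded ((\<lambda>x. Da x v * \<theta> x + a x * frechet_derivative \<theta> (at x) v) ` K)"
      by (intro compact_imp_bounded compact_continuous_image Dcont K)
    then obtain B where "B > 0" "\<forall>x\<in>K. norm (Da x v * \<theta> x + a x * frechet_derivative \<theta> (at x) v) \<le> B"
      by (auto simp: bounded_pos)
    then show ?thesis by (intro exI[of _ B]) (auto simp: D_def indicator_def)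
  qed
  then obtain B where B: "\<And>v. B v \<ge> 0" "\<And>v x. norm (D x v) \<le> B v" by metis
  have Db: "norm (D x v) \<le> (B 1 + B \<i>) * norm v" for x v
  proof -
    have lin: "linear (D x)" using hD has_derivative_linear by blast
    have "D x v = D x (Re v *\<^sub>R 1 + Im v *\<^sub>R \<i>)" by (rule arg_cong[where f = "D x"]) (simp add: complex_eq_iff)
    also have "\<dots> = Re v *\<^sub>R D x 1 + Im v *\<^sub>R D x \<i>" by (simp only: linear_add[OF lin] linear_scale[OF lin])
    also have "norm \<dots> \<le> \<bar>Re v\<bar> * norm (D x 1) + \<bar>Im v\<bar> * norm (D x \<i>)"
      by (rule order_trans[OF norm_triangle_ineq]) simp
    also have "\<dots> \<le> norm v * B 1 + norm v * B \<i>"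
      using B abs_Re_le_cmod abs_Im_le_cmod by (intro add_mono mult_mono) auto
    finally show ?thesis by (simp add: algebra_simps)
  qed
  obtain R where R: "K \<subseteq> ball 0 R" using bounded_subset_ballD[OF compact_imp_bounded[OF K(1)], of 0] by auto
  have hR: "h x = 0" if "norm x > R" for x
  proof -
    have "x \<notin> K" using R that by auto
    then show ?thesis using \<theta>(2) by (simp add: h_def)
  qed
  have z: "(\<integral>x. D x v \<partial>lborel) = 0" for v
    by (rule integral_derivative_zero[OF hD Db hR])
  have Dm: "(\<lambda>x. D x v) \<in> borel_measurable borel" for v
    unfolding D_def by (intro borel_measurable_continuous_on_indicator Dcont) (simp add: borel_compact K)
  have Di: "integrable lborel (\<lambda>x. D x v)" for v
  proof (rule integrable_bounded_support[OF Dm B(2)])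
    show "D x v = 0" if "norm x > R" for x using that R by (auto simp: D_def indicator_def)
  qed
  have "(\<integral>x. indicator K x *\<^sub>R ((Da x 1 + \<i> * Da x \<i>) / 2 * \<theta> x + a x * dbar \<theta> x) \<partial>lborel)
      = (\<integral>x. (D x 1 + \<i> * D x \<i>) / 2 \<partial>lborel)"
    by (intro Bochner_Integration.integral_cong refl)
      (simp add: D_def dbar_def scaleR_conv_of_real field_simps)
  also have "\<dots> = ((\<integral>x. D x 1 \<partial>lborel) + \<i> * (\<integral>x. D x \<i> \<partial>lborel)) / 2"
    using Di by (simp add: Bochner_Integration.integral_add)
  finally show ?thesis by (simp add: z)
qed

text \<open>The combination annihilates the complex linear part of D; on the antilinear part c acts
  through \<open>cnj c\<close>. This is the chain rule for \<open>dbar\<close> along a linear inner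
  map.\<close>

lemma real_linear_wirtinger:
  fixes D :: "complex \<Rightarrow> complex"
  assumes "linear D" shows "D c + \<i> * D (\<i> * c) = cnj c * (D 1 + \<i> * D \<i>)"
proof -
  have e: "D v = of_real (Re v) * D 1 + of_real (Im v) * D \<i>" for v
  proof -
    have "D v = D (Re v *\<^sub>R 1 + Im v *\<^sub>R \<i>)" by (rule arg_cong[where f = D]) (simp add: complex_eq_iff)
    also have "\<dots> = Re v *\<^sub>R D 1 + Im v *\<^sub>R D \<i>" by (simp only: linear_add[OF assms] linear_scale[OF assms])
    finally show ?thesis by (simp add: scaleR_conv_of_real)
  qed
  show ?thesis
    by (subst e[of c], subst e[of "\<i> * c"]) (simp add: complex_eq_iff algebra_simps)
qed

lemma smooth_direction_expansion:
  fixes p :: "complex ^ 'n::finite \<Rightarrow> complex"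
  assumes "smooth p"
  shows "frechet_derivative p (at y) v =
    (\<Sum>l\<in>UNIV. of_real (Re (v $ l)) * frechet_derivative p (at y) (axis l 1) +
      of_real (Im (v $ l)) * frechet_derivative p (at y) (axis l \<i>))"
proof -
  let ?D = "frechet_derivative p (at y)"
  have lin: "linear ?D" using smooth_has_derivative[OF assms] has_derivative_linear by blast
  have ax: "axis l c = Re c *\<^sub>R axis l 1 + Im c *\<^sub>R (axis l \<i> :: complex ^ 'n)" for l c
    by (simp add: vec_eq_iff axis_def complex_eq_iff)
  have "?D v = ?D (\<Sum>l\<in>UNIV. axis l (v $ l))" by (subst vec_as_axis_sum[of v]) simp
  also have "\<dots> = (\<Sum>l\<in>UNIV. ?D (axis l (v $ l)))" by (rule linear_sum[OF lin])
  also have "\<dots> = (\<Sum>l\<in>UNIV. Re (v $ l) *\<^sub>R ?D (axis l 1) + Im (v $ l) *\<^sub>R ?D (axis l \<i>))"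
    by (intro sum.cong refl, subst ax) (simp only: linear_add[OF lin] linear_scale[OF lin])
  finally show ?thesis by (simp add: scaleR_conv_of_real)
qed

text \<open>The chain rule for the conjugate derivative of p along a holomorphic direction v: only
  the conjugate partials of p enter.\<close>

lemma smooth_wirtinger_expansion:
  fixes p :: "complex ^ 'n::finite \<Rightarrow> complex"
  assumes "smooth p"
  shows "(frechet_derivative p (at y) v + \<i> * frechet_derivative p (at y) (\<i> *s v)) / 2 =
    (\<Sum>l\<in>UNIV. wirtinger_bar l p y * cnj (v $ l))"
  unfolding smooth_direction_expansion[OF assms, of _ v] smooth_direction_expansion[OF assms, of _ "\<i> *s v"]
    sum_distrib_left sum.distrib[symmetric] sum_divide_distrib wirtinger_bar_def
  by (intro sum.cong refl) (simp add: complex_eq_iff algebra_simps add_divide_distrib diff_divide_distrib)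

text \<open>The common form of two integrations by parts on a curve, once in the chart coordinate
  and once in w. Since y and m are holomorphic, the conjugate derivatives of \<open>p (y x)\<close>
  and \<open>cnj (m x)\<close> involve only conjugates of y' and m'.\<close>

lemma integral_by_parts_holomorphic:
  fixes p :: "complex ^ 'n::finite \<Rightarrow> complex" and y y' :: "complex \<Rightarrow> complex ^ 'n"
  assumes U: "open U" and K: "compact K" "K \<subseteq> U"
    and \<theta>: "smooth \<theta>" "\<And>x. x \<notin> K \<Longrightarrow> \<theta> x = 0" and p: "smooth p"
    and y: "\<And>x. x \<in> U \<Longrightarrow> (y has_derivative (\<lambda>v. v *s y' x)) (at x)"
    and m: "\<And>x. x \<in> U \<Longrightarrow> (m has_derivative (\<lambda>v. v * m' x)) (at x)"
    and cont: "continuous_on U y'" "continuous_on U m'"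
  shows "(\<integral>x. indicator K x *\<^sub>R (((\<Sum>l\<in>UNIV. wirtinger_bar l p (y x) * cnj (y' x $ l)) * cnj (m x) +
      p (y x) * cnj (m' x)) * \<theta> x + p (y x) * cnj (m x) * dbar \<theta> x) \<partial>lborel) = 0"
proof -
  let ?Da = "\<lambda>x v. p (y x) * cnj (v * m' x) + frechet_derivative p (at (y x)) (v *s y' x) * cnj (m x)"
  have a: "((\<lambda>x. p (y x) * cnj (m x)) has_derivative ?Da x) (at x)" if x: "x \<in> U" for x
  proof (rule has_derivative_mult)
    show "((\<lambda>x. p (y x)) has_derivative (\<lambda>v. frechet_derivative p (at (y x)) (v *s y' x))) (at x)"
      by (rule has_derivative_compose[OF y[OF x] smooth_has_derivative[OF p]])
    show "((\<lambda>x. cnj (m x)) has_derivative (\<lambda>v. cnj (v * m' x))) (at x)"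
      by (rule bounded_linear.has_derivative[OF bounded_linear_cnj m[OF x]])
  qed
  have yc: "continuous_on U y" and mc: "continuous_on U m"
    using y m has_derivative_continuous by (blast intro: continuous_at_imp_continuous_on)+
  have pc: "continuous_on U (\<lambda>x. p (y x))"
    by (rule continuous_on_compose2[OF smooth_continuous_on[OF p, of UNIV] yc]) simp
  have fc: "continuous_on U (\<lambda>x. frechet_derivative p (at (y x)) b)" for b
    by (rule continuous_on_compose2[OF smooth_continuous_on[OF smooth_frechet_derivative[OF p], of UNIV] yc]) simp
  have "continuous_on U (\<lambda>x. ?Da x v)" for v
    by (subst smooth_direction_expansion[OF p]) (simp, intro continuous_intros cont mc pc fc)
  from integral_by_parts_dbar[OF U K \<theta> a this]
  have "(\<integral>x. indicator K x *\<^sub>R ((?Da x 1 + \<i> * ?Da x \<i>) / 2 * \<theta> x + p (y x) * cnj (m x) * dbar \<theta> x) \<partial>lborel) = 0" .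
  moreover have "(?Da x 1 + \<i> * ?Da x \<i>) / 2 =
      (\<Sum>l\<in>UNIV. wirtinger_bar l p (y x) * cnj (y' x $ l)) * cnj (m x) + p (y x) * cnj (m' x)" for x
    unfolding smooth_wirtinger_expansion[OF p, symmetric]
    by (simp add: field_simps)
  ultimately show ?thesis by (simp only:)
qed

lemma dbar_outside_support:
  assumes "closed W" "\<And>w. w \<notin> W \<Longrightarrow> \<theta> w = 0" "w \<notin> W"
  shows "dbar \<theta> w = 0"
proof -
  have "(\<theta> has_derivative (\<lambda>_. 0)) (at w)"
    by (rule has_derivative_transform_within_open[OF has_derivative_const[of 0] open_Compl[OF assms(1)]])
      (use assms in auto)
  from dbar_eqI[OF this] show ?thesis by simp
qed

section \<open>The mixed closedness equation\<close>

locale test_piece = chart_piece \<beta> M I V \<Phi> K u F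
  for \<beta> :: "'n::finite \<Rightarrow> nat" and M I V \<Phi> K u F +
  fixes f :: "'n \<Rightarrow> complex ^ 'n \<Rightarrow> complex" and \<phi> :: "complex ^ 'n \<Rightarrow> complex"
  assumes \<beta>_pos: "\<And>k. \<beta> k \<ge> 1"
    and \<phi>_smooth: "smooth \<phi>" and \<phi>_supp: "\<And>t. t \<in> coord_subspace I - K \<Longrightarrow> \<phi> t = 0"
    and u_eq: "\<And>k z. z \<in> M \<Longrightarrow> u k z = f k z"
    and closed_form: "dbar_closed_on M f"
begin

definition \<phi>\<^sub>0 :: "complex ^ 'n \<Rightarrow> complex" where
  "\<phi>\<^sub>0 t = indicator K t *\<^sub>R \<phi> t"

definition d\<phi> :: "'n \<Rightarrow> complex ^ 'n \<Rightarrow> complex" where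
  "d\<phi> j t = indicator K t *\<^sub>R wirtinger_bar j \<phi> t"

lemma wirtinger_smooth: "smooth (wirtinger_bar j \<phi>)"
proof -
  have "smooth (\<lambda>x. (frechet_derivative \<phi> (at x) (axis j 1) + \<i> * frechet_derivative \<phi> (at x) (axis j \<i>)) * (1 / 2))"
    by (intro smooth_mult smooth_add smooth_const smooth_frechet_derivative \<phi>_smooth)
  then show ?thesis by (simp add: wirtinger_bar_def[abs_def])
qed

lemma cut_meas_bounded:
  assumes "smooth h"
  shows "(\<lambda>t. indicator K t *\<^sub>R h t) \<in> borel_measurable borel" "\<exists>C\<ge>0. \<forall>t. cmod (indicator K t *\<^sub>R h t) \<le> C"
proof -
  show "(\<lambda>t. indicator K t *\<^sub>R h t) \<in> borel_measurable borel"
    by (intro borel_measurable_continuous_on_indicator smooth_continuous_on assms K_sets)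
  have "bounded (h ` K)"
    by (intro compact_imp_bounded compact_continuous_image smooth_continuous_on assms K)
  then obtain C where "C > 0" "\<forall>t\<in>K. norm (h t) \<le> C" by (auto simp: bounded_pos)
  then show "\<exists>C\<ge>0. \<forall>t. cmod (indicator K t *\<^sub>R h t) \<le> C"
    by (intro exI[of _ C]) (auto simp: indicator_def)
qed

lemma \<phi>0_meas [measurable]: "\<phi>\<^sub>0 \<in> borel_measurable borel" and d\<phi>_meas [measurable]: "d\<phi> j \<in> borel_measurable borel"
  unfolding \<phi>\<^sub>0_def[abs_def] d\<phi>_def[abs_def] by (intro cut_meas_bounded \<phi>_smooth wirtinger_smooth)+

lemma \<phi>0_bounded: "\<exists>C\<ge>0. \<forall>t. cmod (\<phi>\<^sub>0 t) \<le> C" and d\<phi>_bounded: "\<exists>C\<ge>0. \<forall>t. cmod (d\<phi> j t) \<le> C"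
  unfolding \<phi>\<^sub>0_def d\<phi>_def by (intro cut_meas_bounded \<phi>_smooth wirtinger_smooth)+

lemma \<phi>0_outside: "t \<notin> K \<Longrightarrow> \<phi>\<^sub>0 t = 0" and d\<phi>_outside: "t \<notin> K \<Longrightarrow> d\<phi> j t = 0"
  by (simp_all add: \<phi>\<^sub>0_def d\<phi>_def)

lemma axis_in_coord_subspace:
  "j \<in> I \<Longrightarrow> t \<in> coord_subspace I \<Longrightarrow> t + axis j c \<in> coord_subspace I"
  by (auto simp: coord_subspace_def axis_def)

text \<open>The test function vanishes off K only within the coordinate subspace, so its derivatives
  in transversal directions are uncontrolled. For j in I the j-th slice stays in the
  subspace.\<close>

lemma wirtinger_outside:
  assumes "j \<in> I" "t \<in> coord_subspace I - K" shows "wirtinger_bar j \<phi> t = 0"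
proof -
  let ?D = "frechet_derivative \<phi> (at t)"
  have "frechet_derivative \<phi> (at t) (axis j c) = 0" for c
  proof -
    have ax: "((\<lambda>s. t + axis j s) has_derivative axis j) (at 0)"
      using bounded_linear_imp_has_derivative[OF bounded_linear_axis] by (auto intro!: derivative_eq_intros)
    have D: "(\<phi> has_derivative ?D) (at (t + axis j 0))"
      using smooth_has_derivative[OF \<phi>_smooth] by (simp add: axis_zero)
    have comp: "((\<lambda>s. \<phi> (t + axis j s)) has_derivative (\<lambda>s. ?D (axis j s))) (at 0)"
      by (rule has_derivative_compose[OF ax D])
    let ?U = "{s. t + axis j s \<in> - K}"
    have "open ?U"
    proof -
      have "continuous_on UNIV (\<lambda>s. t + axis j s)"
        by (intro continuous_on_add continuous_on_const linear_continuous_on bounded_linear_axis)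
      moreover have "open (- K)" using K(1) by (simp add: compact_imp_closed open_Compl)
      ultimately have "open ((\<lambda>s. t + axis j s) -` (- K))" by (simp add: open_vimage)
      then show ?thesis by (simp add: vimage_def)
    qed
    moreover have "0 \<in> ?U" using assms(2) by (simp add: axis_zero)
    moreover have "\<phi> (t + axis j s) = 0" if "s \<in> ?U" for s
      using that assms axis_in_coord_subspace[of j t s] by (intro \<phi>_supp) auto
    ultimately have "((\<lambda>_. 0) has_derivative (\<lambda>s. ?D (axis j s))) (at (0::complex))"
      by (intro has_derivative_transform_within_open[OF comp]) auto
    from has_derivative_unique[OF this has_derivative_const[of 0]] show ?thesis by meson
  qed
  then show ?thesis by (simp add: wirtinger_bar_def)
qed

lemma d\<phi>_eq: "j \<in> I \<Longrightarrow> t \<in> coord_subspace I \<Longrightarrow> d\<phi> j t = wirtinger_bar j \<phi> t"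
  using wirtinger_outside[of j t] by (cases "t \<in> K") (auto simp: d\<phi>_def)

lemma \<phi>0_eq: "t \<in> coord_subspace I \<Longrightarrow> \<phi>\<^sub>0 t = \<phi> t"
  using \<phi>_supp[of t] by (cases "t \<in> K") (auto simp: \<phi>\<^sub>0_def)

text \<open>Leibniz rule for the test function in a twisted chart. The additional factor
  \<open>cnj c\<close> is the same as in the twisted pull-back, which makes the two
  comparable.\<close>

lemma twisted_wirtinger:
  assumes \<theta>: "smooth \<theta>"
  shows "wirtinger_bar j (\<lambda>t. \<phi> t * \<theta> (w0 + c * t $ l)) t =
    wirtinger_bar j \<phi> t * \<theta> (w0 + c * t $ l) +
    (if j = l then \<phi> t * (cnj c * dbar \<theta> (w0 + c * t $ l)) else 0)"
proof -
  let ?w = "w0 + c * t $ l" and ?D\<phi> = "frechet_derivative \<phi> (at t)"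
  let ?D\<theta> = "frechet_derivative \<theta> (at ?w)"
  have "((\<lambda>t. t $ l) has_derivative (\<lambda>h. h $ l)) (at t)"
    by (rule bounded_linear_imp_has_derivative[OF bounded_linear_vec_nth])
  then have "((\<lambda>t. w0 + c * t $ l) has_derivative (\<lambda>h. c * h $ l)) (at t)"
    by (auto intro!: derivative_eq_intros)
  from has_derivative_compose[OF this smooth_has_derivative[OF \<theta>]]
  have "((\<lambda>t. \<theta> (w0 + c * t $ l)) has_derivative (\<lambda>h. ?D\<theta> (c * h $ l))) (at t)" .
  from has_derivative_mult[OF smooth_has_derivative[OF \<phi>_smooth] this]
  have "((\<lambda>t. \<phi> t * \<theta> (w0 + c * t $ l)) has_derivative (\<lambda>h. \<phi> t * ?D\<theta> (c * h $ l) + ?D\<phi> h * \<theta> ?w)) (at t)" .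
  from frechet_derivative_at[OF this, symmetric]
  have fd: "frechet_derivative (\<lambda>t. \<phi> t * \<theta> (w0 + c * t $ l)) (at t) = (\<lambda>h. \<phi> t * ?D\<theta> (c * h $ l) + ?D\<phi> h * \<theta> ?w)" .
  have lin: "linear ?D\<theta>" using smooth_has_derivative[OF \<theta>] has_derivative_linear by blast
  show ?thesis
  proof (cases "j = l")
    case True
    have "(\<phi> t * ?D\<theta> c + ?D\<phi> (axis l 1) * \<theta> ?w + \<i> * (\<phi> t * ?D\<theta> (\<i> * c) + ?D\<phi> (axis l \<i>) * \<theta> ?w)) / 2 =
       (?D\<phi> (axis l 1) + \<i> * ?D\<phi> (axis l \<i>)) / 2 * \<theta> ?w + \<phi> t * ((?D\<theta> c + \<i> * ?D\<theta> (\<i> * c)) / 2)"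
      by (simp add: field_simps)
    also have "(?D\<theta> c + \<i> * ?D\<theta> (\<i> * c)) / 2 = cnj c * dbar \<theta> ?w"
      unfolding real_linear_wirtinger[OF lin] by (simp add: dbar_def)
    finally show ?thesis using True unfolding wirtinger_bar_def fd by (simp add: mult.commute[of c])
  next
    case False
    then show ?thesis unfolding wirtinger_bar_def fd
      by (simp add: axis_def linear_0[OF lin] algebra_simps)
  qed
qed

text \<open>The orbit coefficient a enters with factor \<open>cnj c\<close>, and only in the
  direction l.\<close>

lemma twisted_pullback:
  assumes t: "t \<in> K" and w: "w0 + c * t $ l \<noteq> 0"
  shows "pullback_coeff (\<lambda>t. weighted_action \<beta> (w0 + c * t $ l) (\<Phi> t)) f j t =
    coeff_t j t (w0 + c * t $ l) + (if j = l then cnj c * coeff_w t (w0 + c * t $ l) else 0)"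
proof -
  let ?w = "w0 + c * t $ l"
  have tV: "t \<in> V" using t K_sub by auto
  have M: "weighted_action \<beta> ?w (\<Phi> t) \<in> M" using inv[OF w] \<Phi>_in_M[OF t] by simp
  have "pullback_coeff (\<lambda>t. weighted_action \<beta> (w0 + c * t $ l) (\<Phi> t)) f j t =
    (\<Sum>k\<in>UNIV. u k (weighted_action \<beta> ?w (\<Phi> t)) * cnj (?w ^ \<beta> k * frechet_derivative \<Phi> (at t) (axis j 1) $ k +
      (if j = l then c * (of_nat (\<beta> k) * ?w ^ (\<beta> k - 1) * \<Phi> t $ k) else 0)))"
    unfolding pullback_coeff_def twisted_chart_partial[OF \<Phi>_hol tV] using u_eq[OF M] by simp
  also have "\<dots> = coeff_t j t ?w + (if j = l then cnj c * coeff_w t ?w else 0)"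
    unfolding coeff_t_def coeff_w_def \<Phi>0_eq[OF t] D0_eq[OF t]
    by (cases "j = l") (simp_all add: sum_distrib_left sum.distrib[symmetric] algebra_simps)
  finally show ?thesis .
qed

section \<open>Dimension at least two: closedness in twisted charts\<close>

lemma product_bound:
  fixes h1 :: "complex ^ 'n \<Rightarrow> complex \<Rightarrow> complex"
  assumes [measurable]: "case_prod h1 \<in> borel_measurable (borel \<Otimes>\<^sub>M borel)" "h2 \<in> borel_measurable borel" "h3 \<in> borel_measurable borel"
    and b1: "\<exists>C\<ge>0. \<forall>t w. cmod w \<le> R \<longrightarrow> cmod (h1 t w) \<le> C" and b2: "\<exists>C\<ge>0. \<forall>t. cmod (h2 t) \<le> C" and b3: "\<exists>C\<ge>0. \<forall>w. cmod (h3 w) \<le> C"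
    and s2: "\<And>t. t \<notin> K \<Longrightarrow> h2 t = 0" and s3: "\<And>w. cmod w > R \<Longrightarrow> h3 w = 0"
  shows "integrable (\<mu> \<Otimes>\<^sub>M lborel) (\<lambda>(t, w). h1 t w * h2 t * h3 w)"
    "(\<lambda>(t, w). h1 t w * h2 t * h3 w) \<in> borel_measurable (borel \<Otimes>\<^sub>M borel)"
proof -
  show m: "(\<lambda>(t, w). h1 t w * h2 t * h3 w) \<in> borel_measurable (borel \<Otimes>\<^sub>M borel)"
    by (simp add: split_beta')
  obtain C1 C2 C3 where C: "C1 \<ge> 0" "C2 \<ge> 0" "C3 \<ge> 0" "\<And>t w. cmod w \<le> R \<Longrightarrow> cmod (h1 t w) \<le> C1"
    "\<And>t. cmod (h2 t) \<le> C2" "\<And>w. cmod (h3 w) \<le> C3"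
    using b1 b2 b3 by metis
  have m': "(\<lambda>(t, w). h1 t w * h2 t * h3 w) \<in> borel_measurable (\<mu> \<Otimes>\<^sub>M lborel)"
    using m by (subst measurable_cong_sets[OF sets_pair_measure_cong[OF sets_coord_lebesgue sets_lborel] refl])
  show "integrable (\<mu> \<Otimes>\<^sub>M lborel) (\<lambda>(t, w). h1 t w * h2 t * h3 w)"
  proof (rule integrable_on_product[OF m'])
    show "cmod (case (t, w) of (t, w) \<Rightarrow> h1 t w * h2 t * h3 w) \<le> C1 * C2 * C3" if "t \<in> K" "cmod w \<le> R" for t w
      unfolding prod.case norm_mult using C that by (intro mult_mono mult_nonneg_nonneg) auto
  qed (use s2 s3 in auto)
qed

lemma smooth_bounded_support:
  assumes "smooth \<theta>" "compact W" "\<And>w. w \<notin> W \<Longrightarrow> \<theta> w = (0::complex)"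
  shows "\<exists>C\<ge>0. \<forall>w :: complex. cmod (\<theta> w) \<le> C"
proof -
  have "bounded (\<theta> ` W)" by (intro compact_imp_bounded compact_continuous_image smooth_continuous_on assms)
  then obtain C where C: "C > 0" "\<forall>w\<in>W. cmod (\<theta> w) \<le> C" by (auto simp: bounded_pos)
  have "cmod (\<theta> w) \<le> C" for w using C assms(3)[of w] by (cases "w \<in> W") auto
  then show ?thesis using C(1) by (intro exI[of _ C]) auto
qed

text \<open>The closedness relation for the pair (i, l) is tested with
  \<open>\<phi> t * \<theta> (w0 + c * t $ l)\<close>. After integration over w0 both sides are
  exactly affine in \<open>cnj c\<close>, so the two values c = 0 and c = c0 isolate the linear
  coefficients; no limit is taken.\<close>

lemma mixed_equation_several:
  assumes il: "i \<in> I" "l \<in> I" "i \<noteq> l"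
    and \<theta>: "smooth \<theta>" and W: "compact W" "0 \<notin> W" and \<theta>0: "\<And>w. w \<notin> W \<Longrightarrow> \<theta> w = 0"
  shows "(\<integral>w. \<integral>t. coeff_w t w * d\<phi> i t * \<theta> w \<partial>\<mu> \<partial>lborel) = (\<integral>w. \<integral>t. coeff_t i t w * \<phi>\<^sub>0 t * dbar \<theta> w \<partial>\<mu> \<partial>lborel)"
proof -
  obtain R where R: "W \<subseteq> ball 0 R" using bounded_subset_ballD[OF compact_imp_bounded[OF W(1)], of 0] by auto
  have d\<theta>0: "dbar \<theta> w = 0" if "w \<notin> W" for w
    by (rule dbar_outside_support[OF compact_imp_closed[OF W(1)] \<theta>0 that])
  have \<theta>b: "\<exists>C\<ge>0. \<forall>w. cmod (\<theta> w) \<le> C" "\<exists>C\<ge>0. \<forall>w. cmod (dbar \<theta> w) \<le> C"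
    using smooth_bounded_support[OF \<theta> W(1) \<theta>0] smooth_bounded_support[OF smooth_dbar[OF \<theta>] W(1) d\<theta>0] by auto
  have \<theta>R: "\<theta> w = 0" "dbar \<theta> w = 0" if "cmod w > R" for w
    using that R by (auto intro!: \<theta>0 d\<theta>0)
  have [measurable]: "\<theta> \<in> borel_measurable borel" "dbar \<theta> \<in> borel_measurable borel"
    using \<theta> by (auto intro!: borel_measurable_continuous_onI smooth_continuous_on smooth_dbar)
  have cm [measurable]: "case_prod coeff_w \<in> borel_measurable (borel \<Otimes>\<^sub>M borel)" "\<And>j. case_prod (coeff_t j) \<in> borel_measurable (borel \<Otimes>\<^sub>M borel)"
    by (simp_all add: split_beta')
  note int_w = product_bound[OF cm(1) _ _ coeff_w_bounded]
  note int_t = product_bound[OF cm(2) _ _ coeff_t_bounded]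
  obtain c0 where c0: "c0 > 0" "\<And>c w0. cmod c \<le> c0 \<Longrightarrow> \<exists>V'. V' \<subseteq> V \<and> {t \<in> K. w0 + c * t $ l \<in> W} \<subseteq> V' \<and>
      (\<forall>t\<in>V'. w0 + c * t $ l \<noteq> 0) \<and> biholomorphic_on V' (\<lambda>t. weighted_action \<beta> (w0 + c * t $ l) (\<Phi> t))"
    using twisted_chart_biholomorphic[OF bihol K(1) K_sub(1) W, of l \<beta>] by blast
  \<comment> \<open>The two sides of the closedness relation in the twisted chart, with the twist
    replaced by a free variable w.\<close>
  define H1 where "H1 c t w = coeff_t l t w * d\<phi> i t * \<theta> w + cnj c * (coeff_w t w * d\<phi> i t * \<theta> w)" for c t w
  define H2 where "H2 c t w = coeff_t i t w * d\<phi> l t * \<theta> w + cnj c * (coeff_t i t w * \<phi>\<^sub>0 t * dbar \<theta> w)" for c t w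
  have local: "(\<integral>t. H1 c t (w0 + c * t $ l) \<partial>\<mu>) = (\<integral>t. H2 c t (w0 + c * t $ l) \<partial>\<mu>)" if c: "cmod c \<le> c0" for c w0
  proof -
    let ?w = "\<lambda>t :: complex ^ 'n. w0 + c * t $ l"
    let ?\<Psi> = "\<lambda>t. weighted_action \<beta> (?w t) (\<Phi> t)" and ?\<psi> = "\<lambda>t. \<phi> t * \<theta> (?w t)"
    obtain V' where V': "V' \<subseteq> V" "{t \<in> K. ?w t \<in> W} \<subseteq> V'" "\<And>t. t \<in> V' \<Longrightarrow> ?w t \<noteq> 0" "biholomorphic_on V' ?\<Psi>"
      using c0(2)[OF c, of w0] by blast
    have chart': "submanifold_chart M I V' ?\<Psi>"
      by (rule twisted_submanifold_chart[OF chart inv V'(1,3,4)])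
    have bl: "bounded_linear (\<lambda>t :: complex ^ 'n. c * t $ l)"
      by (rule bounded_linear_compose[OF bounded_linear_mult_right bounded_linear_vec_nth])
    have sm: "smooth ?\<psi>" by (intro smooth_mult \<phi>_smooth smooth_affine[OF bl] \<theta>)
    \<comment> \<open>The factor \<theta> confines the support to points whose twist lies in W, and
      V' was built to contain exactly those points of K.\<close>
    have test: "test_function I V' ?\<psi>"
      unfolding test_function_def
    proof (intro conjI exI ballI)
      show "\<forall>m. times_cont_diff m ?\<psi>" using sm by (simp add: smooth_def)
      have "closed (?w -` W)"
        by (intro closed_vimage compact_imp_closed W continuous_intros)
      then have "compact (K \<inter> ?w -` W)" by (rule compact_Int_closed[OF K(1)])
      moreover have "K \<inter> ?w -` W = {t \<in> K. ?w t \<in> W}" by auto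
      ultimately show "compact {t \<in> K. ?w t \<in> W}" by simp
      show "{t \<in> K. ?w t \<in> W} \<subseteq> V' \<inter> coord_subspace I" using V'(2) K_sub by auto
      fix t assume "t \<in> coord_subspace I - {t \<in> K. ?w t \<in> W}"
      then show "?\<psi> t = 0" using \<phi>_supp[of t] \<theta>0[of "?w t"] by auto
    qed
    have eq: "chart_integral I V' (\<lambda>t. pullback_coeff ?\<Psi> f l t * wirtinger_bar i ?\<psi> t) =
        chart_integral I V' (\<lambda>t. pullback_coeff ?\<Psi> f i t * wirtinger_bar l ?\<psi> t)"
      using closed_form chart' test il unfolding dbar_closed_on_def by blast
    have "chart_integral I V' (\<lambda>t. pullback_coeff ?\<Psi> f l t * wirtinger_bar i ?\<psi> t) = (\<integral>t. H1 c t (?w t) \<partial>\<mu>)"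
      unfolding chart_integral_def set_lebesgue_integral_def
    proof (intro Bochner_Integration.integral_cong refl)
      fix t
      show "indicator (V' \<inter> coord_subspace I) t *\<^sub>R (pullback_coeff ?\<Psi> f l t * wirtinger_bar i ?\<psi> t) = H1 c t (?w t)"
      proof (cases "t \<in> K")
        case True
        then have tI: "t \<in> coord_subspace I" using K_sub by auto
        show ?thesis
        proof (cases "t \<in> V'")
          case tV: True
          have "pullback_coeff ?\<Psi> f l t = coeff_t l t (?w t) + cnj c * coeff_w t (?w t)"
            using twisted_pullback[OF True V'(3)[OF tV], of l] by simp
          moreover have "wirtinger_bar i ?\<psi> t = d\<phi> i t * \<theta> (?w t)"
            using twisted_wirtinger[OF \<theta>, of i w0 c l t] il d\<phi>_eq[OF il(1) tI] by simp
          ultimately show ?thesis using tI tV by (simp add: H1_def algebra_simps)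
        next
          case False
          then have "?w t \<notin> W" using True V'(2) by auto
          then show ?thesis using False \<theta>0 by (simp add: H1_def)
        qed
      next
        case False
        show ?thesis
        proof (cases "t \<in> coord_subspace I")
          case True
          have "wirtinger_bar i ?\<psi> t = 0"
            using twisted_wirtinger[OF \<theta>, of i w0 c l t] il wirtinger_outside[OF il(1), of t] True False by simp
          then show ?thesis using d\<phi>_outside[OF False] by (simp add: H1_def)
        qed (use d\<phi>_outside[OF False] in \<open>simp add: H1_def\<close>)
      qed
    qed
    moreover have "chart_integral I V' (\<lambda>t. pullback_coeff ?\<Psi> f i t * wirtinger_bar l ?\<psi> t) = (\<integral>t. H2 c t (?w t) \<partial>\<mu>)"
      unfolding chart_integral_def set_lebesgue_integral_def
    proof (intro Bochner_Integration.integral_cong refl)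
      fix t
      show "indicator (V' \<inter> coord_subspace I) t *\<^sub>R (pullback_coeff ?\<Psi> f i t * wirtinger_bar l ?\<psi> t) = H2 c t (?w t)"
      proof (cases "t \<in> K")
        case True
        then have tI: "t \<in> coord_subspace I" using K_sub by auto
        show ?thesis
        proof (cases "t \<in> V'")
          case tV: True
          have "pullback_coeff ?\<Psi> f i t = coeff_t i t (?w t)"
            using twisted_pullback[OF True V'(3)[OF tV], of i] il by simp
          moreover have "wirtinger_bar l ?\<psi> t = d\<phi> l t * \<theta> (?w t) + \<phi>\<^sub>0 t * (cnj c * dbar \<theta> (?w t))"
            using twisted_wirtinger[OF \<theta>, of l w0 c l t] d\<phi>_eq[OF il(2) tI] \<phi>0_eq[OF tI] by simp
          ultimately show ?thesis using tI tV by (simp add: H2_def algebra_simps)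
        next
          case False
          then have "?w t \<notin> W" using True V'(2) by auto
          then show ?thesis using False \<theta>0 d\<theta>0 by (simp add: H2_def)
        qed
      next
        case False
        show ?thesis
        proof (cases "t \<in> coord_subspace I")
          case True
          have "wirtinger_bar l ?\<psi> t = 0"
            using twisted_wirtinger[OF \<theta>, of l w0 c l t] wirtinger_outside[OF il(2), of t] \<phi>_supp[of t] True False by simp
          then show ?thesis using d\<phi>_outside[OF False] \<phi>0_outside[OF False] by (simp add: H2_def)
        qed (use d\<phi>_outside[OF False] \<phi>0_outside[OF False] in \<open>simp add: H2_def\<close>)
      qed
    qed
    ultimately show ?thesis using eq by simp
  qed
  let ?J = "\<lambda>h. \<integral>x. case_prod h x \<partial>(\<mu> \<Otimes>\<^sub>M lborel)"
  let ?a = "\<lambda>t w. coeff_w t w * d\<phi> i t * \<theta> w" and ?b = "\<lambda>t w. coeff_t i t w * \<phi>\<^sub>0 t * dbar \<theta> w"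
    and ?x = "\<lambda>t w. coeff_t l t w * d\<phi> i t * \<theta> w" and ?y = "\<lambda>t w. coeff_t i t w * d\<phi> l t * \<theta> w"
  have a: "integrable (\<mu> \<Otimes>\<^sub>M lborel) (case_prod ?a)" "case_prod ?a \<in> borel_measurable (borel \<Otimes>\<^sub>M borel)"
    by (rule int_w[OF _ _ d\<phi>_bounded \<theta>b(1) d\<phi>_outside \<theta>R(1)]; simp)+
  have b: "integrable (\<mu> \<Otimes>\<^sub>M lborel) (case_prod ?b)" "case_prod ?b \<in> borel_measurable (borel \<Otimes>\<^sub>M borel)"
    by (rule int_t[OF _ _ \<phi>0_bounded \<theta>b(2) \<phi>0_outside \<theta>R(2)]; simp)+
  have x: "integrable (\<mu> \<Otimes>\<^sub>M lborel) (case_prod ?x)" "case_prod ?x \<in> borel_measurable (borel \<Otimes>\<^sub>M borel)"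
    by (rule int_t[OF _ _ d\<phi>_bounded \<theta>b(1) d\<phi>_outside \<theta>R(1)]; simp)+
  have y: "integrable (\<mu> \<Otimes>\<^sub>M lborel) (case_prod ?y)" "case_prod ?y \<in> borel_measurable (borel \<Otimes>\<^sub>M borel)"
    by (rule int_t[OF _ _ d\<phi>_bounded \<theta>b(1) d\<phi>_outside \<theta>R(1)]; simp)+
  have J: "?J ?x + cnj c * ?J ?a = ?J ?y + cnj c * ?J ?b" if c: "cmod c \<le> c0" for c
  proof -
    have H1e: "case_prod (H1 c) = (\<lambda>z. case_prod ?x z + cnj c * case_prod ?a z)"
      and H2e: "case_prod (H2 c) = (\<lambda>z. case_prod ?y z + cnj c * case_prod ?b z)"
      by (auto simp: H1_def H2_def)
    have i1: "integrable (\<mu> \<Otimes>\<^sub>M lborel) (case_prod (H1 c))" and i2: "integrable (\<mu> \<Otimes>\<^sub>M lborel) (case_prod (H2 c))"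
      unfolding H1e H2e by (intro Bochner_Integration.integrable_add integrable_mult_right a b x y)+
    have m1: "case_prod (H1 c) \<in> borel_measurable (borel \<Otimes>\<^sub>M borel)" and m2: "case_prod (H2 c) \<in> borel_measurable (borel \<Otimes>\<^sub>M borel)"
      unfolding H1e H2e by (intro borel_measurable_add borel_measurable_times borel_measurable_const a b x y)+
    have g: "(\<lambda>t :: complex ^ 'n. c * t $ l) \<in> borel_measurable borel" by measurable
    \<comment> \<open>The outer variable plays the role of w0: both integrals are shifted to the
      twisted argument, where the inner integrals agree for every w0.\<close>
    have "(\<integral>w. \<integral>t. H1 c t w \<partial>\<mu> \<partial>lborel) = (\<integral>w. \<integral>t. H2 c t w \<partial>\<mu> \<partial>lborel)"
      unfolding integral_shift[OF m1 i1 g, symmetric] integral_shift[OF m2 i2 g, symmetric]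
      by (intro Bochner_Integration.integral_cong refl local c)
    then have "?J (H1 c) = ?J (H2 c)"
      using pair.integral_snd[OF i1] pair.integral_snd[OF i2] by simp
    then show ?thesis unfolding H1e H2e
      by (simp only: Bochner_Integration.integral_add[OF x(1) integrable_mult_right[OF a(1)]]
          Bochner_Integration.integral_add[OF y(1) integrable_mult_right[OF b(1)]] integral_mult_right_zero)
  qed
  \<comment> \<open>At c = 0 the constant terms agree; they cancel at c = c0, where division by c0
    leaves the mixed equation.\<close>
  have "?J ?x = ?J ?y" using J[of 0] c0 by simp
  moreover have "?J ?x + cnj (of_real c0) * ?J ?a = ?J ?y + cnj (of_real c0) * ?J ?b" using c0 by (intro J) simp
  ultimately have "?J ?a = ?J ?b" using c0 by simp
  then show ?thesis using pair.integral_snd[OF a(1)] pair.integral_snd[OF b(1)] by simp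
qed

end

section \<open>Curves: polynomial coefficients\<close>

context test_piece
begin

text \<open>The orbit through \<Phi> t stays in M, so the inverse chart maps it into a single
  coordinate axis and its velocity there is a multiple of that axis. The derivative of \<Phi>
  carries this back; \<rho> is the coordinate of the orbit velocity.\<close>

lemma orbit_tangent:
  assumes I: "I = {i}" and t: "t \<in> K"
  obtains \<rho> where "\<And>k. of_nat (\<beta> k) * \<Phi> t $ k = \<rho> * frechet_derivative \<Phi> (at t) (axis i 1) $ k"
proof -
  let ?g = "the_inv_into V \<Phi>" and ?z = "\<Phi> t"
  \<comment> \<open>The Euler field of the weighted action: the velocity of the orbit at w =
    1.\<close>
  define E where "E = (\<chi> k. of_nat (\<beta> k) * ?z $ k)"
  have tV: "t \<in> V" using t K_sub by auto
  have opn: "open (\<Phi> ` V)" and ghol: "holomorphic_map_on (\<Phi> ` V) ?g"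
    using bihol by (auto simp: biholomorphic_on_def)
  define g' where "g' = frechet_derivative ?g (at ?z)"
  have zV: "?z \<in> \<Phi> ` V" using tV by auto
  have g': "(?g has_derivative g') (at ?z)" unfolding g'_def by (rule holomorphic_map_onD(1)[OF ghol zV])
  let ?c = "\<lambda>\<zeta>. weighted_action \<beta> (1 + \<zeta>) ?z"
  have c': "(?c has_derivative (\<lambda>v. v *s E)) (at 0)"
  proof (rule has_derivative_vecI)
    fix k
    have "((\<lambda>\<zeta>. (1 + \<zeta>) ^ \<beta> k * ?z $ k) has_field_derivative of_nat (\<beta> k) * ?z $ k) (at 0)"
      by (auto intro!: derivative_eq_intros)
    then show "((\<lambda>\<zeta>. ?c \<zeta> $ k) has_derivative (\<lambda>v. (v *s E) $ k)) (at 0)"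
      unfolding weighted_action_nth has_field_derivative_def
      by (rule has_derivative_eq_rhs) (simp add: E_def fun_eq_iff)
  qed
  have gc: "((\<lambda>\<zeta>. ?g (?c \<zeta>)) has_derivative (\<lambda>v. g' (v *s E))) (at 0)"
    by (rule has_derivative_compose[OF c']) (use g' in simp)
  \<comment> \<open>M is known to be invariant only under nonzero parameters, hence the condition on
    \<open>1 + \<zeta>\<close>.\<close>
  let ?U = "{\<zeta>. ?c \<zeta> \<in> \<Phi> ` V} \<inter> {\<zeta>. 1 + \<zeta> \<noteq> 0}"
  have U: "open ?U" "0 \<in> ?U"
  proof -
    have "open (?c -` (\<Phi> ` V))" by (intro open_vimage opn continuous_intros)
    moreover have "open {\<zeta> :: complex. 1 + \<zeta> \<noteq> 0}" by (intro open_Collect_neq continuous_intros)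
    ultimately show "open ?U" by (simp add: vimage_def open_Int)
    show "0 \<in> ?U" using zV by simp
  qed
  have comp: "g' E $ j = 0" if j: "j \<noteq> i" for j
  proof -
    have d: "((\<lambda>\<zeta>. ?g (?c \<zeta>) $ j) has_derivative (\<lambda>v. g' (v *s E) $ j)) (at 0)"
      by (rule bounded_linear.has_derivative[OF bounded_linear_vec_nth gc])
    have zero: "?g (?c \<zeta>) $ j = 0" if z: "\<zeta> \<in> ?U" for \<zeta>
    proof -
      have z1: "?c \<zeta> \<in> \<Phi> ` V" and z2: "1 + \<zeta> \<noteq> 0" using z by blast+
      obtain s where s: "s \<in> V" "?c \<zeta> = \<Phi> s" using z1 by (rule imageE) metis
      have "?c \<zeta> \<in> M" using inv[OF z2, of ?z] \<Phi>_in_M[OF t] by blast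
      then have "s \<in> coord_subspace I" using submanifold_chart_mem_iff[OF chart s(1)] s(2) by metis
      then show ?thesis using j I unfolding s(2) the_inv_into_f_f[OF \<Phi>_inj s(1)] coord_subspace_def by blast
    qed
    have "((\<lambda>_. 0) has_derivative (\<lambda>v. g' (v *s E) $ j)) (at (0::complex))"
      by (rule has_derivative_transform_within_open[OF d U]) (rule zero)
    then have "(\<lambda>v. g' (v *s E) $ j) = (\<lambda>v. 0)" by (rule has_derivative_unique[OF _ has_derivative_const])
    from fun_cong[OF this, of 1] show ?thesis by simp
  qed
  define \<rho> where "\<rho> = g' E $ i"
  have gE: "g' E = axis i \<rho>" unfolding vec_eq_iff using comp by (simp add: axis_def \<rho>_def)
  let ?D = "frechet_derivative \<Phi> (at t)"
  have "((\<lambda>z. \<Phi> (?g z)) has_derivative (\<lambda>v. ?D (g' v))) (at ?z)"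
    by (rule has_derivative_compose[OF g'])
      (use holomorphic_map_onD(1)[OF \<Phi>_hol tV] the_inv_into_f_f[OF \<Phi>_inj tV] in simp)
  then have "((\<lambda>z. z) has_derivative (\<lambda>v. ?D (g' v))) (at ?z)"
    by (rule has_derivative_transform_within_open[OF _ opn zV]) (rule f_the_inv_into_f[OF \<Phi>_inj])
  then have "(\<lambda>v. ?D (g' v)) = (\<lambda>v. v)" by (rule has_derivative_unique[OF _ has_derivative_ident])
  from fun_cong[OF this, of E] have "?D (g' E) = E" .
  then have "E = \<rho> *s ?D (axis i 1)"
    unfolding gE by (subst (asm) axis_smult) (simp add: holomorphic_map_onD(2)[OF \<Phi>_hol tV])
  then have "of_nat (\<beta> k) * \<Phi> t $ k = \<rho> * ?D (axis i 1) $ k" for k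
    by (metis E_def vec_lambda_beta vector_smult_component)
  then show ?thesis by (rule that)
qed

text \<open>
  In dimension one closedness is vacuous and the mixed equation is a change of variables. It is
  checked on polynomial coefficients, where it is an integration by parts in \<open>t\<close> and in \<open>w\<close>.
\<close>

lemma mixed_equation_polynomial:
  assumes I: "I = {i}" and p: "smooth p"
    and \<theta>: "smooth \<theta>" and W: "compact W" "0 \<notin> W" and \<theta>0: "\<And>w. w \<notin> W \<Longrightarrow> \<theta> w = 0"
  shows "(\<integral>w. \<integral>t. p (weighted_action \<beta> w (\<Phi>\<^sub>0 t)) * cnj (of_nat (\<beta> k) * w ^ (\<beta> k - 1) * \<Phi>\<^sub>0 t $ k) * d\<phi> i t * \<theta> w \<partial>\<mu> \<partial>lborel) =
    (\<integral>w. \<integral>t. p (weighted_action \<beta> w (\<Phi>\<^sub>0 t)) * cnj (w ^ \<beta> k * D\<^sub>0 i t $ k) * \<phi>\<^sub>0 t * dbar \<theta> w \<partial>\<mu> \<partial>lborel)"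
proof -
  \<comment> \<open>For points of K, X and Y are the derivatives in w and in t of the coordinates of
    the orbit map, and Z is the mixed derivative of its k-th coordinate. Then Q is the conjugate
    t-derivative of \<open>P t w * cnj (X t w k)\<close>.\<close>
  define X where "X t w j = of_nat (\<beta> j) * w ^ (\<beta> j - 1) * \<Phi>\<^sub>0 t $ j" for t w j
  define Y where "Y t w j = w ^ \<beta> j * D\<^sub>0 i t $ j" for t w j
  define Z where "Z t w = of_nat (\<beta> k) * w ^ (\<beta> k - 1) * D\<^sub>0 i t $ k" for t w
  define P where "P t w = p (weighted_action \<beta> w (\<Phi>\<^sub>0 t))" for t w
  define Q where "Q t w = (\<Sum>l\<in>UNIV. wirtinger_bar l p (weighted_action \<beta> w (\<Phi>\<^sub>0 t)) * cnj (Y t w l)) * cnj (X t w k) + P t w * cnj (Z t w)" for t w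
  have sw: "smooth (wirtinger_bar l p)" for l
  proof -
    have "smooth (\<lambda>x. (frechet_derivative p (at x) (axis l 1) + \<i> * frechet_derivative p (at x) (axis l \<i>)) * (1 / 2))"
      by (intro smooth_mult smooth_add smooth_const smooth_frechet_derivative p)
    then show ?thesis by (simp add: wirtinger_bar_def[abs_def])
  qed
  note [measurable] = borel_measurable_continuous_onI[OF smooth_continuous_on[OF p]]
    borel_measurable_continuous_onI[OF smooth_continuous_on[OF sw]]
    borel_measurable_continuous_onI[OF smooth_continuous_on[OF \<theta>]]
    borel_measurable_continuous_onI[OF smooth_continuous_on[OF smooth_dbar[OF \<theta>]]]
  \<comment> \<open>On a curve X and Y are multiples of the same tangent vector, up to the powers of
    w that balance in the product.\<close>
  have sym: "X t w k * Y t w l = X t w l * Y t w k" if t: "t \<in> K" for t w l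
  proof -
    obtain \<rho> where \<rho>: "\<And>k. of_nat (\<beta> k) * \<Phi> t $ k = \<rho> * frechet_derivative \<Phi> (at t) (axis i 1) $ k"
      using orbit_tangent[OF I t] by blast
    have X: "X t w j = w ^ (\<beta> j - 1) * (\<rho> * D\<^sub>0 i t $ j)" for j
      unfolding X_def \<Phi>0_eq[OF t] D0_eq[OF t] using \<rho>[of j] by (simp add: mult.assoc[symmetric] mult.commute[of _ "w ^ _"])
    have "w ^ (\<beta> k - 1) * w ^ \<beta> l = w ^ (\<beta> l - 1) * w ^ \<beta> k"
      using \<beta>_pos[of k] \<beta>_pos[of l] by (simp add: power_add[symmetric] add.commute)
    then have "w ^ (\<beta> k - 1) * w ^ \<beta> l * (\<rho> * D\<^sub>0 i t $ k * D\<^sub>0 i t $ l) = w ^ (\<beta> l - 1) * w ^ \<beta> k * (\<rho> * D\<^sub>0 i t $ k * D\<^sub>0 i t $ l)"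
      by simp
    then show ?thesis unfolding X Y_def by (simp add: mult_ac)
  qed
  \<comment> \<open>By this symmetry Q is also the conjugate w-derivative of
    \<open>P t w * cnj (Y t w k)\<close>, so both integrations by parts produce the same
    term.\<close>
  have Qsym: "Q t w = (\<Sum>l\<in>UNIV. wirtinger_bar l p (weighted_action \<beta> w (\<Phi>\<^sub>0 t)) * cnj (X t w l)) * cnj (Y t w k) + P t w * cnj (Z t w)"
    if t: "t \<in> K" for t w
  proof -
    have "cnj (Y t w l) * cnj (X t w k) = cnj (X t w l) * cnj (Y t w k)" for l
      using sym[OF t, of w l] by (simp only: complex_cnj_mult[symmetric] mult.commute)
    then show ?thesis unfolding Q_def sum_distrib_right by (simp add: mult.assoc)
  qed
  let ?O = "{x. axis i x \<in> V}" and ?K1 = "{x. axis i x \<in> K}"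
  have axc: "continuous_on UNIV (axis i :: complex \<Rightarrow> complex ^ 'n)"
    by (intro linear_continuous_on bounded_linear_axis)
  have O: "open ?O" using open_vimage[OF V_open axc] by (simp add: vimage_def)
  have K1: "compact ?K1" "?K1 \<subseteq> ?O"
  proof -
    have "closed ?K1" using closed_vimage[OF compact_imp_closed[OF K(1)] axc] by (simp add: vimage_def)
    moreover have "bounded ?K1"
    proof -
      obtain r where "K \<subseteq> ball 0 r" using bounded_subset_ballD[OF compact_imp_bounded[OF K(1)], of 0] by auto
      then have "?K1 \<subseteq> ball 0 r" by (auto simp: norm_axis_complex dest: subsetD)
      then show ?thesis using bounded_subset bounded_ball by blast
    qed
    ultimately show "compact ?K1" by (simp add: compact_eq_bounded_closed)
    show "?K1 \<subseteq> ?O" using K_sub by auto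
  qed
  have axI: "axis i x \<in> coord_subspace I" for x by (auto simp: I coord_subspace_def axis_def)
  have part_t: "(\<integral>t. Q t w * \<phi>\<^sub>0 t + P t w * cnj (X t w k) * d\<phi> i t \<partial>\<mu>) = 0" for w
  proof -
    let ?\<phi> = "\<lambda>x. \<phi> (0 + axis i x)"
    have \<phi>1: "smooth ?\<phi>" by (rule smooth_affine[OF bounded_linear_axis \<phi>_smooth])
    have d\<phi>1: "dbar ?\<phi> x = wirtinger_bar i \<phi> (axis i x)" for x
    proof -
      have "(axis i has_derivative axis i) (at x)"
        by (rule bounded_linear_imp_has_derivative[OF bounded_linear_axis])
      from has_derivative_compose[OF this smooth_has_derivative[OF \<phi>_smooth]]
      have "(?\<phi> has_derivative (\<lambda>v. frechet_derivative \<phi> (at (axis i x)) (axis i v))) (at x)" by simp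
      from dbar_eqI[OF this] show ?thesis by (simp add: wirtinger_bar_def)
    qed
    let ?y = "\<lambda>x. weighted_action \<beta> w (\<Phi> (axis i x))" and ?d = "\<lambda>x. frechet_derivative \<Phi> (at (axis i x)) (axis i 1)"
    have slice: "((\<lambda>x. \<Phi> (axis i x) $ j) has_field_derivative ?d x $ j) (at x)" if "x \<in> ?O" for x j
      using holomorphic_map_slice_derivative[OF \<Phi>_hol, of 0 i x j] that by simp
    have cd: "continuous_on ?O ?d"
      by (rule continuous_on_compose2[OF partial_continuous continuous_on_subset[OF axc]]) auto
    have "(\<integral>x. indicator ?K1 x *\<^sub>R (((\<Sum>l\<in>UNIV. wirtinger_bar l p (?y x) * cnj (weighted_action \<beta> w (?d x) $ l)) * cnj (of_nat (\<beta> k) * w ^ (\<beta> k - 1) * \<Phi> (axis i x) $ k) +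
      p (?y x) * cnj (of_nat (\<beta> k) * w ^ (\<beta> k - 1) * ?d x $ k)) * ?\<phi> x + p (?y x) * cnj (of_nat (\<beta> k) * w ^ (\<beta> k - 1) * \<Phi> (axis i x) $ k) * dbar ?\<phi> x) \<partial>lborel) = 0"
    proof (rule integral_by_parts_holomorphic[OF O K1 \<phi>1 _ p])
      show "?\<phi> x = 0" if "x \<notin> ?K1" for x using that axI[of x] by (intro \<phi>_supp) auto
      show "(?y has_derivative (\<lambda>v. v *s weighted_action \<beta> w (?d x))) (at x)" if "x \<in> ?O" for x
      proof (rule has_derivative_vecI)
        fix j
        have "((\<lambda>x. w ^ \<beta> j * \<Phi> (axis i x) $ j) has_field_derivative w ^ \<beta> j * ?d x $ j) (at x)"
          by (rule DERIV_cmult[OF slice[OF that]])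
        then show "((\<lambda>x. ?y x $ j) has_derivative (\<lambda>v. (v *s weighted_action \<beta> w (?d x)) $ j)) (at x)"
          unfolding weighted_action_nth has_field_derivative_def
          by (rule has_derivative_eq_rhs) (simp add: fun_eq_iff)
      qed
      show "((\<lambda>x. of_nat (\<beta> k) * w ^ (\<beta> k - 1) * \<Phi> (axis i x) $ k) has_derivative (\<lambda>v. v * (of_nat (\<beta> k) * w ^ (\<beta> k - 1) * ?d x $ k))) (at x)"
        if "x \<in> ?O" for x
        using DERIV_cmult[OF slice[OF that, of k], of "of_nat (\<beta> k) * w ^ (\<beta> k - 1)"]
        unfolding has_field_derivative_def
        by (rule has_derivative_eq_rhs) (simp add: fun_eq_iff)
      show "continuous_on ?O (\<lambda>x. weighted_action \<beta> w (?d x))" by (intro continuous_intros cd)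
      show "continuous_on ?O (\<lambda>x. of_nat (\<beta> k) * w ^ (\<beta> k - 1) * ?d x $ k)" by (intro continuous_intros cd)
    qed
    also have "(\<integral>x. indicator ?K1 x *\<^sub>R (((\<Sum>l\<in>UNIV. wirtinger_bar l p (?y x) * cnj (weighted_action \<beta> w (?d x) $ l)) * cnj (of_nat (\<beta> k) * w ^ (\<beta> k - 1) * \<Phi> (axis i x) $ k) +
      p (?y x) * cnj (of_nat (\<beta> k) * w ^ (\<beta> k - 1) * ?d x $ k)) * ?\<phi> x + p (?y x) * cnj (of_nat (\<beta> k) * w ^ (\<beta> k - 1) * \<Phi> (axis i x) $ k) * dbar ?\<phi> x) \<partial>lborel)
      = (\<integral>x. Q (axis i x) w * \<phi>\<^sub>0 (axis i x) + P (axis i x) w * cnj (X (axis i x) w k) * d\<phi> i (axis i x) \<partial>lborel)"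
    proof (intro Bochner_Integration.integral_cong refl)
      fix x :: complex
      show "indicator ?K1 x *\<^sub>R (((\<Sum>l\<in>UNIV. wirtinger_bar l p (?y x) * cnj (weighted_action \<beta> w (?d x) $ l)) * cnj (of_nat (\<beta> k) * w ^ (\<beta> k - 1) * \<Phi> (axis i x) $ k) +
      p (?y x) * cnj (of_nat (\<beta> k) * w ^ (\<beta> k - 1) * ?d x $ k)) * ?\<phi> x + p (?y x) * cnj (of_nat (\<beta> k) * w ^ (\<beta> k - 1) * \<Phi> (axis i x) $ k) * dbar ?\<phi> x)
      = Q (axis i x) w * \<phi>\<^sub>0 (axis i x) + P (axis i x) w * cnj (X (axis i x) w k) * d\<phi> i (axis i x)"
      proof (cases "axis i x \<in> K")
        case True
        then show ?thesis
          by (simp add: Q_def P_def X_def Y_def Z_def \<Phi>0_eq D0_eq \<phi>\<^sub>0_def d\<phi>_def d\<phi>1[simplified])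
      qed (simp add: \<phi>0_outside d\<phi>_outside)
    qed
    also have "\<dots> = (\<integral>t. Q t w * \<phi>\<^sub>0 t + P t w * cnj (X t w k) * d\<phi> i t \<partial>\<mu>)"
      unfolding I by (rule integral_coord_singleton[symmetric])
        (simp add: Q_def P_def X_def Y_def Z_def)
    finally show ?thesis .
  qed
  have part_w: "(\<integral>w. Q t w * \<theta> w + P t w * cnj (Y t w k) * dbar \<theta> w \<partial>lborel) = 0" if t: "t \<in> K" for t
  proof -
    let ?y = "\<lambda>w. weighted_action \<beta> w (\<Phi>\<^sub>0 t)" and ?y' = "\<lambda>w. \<chi> j. X t w j"
    have d\<theta>0: "dbar \<theta> w = 0" if "w \<notin> W" for w
      by (rule dbar_outside_support[OF compact_imp_closed[OF W(1)] \<theta>0 that])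
    have pw: "((\<lambda>w. w ^ b * c) has_derivative (\<lambda>v. v * (of_nat b * w ^ (b - 1) * c))) (at w)" for b c and w :: complex
    proof -
      have "((\<lambda>w. w ^ b * c) has_field_derivative of_nat b * w ^ (b - 1) * c) (at w)"
        by (auto intro!: derivative_eq_intros)
      then show ?thesis
        unfolding has_field_derivative_def by (rule has_derivative_eq_rhs) (simp add: fun_eq_iff)
    qed
    have "(\<integral>w. indicator W w *\<^sub>R (((\<Sum>l\<in>UNIV. wirtinger_bar l p (?y w) * cnj (?y' w $ l)) * cnj (Y t w k) +
      p (?y w) * cnj (Z t w)) * \<theta> w + p (?y w) * cnj (Y t w k) * dbar \<theta> w) \<partial>lborel) = 0"
    proof (rule integral_by_parts_holomorphic[OF open_UNIV W(1) subset_UNIV \<theta> \<theta>0 p])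
      show "(?y has_derivative (\<lambda>v. v *s ?y' w)) (at w)" for w
        by (rule has_derivative_vecI, unfold weighted_action_nth, rule has_derivative_eq_rhs[OF pw])
          (simp add: X_def)
      show "((\<lambda>w. Y t w k) has_derivative (\<lambda>v. v * Z t w)) (at w)" for w
        unfolding Y_def Z_def by (rule pw)
      show "continuous_on UNIV ?y'" unfolding X_def by (intro continuous_intros)
      show "continuous_on UNIV (Z t)" unfolding Z_def[abs_def] by (intro continuous_intros)
    qed
    also have "(\<integral>w. indicator W w *\<^sub>R (((\<Sum>l\<in>UNIV. wirtinger_bar l p (?y w) * cnj (?y' w $ l)) * cnj (Y t w k) +
      p (?y w) * cnj (Z t w)) * \<theta> w + p (?y w) * cnj (Y t w k) * dbar \<theta> w) \<partial>lborel) =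
      (\<integral>w. Q t w * \<theta> w + P t w * cnj (Y t w k) * dbar \<theta> w \<partial>lborel)"
    proof (intro Bochner_Integration.integral_cong refl)
      fix w show "indicator W w *\<^sub>R (((\<Sum>l\<in>UNIV. wirtinger_bar l p (?y w) * cnj (?y' w $ l)) * cnj (Y t w k) +
        p (?y w) * cnj (Z t w)) * \<theta> w + p (?y w) * cnj (Y t w k) * dbar \<theta> w) =
        Q t w * \<theta> w + P t w * cnj (Y t w k) * dbar \<theta> w"
        using \<theta>0[of w] d\<theta>0[of w] by (cases "w \<in> W") (auto simp: Qsym[OF t] P_def)
    qed
    finally show ?thesis .
  qed
  obtain R where R: "W \<subseteq> ball 0 R" using bounded_subset_ballD[OF compact_imp_bounded[OF W(1)], of 0] by auto
  have d\<theta>0: "dbar \<theta> w = 0" if "w \<notin> W" for w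
    by (rule dbar_outside_support[OF compact_imp_closed[OF W(1)] \<theta>0 that])
  have \<theta>b: "\<exists>C\<ge>0. \<forall>w. cmod (\<theta> w) \<le> C" "\<exists>C\<ge>0. \<forall>w. cmod (dbar \<theta> w) \<le> C"
    using smooth_bounded_support[OF \<theta> W(1) \<theta>0] smooth_bounded_support[OF smooth_dbar[OF \<theta>] W(1) d\<theta>0] by auto
  have \<theta>R: "\<theta> w = 0" "dbar \<theta> w = 0" if "cmod w > R" for w
    using that R by (auto intro!: \<theta>0 d\<theta>0)
  obtain C1 where C1: "C1 \<ge> 0" "\<And>t. norm (\<Phi>\<^sub>0 t) \<le> C1" using \<Phi>0_bounded by auto
  obtain C2 where C2: "C2 \<ge> 0" "\<And>t. norm (D\<^sub>0 i t) \<le> C2" using D0_bounded by auto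
  have bd: "\<exists>C\<ge>0. \<forall>t w. cmod w \<le> R \<longrightarrow> cmod (h w (\<Phi>\<^sub>0 t) (D\<^sub>0 i t)) \<le> C"
    if h: "continuous_on UNIV (\<lambda>x. h (fst x) (fst (snd x)) (snd (snd x)))" for h :: "complex \<Rightarrow> complex ^ 'n \<Rightarrow> complex ^ 'n \<Rightarrow> complex"
  proof -
    let ?B = "cball (0::complex) R \<times> cball (0::complex ^ 'n) C1 \<times> cball (0::complex ^ 'n) C2"
    have "bounded ((\<lambda>x. h (fst x) (fst (snd x)) (snd (snd x))) ` ?B)"
      by (intro compact_imp_bounded compact_continuous_image continuous_on_subset[OF h] compact_Times compact_cball) auto
    then obtain C where C: "C > 0" "\<And>x. x \<in> ?B \<Longrightarrow> cmod (h (fst x) (fst (snd x)) (snd (snd x))) \<le> C"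
      unfolding bounded_pos by blast
    have "cmod (h w (\<Phi>\<^sub>0 t) (D\<^sub>0 i t)) \<le> C" if "cmod w \<le> R" for t w
      using C(2)[of "(w, \<Phi>\<^sub>0 t, D\<^sub>0 i t)"] that C1 C2 by simp
    then show ?thesis using C(1) by (intro exI[of _ C]) auto
  qed
  have pc: "continuous_on UNIV (\<lambda>x :: complex \<times> (complex ^ 'n) \<times> (complex ^ 'n). p (weighted_action \<beta> (fst x) (fst (snd x))))"
    by (rule continuous_on_compose2[OF smooth_continuous_on[OF p, of UNIV]]) (auto intro!: continuous_intros)
  have wc: "continuous_on UNIV (\<lambda>x :: complex \<times> (complex ^ 'n) \<times> (complex ^ 'n). wirtinger_bar l p (weighted_action \<beta> (fst x) (fst (snd x))))" for l
    by (rule continuous_on_compose2[OF smooth_continuous_on[OF sw, of UNIV]]) (auto intro!: continuous_intros)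
  have bQ: "\<exists>C\<ge>0. \<forall>t w. cmod w \<le> R \<longrightarrow> cmod (Q t w) \<le> C"
    unfolding Q_def P_def X_def Y_def Z_def
    by (rule bd[of "\<lambda>w a d. (\<Sum>l\<in>UNIV. wirtinger_bar l p (weighted_action \<beta> w a) * cnj (w ^ \<beta> l * d $ l)) * cnj (of_nat (\<beta> k) * w ^ (\<beta> k - 1) * a $ k) +
        p (weighted_action \<beta> w a) * cnj (of_nat (\<beta> k) * w ^ (\<beta> k - 1) * d $ k)"])
      (intro continuous_intros pc wc)
  have bX: "\<exists>C\<ge>0. \<forall>t w. cmod w \<le> R \<longrightarrow> cmod (P t w * cnj (X t w k)) \<le> C"
    unfolding P_def X_def
    by (rule bd[of "\<lambda>w a d. p (weighted_action \<beta> w a) * cnj (of_nat (\<beta> k) * w ^ (\<beta> k - 1) * a $ k)"])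
      (intro continuous_intros pc)
  have bY: "\<exists>C\<ge>0. \<forall>t w. cmod w \<le> R \<longrightarrow> cmod (P t w * cnj (Y t w k)) \<le> C"
    unfolding P_def Y_def
    by (rule bd[of "\<lambda>w a d. p (weighted_action \<beta> w a) * cnj (w ^ \<beta> k * d $ k)"])
      (intro continuous_intros pc)
  have mQ: "case_prod Q \<in> borel_measurable (borel \<Otimes>\<^sub>M borel)"
    and mX: "(\<lambda>(t, w). P t w * cnj (X t w k)) \<in> borel_measurable (borel \<Otimes>\<^sub>M borel)"
    and mY: "(\<lambda>(t, w). P t w * cnj (Y t w k)) \<in> borel_measurable (borel \<Otimes>\<^sub>M borel)"
    unfolding Q_def P_def X_def Y_def Z_def split_beta' by measurable
  have iQ: "integrable (\<mu> \<Otimes>\<^sub>M lborel) (\<lambda>(t, w). Q t w * \<phi>\<^sub>0 t * \<theta> w)"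
    by (rule product_bound(1)[OF mQ _ _ bQ \<phi>0_bounded \<theta>b(1) \<phi>0_outside \<theta>R(1)]; simp)
  have iX: "integrable (\<mu> \<Otimes>\<^sub>M lborel) (\<lambda>(t, w). P t w * cnj (X t w k) * d\<phi> i t * \<theta> w)"
    by (rule product_bound(1)[OF mX _ _ bX d\<phi>_bounded \<theta>b(1) d\<phi>_outside \<theta>R(1)]; simp)
  have iY: "integrable (\<mu> \<Otimes>\<^sub>M lborel) (\<lambda>(t, w). P t w * cnj (Y t w k) * \<phi>\<^sub>0 t * dbar \<theta> w)"
    by (rule product_bound(1)[OF mY _ _ bY \<phi>0_bounded \<theta>b(2) \<phi>0_outside \<theta>R(2)]; simp)
  let ?J = "\<lambda>h. \<integral>x. case_prod h x \<partial>(\<mu> \<Otimes>\<^sub>M lborel)"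
  have e1: "?J (\<lambda>t w. Q t w * \<phi>\<^sub>0 t * \<theta> w) + ?J (\<lambda>t w. P t w * cnj (X t w k) * d\<phi> i t * \<theta> w) = 0"
  proof -
    let ?h = "\<lambda>t w. (Q t w * \<phi>\<^sub>0 t + P t w * cnj (X t w k) * d\<phi> i t) * \<theta> w"
    have h: "case_prod ?h = (\<lambda>x. (\<lambda>(t, w). Q t w * \<phi>\<^sub>0 t * \<theta> w) x + (\<lambda>(t, w). P t w * cnj (X t w k) * d\<phi> i t * \<theta> w) x)"
      by (auto simp: algebra_simps)
    have ih: "integrable (\<mu> \<Otimes>\<^sub>M lborel) (case_prod ?h)" unfolding h by (rule Bochner_Integration.integrable_add[OF iQ iX])
    have "?J ?h = (\<integral>w. \<integral>t. ?h t w \<partial>\<mu> \<partial>lborel)" by (rule pair.integral_snd[OF ih, symmetric])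
    also have "\<dots> = 0" by (simp add: part_t)
    finally show ?thesis unfolding h by (simp only: Bochner_Integration.integral_add[OF iQ iX])
  qed
  have e2: "?J (\<lambda>t w. Q t w * \<phi>\<^sub>0 t * \<theta> w) + ?J (\<lambda>t w. P t w * cnj (Y t w k) * \<phi>\<^sub>0 t * dbar \<theta> w) = 0"
  proof -
    let ?h = "\<lambda>t w. (Q t w * \<theta> w + P t w * cnj (Y t w k) * dbar \<theta> w) * \<phi>\<^sub>0 t"
    have h: "case_prod ?h = (\<lambda>x. (\<lambda>(t, w). Q t w * \<phi>\<^sub>0 t * \<theta> w) x + (\<lambda>(t, w). P t w * cnj (Y t w k) * \<phi>\<^sub>0 t * dbar \<theta> w) x)"
      by (auto simp: algebra_simps)
    have ih: "integrable (\<mu> \<Otimes>\<^sub>M lborel) (case_prod ?h)" unfolding h by (rule Bochner_Integration.integrable_add[OF iQ iY])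
    have "?J ?h = (\<integral>w. \<integral>t. ?h t w \<partial>\<mu> \<partial>lborel)" by (rule pair.integral_snd[OF ih, symmetric])
    also have "\<dots> = (\<integral>t. \<integral>w. ?h t w \<partial>lborel \<partial>\<mu>)" by (rule pair.Fubini_integral[OF ih])
    also have "\<dots> = (\<integral>t. 0 \<partial>\<mu>)"
    proof (intro Bochner_Integration.integral_cong refl)
      fix t show "(\<integral>w. ?h t w \<partial>lborel) = 0"
      proof (cases "t \<in> K")
        case True
        then show ?thesis unfolding integral_mult_left_zero part_w[OF True] by simp
      qed (simp add: \<phi>0_outside)
    qed
    finally show ?thesis unfolding h by (simp only: Bochner_Integration.integral_add[OF iQ iY] integral_zero)
  qed
  \<comment> \<open>Integrating by parts in t and in w expresses both sides as minus the same
    integral of Q.\<close>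
  have "?J (\<lambda>t w. P t w * cnj (X t w k) * d\<phi> i t * \<theta> w) = ?J (\<lambda>t w. P t w * cnj (Y t w k) * \<phi>\<^sub>0 t * dbar \<theta> w)"
    by (rule add_left_imp_eq[OF trans[OF e1 e2[symmetric]]])
  then show ?thesis
    using pair.integral_snd[OF iX] pair.integral_snd[OF iY] by (simp add: P_def X_def Y_def)
qed

end

text \<open>The error made by replacing v with a polynomial is at most the L1 distance with respect
  to the image under T of the measure with density |\<kappa>|. That image is finite and carried by
  the compact C, so polynomials are dense for it.\<close>

lemma integral_zero_by_polynomials:
  fixes T :: "'x \<Rightarrow> 'a::euclidean_space" and \<kappa> :: "'x \<Rightarrow> complex" and v :: "'a \<Rightarrow> complex"
  assumes T [measurable]: "T \<in> borel_measurable N" and \<kappa>: "integrable N \<kappa>"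
    and C: "compact C" "\<And>x. \<kappa> x \<noteq> 0 \<Longrightarrow> T x \<in> C"
    and v [measurable]: "v \<in> borel_measurable borel" and vb: "\<And>z. cmod (v z) \<le> G"
    and poly: "\<And>p. polynomial_function p \<Longrightarrow> (\<integral>x. p (T x) * \<kappa> x \<partial>N) = 0"
  shows "(\<integral>x. v (T x) * \<kappa> x \<partial>N) = 0"
proof -
  have [measurable]: "\<kappa> \<in> borel_measurable N" using \<kappa> by simp
  define \<nu> where "\<nu> = distr (density N (\<lambda>x. ennreal (cmod (\<kappa> x)))) borel T"
  have \<nu>s: "sets \<nu> = sets borel" by (simp add: \<nu>_def)
  have \<nu>n: "(\<integral>\<^sup>+z. h z \<partial>\<nu>) = (\<integral>\<^sup>+x. ennreal (cmod (\<kappa> x)) * h (T x) \<partial>N)" if [measurable]: "h \<in> borel_measurable borel" for h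
    unfolding \<nu>_def by (simp add: nn_integral_distr nn_integral_density)
  have fin: "finite_measure \<nu>"
  proof
    have "emeasure \<nu> (space \<nu>) = (\<integral>\<^sup>+z. 1 \<partial>\<nu>)" by simp
    also have "\<dots> = (\<integral>\<^sup>+x. ennreal (cmod (\<kappa> x)) \<partial>N)" by (subst \<nu>n) simp_all
    also have "\<dots> < \<infinity>" using \<kappa> by (simp add: integrable_iff_bounded)
    finally show "emeasure \<nu> (space \<nu>) \<noteq> \<infinity>" by simp
  qed
  have AEC: "AE z in \<nu>. z \<in> C"
  proof -
    have [measurable]: "C \<in> sets borel" using C(1) by (simp add: borel_compact)
    have "AE x in density N (\<lambda>x. ennreal (cmod (\<kappa> x))). T x \<in> C"
      by (subst AE_density) (use C(2) in \<open>auto intro!: AE_I2\<close>)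
    then show ?thesis unfolding \<nu>_def by (subst AE_distr_iff) simp_all
  qed
  have iv: "integrable \<nu> v"
    by (rule finite_measure.integrable_const_bound[OF fin, of _ G]) (use vb in \<open>auto simp: \<nu>_def\<close>)
  have ivk: "integrable N (\<lambda>x. v (T x) * \<kappa> x)"
  proof (rule Bochner_Integration.integrable_bound)
    show "integrable N (\<lambda>x. G * cmod (\<kappa> x))" by (intro integrable_mult_right integrable_norm \<kappa>)
    show "AE x in N. norm (v (T x) * \<kappa> x) \<le> norm (G * cmod (\<kappa> x))"
      using vb order_trans[OF norm_ge_zero vb] by (intro AE_I2) (auto simp: norm_mult intro!: mult_right_mono)
  qed measurable
  have "cmod (\<integral>x. v (T x) * \<kappa> x \<partial>N) \<le> 0 + e" if e: "e > 0" for e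
  proof -
    obtain p where p: "polynomial_function p" "integrable \<nu> p" "(\<integral>z. norm (v z - p z) \<partial>\<nu>) < e"
      using finite_measure_L1_polynomial[OF \<nu>s fin C(1) AEC iv e] by blast
    have [measurable]: "p \<in> borel_measurable borel"
      by (intro borel_measurable_continuous_onI continuous_on_polymonial_function p)
    have "bounded (p ` C)"
      by (intro compact_imp_bounded compact_continuous_image continuous_on_polymonial_function p C)
    then obtain Q where Q: "Q > 0" "\<forall>z\<in>C. cmod (p z) \<le> Q" by (auto simp: bounded_pos)
    have ipk: "integrable N (\<lambda>x. p (T x) * \<kappa> x)"
    proof (rule Bochner_Integration.integrable_bound)
      show "integrable N (\<lambda>x. Q * cmod (\<kappa> x))" by (intro integrable_mult_right integrable_norm \<kappa>)
      have "norm (p (T x) * \<kappa> x) \<le> norm (Q * cmod (\<kappa> x))" for x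
        using Q C(2)[of x] by (cases "\<kappa> x = 0") (auto simp: norm_mult intro!: mult_right_mono)
      then show "AE x in N. norm (p (T x) * \<kappa> x) \<le> norm (Q * cmod (\<kappa> x))" by (intro AE_I2)
    qed measurable
    have idiff: "integrable N (\<lambda>x. (v (T x) - p (T x)) * \<kappa> x)"
      using Bochner_Integration.integrable_diff[OF ivk ipk] by (simp add: left_diff_distrib)
    have "(\<integral>x. v (T x) * \<kappa> x \<partial>N) = (\<integral>x. (v (T x) - p (T x)) * \<kappa> x \<partial>N)"
      using Bochner_Integration.integral_diff[OF ivk ipk] poly[OF p(1)] by (simp add: left_diff_distrib)
    then have "ennreal (cmod (\<integral>x. v (T x) * \<kappa> x \<partial>N)) \<le> (\<integral>\<^sup>+x. ennreal (cmod ((v (T x) - p (T x)) * \<kappa> x)) \<partial>N)"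
      using integral_norm_bound_ennreal[OF idiff] by simp
    also have "\<dots> = (\<integral>\<^sup>+z. ennreal (norm (v z - p z)) \<partial>\<nu>)"
      by (subst \<nu>n) (simp_all add: norm_mult ennreal_mult mult.commute)
    also have "\<dots> = ennreal (\<integral>z. norm (v z - p z) \<partial>\<nu>)"
      using iv p(2) by (intro nn_integral_eq_integral) auto
    also have "\<dots> \<le> ennreal e" using p(3) by (intro ennreal_leI) simp
    finally show ?thesis using e by (simp add: ennreal_le_iff)
  qed
  then have "cmod (\<integral>x. v (T x) * \<kappa> x \<partial>N) \<le> 0" by (rule field_le_epsilon)
  then show ?thesis by simp
qed

section \<open>From polynomial to bounded Borel coefficients\<close>

context test_piece
begin

text \<open>The difference of the two sides is a sum over k of integrals of \<open>u k\<close> along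
  the orbit map against a fixed integrable kernel. Each kernel annihilates polynomials, hence
  bounded Borel functions, so the equation holds separately for every k.\<close>

lemma mixed_equation_one:
  assumes I: "I = {i}"
    and \<theta>: "smooth \<theta>" and W: "compact W" "0 \<notin> W" and \<theta>0: "\<And>w. w \<notin> W \<Longrightarrow> \<theta> w = 0"
  shows "(\<integral>w. \<integral>t. coeff_w t w * d\<phi> i t * \<theta> w \<partial>\<mu> \<partial>lborel) = (\<integral>w. \<integral>t. coeff_t i t w * \<phi>\<^sub>0 t * dbar \<theta> w \<partial>\<mu> \<partial>lborel)"
proof -
  obtain R where R: "W \<subseteq> ball 0 R" using bounded_subset_ballD[OF compact_imp_bounded[OF W(1)], of 0] by auto
  have d\<theta>0: "dbar \<theta> w = 0" if "w \<notin> W" for w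
    by (rule dbar_outside_support[OF compact_imp_closed[OF W(1)] \<theta>0 that])
  have \<theta>b: "\<exists>C\<ge>0. \<forall>w. cmod (\<theta> w) \<le> C" "\<exists>C\<ge>0. \<forall>w. cmod (dbar \<theta> w) \<le> C"
    using smooth_bounded_support[OF \<theta> W(1) \<theta>0] smooth_bounded_support[OF smooth_dbar[OF \<theta>] W(1) d\<theta>0] by auto
  have \<theta>R: "\<theta> w = 0" "dbar \<theta> w = 0" if "cmod w > R" for w
    using that R by (auto intro!: \<theta>0 d\<theta>0)
  have [measurable]: "\<theta> \<in> borel_measurable borel" "dbar \<theta> \<in> borel_measurable borel"
    using \<theta> by (auto intro!: borel_measurable_continuous_onI smooth_continuous_on smooth_dbar)
  obtain C1 where C1: "C1 \<ge> 0" "\<And>t. norm (\<Phi>\<^sub>0 t) \<le> C1" using \<Phi>0_bounded by auto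
  obtain C2 where C2: "C2 \<ge> 0" "\<And>t. norm (D\<^sub>0 i t) \<le> C2" using D0_bounded by auto
  define X where "X k t w = cnj (of_nat (\<beta> k) * w ^ (\<beta> k - 1) * \<Phi>\<^sub>0 t $ k)" for k t w
  define Y where "Y k t w = cnj (w ^ \<beta> k * D\<^sub>0 i t $ k)" for k t w
  let ?T = "\<lambda>x. weighted_action \<beta> (snd x) (\<Phi>\<^sub>0 (fst x))"
  have mX: "case_prod (X k) \<in> borel_measurable (borel \<Otimes>\<^sub>M borel)" and mY: "case_prod (Y k) \<in> borel_measurable (borel \<Otimes>\<^sub>M borel)" for k
    unfolding X_def Y_def split_beta' by measurable
  have bX: "\<exists>C\<ge>0. \<forall>t w. cmod w \<le> R \<longrightarrow> cmod (X k t w) \<le> C" for k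
  proof (intro exI conjI allI impI)
    show "0 \<le> real (\<beta> k) * \<bar>R\<bar> ^ (\<beta> k - 1) * C1" using C1 by auto
    fix t w assume "cmod w \<le> R"
    moreover have "cmod (\<Phi>\<^sub>0 t $ k) \<le> C1" using C1(2) Finite_Cartesian_Product.norm_nth_le order_trans by blast
    ultimately show "cmod (X k t w) \<le> real (\<beta> k) * \<bar>R\<bar> ^ (\<beta> k - 1) * C1"
      unfolding X_def norm_mult complex_mod_cnj norm_power norm_of_nat using C1(1)
      by (intro mult_mono power_mono mult_nonneg_nonneg) auto
  qed
  have bY: "\<exists>C\<ge>0. \<forall>t w. cmod w \<le> R \<longrightarrow> cmod (Y k t w) \<le> C" for k
  proof (intro exI conjI allI impI)
    show "0 \<le> \<bar>R\<bar> ^ \<beta> k * C2" using C2 by auto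
    fix t w assume "cmod w \<le> R"
    moreover have "cmod (D\<^sub>0 i t $ k) \<le> C2" using C2(2) Finite_Cartesian_Product.norm_nth_le order_trans by blast
    ultimately show "cmod (Y k t w) \<le> \<bar>R\<bar> ^ \<beta> k * C2"
      unfolding Y_def norm_mult complex_mod_cnj norm_power using C2(1)
      by (intro mult_mono power_mono mult_nonneg_nonneg) auto
  qed
  have iX: "integrable (\<mu> \<Otimes>\<^sub>M lborel) (\<lambda>(t, w). X k t w * d\<phi> i t * \<theta> w)" for k
    by (rule product_bound(1)[OF mX _ _ bX d\<phi>_bounded \<theta>b(1) d\<phi>_outside \<theta>R(1)]; simp)
  have iY: "integrable (\<mu> \<Otimes>\<^sub>M lborel) (\<lambda>(t, w). Y k t w * \<phi>\<^sub>0 t * dbar \<theta> w)" for k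
    by (rule product_bound(1)[OF mY _ _ bY \<phi>0_bounded \<theta>b(2) \<phi>0_outside \<theta>R(2)]; simp)
  \<comment> \<open>Everything independent of the coefficient is collected here: the kernel of the
    left side minus that of the right side.\<close>
  define \<kappa> where "\<kappa> k x = (\<lambda>(t, w). X k t w * d\<phi> i t * \<theta> w) x - (\<lambda>(t, w). Y k t w * \<phi>\<^sub>0 t * dbar \<theta> w) x" for k x
  have i\<kappa>: "integrable (\<mu> \<Otimes>\<^sub>M lborel) (\<kappa> k)" for k
    unfolding \<kappa>_def[abs_def] by (rule Bochner_Integration.integrable_diff[OF iX iY])
  have mT: "?T \<in> borel_measurable (\<mu> \<Otimes>\<^sub>M lborel)" by measurable
  define B where "B = (1 + \<bar>R\<bar>) ^ (\<Sum>k\<in>UNIV. \<beta> k) * C1"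
  have inC: "?T x \<in> cball 0 B" if "\<kappa> k x \<noteq> 0" for k x
  proof -
    have "cmod (snd x) \<le> R" using that \<theta>R[of "snd x"] by (force simp: \<kappa>_def split_beta)
    then have "norm (?T x) \<le> B"
      unfolding B_def using C1 by (intro order_trans[OF norm_weighted_action_le] mult_mono power_mono) auto
    then show ?thesis by simp
  qed
  have mul: "integrable (\<mu> \<Otimes>\<^sub>M lborel) (\<lambda>x. v (?T x) * h x)"
    if v: "v \<in> borel_measurable borel" and vb: "\<And>z. z \<in> cball 0 B \<Longrightarrow> cmod (v z) \<le> G" and h: "integrable (\<mu> \<Otimes>\<^sub>M lborel) h"
      and h0: "\<And>x. cmod (snd x) > R \<Longrightarrow> h x = 0" for v :: "complex ^ 'n \<Rightarrow> complex" and h G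
  proof (rule Bochner_Integration.integrable_bound)
    show "integrable (\<mu> \<Otimes>\<^sub>M lborel) (\<lambda>x. \<bar>G\<bar> * cmod (h x))" by (intro integrable_mult_right integrable_norm h)
    show "(\<lambda>x. v (?T x) * h x) \<in> borel_measurable (\<mu> \<Otimes>\<^sub>M lborel)"
      by (intro borel_measurable_times measurable_compose[OF mT v] borel_measurable_integrable[OF h])
    show "AE x in \<mu> \<Otimes>\<^sub>M lborel. norm (v (?T x) * h x) \<le> norm (\<bar>G\<bar> * cmod (h x))"
    proof (rule AE_I2)
      fix x :: "(complex ^ 'n) \<times> complex"
      show "norm (v (?T x) * h x) \<le> norm (\<bar>G\<bar> * cmod (h x))"
      proof (cases "cmod (snd x) \<le> R")
        case True
        then have "norm (?T x) \<le> B"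
          unfolding B_def using C1 by (intro order_trans[OF norm_weighted_action_le] mult_mono power_mono) auto
        then have "cmod (v (?T x)) \<le> G" by (intro vb) simp
        then show ?thesis by (auto simp: norm_mult intro!: mult_right_mono)
      qed (simp add: h0)
    qed
  qed
  have X0: "(\<lambda>(t, w). X k t w * d\<phi> i t * \<theta> w) x = 0" "(\<lambda>(t, w). Y k t w * \<phi>\<^sub>0 t * dbar \<theta> w) x = 0" if "cmod (snd x) > R" for k x
    using \<theta>R[OF that] by (auto simp: split_beta)
  have poly: "(\<integral>x. p (?T x) * \<kappa> k x \<partial>(\<mu> \<Otimes>\<^sub>M lborel)) = 0" if p: "polynomial_function p" for p k
  proof -
    have pm: "p \<in> borel_measurable borel"
      by (intro borel_measurable_continuous_onI continuous_on_polymonial_function p)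
    have "bounded (p ` cball 0 B)"
      by (intro compact_imp_bounded compact_continuous_image continuous_on_polymonial_function p compact_cball)
    then obtain G where G: "\<forall>z\<in>cball 0 B. cmod (p z) \<le> G" by (auto simp: bounded_pos)
    have I1: "integrable (\<mu> \<Otimes>\<^sub>M lborel) (\<lambda>x. p (?T x) * (\<lambda>(t, w). X k t w * d\<phi> i t * \<theta> w) x)"
      by (rule mul[OF pm _ iX X0(1)]) (use G in blast)
    have I2: "integrable (\<mu> \<Otimes>\<^sub>M lborel) (\<lambda>x. p (?T x) * (\<lambda>(t, w). Y k t w * \<phi>\<^sub>0 t * dbar \<theta> w) x)"
      by (rule mul[OF pm _ iY X0(2)]) (use G in blast)
    let ?h1 = "\<lambda>t w. p (weighted_action \<beta> w (\<Phi>\<^sub>0 t)) * cnj (of_nat (\<beta> k) * w ^ (\<beta> k - 1) * \<Phi>\<^sub>0 t $ k) * d\<phi> i t * \<theta> w"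
    let ?h2 = "\<lambda>t w. p (weighted_action \<beta> w (\<Phi>\<^sub>0 t)) * cnj (w ^ \<beta> k * D\<^sub>0 i t $ k) * \<phi>\<^sub>0 t * dbar \<theta> w"
    have e1: "(\<lambda>x. p (?T x) * (\<lambda>(t, w). X k t w * d\<phi> i t * \<theta> w) x) = case_prod ?h1"
      and e2: "(\<lambda>x. p (?T x) * (\<lambda>(t, w). Y k t w * \<phi>\<^sub>0 t * dbar \<theta> w) x) = case_prod ?h2"
      by (auto simp: X_def Y_def fun_eq_iff)
    have "(\<integral>x. case_prod ?h1 x \<partial>(\<mu> \<Otimes>\<^sub>M lborel)) = (\<integral>x. case_prod ?h2 x \<partial>(\<mu> \<Otimes>\<^sub>M lborel))"
      using mixed_equation_polynomial[OF I smooth_polynomial_function[OF p] \<theta> W \<theta>0, of k]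
        pair.integral_snd[OF I1[unfolded e1]] pair.integral_snd[OF I2[unfolded e2]] by simp
    then show ?thesis
      unfolding \<kappa>_def right_diff_distrib Bochner_Integration.integral_diff[OF I1 I2] unfolding e1 e2
      by (simp only: diff_self)
  qed
  let ?A = "\<lambda>k x. u k (?T x) * (\<lambda>(t, w). X k t w * d\<phi> i t * \<theta> w) x"
    and ?B = "\<lambda>k x. u k (?T x) * (\<lambda>(t, w). Y k t w * \<phi>\<^sub>0 t * dbar \<theta> w) x"
  have J1: "integrable (\<mu> \<Otimes>\<^sub>M lborel) (?A k)" for k by (rule mul[OF u_meas u_bound iX X0(1)])
  have J2: "integrable (\<mu> \<Otimes>\<^sub>M lborel) (?B k)" for k by (rule mul[OF u_meas u_bound iY X0(2)])
  have k_eq: "(\<integral>x. ?A k x \<partial>(\<mu> \<Otimes>\<^sub>M lborel)) = (\<integral>x. ?B k x \<partial>(\<mu> \<Otimes>\<^sub>M lborel))" for k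
  proof -
    have "(\<integral>x. u k (?T x) * \<kappa> k x \<partial>(\<mu> \<Otimes>\<^sub>M lborel)) = 0"
      by (rule integral_zero_by_polynomials[OF mT i\<kappa> compact_cball inC u_meas u_bound poly])
    then show ?thesis
      unfolding \<kappa>_def right_diff_distrib Bochner_Integration.integral_diff[OF J1 J2] by (rule eq_iff_diff_eq_0[THEN iffD2])
  qed
  let ?a = "\<lambda>t w. coeff_w t w * d\<phi> i t * \<theta> w" and ?b = "\<lambda>t w. coeff_t i t w * \<phi>\<^sub>0 t * dbar \<theta> w"
  have ea: "case_prod ?a = (\<lambda>x. \<Sum>k\<in>UNIV. ?A k x)" and eb: "case_prod ?b = (\<lambda>x. \<Sum>k\<in>UNIV. ?B k x)"
    by (auto simp: fun_eq_iff coeff_w_def coeff_t_def X_def Y_def sum_distrib_right mult.assoc)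
  have ia: "integrable (\<mu> \<Otimes>\<^sub>M lborel) (case_prod ?a)" and ib: "integrable (\<mu> \<Otimes>\<^sub>M lborel) (case_prod ?b)"
    unfolding ea eb by (intro Bochner_Integration.integrable_sum J1 J2)+
  have "(\<integral>x. case_prod ?a x \<partial>(\<mu> \<Otimes>\<^sub>M lborel)) = (\<integral>x. case_prod ?b x \<partial>(\<mu> \<Otimes>\<^sub>M lborel))"
    unfolding ea eb by (subst (1 2) Bochner_Integration.integral_sum) (simp_all only: J1 J2 k_eq)
  then show ?thesis using pair.integral_snd[OF ia] pair.integral_snd[OF ib] by simp
qed

lemma mixed_equation:
  assumes i: "i \<in> I"
    and \<theta>: "smooth \<theta>" and W: "compact W" "0 \<notin> W" and \<theta>0: "\<And>w. w \<notin> W \<Longrightarrow> \<theta> w = 0"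
  shows "(\<integral>w. \<integral>t. coeff_w t w * d\<phi> i t * \<theta> w \<partial>\<mu> \<partial>lborel) = (\<integral>w. \<integral>t. coeff_t i t w * \<phi>\<^sub>0 t * dbar \<theta> w \<partial>\<mu> \<partial>lborel)"
proof (cases "I = {i}")
  case True
  show ?thesis by (rule mixed_equation_one[OF True \<theta> W \<theta>0])
next
  case False
  then obtain l where "l \<in> I" "i \<noteq> l" using i by blast
  then show ?thesis by (rule mixed_equation_several[OF i _ _ \<theta> W \<theta>0])
qed

end

section \<open>Bounds for the integral operator\<close>

text \<open>All weights are at least 1. For points bounded away from 0 this forces orbits to leave
  every ball after a uniform |w|.\<close>

lemma norm_weighted_action_ge:
  fixes z :: "complex ^ 'n::finite"
  assumes "\<And>k. \<beta> k \<ge> 1" "cmod w \<ge> 1"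
  shows "cmod w * norm z \<le> norm (weighted_action \<beta> w z)"
proof -
  have "norm (cmod w *\<^sub>R z) \<le> norm (weighted_action \<beta> w z)"
  proof (rule norm_le_componentwise_cart)
    fix k
    have "cmod w ^ 1 \<le> cmod w ^ \<beta> k" using assms by (intro power_increasing) auto
    then show "norm ((cmod w *\<^sub>R z) $ k) \<le> norm (weighted_action \<beta> w z $ k)"
      by (simp add: norm_mult norm_power mult_right_mono)
  qed
  then show ?thesis by simp
qed

text \<open>Let b be the weight. The support forces |w|^b |z_k| \<le> R, a disc of radius at most
  \<rho> of order |z_k|^(-1/b). There the integrand is at most F |z_k| \<rho>^(b-1) / |w - 1|, whose
  integral grows like F |z_k| \<rho>^b. This product is constant by the choice of \<rho>, so the
  bound is uniform on bounded sets, even as z_k tends to 0.\<close>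

lemma nn_integral_dbar_integrand_le:
  fixes z :: "complex ^ 'n::finite"
  assumes \<beta>: "\<beta> k \<ge> 1"
    and u: "\<And>z. cmod (u k z) \<le> F" and supp: "\<And>z. norm z > R \<Longrightarrow> u k z = 0" and R: "R \<ge> 0"
    and z: "norm z \<le> r"
  shows "(\<integral>\<^sup>+w. ennreal (cmod (dbar_integrand \<beta> u z k w)) \<partial>lborel) \<le> ennreal (12 * pi * F * (R + r + 1))"
proof (cases "z $ k = 0")
  case True
  then show ?thesis by (simp add: dbar_integrand_def)
next
  case False
  define b where "b = \<beta> k"
  define a where "a = cmod (z $ k)"
  have a: "0 < a" "a \<le> r" using False z Finite_Cartesian_Product.norm_nth_le[of z k] by (auto simp: a_def)
  have F: "F \<ge> 0" using order_trans[OF norm_ge_zero u] .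
  \<comment> \<open>R alone would describe the support; adding r + 1 ensures \<rho> \<ge> 1 for
    every z_k in range. Then \<rho> + 2 \<le> 3 \<rho>, which turns the 4 pi of the planar estimate
    into 12 pi.\<close>
  define \<rho> where "\<rho> = root b ((R + r + 1) / a)"
  have q: "(R + r + 1) / a \<ge> 1" using a R by (simp add: field_simps)
  have b: "b > 0" using \<beta> by (simp add: b_def)
  have \<rho>b: "\<rho> ^ b = (R + r + 1) / a" unfolding \<rho>_def using q b by (intro real_root_pow_pos2) auto
  have \<rho>1: "\<rho> \<ge> 1" unfolding \<rho>_def using q b by simp
  have le: "cmod (dbar_integrand \<beta> u z k w) \<le> F * a * \<rho> ^ (b - 1) * (indicator (ball 1 (\<rho> + 2)) w / cmod (w - 1))" for w
  proof (cases "w = 0 \<or> u k (weighted_action \<beta> w z) = 0")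
    case True
    then show ?thesis using F a \<rho>1 by (auto simp: dbar_integrand_def)
  next
    case False
    then have w0: "w \<noteq> 0" and "norm (weighted_action \<beta> w z) \<le> R" using supp by (auto simp: not_less[symmetric])
    then have "cmod w ^ b * a \<le> R"
      using Finite_Cartesian_Product.norm_nth_le[of "weighted_action \<beta> w z" k]
      by (simp add: norm_mult norm_power a_def b_def)
    then have "cmod w ^ b \<le> (R + r + 1) / a" using a by (simp add: field_simps)
    then have "cmod w ^ b \<le> \<rho> ^ b" by (simp add: \<rho>b)
    then have wr: "cmod w \<le> \<rho>" using b \<rho>1 by (simp add: power_mono_iff)
    have "dist 1 w \<le> 1 + cmod w" using norm_triangle_ineq4[of 1 w] by (simp add: dist_norm)
    then have ind: "w \<in> ball 1 (\<rho> + 2)" using wr by simp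
    have pw: "cmod w ^ b / cmod w = cmod w ^ (b - 1)" using w0 b by (cases b) auto
    have "cmod (dbar_integrand \<beta> u z k w) = cmod (u k (weighted_action \<beta> w z)) * a * (cmod w ^ b / cmod w) * (1 / cmod (w - 1))"
      unfolding dbar_integrand_def norm_divide norm_mult complex_mod_cnj norm_power a_def b_def by simp
    also have "\<dots> \<le> F * a * \<rho> ^ (b - 1) * (1 / cmod (w - 1))"
      unfolding pw using u F a wr by (intro mult_right_mono mult_mono power_mono) auto
    finally show ?thesis using ind by simp
  qed
  have "(\<integral>\<^sup>+w. ennreal (cmod (dbar_integrand \<beta> u z k w)) \<partial>lborel) \<le>
      (\<integral>\<^sup>+w. ennreal (F * a * \<rho> ^ (b - 1)) * ennreal (indicator (ball 1 (\<rho> + 2)) w / cmod (w - 1)) \<partial>lborel)"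
    using le F a \<rho>1 by (intro nn_integral_mono) (simp add: ennreal_mult[symmetric])
  also have "\<dots> = ennreal (F * a * \<rho> ^ (b - 1)) * (\<integral>\<^sup>+w. ennreal (indicator (ball 1 (\<rho> + 2)) w / cmod (w - 1)) \<partial>lborel)"
  proof (rule nn_integral_cmult)
    have [measurable]: "ball (1::complex) (\<rho> + 2) \<in> sets borel" by simp
    show "(\<lambda>w. ennreal (indicator (ball 1 (\<rho> + 2)) w / cmod (w - 1))) \<in> borel_measurable lborel" by measurable
  qed
  also have "\<dots> \<le> ennreal (F * a * \<rho> ^ (b - 1)) * ennreal (4 * pi * (\<rho> + 2))"
    using \<rho>1 by (intro mult_left_mono nn_integral_inverse_norm) auto
  also have "\<dots> = ennreal (F * a * \<rho> ^ (b - 1) * (4 * pi * (\<rho> + 2)))"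
    using F a \<rho>1 by (intro ennreal_mult[symmetric]) auto
  also have "\<dots> \<le> ennreal (12 * pi * F * (R + r + 1))"
  proof (rule ennreal_leI)
    have "F * a * \<rho> ^ (b - 1) * (4 * pi * (\<rho> + 2)) \<le> F * a * \<rho> ^ (b - 1) * (4 * pi * (3 * \<rho>))"
      using F a \<rho>1 by (intro mult_left_mono) auto
    also have "\<dots> = 12 * pi * F * (a * (\<rho> ^ (b - 1) * \<rho>))" by simp
    also have "\<rho> ^ (b - 1) * \<rho> = \<rho> ^ b" using b by (cases b) auto
    also have "a * \<rho> ^ b = R + r + 1" using a by (simp add: \<rho>b)
    finally show "F * a * \<rho> ^ (b - 1) * (4 * pi * (\<rho> + 2)) \<le> 12 * pi * F * (R + r + 1)" .
  qed
  finally show ?thesis .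
qed

lemma integrable_dbar_integrand:
  fixes z :: "complex ^ 'n::finite"
  assumes "\<beta> k \<ge> 1" and [measurable]: "u k \<in> borel_measurable borel"
    and u: "\<And>z. cmod (u k z) \<le> F" and supp: "\<And>z. norm z > R \<Longrightarrow> u k z = 0" and R: "R \<ge> 0"
  shows "integrable lborel (dbar_integrand \<beta> u z k)"
proof (rule integrableI_bounded)
  show "dbar_integrand \<beta> u z k \<in> borel_measurable lborel"
    unfolding dbar_integrand_def[abs_def] by measurable
  show "(\<integral>\<^sup>+w. ennreal (norm (dbar_integrand \<beta> u z k w)) \<partial>lborel) < \<infinity>"
    using nn_integral_dbar_integrand_le[of \<beta> k u F R z "norm z"] assms by (auto simp: le_less_trans)
qed

section \<open>The solution on a piece of a chart\<close>

locale solution_piece = test_piece \<beta> M I V \<Phi> K u F f \<phi>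
  for \<beta> :: "'n::finite \<Rightarrow> nat" and M I V \<Phi> K u F f \<phi> +
  fixes R\<^sub>0 :: real
  assumes u_supp: "\<And>k z. norm z > R\<^sub>0 \<Longrightarrow> u k z = 0" and R0: "R\<^sub>0 \<ge> 0"
begin

text \<open>The operator read in the chart with globally Borel data. The constant is 1/(2 pi i)
  times the factor -2 i of the area form; the weights are absorbed in
  \<open>coeff_w\<close>.\<close>

definition G :: "complex ^ 'n \<Rightarrow> complex" where
  "G t = - (1 / of_real pi) * (\<integral>w. coeff_w t w / (w - 1) \<partial>lborel)"

lemma G_meas [measurable]: "G \<in> borel_measurable borel"
  unfolding G_def[abs_def] by measurable

lemma dbar_operator_eq_G:
  assumes t: "t \<in> K" shows "dbar_operator \<beta> f (\<Phi> t) = G t"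
proof -
  have int: "integrable lborel (dbar_integrand \<beta> u (\<Phi> t) k)" for k
    by (rule integrable_dbar_integrand[OF \<beta>_pos u_meas u_bound u_supp R0])
  \<comment> \<open>At w = 0 the quotient by zero makes both integrands 0, so only nonzero w matter,
    where the orbit stays in M and u agrees with f.\<close>
  have eq: "(\<integral>w. dbar_integrand \<beta> f (\<Phi> t) k w \<partial>lborel) = (\<integral>w. dbar_integrand \<beta> u (\<Phi> t) k w \<partial>lborel)" for k
  proof (intro Bochner_Integration.integral_cong refl)
    fix w show "dbar_integrand \<beta> f (\<Phi> t) k w = dbar_integrand \<beta> u (\<Phi> t) k w"
      using u_eq[of "weighted_action \<beta> w (\<Phi> t)" k] inv[of w "\<Phi> t"] \<Phi>_in_M[OF t]
      by (cases "w = 0") (auto simp: dbar_integrand_def)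
  qed
  have c: "of_nat (\<beta> k) / (2 * of_real pi * \<i>) * (- 2 * \<i> * x) = - (1 / of_real pi) * (of_nat (\<beta> k) * x)" for k and x :: complex
    by (simp add: field_simps)
  have "dbar_operator \<beta> f (\<Phi> t) = - (1 / of_real pi) * (\<Sum>k\<in>UNIV. of_nat (\<beta> k) * (\<integral>w. dbar_integrand \<beta> u (\<Phi> t) k w \<partial>lborel))"
    unfolding dbar_operator_def integral_dw_dwbar_def eq c sum_distrib_left ..
  also have "(\<Sum>k\<in>UNIV. of_nat (\<beta> k) * (\<integral>w. dbar_integrand \<beta> u (\<Phi> t) k w \<partial>lborel)) =
      (\<integral>w. (\<Sum>k\<in>UNIV. of_nat (\<beta> k) * dbar_integrand \<beta> u (\<Phi> t) k w) \<partial>lborel)"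
    by (subst Bochner_Integration.integral_sum) (simp_all add: int)
  \<comment> \<open>Equality holds only almost everywhere: at w = 0 the left side is 0 by division
    by zero, while \<open>coeff_w\<close> can be nonzero if some weight is 1.\<close>
  also have "\<dots> = (\<integral>w. coeff_w t w / (w - 1) \<partial>lborel)"
  proof (rule integral_cong_AE)
    show "(\<lambda>w. \<Sum>k\<in>UNIV. of_nat (\<beta> k) * dbar_integrand \<beta> u (\<Phi> t) k w) \<in> borel_measurable lborel"
      using int by (intro borel_measurable_sum borel_measurable_times borel_measurable_const borel_measurable_integrable)
    show "(\<lambda>w. coeff_w t w / (w - 1)) \<in> borel_measurable lborel" by measurable
    have *: "(\<Sum>k\<in>UNIV. of_nat (\<beta> k) * dbar_integrand \<beta> u (\<Phi> t) k w) = coeff_w t w / (w - 1)" if w: "w \<noteq> 0" for w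
    proof -
      have "of_nat (\<beta> k) * dbar_integrand \<beta> u (\<Phi> t) k w =
          u k (weighted_action \<beta> w (\<Phi>\<^sub>0 t)) * cnj (of_nat (\<beta> k) * w ^ (\<beta> k - 1) * \<Phi>\<^sub>0 t $ k) / (w - 1)" for k
      proof -
        have "cnj w ^ \<beta> k = cnj w * cnj w ^ (\<beta> k - 1)" using \<beta>_pos[of k] by (cases "\<beta> k") auto
        then show ?thesis using w unfolding dbar_integrand_def \<Phi>0_eq[OF t] by simp
      qed
      then show ?thesis unfolding coeff_w_def sum_divide_distrib by simp
    qed
    show "AE w in lborel. (\<Sum>k\<in>UNIV. of_nat (\<beta> k) * dbar_integrand \<beta> u (\<Phi> t) k w) = coeff_w t w / (w - 1)"
      using AE_lborel_singleton[of "0::complex"] by eventually_elim (rule *)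
  qed
  finally show ?thesis by (simp add: G_def)
qed

text \<open>The estimate of the integrand depends only on an upper bound for |z|, so it survives a
  zero of \<Phi> in K. Local integrability and the removal of that zero both rest on this.\<close>

lemma G_bounded: "\<exists>C. \<forall>t\<in>K. cmod (G t) \<le> C"
proof -
  obtain r where r: "r \<ge> 0" "\<And>t. norm (\<Phi>\<^sub>0 t) \<le> r" using \<Phi>0_bounded by auto
  let ?B = "12 * pi * F * (R\<^sub>0 + r + 1)"
  have B: "?B \<ge> 0" using F_nonneg R0 r(1) by (intro mult_nonneg_nonneg) auto
  have "cmod (G t) \<le> (\<Sum>k\<in>UNIV. real (\<beta> k) / pi * ?B)" if t: "t \<in> K" for t
  proof -
    have z: "norm (\<Phi> t) \<le> r" using r(2)[of t] \<Phi>0_eq[OF t] by simp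
    have bound: "cmod (\<integral>w. dbar_integrand \<beta> f (\<Phi> t) k w \<partial>lborel) \<le> ?B" for k
    proof -
      have eq: "dbar_integrand \<beta> f (\<Phi> t) k = dbar_integrand \<beta> u (\<Phi> t) k"
      proof
        fix w show "dbar_integrand \<beta> f (\<Phi> t) k w = dbar_integrand \<beta> u (\<Phi> t) k w"
          using u_eq[of "weighted_action \<beta> w (\<Phi> t)" k] inv[of w "\<Phi> t"] \<Phi>_in_M[OF t]
          by (cases "w = 0") (auto simp: dbar_integrand_def)
      qed
      have "ennreal (cmod (\<integral>w. dbar_integrand \<beta> f (\<Phi> t) k w \<partial>lborel)) \<le> (\<integral>\<^sup>+w. ennreal (cmod (dbar_integrand \<beta> u (\<Phi> t) k w)) \<partial>lborel)"
        unfolding eq by (intro integral_norm_bound_ennreal integrable_dbar_integrand[OF \<beta>_pos u_meas u_bound u_supp R0])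
      also have "\<dots> \<le> ennreal ?B"
        by (rule nn_integral_dbar_integrand_le[OF \<beta>_pos u_bound u_supp R0 z])
      finally show ?thesis using B by (simp only: ennreal_le_iff)
    qed
    have "cmod (G t) = cmod (dbar_operator \<beta> f (\<Phi> t))" using dbar_operator_eq_G[OF t] by simp
    also have "\<dots> \<le> (\<Sum>k\<in>UNIV. real (\<beta> k) / pi * ?B)"
      unfolding dbar_operator_def
    proof (rule order_trans[OF norm_sum sum_mono])
      fix k
      have "cmod (of_nat (\<beta> k) / (2 * of_real pi * \<i>) * integral_dw_dwbar (dbar_integrand \<beta> f (\<Phi> t) k)) =
          real (\<beta> k) / pi * cmod (\<integral>w. dbar_integrand \<beta> f (\<Phi> t) k w \<partial>lborel)"
        by (simp add: integral_dw_dwbar_def norm_mult norm_divide)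
      also have "\<dots> \<le> real (\<beta> k) / pi * ?B" by (intro mult_left_mono bound) auto
      finally show "cmod (of_nat (\<beta> k) / (2 * of_real pi * \<i>) * integral_dw_dwbar (dbar_integrand \<beta> f (\<Phi> t) k)) \<le> real (\<beta> k) / pi * ?B" .
    qed
    finally show ?thesis .
  qed
  then show ?thesis by blast
qed

lemma set_integrable_solution: "set_integrable \<mu> K (dbar_operator \<beta> f \<circ> \<Phi>)"
proof -
  obtain C where C: "\<And>t. t \<in> K \<Longrightarrow> cmod (G t) \<le> C" using G_bounded by blast
  have "integrable \<mu> (\<lambda>t. indicator K t *\<^sub>R G t)"
    by (rule integrable_on_piece[of _ C]) (use C in auto)
  moreover have "(\<lambda>t. indicator K t *\<^sub>R G t) = (\<lambda>t. indicator K t *\<^sub>R (dbar_operator \<beta> f \<circ> \<Phi>) t)"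
  proof
    fix t show "indicator K t *\<^sub>R G t = indicator K t *\<^sub>R (dbar_operator \<beta> f \<circ> \<Phi>) t"
      using dbar_operator_eq_G[of t] by (cases "t \<in> K") auto
  qed
  ultimately show ?thesis by (simp add: set_integrable_def)
qed

section \<open>The equation tested in a single chart\<close>

lemma chart_integral_eqI:
  assumes "\<And>t. t \<in> K \<Longrightarrow> h t = H t" "\<And>t. t \<notin> K \<Longrightarrow> t \<in> coord_subspace I \<Longrightarrow> h t = 0" "\<And>t. t \<notin> K \<Longrightarrow> H t = 0"
  shows "chart_integral I V h = (\<integral>t. H t \<partial>\<mu>)"
  unfolding chart_integral_def set_lebesgue_integral_def
proof (intro Bochner_Integration.integral_cong refl)
  fix t show "indicator (V \<inter> coord_subspace I) t *\<^sub>R h t = H t"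
    using assms[of t] K_sub by (cases "t \<in> K"; cases "t \<in> V \<inter> coord_subspace I") auto
qed

lemma pullback_eq:
  assumes t: "t \<in> K" shows "pullback_coeff \<Phi> f j t = coeff_t j t 1"
  unfolding pullback_coeff_def coeff_t_def \<Phi>0_eq[OF t] D0_eq[OF t]
  using u_eq[OF \<Phi>_in_M[OF t]] by simp

text \<open>Pairing with the test function in t leaves functions of w alone: \<alpha> from a and B
  from b_i. The mixed equation says \<open>dbar\<close> B = - \<alpha> weakly off 0, so the
  Cauchy-Pompeiu formula gives pi B 1, and Fubini recognises the same integral as - pi times G
  tested against the derivative of \<phi>. Nonvanishing of \<Phi> on K gives \<alpha> and B compact
  support.\<close>

lemma chart_equation_nonzero:
  assumes i: "i \<in> I" and nz: "\<And>t. t \<in> K \<Longrightarrow> \<Phi> t \<noteq> 0"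
  shows "chart_integral I V (\<lambda>t. dbar_operator \<beta> f (\<Phi> t) * wirtinger_bar i \<phi> t) =
    - chart_integral I V (\<lambda>t. pullback_coeff \<Phi> f i t * \<phi> t)"
proof -
  have L: "chart_integral I V (\<lambda>t. dbar_operator \<beta> f (\<Phi> t) * wirtinger_bar i \<phi> t) = (\<integral>t. G t * d\<phi> i t \<partial>\<mu>)"
  proof (rule chart_integral_eqI)
    show "dbar_operator \<beta> f (\<Phi> t) * wirtinger_bar i \<phi> t = G t * d\<phi> i t" if "t \<in> K" for t
      using dbar_operator_eq_G[OF that] that by (simp add: d\<phi>_def)
  qed (use wirtinger_outside[OF i] d\<phi>_outside in auto)
  have Rr: "chart_integral I V (\<lambda>t. pullback_coeff \<Phi> f i t * \<phi> t) = (\<integral>t. coeff_t i t 1 * \<phi>\<^sub>0 t \<partial>\<mu>)"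
  proof (rule chart_integral_eqI)
    show "pullback_coeff \<Phi> f i t * \<phi> t = coeff_t i t 1 * \<phi>\<^sub>0 t" if "t \<in> K" for t
      using pullback_eq[OF that] that by (simp add: \<phi>\<^sub>0_def)
  qed (use \<phi>_supp \<phi>0_outside in auto)
  define \<alpha> where "\<alpha> w = (\<integral>t. coeff_w t w * d\<phi> i t \<partial>\<mu>)" for w
  define B where "B w = (\<integral>t. coeff_t i t w * \<phi>\<^sub>0 t \<partial>\<mu>)" for w
  obtain R where R: "R \<ge> 1" "\<And>t w. t \<in> K \<Longrightarrow> cmod w > R \<Longrightarrow> norm (weighted_action \<beta> w (\<Phi>\<^sub>0 t)) > R\<^sub>0"
  proof -
    have cc: "closed (\<Phi> ` K)"
      by (intro compact_imp_closed compact_continuous_image continuous_on_subset[OF \<Phi>_continuous] K K_sub)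
    have "0 \<notin> \<Phi> ` K" using nz by force
    from separate_point_closed[OF cc this] obtain m where "m > 0" and m': "\<forall>x\<in>\<Phi> ` K. m \<le> dist 0 x" by (elim exE conjE)
    then have m: "m > 0" "\<And>t. t \<in> K \<Longrightarrow> m \<le> dist 0 (\<Phi> t)" by simp_all
    have "norm (weighted_action \<beta> w (\<Phi>\<^sub>0 t)) > R\<^sub>0" if t: "t \<in> K" and w: "cmod w > max 1 (R\<^sub>0 / m)" for t w
    proof -
      have "R\<^sub>0 = (R\<^sub>0 / m) * m" using m by simp
      also have "\<dots> < cmod w * m" using w m by (intro mult_strict_right_mono) auto
      also have "\<dots> \<le> cmod w * norm (\<Phi>\<^sub>0 t)" using m(2)[OF t] by (intro mult_left_mono) (auto simp: \<Phi>0_eq[OF t])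
      also have "\<dots> \<le> norm (weighted_action \<beta> w (\<Phi>\<^sub>0 t))"
        by (rule norm_weighted_action_ge[OF \<beta>_pos]) (use w in simp)
      finally show ?thesis .
    qed
    then show ?thesis using that[of "max 1 (R\<^sub>0 / m)"] by simp
  qed
  have cw0: "coeff_w t w = 0" "coeff_t i t w = 0" if "t \<in> K" "cmod w > R" for t w
    using u_supp[OF R(2)[OF that]] by (simp_all add: coeff_w_def coeff_t_def)
  obtain Cw where Cw: "Cw \<ge> 0" "\<And>t w. cmod w \<le> R \<Longrightarrow> cmod (coeff_w t w) \<le> Cw" using coeff_w_bounded[of R] by (elim exE conjE) simp
  obtain Ct where Ct: "Ct \<ge> 0" "\<And>t w. cmod w \<le> R \<Longrightarrow> cmod (coeff_t i t w) \<le> Ct" using coeff_t_bounded[of R i] by (elim exE conjE) simp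
  obtain Pd where Pd: "Pd \<ge> 0" "\<And>t. cmod (d\<phi> i t) \<le> Pd" using d\<phi>_bounded[of i] by (elim exE conjE) simp
  obtain P0 where P0: "P0 \<ge> 0" "\<And>t. cmod (\<phi>\<^sub>0 t) \<le> P0" using \<phi>0_bounded by (elim exE conjE) simp
  have hw: "cmod (coeff_w t w * d\<phi> i t) \<le> Cw * Pd" for t w
  proof (cases "t \<in> K \<and> cmod w \<le> R")
    case True
    then show ?thesis unfolding norm_mult using Cw Pd by (intro mult_mono) auto
  next
    case False
    then have z: "coeff_w t w * d\<phi> i t = 0" using cw0[of t w] d\<phi>_outside[of t] by (cases "t \<in> K") auto
    show ?thesis unfolding z using Cw(1) Pd(1) by simp
  qed
  have ht: "cmod (coeff_t i t w * \<phi>\<^sub>0 t) \<le> Ct * P0" for t w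
  proof (cases "t \<in> K \<and> cmod w \<le> R")
    case True
    then show ?thesis unfolding norm_mult using Ct P0 by (intro mult_mono) auto
  next
    case False
    then have z: "coeff_t i t w * \<phi>\<^sub>0 t = 0" using cw0[of t w] \<phi>0_outside[of t] by (cases "t \<in> K") auto
    show ?thesis unfolding z using Ct(1) P0(1) by simp
  qed
  define k where "k = measure \<mu> K"
  have norm_int: "cmod (\<integral>t. h t \<partial>\<mu>) \<le> C * k" if hm [measurable]: "h \<in> borel_measurable borel" and "\<And>t. cmod (h t) \<le> C" "\<And>t. t \<notin> K \<Longrightarrow> h t = 0"
    for h :: "complex ^ 'n \<Rightarrow> complex" and C
  proof -
    have "cmod (\<integral>t. h t \<partial>\<mu>) \<le> (\<integral>t. cmod (h t) \<partial>\<mu>)" by (rule integral_norm_bound)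
    also have "\<dots> \<le> (\<integral>t. C * indicator K t \<partial>\<mu>)"
    proof (rule integral_mono)
      show "integrable \<mu> (\<lambda>t. cmod (h t))" by (rule integrable_on_piece[of _ C]) (use that in auto)
      show "integrable \<mu> (\<lambda>t. C * indicator K t :: real)"
        using emeasure_K by (intro integrable_mult_right integrable_real_indicator) auto
      show "cmod (h t) \<le> C * indicator K t" for t using that(2,3)[of t] by (cases "t \<in> K") auto
    qed
    also have "\<dots> = C * k" by (simp add: k_def)
    finally show ?thesis .
  qed
  have k0: "k \<ge> 0" by (simp add: k_def)
  have eqB: "of_real pi * B 1 = (\<integral>w. \<alpha> w / (w - 1) \<partial>lborel)"
  proof (rule weak_cauchy_pompeiu[symmetric])
    show "\<alpha> \<in> borel_measurable borel" "B \<in> borel_measurable borel"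
    proof -
      have "(\<lambda>x. coeff_w (snd x) (fst x) * d\<phi> i (snd x)) \<in> borel_measurable (borel \<Otimes>\<^sub>M \<mu>)"
        and "(\<lambda>x. coeff_t i (snd x) (fst x) * \<phi>\<^sub>0 (snd x)) \<in> borel_measurable (borel \<Otimes>\<^sub>M \<mu>)" by measurable
      then show "\<alpha> \<in> borel_measurable borel" "B \<in> borel_measurable borel"
        unfolding \<alpha>_def[abs_def] B_def[abs_def]
        by (auto intro!: sigma_finite_measure.borel_measurable_lebesgue_integral[OF sigma_finite_coord_lebesgue] simp: split_beta')
    qed
    show "cmod (\<alpha> w) \<le> Cw * Pd * k + Ct * P0 * k" for w
    proof -
      have "cmod (\<alpha> w) \<le> Cw * Pd * k" unfolding \<alpha>_def by (rule norm_int) (use hw d\<phi>_outside in auto)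
      moreover have "0 \<le> Ct * P0 * k" using Ct P0 k0 by simp
      ultimately show ?thesis by simp
    qed
    show "cmod (B w) \<le> Cw * Pd * k + Ct * P0 * k" for w
    proof -
      have "cmod (B w) \<le> Ct * P0 * k" unfolding B_def by (rule norm_int) (use ht \<phi>0_outside in auto)
      moreover have "0 \<le> Cw * Pd * k" using Cw Pd k0 by simp
      ultimately show ?thesis by simp
    qed
    show "\<alpha> w = 0" "B w = 0" if "cmod w > R" for w
    proof -
      have z: "coeff_w t w * d\<phi> i t = 0" "coeff_t i t w * \<phi>\<^sub>0 t = 0" for t
        using cw0[of t w] that d\<phi>_outside[of t] \<phi>0_outside[of t] by (cases "t \<in> K"; simp)+
      show "\<alpha> w = 0" "B w = 0" unfolding \<alpha>_def B_def z by simp_all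
    qed
    \<comment> \<open>The powers of w come out of the t-integral, leaving for each coefficient an
      integral along the moved piece, to which weak continuity applies.\<close>
    show "isCont B 1"
    proof -
      let ?\<psi> = "\<lambda>j t. cnj (D\<^sub>0 i t $ j) * \<phi>\<^sub>0 t"
      obtain C2 where C2: "C2 \<ge> 0" "\<And>t. norm (D\<^sub>0 i t) \<le> C2" using D0_bounded by auto
      have \<psi>b: "cmod (?\<psi> j t) \<le> C2 * P0" for j t
        unfolding norm_mult complex_mod_cnj using C2 P0 order_trans[OF Finite_Cartesian_Product.norm_nth_le C2(2)]
        by (intro mult_mono) auto
      have intj: "integrable \<mu> (\<lambda>t. u j (weighted_action \<beta> w (\<Phi>\<^sub>0 t)) * ?\<psi> j t)" for j w
      proof (rule integrable_on_piece)
        show "cmod (u j (weighted_action \<beta> w (\<Phi>\<^sub>0 t)) * ?\<psi> j t) \<le> F * (C2 * P0)" for t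
          unfolding norm_mult[of "u j _"] using u_bound \<psi>b F_nonneg by (intro mult_mono) auto
      qed (use \<phi>0_outside in auto)
      have "B = (\<lambda>w. \<Sum>j\<in>UNIV. cnj (w ^ \<beta> j) * (\<integral>t. u j (weighted_action \<beta> w (\<Phi>\<^sub>0 t)) * ?\<psi> j t \<partial>\<mu>))"
      proof
        fix w
        have "B w = (\<integral>t. (\<Sum>j\<in>UNIV. cnj (w ^ \<beta> j) * (u j (weighted_action \<beta> w (\<Phi>\<^sub>0 t)) * ?\<psi> j t)) \<partial>\<mu>)"
          unfolding B_def coeff_t_def sum_distrib_right by (simp add: mult_ac)
        also have "\<dots> = (\<Sum>j\<in>UNIV. (\<integral>t. cnj (w ^ \<beta> j) * (u j (weighted_action \<beta> w (\<Phi>\<^sub>0 t)) * ?\<psi> j t) \<partial>\<mu>))"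
          by (intro Bochner_Integration.integral_sum integrable_mult_right intj)
        also have "\<dots> = (\<Sum>j\<in>UNIV. cnj (w ^ \<beta> j) * (\<integral>t. u j (weighted_action \<beta> w (\<Phi>\<^sub>0 t)) * ?\<psi> j t \<partial>\<mu>))"
          by (simp only: integral_mult_right_zero)
        finally show "B w = (\<Sum>j\<in>UNIV. cnj (w ^ \<beta> j) * (\<integral>t. u j (weighted_action \<beta> w (\<Phi>\<^sub>0 t)) * ?\<psi> j t \<partial>\<mu>))" .
      qed
      moreover have "isCont (\<lambda>w. \<Sum>j\<in>UNIV. cnj (w ^ \<beta> j) * (\<integral>t. u j (weighted_action \<beta> w (\<Phi>\<^sub>0 t)) * ?\<psi> j t \<partial>\<mu>)) 1"
      proof (intro continuous_sum continuous_mult)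
        show "isCont (\<lambda>w. cnj (w ^ \<beta> j)) 1" for j by (intro continuous_intros)
        show "isCont (\<lambda>w. \<integral>t. u j (weighted_action \<beta> w (\<Phi>\<^sub>0 t)) * ?\<psi> j t \<partial>\<mu>) 1" for j
          by (rule isCont_action_integral[OF u_meas u_bound _ \<psi>b]) (use \<phi>0_outside in auto)
      qed
      ultimately show ?thesis by simp
    qed
    show "(\<integral>w. \<alpha> w * \<theta> w \<partial>lborel) = (\<integral>w. B w * dbar \<theta> w \<partial>lborel)"
      if "smooth \<theta>" "compact W" "0 \<notin> W" "\<And>w. w \<notin> W \<Longrightarrow> \<theta> w = 0" for \<theta> W
      using mixed_equation[OF i that] unfolding \<alpha>_def B_def by simp
  qed
  let ?h = "\<lambda>t w. coeff_w t w * d\<phi> i t / (w - 1)"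
  let ?J = "\<lambda>w. indicator (cball (0::complex) R) w / cmod (w - 1) :: real"
  have iJ: "integrable lborel ?J" by (rule integrable_inverse_norm) simp_all
  \<comment> \<open>On K times a disc the integrand is at most a constant over |w - 1|, and it
    vanishes elsewhere.\<close>
  have ih: "integrable (\<mu> \<Otimes>\<^sub>M lborel) (case_prod ?h)"
  proof (rule Bochner_Integration.integrable_bound)
    have [measurable]: "cball (0::complex) R \<in> sets borel" by simp
    show "integrable (\<mu> \<Otimes>\<^sub>M lborel) (\<lambda>x. Cw * Pd * (indicator K (fst x) * ?J (snd x)))"
    proof (intro integrable_mult_right)
      show "integrable (\<mu> \<Otimes>\<^sub>M lborel) (\<lambda>x. indicator K (fst x) * ?J (snd x))"
      proof (rule pair.Fubini_integrable)
        show "(\<lambda>x. indicator K (fst x) * ?J (snd x)) \<in> borel_measurable (\<mu> \<Otimes>\<^sub>M lborel)" by measurable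
        have "(\<lambda>t. \<integral>w. norm (indicator K (fst (t, w)) * ?J (snd (t, w))) \<partial>lborel) = (\<lambda>t. indicator K t * (\<integral>w. ?J w \<partial>lborel))"
          by (auto simp: fun_eq_iff indicator_def)
        moreover have "integrable \<mu> (\<lambda>t. indicator K t * (\<integral>w. ?J w \<partial>lborel))"
          using emeasure_K by (intro integrable_mult_left integrable_real_indicator) auto
        ultimately show "integrable \<mu> (\<lambda>t. \<integral>w. norm (indicator K (fst (t, w)) * ?J (snd (t, w))) \<partial>lborel)" by simp
        show "AE t in \<mu>. integrable lborel (\<lambda>w. indicator K (fst (t, w)) * ?J (snd (t, w)))"
          unfolding fst_conv snd_conv by (intro AE_I2 integrable_mult_right iJ)
      qed
    qed
    show "case_prod ?h \<in> borel_measurable (\<mu> \<Otimes>\<^sub>M lborel)" by (simp add: split_beta')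
    show "AE x in \<mu> \<Otimes>\<^sub>M lborel. norm (case_prod ?h x) \<le> norm (Cw * Pd * (indicator K (fst x) * ?J (snd x)))"
    proof (rule AE_I2)
      fix x :: "(complex ^ 'n) \<times> complex"
      obtain t w where x: "x = (t, w)" by (cases x)
      have "norm (?h t w) \<le> norm (Cw * Pd * (indicator K t * ?J w))"
      proof (cases "t \<in> K \<and> cmod w \<le> R")
        case True
        have "norm (?h t w) \<le> Cw * Pd / cmod (w - 1)"
          unfolding norm_divide by (intro divide_right_mono hw) auto
        then show ?thesis using True Cw Pd by simp
      next
        case False
        then have z: "coeff_w t w * d\<phi> i t = 0" using cw0[of t w] d\<phi>_outside[of t] by (cases "t \<in> K") auto
        show ?thesis unfolding z by simp
      qed
      then show "norm (case_prod ?h x) \<le> norm (Cw * Pd * (indicator K (fst x) * ?J (snd x)))" by (simp add: x)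
    qed
  qed
  have "(\<integral>w. \<alpha> w / (w - 1) \<partial>lborel) = (\<integral>w. \<integral>t. ?h t w \<partial>\<mu> \<partial>lborel)"
    by (simp add: \<alpha>_def)
  also have "\<dots> = (\<integral>t. \<integral>w. ?h t w \<partial>lborel \<partial>\<mu>)" by (rule pair.Fubini_integral[OF ih])
  also have "\<dots> = (\<integral>t. - of_real pi * (G t * d\<phi> i t) \<partial>\<mu>)"
  proof (intro Bochner_Integration.integral_cong refl)
    fix t
    have "(\<integral>w. ?h t w \<partial>lborel) = (\<integral>w. coeff_w t w / (w - 1) * d\<phi> i t \<partial>lborel)" by simp
    also have "\<dots> = (\<integral>w. coeff_w t w / (w - 1) \<partial>lborel) * d\<phi> i t" by (rule integral_mult_left_zero)
    finally show "(\<integral>w. ?h t w \<partial>lborel) = - of_real pi * (G t * d\<phi> i t)" by (simp add: G_def)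
  qed
  also have "\<dots> = - of_real pi * (\<integral>t. G t * d\<phi> i t \<partial>\<mu>)" by (rule integral_mult_right_zero)
  finally have "of_real pi * B 1 = - of_real pi * (\<integral>t. G t * d\<phi> i t \<partial>\<mu>)" using eqB by simp
  then have e: "of_real pi * B 1 = of_real pi * - (\<integral>t. G t * d\<phi> i t \<partial>\<mu>)" by simp
  have "complex_of_real pi \<noteq> 0" by simp
  from mult_left_cancel[THEN iffD1, OF this e] have "B 1 = - (\<integral>t. G t * d\<phi> i t \<partial>\<mu>)" .
  then show ?thesis unfolding L Rr B_def by simp
qed

text \<open>
  The vanishing point of \<open>\<Phi>\<close>, if there is one in \<open>K\<close>, is cut off in the coordinate \<open>t\<^sub>i\<close>; as the
  solution is bounded, the cut-off can be removed.
\<close>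

lemma chart_equation:
  assumes i: "i \<in> I"
  shows "chart_integral I V (\<lambda>t. dbar_operator \<beta> f (\<Phi> t) * wirtinger_bar i \<phi> t) =
    - chart_integral I V (\<lambda>t. pullback_coeff \<Phi> f i t * \<phi> t)"
proof (cases "\<exists>t0\<in>K. \<Phi> t0 = 0")
  case False
  then show ?thesis by (intro chart_equation_nonzero[OF i]) auto
next
  case True
  then obtain t0 where t0: "t0 \<in> K" "\<Phi> t0 = 0" by auto
  \<comment> \<open>The distance in the i-th coordinate from the zero, spelled as a twist with w0 =
    - t0_i, c = 1 and l = i so that \<open>twisted_wirtinger\<close> differentiates the
    cut-off.\<close>
  let ?s = "\<lambda>t :: complex ^ 'n. - t0 $ i + 1 * t $ i"
  define c where "c n = cut_zero (real (Suc n))" for n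
  define \<phi>' where "\<phi>' n t = \<phi> t * c n (?s t)" for n t
  \<comment> \<open>The cut-off test function is supported here, and t0 is excluded.\<close>
  define K' where "K' n = K \<inter> {t. 1 / real (Suc n) \<le> cmod (?s t)}" for n
  have csm: "smooth (c n)" for n by (simp add: c_def smooth_cut_zero)
  have bl: "bounded_linear (\<lambda>t :: complex ^ 'n. 1 * t $ i)"
    by (rule bounded_linear_compose[OF bounded_linear_mult_right bounded_linear_vec_nth])
  have eq_n: "chart_integral I V (\<lambda>t. dbar_operator \<beta> f (\<Phi> t) * wirtinger_bar i (\<phi>' n) t) =
    - chart_integral I V (\<lambda>t. pullback_coeff \<Phi> f i t * \<phi>' n t)" for n
  proof -
    have "solution_piece \<beta> M I V \<Phi> (K' n) u F f (\<phi>' n) R\<^sub>0"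
    proof
      show "submanifold_chart M I V \<Phi>" by (rule chart)
      show "weighted_action \<beta> w z \<in> M \<longleftrightarrow> z \<in> M" if "w \<noteq> 0" for w z using that by (rule inv)
      have "closed {t. 1 / real (Suc n) \<le> cmod (?s t)}" by (intro closed_Collect_le continuous_intros)
      then show "compact (K' n)" unfolding K'_def by (rule compact_Int_closed[OF K(1)])
      show "K' n \<subseteq> V \<inter> coord_subspace I" using K(2) by (auto simp: K'_def)
      show "smooth (\<phi>' n)" unfolding \<phi>'_def by (intro smooth_mult \<phi>_smooth smooth_affine[OF bl] csm)
      show "\<phi>' n t = 0" if t: "t \<in> coord_subspace I - K' n" for t
      proof (cases "t \<in> K")
        case True
        then have "cmod (?s t) < 1 / real (Suc n)" using t by (simp add: K'_def)
        then have "real (Suc n) * cmod (?s t) \<le> 1" by (simp add: field_simps)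
        then have "(real (Suc n) * cmod (?s t))\<^sup>2 \<le> 1\<^sup>2" by (intro power_mono) auto
        then have "(real (Suc n))\<^sup>2 * (?s t \<bullet> ?s t) - 1 \<le> 0" by (simp add: dot_square_norm power_mult_distrib)
        then have "c n (?s t) = 0" unfolding c_def cut_zero_def flat_def by simp
        then show ?thesis by (simp add: \<phi>'_def)
      next
        case False
        then show ?thesis using t \<phi>_supp[of t] by (simp add: \<phi>'_def)
      qed
    qed (use u_meas u_bound \<beta>_pos u_eq closed_form u_supp R0 in auto)
    then show ?thesis
    proof (rule solution_piece.chart_equation_nonzero[OF _ i])
      fix t assume t: "t \<in> K' n"
      show "\<Phi> t \<noteq> 0"
      proof
        assume "\<Phi> t = 0"
        \<comment> \<open>Injectivity of \<Phi> leaves t0 as its only zero.\<close>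
        then have "t = t0" using inj_onD[OF \<Phi>_inj, of t t0] t t0 K_sub by (auto simp: K'_def)
        moreover have "?s t0 = 0" by simp
        ultimately show False using t by (simp add: K'_def)
      qed
    qed
  qed
  obtain CG where CG: "\<And>t. t \<in> K \<Longrightarrow> cmod (G t) \<le> CG" using G_bounded by blast
  obtain Pd where Pd: "Pd \<ge> 0" "\<And>t. cmod (d\<phi> i t) \<le> Pd" using d\<phi>_bounded[of i] by (elim exE conjE) simp
  obtain P0 where P0: "P0 \<ge> 0" "\<And>t. cmod (\<phi>\<^sub>0 t) \<le> P0" using \<phi>0_bounded by (elim exE conjE) simp
  obtain Ct where Ct: "Ct \<ge> 0" "\<And>t w. cmod w \<le> 1 \<Longrightarrow> cmod (coeff_t i t w) \<le> Ct" using coeff_t_bounded[of 1 i] by (elim exE conjE) simp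
  have CG0: "CG \<ge> 0" using order_trans[OF norm_ge_zero CG[OF t0(1)]] .
  have [measurable]: "c n \<in> borel_measurable borel" "dbar (c n) \<in> borel_measurable borel" for n
    by (auto intro!: borel_measurable_continuous_onI smooth_continuous_on smooth_dbar csm)
  let ?l = "\<lambda>n t. G t * (d\<phi> i t * c n (?s t) + \<phi>\<^sub>0 t * dbar (c n) (?s t))"
  have Ln: "chart_integral I V (\<lambda>t. dbar_operator \<beta> f (\<Phi> t) * wirtinger_bar i (\<phi>' n) t) = (\<integral>t. ?l n t \<partial>\<mu>)" for n
  proof (rule chart_integral_eqI)
    have w: "wirtinger_bar i (\<phi>' n) t = wirtinger_bar i \<phi> t * c n (?s t) + \<phi> t * dbar (c n) (?s t)" for t
      unfolding \<phi>'_def using twisted_wirtinger[OF csm, of i n "- t0 $ i" 1 i t] by simp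
    show "dbar_operator \<beta> f (\<Phi> t) * wirtinger_bar i (\<phi>' n) t = ?l n t" if "t \<in> K" for t
      using dbar_operator_eq_G[OF that] that by (simp add: w d\<phi>_def \<phi>\<^sub>0_def)
    show "dbar_operator \<beta> f (\<Phi> t) * wirtinger_bar i (\<phi>' n) t = 0" if "t \<notin> K" "t \<in> coord_subspace I" for t
      using wirtinger_outside[OF i, of t] \<phi>_supp[of t] that by (simp add: w)
  qed (simp add: d\<phi>_outside \<phi>0_outside)
  have L: "chart_integral I V (\<lambda>t. dbar_operator \<beta> f (\<Phi> t) * wirtinger_bar i \<phi> t) = (\<integral>t. G t * d\<phi> i t \<partial>\<mu>)"
  proof (rule chart_integral_eqI)
    show "dbar_operator \<beta> f (\<Phi> t) * wirtinger_bar i \<phi> t = G t * d\<phi> i t" if "t \<in> K" for t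
      using dbar_operator_eq_G[OF that] that by (simp add: d\<phi>_def)
  qed (use wirtinger_outside[OF i] d\<phi>_outside in auto)
  have Rn: "chart_integral I V (\<lambda>t. pullback_coeff \<Phi> f i t * \<phi>' n t) = (\<integral>t. coeff_t i t 1 * \<phi>\<^sub>0 t * c n (?s t) \<partial>\<mu>)" for n
  proof (rule chart_integral_eqI)
    show "pullback_coeff \<Phi> f i t * \<phi>' n t = coeff_t i t 1 * \<phi>\<^sub>0 t * c n (?s t)" if "t \<in> K" for t
      using pullback_eq[OF that] that by (simp add: \<phi>\<^sub>0_def \<phi>'_def)
  qed (use \<phi>_supp \<phi>0_outside in \<open>auto simp: \<phi>'_def\<close>)
  have Rr: "chart_integral I V (\<lambda>t. pullback_coeff \<Phi> f i t * \<phi> t) = (\<integral>t. coeff_t i t 1 * \<phi>\<^sub>0 t \<partial>\<mu>)"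
  proof (rule chart_integral_eqI)
    show "pullback_coeff \<Phi> f i t * \<phi> t = coeff_t i t 1 * \<phi>\<^sub>0 t" if "t \<in> K" for t
      using pullback_eq[OF that] that by (simp add: \<phi>\<^sub>0_def)
  qed (use \<phi>_supp \<phi>0_outside in auto)
  \<comment> \<open>The cut-off is constant in the other coordinates and fails to tend to 1 only on
    the slice through t0, which is a null set.\<close>
  have ne: "AE t in \<mu>. ?s t \<noteq> 0"
  proof -
    have "emeasure \<mu> {t. \<forall>k\<in>I. t $ k \<in> (if k = i then {t0 $ i} else UNIV)} = (\<Prod>k\<in>I. emeasure lborel (if k = i then {t0 $ i} else UNIV))"
      by (rule emeasure_coord_box) auto
    also have "\<dots> = 0" using i by (intro prod_zero) (auto intro!: bexI[of _ i])
    finally have "{t. \<forall>k\<in>I. t $ k \<in> (if k = i then {t0 $ i} else UNIV)} \<in> null_sets \<mu>"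
      by (auto simp: null_sets_def intro!: sets_coord_box)
    then have "AE t in \<mu>. t \<notin> {t. \<forall>k\<in>I. t $ k \<in> (if k = i then {t0 $ i} else UNIV)}" by (rule AE_not_in)
    then show ?thesis by eventually_elim (use i in \<open>auto split: if_splits\<close>)
  qed
  have c1: "cmod (c n w) \<le> 1" "cmod (dbar (c n) w) \<le> 3 / cmod w" for n w
    by (simp_all add: c_def norm_cut_zero_le norm_dbar_cut_zero_le)
  \<comment> \<open>G is bounded and the derivative of the cut-off is at most 3/|t_i - t0_i|, which
    is integrable over K. The derivative tends to 0 off the slice.\<close>
  have lim1: "(\<lambda>n. \<integral>t. ?l n t \<partial>\<mu>) \<longlonglongrightarrow> (\<integral>t. G t * d\<phi> i t \<partial>\<mu>)"
  proof (rule integral_dominated_convergence[where w = "\<lambda>t. CG * Pd * indicator K t + 3 * CG * P0 * (indicator K t / cmod (t $ i - t0 $ i))"])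
    have "integrable \<mu> (\<lambda>t. indicator K t :: real)"
      using emeasure_K by (intro integrable_real_indicator) auto
    moreover have "integrable \<mu> (\<lambda>t. indicator K t / cmod (t $ i - t0 $ i))"
      by (rule integrable_coord_inverse_norm[OF i compact_imp_bounded[OF K(1)] K_sets])
    ultimately show "integrable \<mu> (\<lambda>t. CG * Pd * indicator K t + 3 * CG * P0 * (indicator K t / cmod (t $ i - t0 $ i)))"
      by (intro Bochner_Integration.integrable_add integrable_mult_right)
    show "AE t in \<mu>. (\<lambda>n. ?l n t) \<longlonglongrightarrow> G t * d\<phi> i t"
      using ne
    proof eventually_elim
      fix t assume "?s t \<noteq> 0"
      then have "(\<lambda>n. ?l n t) \<longlonglongrightarrow> G t * (d\<phi> i t * 1 + \<phi>\<^sub>0 t * 0)"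
        unfolding c_def by (intro tendsto_intros cut_zero_tendsto dbar_cut_zero_tendsto)
      then show "(\<lambda>n. ?l n t) \<longlonglongrightarrow> G t * d\<phi> i t" by simp
    qed
    show "AE t in \<mu>. norm (?l n t) \<le> CG * Pd * indicator K t + 3 * CG * P0 * (indicator K t / cmod (t $ i - t0 $ i))" for n
    proof (rule AE_I2)
      fix t
      show "norm (?l n t) \<le> CG * Pd * indicator K t + 3 * CG * P0 * (indicator K t / cmod (t $ i - t0 $ i))"
      proof (cases "t \<in> K")
        case True
        have "norm (d\<phi> i t * c n (?s t) + \<phi>\<^sub>0 t * dbar (c n) (?s t)) \<le> Pd * 1 + P0 * (3 / cmod (?s t))"
          by (rule order_trans[OF norm_triangle_ineq]) (unfold norm_mult, intro add_mono mult_mono Pd P0 c1, use P0 in auto)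
        then have "norm (?l n t) \<le> CG * (Pd * 1 + P0 * (3 / cmod (?s t)))"
          unfolding norm_mult[of "G t"] using CG[OF True] CG0 by (intro mult_mono) auto
        also have "?s t = t $ i - t0 $ i" by simp
        finally show ?thesis using True by (simp add: algebra_simps)
      qed (simp add: d\<phi>_outside \<phi>0_outside)
    qed
  qed measurable
  have lim2: "(\<lambda>n. \<integral>t. coeff_t i t 1 * \<phi>\<^sub>0 t * c n (?s t) \<partial>\<mu>) \<longlonglongrightarrow> (\<integral>t. coeff_t i t 1 * \<phi>\<^sub>0 t \<partial>\<mu>)"
  proof (rule integral_dominated_convergence[where w = "\<lambda>t. Ct * P0 * indicator K t"])
    show "integrable \<mu> (\<lambda>t. Ct * P0 * indicator K t)"
      using emeasure_K by (intro integrable_mult_right integrable_real_indicator) auto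
    show "AE t in \<mu>. (\<lambda>n. coeff_t i t 1 * \<phi>\<^sub>0 t * c n (?s t)) \<longlonglongrightarrow> coeff_t i t 1 * \<phi>\<^sub>0 t"
      using ne
    proof eventually_elim
      fix t assume "?s t \<noteq> 0"
      then have "(\<lambda>n. coeff_t i t 1 * \<phi>\<^sub>0 t * c n (?s t)) \<longlonglongrightarrow> coeff_t i t 1 * \<phi>\<^sub>0 t * 1"
        unfolding c_def by (intro tendsto_intros cut_zero_tendsto)
      then show "(\<lambda>n. coeff_t i t 1 * \<phi>\<^sub>0 t * c n (?s t)) \<longlonglongrightarrow> coeff_t i t 1 * \<phi>\<^sub>0 t" by simp
    qed
    show "AE t in \<mu>. norm (coeff_t i t 1 * \<phi>\<^sub>0 t * c n (?s t)) \<le> Ct * P0 * indicator K t" for n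
    proof (rule AE_I2)
      fix t
      show "norm (coeff_t i t 1 * \<phi>\<^sub>0 t * c n (?s t)) \<le> Ct * P0 * indicator K t"
      proof (cases "t \<in> K")
        case True
        have "norm (coeff_t i t 1 * \<phi>\<^sub>0 t * c n (?s t)) \<le> Ct * P0 * 1"
          unfolding norm_mult using Ct P0 c1 by (intro mult_mono mult_nonneg_nonneg) auto
        then show ?thesis using True by simp
      qed (simp add: \<phi>0_outside)
    qed
  qed measurable
  have "(\<integral>t. G t * d\<phi> i t \<partial>\<mu>) = - (\<integral>t. coeff_t i t 1 * \<phi>\<^sub>0 t \<partial>\<mu>)"
    by (rule LIMSEQ_unique[OF lim1[unfolded eq_n[unfolded Ln Rn]] tendsto_minus[OF lim2]])
  then show ?thesis unfolding L Rr .
qed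

end

section \<open>From pieces of charts to the variety\<close>

theorem theorem2:
  fixes \<beta> :: "'n::finite \<Rightarrow> nat"
    and S :: "(complex ^ 'n) set"
    and f :: "'n \<Rightarrow> complex ^ 'n \<Rightarrow> complex"
  assumes "CARD('n) \<ge> 2"
    and "\<And>k. \<beta> k \<ge> 1"
    and "weighted_homogeneous_variety \<beta> S"
    and "\<And>k. f k \<in> borel_measurable (restrict_space borel S)"
    and "\<And>k. bounded (f k ` S)"
    and "\<exists>K. compact K \<and> K \<subseteq> S \<and> (\<forall>k. \<forall>z\<in>S - K. f k z = 0)"
  shows "(\<forall>z\<in>S. \<forall>k. integrable lborel (dbar_integrand \<beta> f z k)) \<and>
    (dbar_closed_on (regular_part S) f \<longrightarrow>
       dbar_solution_on (regular_part S) (dbar_operator \<beta> f) f)"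
proof -
  have clS: "closed S" by (rule weighted_homogeneous_variety_closed[OF assms(3)])
  \<comment> \<open>Extension by zero; it is Borel on the whole space because S is closed, and
    bounded with one constant for all k.\<close>
  define u where "u k z = indicator S z *\<^sub>R f k z" for k z
  have u_meas: "u k \<in> borel_measurable borel" for k
    using assms(4)[of k] borel_measurable_restrict_space_iff[of S borel "f k"] clS by (simp add: u_def[abs_def])
  have "\<exists>C. \<forall>z\<in>S. cmod (f k z) \<le> C" for k using assms(5)[of k] by (auto simp: bounded_iff)
  then obtain C where C: "\<And>k z. z \<in> S \<Longrightarrow> cmod (f k z) \<le> C k" by metis
  define F where "F = (\<Sum>k\<in>UNIV. \<bar>C k\<bar>)"
  have u_bound: "cmod (u k z) \<le> F" for k z
  proof -
    have "\<bar>C k\<bar> \<le> F" unfolding F_def by (rule member_le_sum) auto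
    then show ?thesis using C[of z k] by (cases "z \<in> S") (auto simp: u_def)
  qed
  obtain K0 where K0: "compact K0" "K0 \<subseteq> S" "\<And>k z. z \<in> S - K0 \<Longrightarrow> f k z = 0" using assms(6) by blast
  obtain R where R: "R > 0" "\<And>z. z \<in> K0 \<Longrightarrow> norm z \<le> R"
    using compact_imp_bounded[OF K0(1)] unfolding bounded_pos by blast
  have u_supp: "u k z = 0" if "norm z > R" for k z
  proof -
    have "z \<notin> K0" using R(2)[of z] that by auto
    then show ?thesis using K0(3)[of z k] by (cases "z \<in> S") (auto simp: u_def)
  qed
  have R0: "R \<ge> 0" using R by simp
  show ?thesis
  proof (intro conjI ballI allI impI)
    fix z k assume z: "z \<in> S"
    \<comment> \<open>The orbit of a point of S remains in S for every w, including 0, so the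
      integrand never sees values of f outside S.\<close>
    have "dbar_integrand \<beta> f z k = dbar_integrand \<beta> u z k"
      using weighted_homogeneous_variety_action[OF assms(3) z] by (simp add: dbar_integrand_def[abs_def] u_def)
    then show "integrable lborel (dbar_integrand \<beta> f z k)"
      using integrable_dbar_integrand[OF assms(2) u_meas u_bound u_supp R0] by simp
  next
    let ?M = "regular_part S"
    assume closed: "dbar_closed_on ?M f"
    have piece: "solution_piece \<beta> ?M I V \<Phi> K u F f \<phi> R"
      if "submanifold_chart ?M I V \<Phi>" "compact K" "K \<subseteq> V \<inter> coord_subspace I" "smooth \<phi>"
        "\<And>t. t \<in> coord_subspace I - K \<Longrightarrow> \<phi> t = 0" for I V \<Phi> K \<phi>
    proof
      show "weighted_action \<beta> w z \<in> ?M \<longleftrightarrow> z \<in> ?M" if "w \<noteq> 0" for w z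
        by (rule regular_part_action[OF assms(3) that])
      show "u k z = f k z" if "z \<in> ?M" for k z using that by (simp add: u_def regular_part_def)
    qed (use that assms(2) u_meas u_bound closed u_supp R0 in auto)
    show "dbar_solution_on ?M (dbar_operator \<beta> f) f"
      unfolding dbar_solution_on_def
    proof (intro allI impI conjI ballI)
      fix I V \<Phi> assume chart: "submanifold_chart ?M I V \<Phi>"
      show "chart_locally_integrable I V (dbar_operator \<beta> f \<circ> \<Phi>)"
        unfolding chart_locally_integrable_def
      proof (intro allI impI)
        fix K assume K: "compact K" "K \<subseteq> V \<inter> coord_subspace I"
        \<comment> \<open>Local integrability concerns G alone, so the zero test function is enough
          to enter the locale with an arbitrary compact K.\<close>
        interpret solution_piece \<beta> ?M I V \<Phi> K u F f "\<lambda>_. 0" R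
          by (rule piece[OF chart K smooth_const]) simp
        show "set_integrable (coord_lebesgue I) K (dbar_operator \<beta> f \<circ> \<Phi>)" by (rule set_integrable_solution)
      qed
      fix j assume j: "j \<in> I"
      show "chart_locally_integrable I V (pullback_coeff \<Phi> f j)"
        using closed chart j unfolding dbar_closed_on_def by blast
      fix \<phi> assume "test_function I V \<phi>"
      then obtain K where \<phi>: "smooth \<phi>" and K: "compact K" "K \<subseteq> V \<inter> coord_subspace I" and
        \<phi>0: "\<And>t. t \<in> coord_subspace I - K \<Longrightarrow> \<phi> t = 0"
        unfolding test_function_def smooth_def by blast
      interpret solution_piece \<beta> ?M I V \<Phi> K u F f \<phi> R
        by (rule piece[OF chart K \<phi> \<phi>0])
      show "chart_integral I V (\<lambda>t. dbar_operator \<beta> f (\<Phi> t) * wirtinger_bar j \<phi> t) =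
          - chart_integral I V (\<lambda>t. pullback_coeff \<Phi> f j t * \<phi> t)"
        by (rule chart_equation[OF j])
    qed
  qed
qed

end
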